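(* Let $\mathcal X_n$ be the point process of eigenvalues of $G_n$ and let $U\subseteq\mathbb D$ be an open set such that there exists a sequence of open sets $U_n$ with $\overline U\subset U_n\subseteq\mathbb D$ for all $n$ and such that the balayage measures $\nu_n$ on $\partial U_n$ converge weakly to the balayage measure $\nu$ on $\partial U$. Then $$\lim_{n\to\infty}\frac1{n^2}\log\mathbf P\big[\mathcal X_n(\sqrt n\,U)=0\big]=R_\emptyset-R_U.$$
   Context: $\mathbb D$ is the open unit disk, $m$ Lebesgue measure on $\mathbb C$. $G_n$ is an $n\times n$ random matrix with i.i.d. standard complex Gaussian entries (density $\frac1\pi e^{-|z|^2}$); $\mathcal X(A)$ denotes the number of points of $\mathcal X$ in $A$, and $\sqrt nU=\{\sqrt nz:z\in U\}$. For $E\subseteq\mathbb C$, $\mathcal P(E)$ is the set of compactly supported Borel probability measures with support in $E$. $R_\mu=\iint\log\frac1{|z-w|}d\mu(z)d\mu(w)+\int|z|^2d\mu(z)$, $R_U=\inf_{\mu\in\mathcal P(\mathbb C\setminus U)}R_\mu$ and $R_\emptyset=\inf_{\mu\in\mathcal P(\mathbb C)}R_\mu$ $(=3/4)$. A Borel set $B$ is polar if $\iint\log\frac1{|z-w|}d\mu d\mu=+\infty$ for every compactly supported probability measure $\mu$ supported in $B$; "q.e." means outside a Borel polar set. For a bounded open set $V$, the balayage measure on $\partial V$ is the unique positive Borel measure $\nu$ on $\partial V$ with $\nu(B)=0$ for every Borel polar $B$ and $\int\log\frac1{|z-w|}d\nu(w)=\frac1\pi\int_V\log\frac1{|z-w|}dm(w)$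 for q.e. $z\in\mathbb C\setminus V$. *)

theory Defs
  imports "HOL-Probability.Probability"
begin

definition complex_gaussian :: "complex measure" where
  "complex_gaussian = density lborel (\<lambda>z. ennreal (exp (- ((cmod z) ^ 2)) / pi))"

definition ginibre :: "nat \<Rightarrow> (nat \<times> nat \<Rightarrow> complex) measure" where
  "ginibre n = PiM ({..<n} \<times> {..<n}) (\<lambda>_. complex_gaussian)"

definition cdet :: "nat \<Rightarrow> (nat \<times> nat \<Rightarrow> complex) \<Rightarrow> complex" where
  "cdet n A = (\<Sum>p | p permutes {..<n}. of_int (sign p) * (\<Prod>i<n. A (i, p i)))"

definition is_eigenvalue :: "nat \<Rightarrow> (nat \<times> nat \<Rightarrow> complex) \<Rightarrow> complex \<Rightarrow> bool" where
  "is_eigenvalue n A z \<longleftrightarrow> cdet n (\<lambda>(i, j). (if i = j then z else 0) - A (i, j)) = 0"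

definition hole_prob :: "nat \<Rightarrow> complex set \<Rightarrow> real" where
  "hole_prob n U = measure (ginibre n)
     {G \<in> space (ginibre n). \<forall>z \<in> (\<lambda>w. complex_of_real (sqrt (real n)) * w) ` U.
                               \<not> is_eigenvalue n G z}"

text \<open>P(E): compactly supported Borel probability measures with support in E
  (equivalently: concentrated on a compact subset of E).\<close>
definition cprob :: "complex set \<Rightarrow> complex measure set" where
  "cprob E = {\<mu>. sets \<mu> = sets borel \<and> prob_space \<mu> \<and>
                 (\<exists>K. compact K \<and> K \<subseteq> E \<and> emeasure \<mu> K = 1)}"

definition log_energy :: "complex measure \<Rightarrow> ereal" where
  "log_energy \<mu> =
     enn2ereal (\<integral>\<^sup>+ z. \<integral>\<^sup>+ w. (if z = w then \<infinity> else ennreal (max 0 (- ln (cmod (z - w))))) \<partial>\<mu> \<partial>\<mu>)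
   - enn2ereal (\<integral>\<^sup>+ z. \<integral>\<^sup>+ w. ennreal (max 0 (ln (cmod (z - w)))) \<partial>\<mu> \<partial>\<mu>)"

definition R_measure :: "complex measure \<Rightarrow> ereal" where
  "R_measure \<mu> = log_energy \<mu> + enn2ereal (\<integral>\<^sup>+ z. ennreal ((cmod z)^2) \<partial>\<mu>)"

definition R_set :: "complex set \<Rightarrow> ereal" where
  "R_set U = (INF \<mu> \<in> cprob (- U). R_measure \<mu>)"

definition R_empty :: ereal where
  "R_empty = (INF \<mu> \<in> cprob UNIV. R_measure \<mu>)"

definition polar :: "complex set \<Rightarrow> bool" where
  "polar B \<longleftrightarrow> (\<forall>\<mu> \<in> cprob B. log_energy \<mu> = \<infinity>)"

definition is_balayage :: "complex set \<Rightarrow> complex measure \<Rightarrow> bool" where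
  "is_balayage V \<nu> \<longleftrightarrow>
     sets \<nu> = sets borel \<and> finite_measure \<nu> \<and>
     emeasure \<nu> (- frontier V) = 0 \<and>
     (\<forall>B \<in> sets borel. polar B \<longrightarrow> emeasure \<nu> B = 0) \<and>
     (\<exists>E \<in> sets borel. polar E \<and>
        (\<forall>z \<in> - V - E.
           integrable \<nu> (\<lambda>w. ln (1 / cmod (z - w))) \<and>
           (\<integral>w. ln (1 / cmod (z - w)) \<partial>\<nu>) =
             (1 / pi) * (LINT w:V|lborel. ln (1 / cmod (z - w)))))"

definition weak_conv_c :: "(nat \<Rightarrow> complex measure) \<Rightarrow> complex measure \<Rightarrow> bool" where
  "weak_conv_c \<nu>s \<nu> \<longleftrightarrow>
     (\<forall>f :: complex \<Rightarrow> real. continuous_on UNIV f \<and> bounded (range f) \<longrightarrow>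
        (\<lambda>n. \<integral>z. f z \<partial>(\<nu>s n)) \<longlonglongrightarrow> (\<integral>z. f z \<partial>\<nu>))"

end

theory Submission
  imports Defs "HOL-Complex_Analysis.Complex_Analysis" "Jordan_Normal_Form.Char_Poly" "HOL-Real_Asymp.Real_Asymp"
begin

text \<open>Put \<open>S = - U\<close>. Instead of the joint eigenvalue density, a one-step version of it is used: writing the
  last column of a matrix in terms of an eigenpair \<open>(z, (u, 1))\<close>, and conjugating by a unitary matrix that
  sends the last basis vector to the direction of \<open>(u, 1)\<close>, trades one eigenvalue \<open>z \<in> S\<close> for a factor
  \<open>|det (z - G')|\<^sup>2\<close>, where \<open>G'\<close> is the remaining smaller Gaussian matrix. The sum over all
  eigenvalues lies between the value at one of them and \<open>n\<close> times that value, so the recursion holds up to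
  a factor \<open>n!\<close>, which is harmless on the scale \<open>n\<^sup>2\<close>.

  For the upper bound the resulting product of weights is estimated pointwise by the minimal discrete
  energy of \<open>n\<close> points of \<open>S\<close>; compactness of the set of measures on a large disc turns it into \<open>R_U\<close>.
  For the lower bound Jensen's inequality is applied at each step of the recursion with a measure of bounded density.

  If \<open>\<nu>\<close> is the balayage of \<open>V\<close>, the potential of \<open>\<nu> + m|(D - V) / pi\<close> equals that of the uniform
  measure on the disc quasi-everywhere outside \<open>V\<close>; positivity of the logarithmic kernel on neutral
  measures shows that this measure minimises the energy, so that \<open>R_V\<close> is explicit and continuous along the
  given sequence \<open>U_n\<close>. The minimiser for \<open>U_n\<close> keeps a positive distance from \<open>U\<close>, so
  averaging it over small discs gives a bounded density supported in \<open>S\<close>, and this does not increase the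
  logarithmic energy, because \<open>- ln |z|\<close> is superharmonic.\<close>

text \<open>A balayage is specified only by its potential outside a polar set, with no mass
  prescribed. Measures of finite energy do not charge polar sets, so the quasi-everywhere identities
  can still be integrated against every relevant competitor; the mass is read off at infinity. The
  equilibrium measure of \<open>U\<close> itself may charge the frontier of \<open>U\<close>, and
  smoothing it would spill mass into \<open>U\<close>. This is what the larger sets
  \<open>U_n\<close> are for: their minimisers leave room for smoothing, and weak convergence of the
  balayages makes the loss of energy tend to zero. After rescaling by sqrt n the Gaussian factor at
  an eigenvalue w is exp (- n |w|^2). One unit of the exponent keeps the integrals finite; the
  remaining n - 1 is exactly the coefficient that |w|^2 gets in the sum of (|z|^2 + |w|^2) / 2 over
  ordered pairs of distinct points, so the discrete energy appears without an error term. In the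
  recursion only one substitution is nonlinear: the corner entry of a matrix is a rational function
  of an eigenvalue. All others are affine.\<close>

unbundle no fps_syntax

section \<open>Area formula for holomorphic maps\<close>

abbreviation jac_sq :: "(complex \<Rightarrow> complex) \<Rightarrow> complex \<Rightarrow> ennreal" where
  "jac_sq r z \<equiv> ennreal ((cmod (deriv r z))\<^sup>2)"

text \<open>The change of variables formula and Sard's theorem are applied in \<open>real^2\<close>;
  this measure-preserving linear isomorphism carries their conclusions to
  \<open>complex\<close>.\<close>

definition to_complex :: "real^2 \<Rightarrow> complex" where
  "to_complex v = Complex (v $ 1) (v $ 2)"

definition of_complex :: "complex \<Rightarrow> real^2" where
  "of_complex z = vector [Re z, Im z]"

lemma to_of_complex [simp]: "to_complex (of_complex z) = z"
  by (simp add: to_complex_def of_complex_def)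

lemma of_to_complex [simp]: "of_complex (to_complex v) = v"
  by (simp add: to_complex_def of_complex_def Finite_Cartesian_Product.vec_eq_iff forall_2)

lemma linear_to_complex: "linear to_complex"
  by (rule linearI) (auto simp: to_complex_def complex_eq_iff)

lemma linear_of_complex: "linear of_complex"
  by (rule linearI) (auto simp: of_complex_def Finite_Cartesian_Product.vec_eq_iff forall_2)

lemma bounded_linear_to_complex: "bounded_linear to_complex"
  using linear_to_complex linear_conv_bounded_linear by blast

lemma bounded_linear_of_complex: "bounded_linear of_complex"
  using linear_of_complex linear_conv_bounded_linear by blast

lemma borel_measurable_to_complex [measurable]: "to_complex \<in> borel_measurable borel"
  by (intro borel_measurable_continuous_onI linear_continuous_on bounded_linear_to_complex)

lemma borel_measurable_of_complex [measurable]: "of_complex \<in> borel_measurable borel"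
  by (intro borel_measurable_continuous_onI linear_continuous_on bounded_linear_of_complex)

lemma of_complex_image: "of_complex ` A = to_complex -` A"
proof
  show "of_complex ` A \<subseteq> to_complex -` A" by auto
  show "to_complex -` A \<subseteq> of_complex ` A"
    by (rule subsetI, rule_tac x = "to_complex x" in image_eqI) auto
qed

lemma distr_to_complex: "distr lborel borel to_complex = lborel"
proof (rule lborel_eqI[symmetric])
  fix l u :: complex assume le: "\<And>b. b \<in> Basis \<Longrightarrow> l \<bullet> b \<le> u \<bullet> b"
  have *: "to_complex -` box l u = box (of_complex l) (of_complex u)"
    by (auto simp: to_complex_def of_complex_def box_def Basis_complex_def Basis_vec_def forall_2 inner_axis)
  have "Re l \<le> Re u" "Im l \<le> Im u" using le[of 1] le[of \<i>] by (auto simp: Basis_complex_def)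
  then show "emeasure (distr lborel borel to_complex) (box l u) = ennreal (prod ((\<bullet>) (u - l)) Basis)"
    by (subst emeasure_distr)
       (auto simp: * emeasure_lborel_box_eq Basis_complex_def Basis_vec_def inner_axis of_complex_def UNIV_2 axis_eq_axis
          prod.insert_if forall_2)
qed auto

lemma nn_integral_to_complex:
  assumes [measurable]: "f \<in> borel_measurable borel"
  shows "(\<integral>\<^sup>+v. f (to_complex v) \<partial>lborel) = (\<integral>\<^sup>+z. f z \<partial>lborel)"
  by (subst distr_to_complex[symmetric], subst nn_integral_distr) auto

text \<open>Multiplication by c acts on the plane as a rotation followed by a dilation, so the real
  Jacobian of a holomorphic map is the squared modulus of its derivative.\<close>

lemma det_complex_mult: "Determinants.det (matrix (\<lambda>v. of_complex (c * to_complex v))) = (cmod c)\<^sup>2"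
  by (simp add: Determinants.det_2 matrix_def to_complex_def of_complex_def axis_def cmod_power2) (simp add: power2_eq_square)

lemma has_derivative_conj_complex:
  assumes "open W" "r holomorphic_on W" "to_complex v \<in> W"
  shows "((\<lambda>v. of_complex (r (to_complex v))) has_derivative
    (\<lambda>h. of_complex (deriv r (to_complex v) * to_complex h))) (at v within S)"
proof -
  have "(r has_field_derivative deriv r (to_complex v)) (at (to_complex v))"
    using assms holomorphic_derivI by blast
  then have "(r has_derivative (*) (deriv r (to_complex v))) (at (to_complex v))"
    by (simp add: has_field_derivative_def)
  moreover have "(to_complex has_derivative to_complex) (at v within S)"
    by (rule bounded_linear_imp_has_derivative[OF bounded_linear_to_complex])
  ultimately have "((\<lambda>v. r (to_complex v)) has_derivative (\<lambda>h. deriv r (to_complex v) * to_complex h)) (at v within S)"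
    by (rule has_derivative_compose[rotated])
  then show ?thesis
    by (rule bounded_linear.has_derivative[OF bounded_linear_of_complex])
qed

lemma borel_measurable_indicator_deriv:
  assumes "open W" "r holomorphic_on W" "A \<in> sets borel" "A \<subseteq> W"
  shows "(\<lambda>z. (jac_sq r z) * indicator A z) \<in> borel_measurable borel"
    and "(\<lambda>z. (cmod (deriv r z))\<^sup>2 * indicator A z) \<in> borel_measurable borel"
proof -
  have "continuous_on A (deriv r)"
    using assms by (meson continuous_on_subset holomorphic_deriv holomorphic_on_imp_continuous_on)
  then have *: "continuous_on A (\<lambda>z. (cmod (deriv r z))\<^sup>2)" by (intro continuous_intros)
  show "(\<lambda>z. (cmod (deriv r z))\<^sup>2 * indicator A z) \<in> borel_measurable borel"
    using borel_measurable_continuous_on_indicator[OF assms(3) *] by (simp add: mult.commute)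
  then have "(\<lambda>z. ennreal ((cmod (deriv r z))\<^sup>2 * indicator A z)) \<in> borel_measurable borel" by measurable
  also have "(\<lambda>z. ennreal ((cmod (deriv r z))\<^sup>2 * indicator A z)) = (\<lambda>z. (jac_sq r z) * indicator A z)"
    by (auto simp: indicator_def)
  finally show "(\<lambda>z. (jac_sq r z) * indicator A z) \<in> borel_measurable borel" .
qed

text \<open>The bound \<open>M\<close> on a bounded set makes the Jacobian integrable, so that the
  change of variables formula with finite integral applies. That the image is Borel is a hypothesis
  here; it is later obtained from a local holomorphic inverse.\<close>

lemma emeasure_holomorphic_image:
  assumes W: "open W" "r holomorphic_on W" and A: "A \<in> sets borel" "A \<subseteq> W" "bounded A"
    and M: "\<And>z. z \<in> A \<Longrightarrow> cmod (deriv r z) \<le> M" and inj: "inj_on r A" and rA: "r ` A \<in> sets borel"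
  shows "emeasure lborel (r ` A) = (\<integral>\<^sup>+z. (jac_sq r z) * indicator A z \<partial>lborel)"
proof -
  define S where "S = to_complex -` A"
  define f where "f = (\<lambda>v. of_complex (r (to_complex v)))"
  define g where "g = (\<lambda>v. (cmod (deriv r (to_complex v)))\<^sup>2)"
  note [measurable] = A(1) rA
  have Sb[measurable]: "S \<in> sets borel" unfolding S_def using measurable_sets_borel[OF borel_measurable_to_complex A(1)] by simp
  have "bounded S" unfolding S_def of_complex_image[symmetric]
    using A(3) bounded_linear_image bounded_linear_of_complex by blast
  then have Sfin: "emeasure lborel S < \<infinity>" by (rule emeasure_bounded_finite)
  have fS: "f ` S = to_complex -` (r ` A)"
    unfolding S_def f_def of_complex_image[symmetric] by (auto simp: image_image)
  have [measurable]: "f ` S \<in> sets borel" unfolding fS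
    using measurable_sets_borel[OF borel_measurable_to_complex rA] by simp
  have gm[measurable]: "(\<lambda>v. g v * indicator S v) \<in> borel_measurable borel"
  proof -
    have "(\<lambda>v. (\<lambda>z. (cmod (deriv r z))\<^sup>2 * indicator A z) (to_complex v)) \<in> borel_measurable borel"
      using borel_measurable_indicator_deriv(2)[OF W A(1,2)] by measurable
    then show ?thesis by (simp add: g_def S_def indicator_def vimage_def)
  qed
  have gint: "integrable lborel (\<lambda>v. g v * indicator S v)"
  proof (rule Bochner_Integration.integrable_bound[where f="\<lambda>v. M\<^sup>2 * indicator S v :: real"])
    show "integrable lborel (\<lambda>v. M\<^sup>2 * indicator S v :: real)" using Sfin by (intro integrable_mult_right integrable_real_indicator) auto
    show "AE v in lborel. norm (g v * indicator S v) \<le> norm (M\<^sup>2 * indicator S v)"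
      using M by (intro AE_I2) (auto simp: g_def S_def indicator_def intro!: power_mono)
  qed auto
  define m where "m = (\<integral>v. g v * indicator S v \<partial>lborel)"
  have "((\<lambda>v. g v * indicator S v) has_integral m) UNIV"
    unfolding m_def by (rule has_integral_integral_lborel[OF gint])
  from this have gi: "(g has_integral m) S"
  proof -
    have "(\<lambda>v. g v * indicator S v) = (\<lambda>v. if v \<in> S then g v else 0)" by auto
    with \<open>(_ has_integral m) UNIV\<close> show ?thesis by (simp only: has_integral_restrict_UNIV)
  qed
  have D: "\<And>v. v \<in> S \<Longrightarrow> (f has_derivative (\<lambda>h. of_complex (deriv r (to_complex v) * to_complex h))) (at v within S)"
    unfolding f_def S_def using A(2) by (intro has_derivative_conj_complex[OF W]) auto
  have injf: "inj_on f S"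
  proof (rule inj_onI)
    fix v w assume vw: "v \<in> S" "w \<in> S" "f v = f w"
    then have "to_complex (f v) = to_complex (f w)" by simp
    then have "r (to_complex v) = r (to_complex w)" unfolding f_def to_of_complex .
    then have "to_complex v = to_complex w" using vw inj unfolding S_def by (auto dest: inj_onD)
    then have "of_complex (to_complex v) = of_complex (to_complex w)" by (rule arg_cong)
    then show "v = w" by simp
  qed
  have "f ` S \<in> lmeasurable \<and> measure lebesgue (f ` S) = m"
  proof (subst has_measure_differentiable_image[OF _ D injf])
    show "S \<in> sets lebesgue" using Sb by simp
    show "((\<lambda>v. \<bar>Determinants.det (matrix (\<lambda>h. of_complex (deriv r (to_complex v) * to_complex h)))\<bar>) has_integral m) S"
      using gi unfolding det_complex_mult g_def by simp
  qed
  then have "emeasure lebesgue (f ` S) = ennreal m"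
    using emeasure_eq_measure2[of "f ` S" lebesgue] by (simp only:)
  then have "emeasure lborel (f ` S) = ennreal m" by simp
  moreover have "emeasure lborel (r ` A) = emeasure lborel (f ` S)"
    unfolding fS by (subst distr_to_complex[symmetric], subst emeasure_distr) auto
  moreover have "ennreal m = (\<integral>\<^sup>+v. ennreal (g v * indicator S v) \<partial>lborel)"
    unfolding m_def by (rule nn_integral_eq_integral[symmetric, OF gint]) (auto simp: g_def)
  moreover have "\<dots> = (\<integral>\<^sup>+v. (\<lambda>z. (jac_sq r z) * indicator A z) (to_complex v) \<partial>lborel)"
    by (intro nn_integral_cong) (auto simp: g_def S_def indicator_def)
  moreover have "\<dots> = (\<integral>\<^sup>+z. (jac_sq r z) * indicator A z \<partial>lborel)"
    by (intro nn_integral_to_complex borel_measurable_indicator_deriv[OF W A(1,2)])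
  ultimately show ?thesis by simp
qed

text \<open>Passes from sets to functions: Lebesgue measure on the image and the image of the
  Jacobian density agree on each Borel set \<open>E\<close>, by the formula for sets applied to the
  part of \<open>B\<close> that is mapped into \<open>E\<close>.\<close>

lemma nn_integral_holomorphic_inj:
  assumes W: "open W" "r holomorphic_on W" and B: "B \<in> sets borel" "B \<subseteq> W" "bounded B"
    and M: "\<And>z. z \<in> B \<Longrightarrow> cmod (deriv r z) \<le> M" and inj: "inj_on r B" and rB: "r ` B \<in> sets borel"
    and h[measurable]: "h \<in> borel_measurable borel"
  shows "(\<integral>\<^sup>+a. h a * indicator (r ` B) a \<partial>lborel)
       = (\<integral>\<^sup>+z. h (r z) * ((jac_sq r z) * indicator B z) \<partial>lborel)"
proof -
  \<comment> \<open>The map is replaced by 0 outside \<open>B\<close> to obtain a globally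
    measurable function; nothing is known about \<open>r\<close> off \<open>W\<close>.\<close>
  define r' where "r' = (\<lambda>z. indicator B z *\<^sub>R r z)"
  have "continuous_on B r" using W B by (meson continuous_on_subset holomorphic_on_imp_continuous_on)
  then have r'[measurable]: "r' \<in> borel_measurable borel"
    unfolding r'_def by (rule borel_measurable_continuous_on_indicator[OF B(1)])
  note [measurable] = B(1) rB
  note [measurable] = borel_measurable_indicator_deriv(1)[OF W B(1,2)]
  define w where "w = (\<lambda>z. (jac_sq r z) * indicator B z)"
  have [measurable]: "w \<in> borel_measurable borel" unfolding w_def by measurable
  have eq: "density lborel (indicator (r ` B)) = distr (density lborel w) borel r'"
  proof (rule measure_eqI)
    fix E assume "E \<in> sets (density lborel (indicator (r ` B) :: complex \<Rightarrow> ennreal))"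
    then have E[measurable]: "E \<in> sets borel" by simp
    define A where "A = B \<inter> r' -` E"
    have Ab: "A \<in> sets borel" unfolding A_def using measurable_sets_borel[OF r' E] by simp
    have rA: "r ` A = r ` B \<inter> E" unfolding A_def r'_def by auto
    have "emeasure (density lborel (indicator (r ` B))) E = emeasure lborel (r ` A)"
      unfolding rA by (subst emeasure_density) (auto simp: indicator_inter_arith[symmetric])
    also have "\<dots> = (\<integral>\<^sup>+z. (jac_sq r z) * indicator A z \<partial>lborel)"
      by (rule emeasure_holomorphic_image[OF W Ab, where M=M])
         (use B M inj in \<open>auto simp: A_def rA intro: bounded_subset inj_on_subset\<close>, use rA rB E in \<open>auto simp: A_def\<close>)
    also have "\<dots> = (\<integral>\<^sup>+z. w z * indicator (r' -` E) z \<partial>lborel)"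
      by (intro nn_integral_cong) (auto simp: w_def A_def indicator_def)
    also have "\<dots> = emeasure (density lborel w) (r' -` E)"
      using measurable_sets_borel[OF r' E] by (subst emeasure_density) auto
    also have "\<dots> = emeasure (distr (density lborel w) borel r') E"
      by (subst emeasure_distr) auto
    finally show "emeasure (density lborel (indicator (r ` B))) E = emeasure (distr (density lborel w) borel r') E" .
  qed simp
  have "(\<integral>\<^sup>+a. h a * indicator (r ` B) a \<partial>lborel) = (\<integral>\<^sup>+a. h a \<partial>density lborel (indicator (r ` B)))"
    by (subst nn_integral_density) (auto simp: mult.commute)
  also have "\<dots> = (\<integral>\<^sup>+z. w z * h (r' z) \<partial>lborel)"
    unfolding eq by (simp add: nn_integral_distr nn_integral_density)
  also have "\<dots> = (\<integral>\<^sup>+z. h (r z) * w z \<partial>lborel)"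
    by (intro nn_integral_cong) (auto simp: w_def r'_def indicator_def mult.commute)
  finally show ?thesis unfolding w_def .
qed

text \<open>Sard's theorem: where \<open>deriv r\<close> vanishes, the real differential is not of
  full rank. The critical set can be large, for instance when \<open>r\<close> is constant on a
  component of \<open>W\<close>; only its image is null.\<close>

lemma holomorphic_crit_image_null:
  assumes W: "open W" "r holomorphic_on W"
  shows "AE a in lborel. a \<notin> r ` {z\<in>W. deriv r z = 0}"
proof -
  define S where "S = to_complex -` {z\<in>W. deriv r z = 0}"
  define f where "f = (\<lambda>v. of_complex (r (to_complex v)))"
  have D: "\<And>v. v \<in> S \<Longrightarrow> (f has_derivative (\<lambda>h. of_complex (deriv r (to_complex v) * to_complex h))) (at v within S)"
    unfolding f_def S_def by (intro has_derivative_conj_complex[OF W]) auto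
  have "negligible (f ` S)"
  proof (rule baby_Sard[OF _ D])
    fix v assume v: "v \<in> S"
    have "Determinants.det (matrix (\<lambda>h. of_complex (deriv r (to_complex v) * to_complex h))) = 0"
      using v by (subst det_complex_mult) (simp add: S_def)
    then show "rank (matrix (\<lambda>h. of_complex (deriv r (to_complex v) * to_complex h))) < CARD(2)"
      using det_eq_0_rank by metis
  qed auto
  then have "f ` S \<in> null_sets (completion lborel)" using negligible_iff_null_sets by blast
  then obtain N where N: "N \<in> null_sets lborel" "f ` S \<subseteq> N"
    by (metis null_sets_completion_iff2)
  then have [measurable]: "N \<in> sets borel" by auto
  have "of_complex -` N \<in> null_sets lborel"
  proof
    show *: "of_complex -` N \<in> sets lborel" using measurable_sets_borel[OF borel_measurable_of_complex] by simp
    have "emeasure lborel (of_complex -` N) = emeasure lborel (to_complex -` (of_complex -` N))"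
      using * by (subst distr_to_complex[symmetric], subst emeasure_distr) auto
    also have "to_complex -` (of_complex -` N) = N" by auto
    finally show "emeasure lborel (of_complex -` N) = 0" using N by auto
  qed
  moreover have "{a \<in> space lborel. \<not> a \<notin> r ` {z\<in>W. deriv r z = 0}} \<subseteq> of_complex -` N"
  proof
    fix a assume "a \<in> {a \<in> space lborel. \<not> a \<notin> r ` {z\<in>W. deriv r z = 0}}"
    then obtain z where z: "z \<in> W" "deriv r z = 0" "a = r z" by auto
    then have "of_complex z \<in> S" by (simp add: S_def)
    then have "f (of_complex z) \<in> N" using N by auto
    then show "a \<in> of_complex -` N" using z by (simp add: f_def)
  qed
  ultimately show ?thesis by (rule AE_I')
qed

text \<open>Around each noncritical point \<open>r\<close> is injective on a disc. Lindelof's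
  theorem leaves countably many discs and \<open>disjointed\<close> makes the pieces disjoint. The
  image of a piece is Borel because it is the preimage of that piece under the inverse map, which is
  continuous on the open image of the disc.\<close>

lemma holomorphic_injective_cover:
  assumes W: "open W" "r holomorphic_on W"
  shows "\<exists>B::nat \<Rightarrow> complex set. disjoint_family B \<and> (\<Union>i. B i) = {z\<in>W. deriv r z \<noteq> 0} \<and>
     (\<forall>i. B i \<in> sets borel \<and> bounded (B i) \<and> inj_on r (B i) \<and> r ` B i \<in> sets borel \<and> (\<exists>M. \<forall>z\<in>B i. cmod (deriv r z) \<le> M))"
proof -
  define W' where "W' = {z\<in>W. deriv r z \<noteq> 0}"
  have cd: "continuous_on W (deriv r)"
    using W holomorphic_deriv holomorphic_on_imp_continuous_on by blast
  have "openin (top_of_set W) (W \<inter> deriv r -` (- {0}))"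
    by (rule continuous_openin_preimage_gen[OF cd]) auto
  moreover have "W \<inter> deriv r -` (- {0}) = W'" by (auto simp: W'_def)
  ultimately have oW': "open W'" using W openin_open_eq by (metis)
  have "\<exists>e>0. cball z e \<subseteq> W' \<and> inj_on r (ball z e)" if "z \<in> W'" for z
  proof -
    have z: "z \<in> W" "deriv r z \<noteq> 0" using that by (auto simp: W'_def)
    obtain e1 where e1: "e1 > 0" "ball z e1 \<subseteq> W" "inj_on r (ball z e1)"
      by (rule has_complex_derivative_locally_injective[OF W(2) z(1) W(1) z(2)])
    obtain e2 where e2: "e2 > 0" "cball z e2 \<subseteq> W'" using oW' \<open>z \<in> W'\<close> unfolding open_contains_cball by blast
    have "cball z (min e1 e2) \<subseteq> cball z e2" by (rule subset_cball) simp
    then have "cball z (min e1 e2) \<subseteq> W'" using e2 by blast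
    moreover have "inj_on r (ball z (min e1 e2))" by (rule inj_on_subset[OF e1(3)]) (rule subset_ball, simp)
    ultimately show ?thesis using e1 e2 by (intro exI[of _ "min e1 e2"]) auto
  qed
  then obtain e where e: "\<And>z. z \<in> W' \<Longrightarrow> e z > 0 \<and> cball z (e z) \<subseteq> W' \<and> inj_on r (ball z (e z))" by metis
  define F where "F = (\<lambda>z. ball z (e z)) ` W'"
  obtain F' where F': "F' \<subseteq> F" "countable F'" "\<Union>F' = \<Union>F"
    using Lindelof[of F] unfolding F_def by auto
  have UF: "\<Union>F = W'"
  proof
    show "\<Union>F \<subseteq> W'" unfolding F_def
    proof (rule UN_least)
      fix z assume "z \<in> W'"
      then show "ball z (e z) \<subseteq> W'" using e[of z] ball_subset_cball[of z "e z"] by blast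
    qed
    show "W' \<subseteq> \<Union>F" unfolding F_def
    proof
      fix z assume "z \<in> W'"
      then show "z \<in> \<Union>((\<lambda>z. ball z (e z)) ` W')" using e[of z] by (intro UN_I[of z]) auto
    qed
  qed
  \<comment> \<open>The empty set is added so that the countable family is nonempty and
    \<open>from_nat_into\<close> enumerates it even when \<open>W'\<close> is empty.\<close>
  define G where "G = insert {} F'"
  have cG: "countable G" "G \<noteq> {}" using F' by (auto simp: G_def)
  define b where "b = from_nat_into G"
  have rb: "range b = G" unfolding b_def using cG by (simp add: range_from_nat_into)
  define B where "B = disjointed b"
  have bG: "b i \<in> G" for i using rb by auto
  have bprop: "open (b i) \<and> bounded (b i) \<and> inj_on r (b i) \<and> b i \<subseteq> W' \<and> (\<exists>M. \<forall>z\<in>b i. cmod (deriv r z) \<le> M)" for i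
  proof (cases "b i = {}")
    case False
    then have "b i \<in> F" using bG[of i] F'(1) by (auto simp: G_def)
    then obtain z where z: "z \<in> W'" "b i = ball z (e z)" unfolding F_def by blast
    have "compact (cball z (e z))" by simp
    moreover have "continuous_on (cball z (e z)) (deriv r)"
      using e[OF z(1)] by (intro continuous_on_subset[OF cd]) (auto simp: W'_def)
    ultimately have "compact (deriv r ` cball z (e z))" using compact_continuous_image by blast
    then obtain M where "\<forall>x\<in>deriv r ` cball z (e z). cmod x \<le> M" using compact_imp_bounded bounded_iff by blast
    then have M: "\<forall>z\<in>b i. cmod (deriv r z) \<le> M" using z by auto
    have "ball z (e z) \<subseteq> cball z (e z)" by (rule ball_subset_cball)
    also have "\<dots> \<subseteq> W'" using e[OF z(1)] by (elim conjE)
    finally have "b i \<subseteq> W'" by (simp only: z(2))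
    show ?thesis
    proof (intro conjI exI[of _ M])
      show "open (b i)" "bounded (b i)" by (simp_all add: z(2))
      show "inj_on r (b i)" using e[OF z(1)] by (simp add: z(2))
    qed fact+
  qed auto
  have BB: "B i \<subseteq> b i" for i unfolding B_def by (rule disjointed_subset)
  have Bm: "B i \<in> sets borel" for i
  proof -
    have "range b \<subseteq> sets borel" using bprop by (auto intro: borel_open)
    then have "range (disjointed b) \<subseteq> sets borel" by (rule sets.range_disjointed_sets)
    then show ?thesis unfolding B_def by auto
  qed
  have rBm: "r ` B i \<in> sets borel" for i
  proof -
    have "r holomorphic_on b i" using W(2) bprop[of i] by (auto simp: W'_def intro: holomorphic_on_subset)
    then obtain g where g: "g holomorphic_on r ` b i" "\<And>z. z \<in> b i \<Longrightarrow> g (r z) = z"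
      by (rule holomorphic_has_inverse) (use bprop in auto)
    have op: "open (r ` b i)" using bprop \<open>r holomorphic_on b i\<close> open_mapping_thm3 by blast
    then have cg: "continuous_on (r ` b i) g" using g holomorphic_on_imp_continuous_on by blast
    have "r ` B i = r ` b i \<inter> g -` (B i)"
    proof
      show "r ` B i \<subseteq> r ` b i \<inter> g -` (B i)" using BB[of i] g(2) by auto
      show "r ` b i \<inter> g -` (B i) \<subseteq> r ` B i" using g(2) by force
    qed
    also have "\<dots> \<in> sets borel"
    proof -
      have "(\<lambda>z. indicator (r ` b i) z *\<^sub>R g z) \<in> borel_measurable borel"
        using op cg by (intro borel_measurable_continuous_on_indicator) auto
      then have "r ` b i \<inter> (\<lambda>z. indicator (r ` b i) z *\<^sub>R g z) -` B i \<in> sets borel"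
        using sets.Int[OF borel_open[OF op] measurable_sets_borel[OF _ Bm[of i]]] by simp
      also have "r ` b i \<inter> (\<lambda>z. indicator (r ` b i) z *\<^sub>R g z) -` B i = r ` b i \<inter> g -` (B i)"
        by auto
      finally show ?thesis .
    qed
    finally show ?thesis .
  qed
  show ?thesis
  proof (intro exI[of _ B] conjI allI)
    show "disjoint_family B" unfolding B_def by (rule disjoint_family_disjointed)
    show "(\<Union>i. B i) = {z \<in> W. deriv r z \<noteq> 0}"
      unfolding B_def UN_disjointed_eq rb using F' UF by (auto simp: G_def W'_def)
    fix i show "B i \<in> sets borel" by fact
    show "r ` B i \<in> sets borel" by fact
    show "bounded (B i)" using BB bprop bounded_subset by blast
    show "inj_on r (B i)" using BB bprop inj_on_subset by blast
    show "\<exists>M. \<forall>z\<in>B i. cmod (deriv r z) \<le> M" using BB[of i] bprop[of i] by blast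
  qed
qed

text \<open>The common core of the two one-sided area formulas. As the pieces are disjoint and
  \<open>r\<close> is injective on each, the sum of indicators is the number of noncritical
  preimages of \<open>a\<close>; by Sard it is at least 1 for almost every \<open>a\<close> in the
  range.\<close>

lemma area_formula_aux:
  assumes W: "open W" "r holomorphic_on W" and h[measurable]: "h \<in> borel_measurable borel"
  shows "\<exists>B::nat \<Rightarrow> complex set. disjoint_family B \<and> (\<forall>i. inj_on r (B i) \<and> B i \<subseteq> W \<and> r ` B i \<in> sets borel) \<and>
     (AE a in lborel. a \<in> r ` W \<longrightarrow> (\<exists>i. a \<in> r ` B i)) \<and>
     (\<integral>\<^sup>+z. h (r z) * ((jac_sq r z) * indicator W z) \<partial>lborel)
       = (\<integral>\<^sup>+a. h a * (\<Sum>i. indicator (r ` B i) a) \<partial>lborel)"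
proof -
  obtain B :: "nat \<Rightarrow> complex set" where B: "disjoint_family B" "(\<Union>i. B i) = {z\<in>W. deriv r z \<noteq> 0}"
     "\<forall>i. B i \<in> sets borel \<and> bounded (B i) \<and> inj_on r (B i) \<and> r ` B i \<in> sets borel \<and> (\<exists>M. \<forall>z\<in>B i. cmod (deriv r z) \<le> M)"
    using holomorphic_injective_cover[OF W] by (elim exE conjE)
  then have B': "B i \<in> sets borel" "bounded (B i)" "inj_on r (B i)" "r ` B i \<in> sets borel" "\<exists>M. \<forall>z\<in>B i. cmod (deriv r z) \<le> M" for i
    by simp_all
  note B = B(1,2) B'
  have BW: "B i \<subseteq> W" for i using B(2) by auto
  note [measurable] = B(3,6)
  have "r ` {z\<in>W. deriv r z = 0} \<union> (\<Union>i. r ` B i) = r ` W"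
    unfolding image_UN[symmetric] B(2) by auto
  then have "a \<in> r ` W \<longrightarrow> (\<exists>i. a \<in> r ` B i)" if "a \<notin> r ` {z\<in>W. deriv r z = 0}" for a
    using that by blast
  then have ae: "AE a in lborel. a \<in> r ` W \<longrightarrow> (\<exists>i. a \<in> r ` B i)"
    by (rule eventually_mono[OF holomorphic_crit_image_null[OF W]])
  have each: "(\<integral>\<^sup>+z. h (r z) * ((jac_sq r z) * indicator (B i) z) \<partial>lborel) = (\<integral>\<^sup>+a. h a * indicator (r ` B i) a \<partial>lborel)" for i
  proof -
    obtain M where "\<forall>z\<in>B i. cmod (deriv r z) \<le> M" using B(7) by blast
    then show ?thesis by (intro nn_integral_holomorphic_inj[OF W, symmetric, where M=M] B BW h) auto
  qed
  have ms: "(\<lambda>z. h (r z) * ((jac_sq r z) * indicator (B i) z)) \<in> borel_measurable borel" for i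
  proof -
    have "continuous_on (B i) r" using W BW by (meson continuous_on_subset holomorphic_on_imp_continuous_on)
    then have [measurable]: "(\<lambda>z. indicator (B i) z *\<^sub>R r z) \<in> borel_measurable borel"
      by (rule borel_measurable_continuous_on_indicator[OF B(3)])
    note [measurable] = borel_measurable_indicator_deriv(1)[OF W B(3) BW]
    have "(\<lambda>z. h (indicator (B i) z *\<^sub>R r z) * ((jac_sq r z) * indicator (B i) z)) \<in> borel_measurable borel"
      by measurable
    also have "(\<lambda>z. h (indicator (B i) z *\<^sub>R r z) * ((jac_sq r z) * indicator (B i) z))
       = (\<lambda>z. h (r z) * ((jac_sq r z) * indicator (B i) z))"
      by (auto simp: indicator_def)
    finally show ?thesis .
  qed
  have "(\<integral>\<^sup>+z. h (r z) * ((jac_sq r z) * indicator W z) \<partial>lborel)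
     = (\<integral>\<^sup>+z. (\<Sum>i. h (r z) * ((jac_sq r z) * indicator (B i) z)) \<partial>lborel)"
  proof (intro nn_integral_cong)
    fix z
    have "(\<Sum>i. h (r z) * ((jac_sq r z) * indicator (B i) z)) = h (r z) * ((jac_sq r z) * (\<Sum>i. indicator (B i) z))"
      by simp
    also have "(\<Sum>i. indicator (B i) z) = (indicator (\<Union>i. B i) z :: ennreal)"
      by (rule suminf_indicator[OF B(1)])
    also have "(jac_sq r z) * (indicator (\<Union>i. B i) z) = (jac_sq r z) * indicator W z"
      unfolding B(2) by (auto simp: indicator_def)
    finally show "h (r z) * ((jac_sq r z) * indicator W z) = (\<Sum>i. h (r z) * ((jac_sq r z) * indicator (B i) z))" by simp
  qed
  also have "\<dots> = (\<Sum>i. \<integral>\<^sup>+z. h (r z) * ((jac_sq r z) * indicator (B i) z) \<partial>lborel)"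
    using ms by (intro nn_integral_suminf) simp
  also have "\<dots> = (\<Sum>i. \<integral>\<^sup>+a. h a * indicator (r ` B i) a \<partial>lborel)" by (simp add: each)
  also have "\<dots> = (\<integral>\<^sup>+a. (\<Sum>i. h a * indicator (r ` B i) a) \<partial>lborel)"
    by (intro nn_integral_suminf[symmetric]) measurable
  also have "\<dots> = (\<integral>\<^sup>+a. h a * (\<Sum>i. indicator (r ` B i) a) \<partial>lborel)" by simp
  finally have eq: "(\<integral>\<^sup>+z. h (r z) * ((jac_sq r z) * indicator W z) \<partial>lborel)
    = (\<integral>\<^sup>+a. h a * (\<Sum>i. indicator (r ` B i) a) \<partial>lborel)" .
  have "\<forall>i. inj_on r (B i) \<and> B i \<subseteq> W \<and> r ` B i \<in> sets borel" using B(5,6) BW by simp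
  with B(1) ae eq show ?thesis by (intro exI[of _ B] conjI)
qed

lemma area_formula_lower:
  assumes W: "open W" "r holomorphic_on W" and h: "h \<in> borel_measurable borel"
    and surj: "AE a in lborel. a \<in> r ` W"
  shows "(\<integral>\<^sup>+a. h a \<partial>lborel) \<le> (\<integral>\<^sup>+z. h (r z) * ((jac_sq r z) * indicator W z) \<partial>lborel)"
proof -
  obtain B :: "nat \<Rightarrow> complex set" where B: "AE a in lborel. a \<in> r ` W \<longrightarrow> (\<exists>i. a \<in> r ` B i)"
     "(\<integral>\<^sup>+z. h (r z) * ((jac_sq r z) * indicator W z) \<partial>lborel)
       = (\<integral>\<^sup>+a. h a * (\<Sum>i. indicator (r ` B i) a) \<partial>lborel)"
    using area_formula_aux[OF W h] by blast
  show ?thesis unfolding B(2)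
  proof (rule nn_integral_mono_AE)
    show "AE a in lborel. h a \<le> h a * (\<Sum>i. indicator (r ` B i) a)"
      using B(1) surj
    proof eventually_elim
      fix a assume "a \<in> r ` W \<longrightarrow> (\<exists>i. a \<in> r ` B i)" "a \<in> r ` W"
      then obtain i where "a \<in> r ` B i" by auto
      then have "1 \<le> (indicator (r ` B i) a :: ennreal)" by simp
      also have "\<dots> = (\<Sum>j\<in>{i}. indicator (r ` B j) a)" by simp
      also have "\<dots> \<le> (\<Sum>i. indicator (r ` B i) a)" by (rule sum_le_suminf) auto
      finally show "h a \<le> h a * (\<Sum>i. indicator (r ` B i) a)"
        by (metis mult.right_neutral mult_left_mono zero_le)
    qed
  qed
qed

lemma area_formula_upper:
  assumes W: "open W" "r holomorphic_on W" and h: "h \<in> borel_measurable borel"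
    and card: "\<And>a. finite {z\<in>W. r z = a} \<and> card {z\<in>W. r z = a} \<le> m"
  shows "(\<integral>\<^sup>+z. h (r z) * ((jac_sq r z) * indicator W z) \<partial>lborel) \<le> of_nat m * (\<integral>\<^sup>+a. h a \<partial>lborel)"
proof -
  obtain B :: "nat \<Rightarrow> complex set" where B: "disjoint_family B" "\<And>i. inj_on r (B i) \<and> B i \<subseteq> W \<and> r ` B i \<in> sets borel"
     "(\<integral>\<^sup>+z. h (r z) * ((jac_sq r z) * indicator W z) \<partial>lborel)
       = (\<integral>\<^sup>+a. h a * (\<Sum>i. indicator (r ` B i) a) \<partial>lborel)"
    using area_formula_aux[OF W h] by blast
  have "(\<integral>\<^sup>+a. h a * (\<Sum>i. indicator (r ` B i) a) \<partial>lborel) \<le> (\<integral>\<^sup>+a. h a * of_nat m \<partial>lborel)"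
  proof (intro nn_integral_mono mult_left_mono suminf_le_const)
    fix a n
    \<comment> \<open>Each of the first \<open>n\<close> pieces whose image contains
      \<open>a\<close> contributes one preimage. Disjointness of the pieces makes these preimages
      distinct, so there are at most \<open>m\<close> of them.\<close>
    define I where "I = {i. i < n \<and> a \<in> r ` B i}"
    have "\<forall>i\<in>I. \<exists>z. z \<in> B i \<and> r z = a" by (auto simp: I_def)
    then obtain z where z: "\<And>i. i \<in> I \<Longrightarrow> z i \<in> B i \<and> r (z i) = a" by metis
    have "inj_on z I"
    proof (rule inj_onI)
      fix i j assume "i \<in> I" "j \<in> I" "z i = z j"
      then have "z i \<in> B i \<inter> B j" using z by (metis IntI)
      then show "i = j" using B(1) unfolding disjoint_family_on_def by auto
    qed
    moreover have "z ` I \<subseteq> {z\<in>W. r z = a}" using z B(2) by blast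
    ultimately have "card I \<le> m"
      using card[of a] card_mono[of "{z\<in>W. r z = a}" "z ` I"] card_image[of z I] by simp
    have "(\<Sum>i<n. indicator (r ` B i) a) = (\<Sum>i\<in>I. (1::ennreal))"
      by (intro sum.mono_neutral_cong_right) (auto simp: I_def indicator_def)
    also have "\<dots> = of_nat (card I)" by simp
    also have "\<dots> \<le> of_nat m" using \<open>card I \<le> m\<close> of_nat_mono by blast
    finally show "(\<Sum>i<n. indicator (r ` B i) a) \<le> (of_nat m :: ennreal)" .
  qed auto
  also have "\<dots> = of_nat m * (\<integral>\<^sup>+a. h a \<partial>lborel)"
    using h by (subst nn_integral_multc) (auto simp: mult.commute)
  finally show ?thesis unfolding B(3) .
qed

text \<open>Every value has exactly one preimage under the affine map, so the lower and the upper
  area formula, the latter with multiplicity bound 1, meet.\<close>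

lemma nn_integral_complex_affine:
  assumes "c \<noteq> 0" and h: "h \<in> borel_measurable borel"
  shows "(\<integral>\<^sup>+z. h (c * z + d) \<partial>lborel) * ennreal ((cmod c)\<^sup>2) = (\<integral>\<^sup>+a. h a \<partial>lborel)"
proof -
  have D: "deriv (\<lambda>z. c * z + d) z = c" for z
    by (rule DERIV_imp_deriv) (auto intro!: derivative_eq_intros)
  have hol: "(\<lambda>z. c * z + d) holomorphic_on UNIV" by (intro holomorphic_intros)
  have sol: "c * z + d = a \<longleftrightarrow> z = (a - d) / c" for z a using assms by (auto simp: field_simps)
  have [measurable]: "(\<lambda>z. h (c * z + d)) \<in> borel_measurable borel" using h by measurable
  have *: "(\<integral>\<^sup>+z. h (c * z + d) * (ennreal ((cmod (deriv (\<lambda>z. c * z + d) z))\<^sup>2) * indicator UNIV z) \<partial>lborel)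
    = (\<integral>\<^sup>+z. h (c * z + d) \<partial>lborel) * ennreal ((cmod c)\<^sup>2)"
    by (simp add: D nn_integral_multc)
  have "a \<in> range (\<lambda>z. c * z + d)" for a
    using sol[of "(a - d) / c" a] by (intro image_eqI[of _ _ "(a - d) / c"]) auto
  then have ae: "AE a in lborel. a \<in> range (\<lambda>z. c * z + d)" by (intro AE_I2)
  have "(\<integral>\<^sup>+a. h a \<partial>lborel) \<le> (\<integral>\<^sup>+z. h (c * z + d) \<partial>lborel) * ennreal ((cmod c)\<^sup>2)"
    using area_formula_lower[OF open_UNIV hol h ae] unfolding * .
  moreover have "(\<integral>\<^sup>+z. h (c * z + d) \<partial>lborel) * ennreal ((cmod c)\<^sup>2) \<le> of_nat 1 * (\<integral>\<^sup>+a. h a \<partial>lborel)"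
    unfolding *[symmetric] by (rule area_formula_upper[OF open_UNIV hol h]) (simp add: sol)
  ultimately show ?thesis by (intro antisym) (simp_all only: of_nat_1 mult_1)
qed

section \<open>Linear changes of complex variables\<close>

abbreviation cprod :: "'i set \<Rightarrow> ('i \<Rightarrow> complex) measure" where
  "cprod I \<equiv> Pi\<^sub>M I (\<lambda>_. lborel)"

interpretation cprod: product_sigma_finite "\<lambda>_. lborel :: complex measure" ..

lemma sigma_finite_cprod: "finite I \<Longrightarrow> sigma_finite_measure (cprod I)"
  by (rule cprod.sigma_finite)

text \<open>A bijection onto a disjoint sum describes an arbitrary way of splitting coordinates into
  two groups. The same lemma thus serves for removing a row, removing a column and, with one empty
  group, for renaming indices.\<close>

lemma cprod_sum_distr:
  fixes I :: "'i set" and J :: "'j set" and K :: "'k set"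
  assumes fin: "finite I" "finite J" "finite K" and s: "bij_betw s K (I <+> J)"
  shows "distr (cprod I \<Otimes>\<^sub>M cprod J) (cprod K) (\<lambda>(x, y). \<lambda>k\<in>K. case s k of Inl i \<Rightarrow> x i | Inr j \<Rightarrow> y j) = cprod K"
    and "(\<lambda>(x, y). \<lambda>k\<in>K. case s k of Inl i \<Rightarrow> x i | Inr j \<Rightarrow> y j) \<in> measurable (cprod I \<Otimes>\<^sub>M cprod J) (cprod K)"
proof -
  let ?T = "\<lambda>(x, y). \<lambda>k\<in>K. case s k of Inl i \<Rightarrow> x i | Inr j \<Rightarrow> (y j :: complex)"
  interpret J: sigma_finite_measure "cprod J" by (rule sigma_finite_cprod) fact
  have sK: "s k \<in> I <+> J" if "k \<in> K" for k using s that bij_betw_apply by fastforce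
  have T: "?T \<in> measurable (cprod I \<Otimes>\<^sub>M cprod J) (cprod K)"
  proof (unfold split_beta, rule measurable_restrict)
    fix k assume "k \<in> K"
    then show "(\<lambda>p. case s k of Inl i \<Rightarrow> fst p i | Inr j \<Rightarrow> snd p j) \<in> measurable (cprod I \<Otimes>\<^sub>M cprod J) lborel"
      using sK[of k] by (cases "s k") auto
  qed
  show "?T \<in> measurable (cprod I \<Otimes>\<^sub>M cprod J) (cprod K)" by (rule T)
  show "distr (cprod I \<Otimes>\<^sub>M cprod J) (cprod K) ?T = cprod K"
  proof (rule cprod.PiM_eqI)
    fix A :: "_ \<Rightarrow> complex set" assume A: "\<And>i. i \<in> K \<Longrightarrow> A i \<in> sets lborel"
    define t where "t = inv_into K s"
    have tK: "t x \<in> K" "s (t x) = x" if "x \<in> I <+> J" for x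
      using s that unfolding t_def by (auto simp: bij_betw_def inv_into_into f_inv_into_f)
    have ts: "t (s k) = k" if "k \<in> K" for k using s that unfolding t_def by (auto simp: bij_betw_def)
    have tbij: "bij_betw t (I <+> J) K" unfolding t_def using s bij_betw_inv_into by blast
    define P where "P = Pi\<^sub>E I (\<lambda>i. A (t (Inl i)))"
    define Q where "Q = Pi\<^sub>E J (\<lambda>j. A (t (Inr j)))"
    have AI: "A (t (Inl i)) \<in> sets borel" if "i \<in> I" for i using A tK that by force
    have AJ: "A (t (Inr i)) \<in> sets borel" if "i \<in> J" for i using A tK that by force
    have P: "P \<in> sets (cprod I)" "Q \<in> sets (cprod J)" unfolding P_def Q_def using fin AI AJ by (auto intro!: sets_PiM_I_finite)
    have pre: "?T -` Pi\<^sub>E K A \<inter> space (cprod I \<Otimes>\<^sub>M cprod J) = P \<times> Q"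
    proof (rule Set.set_eqI)
      fix p :: "('i \<Rightarrow> complex) \<times> ('j \<Rightarrow> complex)"
      obtain x y where p: "p = (x, y)" by force
      show "p \<in> ?T -` Pi\<^sub>E K A \<inter> space (cprod I \<Otimes>\<^sub>M cprod J) \<longleftrightarrow> p \<in> P \<times> Q"
      proof
        assume L: "p \<in> ?T -` Pi\<^sub>E K A \<inter> space (cprod I \<Otimes>\<^sub>M cprod J)"
        then have ext: "x \<in> extensional I" "y \<in> extensional J" by (auto simp: p space_pair_measure space_PiM PiE_def)
        have *: "(case s k of Inl i \<Rightarrow> x i | Inr j \<Rightarrow> y j) \<in> A k" if "k \<in> K" for k
          using L that by (auto simp: p PiE_iff)
        have "x i \<in> A (t (Inl i))" if "i \<in> I" for i using *[of "t (Inl i)"] tK[OF InlI[OF that]] by simp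
        moreover have "y j \<in> A (t (Inr j))" if "j \<in> J" for j using *[of "t (Inr j)"] tK[OF InrI[OF that]] by simp
        ultimately show "p \<in> P \<times> Q" using ext by (auto simp: p P_def Q_def PiE_iff)
      next
        assume R: "p \<in> P \<times> Q"
        have "(case s k of Inl i \<Rightarrow> x i | Inr j \<Rightarrow> y j) \<in> A k" if "k \<in> K" for k
          using R sK[OF that] ts[OF that] by (cases "s k") (auto simp: p P_def Q_def PiE_iff)
        then show "p \<in> ?T -` Pi\<^sub>E K A \<inter> space (cprod I \<Otimes>\<^sub>M cprod J)"
          using R by (auto simp: p P_def Q_def PiE_iff space_pair_measure space_PiM)
      qed
    qed
    have "emeasure (distr (cprod I \<Otimes>\<^sub>M cprod J) (cprod K) ?T) (Pi\<^sub>E K A) = emeasure (cprod I \<Otimes>\<^sub>M cprod J) (P \<times> Q)"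
      unfolding pre[symmetric] by (rule emeasure_distr[OF T]) (use fin A in \<open>auto intro!: sets_PiM_I_finite\<close>)
    also have "\<dots> = emeasure (cprod I) P * emeasure (cprod J) Q" by (rule J.emeasure_pair_measure_Times[OF P])
    also have "\<dots> = (\<Prod>i\<in>I. emeasure lborel (A (t (Inl i)))) * (\<Prod>j\<in>J. emeasure lborel (A (t (Inr j))))"
      unfolding P_def Q_def using fin AI AJ by (subst (1 2) cprod.emeasure_PiM) auto
    also have "\<dots> = (\<Prod>x\<in>I <+> J. emeasure lborel (A (t x)))"
      using fin by (simp add: prod.Plus)
    also have "\<dots> = (\<Prod>k\<in>K. emeasure lborel (A k))"
      by (rule prod.reindex_bij_betw[OF tbij])
    finally show "emeasure (distr (cprod I \<Otimes>\<^sub>M cprod J) (cprod K) ?T) (Pi\<^sub>E K A) = (\<Prod>k\<in>K. emeasure lborel (A k))" .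
  qed (use fin in auto)
qed

lemma nn_integral_cprod_sum:
  assumes fin: "finite I" "finite J" "finite K" and s: "bij_betw s K (I <+> J)"
    and f: "f \<in> borel_measurable (cprod K)"
  shows "(\<integral>\<^sup>+z. f z \<partial>cprod K) = (\<integral>\<^sup>+x. \<integral>\<^sup>+y. f (\<lambda>k\<in>K. case s k of Inl i \<Rightarrow> x i | Inr j \<Rightarrow> y j) \<partial>cprod J \<partial>cprod I)"
proof -
  let ?T = "\<lambda>(x, y). \<lambda>k\<in>K. case s k of Inl i \<Rightarrow> x i | Inr j \<Rightarrow> (y j :: complex)"
  interpret J: sigma_finite_measure "cprod J" by (rule sigma_finite_cprod) fact
  note T = cprod_sum_distr(2)[OF fin s]
  have "(\<integral>\<^sup>+z. f z \<partial>cprod K) = (\<integral>\<^sup>+p. f (?T p) \<partial>(cprod I \<Otimes>\<^sub>M cprod J))"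
    by (subst cprod_sum_distr(1)[OF fin s, symmetric], subst nn_integral_distr[OF T]) (use f in auto)
  also have "\<dots> = (\<integral>\<^sup>+x. \<integral>\<^sup>+y. f (?T (x, y)) \<partial>cprod J \<partial>cprod I)"
    by (rule J.nn_integral_fst[symmetric]) (rule measurable_compose[OF T f])
  finally show ?thesis by simp
qed

lemma nn_integral_cprod_reindex:
  assumes fin: "finite I" "finite K" and s: "bij_betw s K I"
    and f: "f \<in> borel_measurable (cprod K)"
  shows "(\<integral>\<^sup>+z. f z \<partial>cprod K) = (\<integral>\<^sup>+x. f (\<lambda>k\<in>K. x (s k)) \<partial>cprod I)"
proof -
  have "bij_betw (\<lambda>k. Inl (s k) :: _ + unit) K (I <+> {})"
    using s by (auto simp: bij_betw_def inj_on_def)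
  from nn_integral_cprod_sum[OF fin(1) _ fin(2) this f]
  show ?thesis by (simp add: PiM_empty nn_integral_count_space_finite)
qed

lemma nn_integral_cprod_shift:
  assumes fin: "finite I" and f: "f \<in> borel_measurable (cprod I)"
  shows "(\<integral>\<^sup>+x. f (\<lambda>i\<in>I. x i + d i) \<partial>cprod I) = (\<integral>\<^sup>+x. f x \<partial>cprod I)"
proof -
  let ?T = "\<lambda>x. \<lambda>i\<in>I. x i + (d i :: complex)"
  have T: "?T \<in> measurable (cprod I) (cprod I)" by (rule measurable_restrict) measurable
  have "distr (cprod I) (cprod I) ?T = cprod I"
  proof (rule cprod.PiM_eqI)
    fix A :: "_ \<Rightarrow> complex set" assume A: "\<And>i. i \<in> I \<Longrightarrow> A i \<in> sets lborel"
    have m: "(\<lambda>z. z + d i) -` A i \<in> sets borel" if "i \<in> I" for i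
      using measurable_sets_borel[of "\<lambda>z. z + d i" borel "A i"] A[OF that] by simp
    have "?T -` Pi\<^sub>E I A \<inter> space (cprod I) = Pi\<^sub>E I (\<lambda>i. (\<lambda>z. z + d i) -` A i)"
      by (auto simp: space_PiM PiE_iff)
    then have "emeasure (distr (cprod I) (cprod I) ?T) (Pi\<^sub>E I A) = emeasure (cprod I) (Pi\<^sub>E I (\<lambda>i. (\<lambda>z. z + d i) -` A i))"
      using fin A by (subst emeasure_distr[OF T]) (auto intro!: sets_PiM_I_finite)
    also have "\<dots> = (\<Prod>i\<in>I. emeasure lborel ((\<lambda>z. z + d i) -` A i))"
      using fin m by (intro cprod.emeasure_PiM) auto
    also have "\<dots> = (\<Prod>i\<in>I. emeasure lborel (A i))"
    proof (rule prod.cong[OF refl])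
      fix i assume i: "i \<in> I"
      have "emeasure lborel (A i) = emeasure (distr lborel borel ((+) (d i))) (A i)"
        by (simp add: lborel_distr_plus)
      also have "\<dots> = emeasure lborel ((\<lambda>z. z + d i) -` A i)"
        using A[OF i] by (subst emeasure_distr) (auto simp: vimage_def add.commute)
      finally show "emeasure lborel ((\<lambda>z. z + d i) -` A i) = emeasure lborel (A i)" ..
    qed
    finally show "emeasure (distr (cprod I) (cprod I) ?T) (Pi\<^sub>E I A) = (\<Prod>i\<in>I. emeasure lborel (A i))" .
  qed (use fin in auto)
  then show ?thesis by (subst (2) \<open>_ = cprod I\<close>[symmetric], subst nn_integral_distr[OF T]) (use f in auto)
qed

section \<open>Change of variables under an invertible complex matrix\<close>

definition lin_app :: "nat \<Rightarrow> complex mat \<Rightarrow> (nat \<Rightarrow> complex) \<Rightarrow> nat \<Rightarrow> complex" where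
  "lin_app n A x = (\<lambda>i\<in>{..<n}. \<Sum>j<n. A $$ (i, j) * x j)"

lemma measurable_lin_app [measurable]: "lin_app n A \<in> measurable (cprod {..<n}) (cprod {..<n})"
  unfolding lin_app_def by (rule measurable_restrict) measurable

text \<open>Right multiplication by a unipotent lower triangular matrix clears the last row to the
  left of the pivot; the block that remains is the Schur complement.\<close>

lemma det_schur:
  assumes A: "(A :: complex mat) \<in> carrier_mat (Suc n) (Suc n)" and d: "A $$ (n, n) \<noteq> 0"
  shows "Determinant.det A = A $$ (n, n) * Determinant.det (Matrix.mat n n (\<lambda>(i, j). A $$ (i, j) - A $$ (i, n) * A $$ (n, j) / A $$ (n, n)))"
proof -
  define S where "S = Matrix.mat n n (\<lambda>(i, j). A $$ (i, j) - A $$ (i, n) * A $$ (n, j) / A $$ (n, n))"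
  define L where "L = Matrix.mat (Suc n) (Suc n) (\<lambda>(i, j). if i = j then 1 else if i = n then - A $$ (n, j) / A $$ (n, n) else 0)"
  have L: "L \<in> carrier_mat (Suc n) (Suc n)" unfolding L_def by simp
  have S: "S \<in> carrier_mat n n" unfolding S_def by simp
  have detL: "Determinant.det L = 1"
  proof -
    have "Determinant.det L = prod_list (diag_mat L)"
      by (rule det_lower_triangular[OF _ L]) (auto simp: L_def)
    also have "diag_mat L = map (\<lambda>_. 1) [0..<Suc n]"
      unfolding diag_mat_def by (rule map_cong) (auto simp: L_def)
    finally show ?thesis by (simp add: map_replicate_const)
  qed
  have AL: "A * L = four_block_mat S (Matrix.mat n 1 (\<lambda>(i, j). A $$ (i, n))) (0\<^sub>m 1 n) (Matrix.mat 1 1 (\<lambda>_. A $$ (n, n)))"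
  proof (rule eq_matI)
    fix i j assume "i < dim_row (four_block_mat S (Matrix.mat n 1 (\<lambda>(i, j). A $$ (i, n))) (0\<^sub>m 1 n) (Matrix.mat 1 1 (\<lambda>_. A $$ (n, n))))"
      "j < dim_col (four_block_mat S (Matrix.mat n 1 (\<lambda>(i, j). A $$ (i, n))) (0\<^sub>m 1 n) (Matrix.mat 1 1 (\<lambda>_. A $$ (n, n))))"
    then have ij: "i < Suc n" "j < Suc n" using S by auto
    have "(A * L) $$ (i, j) = (\<Sum>k<Suc n. A $$ (i, k) * L $$ (k, j))"
      using A L ij by (simp add: scalar_prod_def lessThan_atLeast0)
    also have "\<dots> = (\<Sum>k<n. if k = j then A $$ (i, k) else 0) + A $$ (i, n) * (if n = j then 1 else - A $$ (n, j) / A $$ (n, n))"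
      unfolding sum.lessThan_Suc by (intro arg_cong2[where f="(+)"] sum.cong) (use ij in \<open>auto simp: L_def\<close>)
    also have "\<dots> = (if j < n then A $$ (i, j) - A $$ (i, n) * A $$ (n, j) / A $$ (n, n) else A $$ (i, n))"
      using ij by (auto simp: sum.delta less_Suc_eq)
    also have "\<dots> = four_block_mat S (Matrix.mat n 1 (\<lambda>(i, j). A $$ (i, n))) (0\<^sub>m 1 n) (Matrix.mat 1 1 (\<lambda>_. A $$ (n, n))) $$ (i, j)"
      using ij d S by (auto simp: S_def less_Suc_eq)
    finally show "(A * L) $$ (i, j) = four_block_mat S (Matrix.mat n 1 (\<lambda>(i, j). A $$ (i, n))) (0\<^sub>m 1 n) (Matrix.mat 1 1 (\<lambda>_. A $$ (n, n))) $$ (i, j)" .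
  qed (use A L S in auto)
  have "Determinant.det A = Determinant.det (A * L)" using det_mult[OF A L] detL by simp
  also have "\<dots> = Determinant.det S * Determinant.det (Matrix.mat 1 1 (\<lambda>_. A $$ (n, n)))"
    unfolding AL by (rule det_four_block_mat_lower_left_zero[OF S]) auto
  also have "Determinant.det (Matrix.mat 1 1 (\<lambda>_. A $$ (n, n))) = A $$ (n, n)"
    by (subst det_single) auto
  finally show ?thesis by (simp add: S_def mult.commute)
qed

lemma nn_integral_cprod_insert_rev:
  assumes "f \<in> borel_measurable (cprod {..<Suc n})"
  shows "(\<integral>\<^sup>+x. f x \<partial>cprod {..<Suc n}) = (\<integral>\<^sup>+t. \<integral>\<^sup>+x. f (x(n := t)) \<partial>cprod {..<n} \<partial>lborel)"
  using assms unfolding lessThan_Suc by (intro cprod.product_nn_integral_insert_rev) auto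

lemma nn_integral_cprod_insert:
  assumes "f \<in> borel_measurable (cprod {..<Suc n})"
  shows "(\<integral>\<^sup>+x. f x \<partial>cprod {..<Suc n}) = (\<integral>\<^sup>+x. \<integral>\<^sup>+t. f (x(n := t)) \<partial>lborel \<partial>cprod {..<n})"
  using assms unfolding lessThan_Suc by (intro cprod.product_nn_integral_insert) auto

lemma measurable_fun_upd_cprod:
  "(\<lambda>(x, t). x(n := t)) \<in> measurable (cprod {..<n} \<Otimes>\<^sub>M lborel) (cprod {..<Suc n})"
  unfolding lessThan_Suc by (rule measurable_add_dim)

text \<open>Induction on the dimension. If the last diagonal entry is nonzero, the last coordinate
  is substituted by an affine map of one complex variable; after Fubini the other coordinates
  undergo the Schur complement followed by a translation, and the two Jacobians multiply by
  \<open>det_schur\<close>. A zero pivot is repaired by a row swap.\<close>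

theorem nn_integral_linear_change:
  assumes "A \<in> carrier_mat n n" "Determinant.det A \<noteq> 0" "f \<in> borel_measurable (cprod {..<n})"
  shows "(\<integral>\<^sup>+x. f x \<partial>cprod {..<n}) = ennreal ((cmod (Determinant.det A))\<^sup>2) * (\<integral>\<^sup>+x. f (lin_app n A x) \<partial>cprod {..<n})"
  using assms
proof (induction n arbitrary: A f)
  case 0
  then have "Determinant.det A = 1" by (simp add: det_dim_zero)
  then show ?case by (simp add: PiM_empty nn_integral_count_space_finite lin_app_def)
next
  case (Suc n)
  have pivot: "(\<integral>\<^sup>+x. f x \<partial>cprod {..<Suc n}) = ennreal ((cmod (Determinant.det A))\<^sup>2) * (\<integral>\<^sup>+x. f (lin_app (Suc n) A x) \<partial>cprod {..<Suc n})"
    if A: "A \<in> carrier_mat (Suc n) (Suc n)" and det: "Determinant.det A \<noteq> 0" and d: "A $$ (n, n) \<noteq> 0"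
     and f: "f \<in> borel_measurable (cprod {..<Suc n})" for A f
  proof -
    define S where "S = Matrix.mat n n (\<lambda>(i, j). A $$ (i, j) - A $$ (i, n) * A $$ (n, j) / A $$ (n, n))"
    define e where "e = A $$ (n, n)"
    have S: "S \<in> carrier_mat n n" unfolding S_def by simp
    have dA: "Determinant.det A = e * Determinant.det S" unfolding S_def e_def by (rule det_schur[OF A d])
    have dS: "Determinant.det S \<noteq> 0" using det dA by auto
    have e: "e \<noteq> 0" using d e_def by simp
    note [measurable] = f
    have fm[measurable]: "(\<lambda>(x, t). f (x(n := t))) \<in> borel_measurable (cprod {..<n} \<Otimes>\<^sub>M lborel)"
      using measurable_compose[OF measurable_fun_upd_cprod f] by (simp add: split_beta')
    \<comment> \<open>In terms of the new last coordinate \<open>t\<close>, the remaining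
      coordinates of the image are the Schur complement applied to \<open>x\<close> plus a multiple
      of the pivot column.\<close>
    define g where "g x t = (\<lambda>i\<in>{..<n}. lin_app n S x i + A $$ (i, n) * t / e)" for x t
    have gm: "(\<lambda>(x, t). g x t) \<in> measurable (cprod {..<n} \<Otimes>\<^sub>M lborel) (cprod {..<n})"
      unfolding g_def split_beta by (rule measurable_restrict) (simp add: lin_app_def)
    have fgm[measurable]: "(\<lambda>(x, t). f ((g x t)(n := t))) \<in> borel_measurable (cprod {..<n} \<Otimes>\<^sub>M lborel)"
    proof -
      have "(\<lambda>p. (g (fst p) (snd p), snd p)) \<in> measurable (cprod {..<n} \<Otimes>\<^sub>M lborel) (cprod {..<n} \<Otimes>\<^sub>M lborel)"
        using gm by (intro measurable_Pair) (auto simp: split_beta)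
      from measurable_compose[OF this fm] show ?thesis by (simp add: split_beta')
    qed
    define b where "b x = (\<Sum>j<n. A $$ (n, j) * x j)" for x :: "nat \<Rightarrow> complex"
    have lin: "lin_app (Suc n) A (x(n := t)) = (g x (e * t + b x))(n := e * t + b x)" for x t
    proof (rule ext)
      fix i
      show "lin_app (Suc n) A (x(n := t)) i = ((g x (e * t + b x))(n := e * t + b x)) i"
      proof (cases "i < n")
        case True
        have "(\<Sum>j<n. A $$ (i, j) * (x(n := t)) j) = (\<Sum>j<n. S $$ (i, j) * x j) + A $$ (i, n) / e * b x"
          unfolding b_def sum_distrib_left sum.distrib[symmetric]
          by (rule sum.cong) (use True e in \<open>auto simp: S_def e_def[symmetric] field_simps\<close>)
        then show ?thesis using True e by (auto simp: g_def lin_app_def field_simps)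
      next
        case False
        then show ?thesis using e by (auto simp: g_def lin_app_def b_def e_def add.commute)
      qed
    qed
    have "(\<integral>\<^sup>+x. f (lin_app (Suc n) A x) \<partial>cprod {..<Suc n}) * ennreal ((cmod e)\<^sup>2)
        = (\<integral>\<^sup>+x. (\<integral>\<^sup>+t. f ((g x (e * t + b x))(n := e * t + b x)) \<partial>lborel) * ennreal ((cmod e)\<^sup>2) \<partial>cprod {..<n})"
    proof (subst nn_integral_cprod_insert)
      show "(\<lambda>x. f (lin_app (Suc n) A x)) \<in> borel_measurable (cprod {..<Suc n})" by measurable
      have "(\<lambda>p. (fst p, e * snd p + b (fst p))) \<in> measurable (cprod {..<n} \<Otimes>\<^sub>M lborel) (cprod {..<n} \<Otimes>\<^sub>M lborel)"
        unfolding b_def by measurable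
      from measurable_compose[OF this fgm]
      have "(\<lambda>(x, t). f ((g x (e * t + b x))(n := e * t + b x))) \<in> borel_measurable (cprod {..<n} \<Otimes>\<^sub>M lborel)" by (simp add: split_beta')
      then have "(\<lambda>x. \<integral>\<^sup>+t. f ((g x (e * t + b x))(n := e * t + b x)) \<partial>lborel) \<in> borel_measurable (cprod {..<n})"
        by (rule lborel.borel_measurable_nn_integral)
      then show "(\<integral>\<^sup>+ x. \<integral>\<^sup>+ t. f (lin_app (Suc n) A (x(n := t))) \<partial>lborel \<partial>cprod {..<n}) * ennreal ((cmod e)\<^sup>2)
        = (\<integral>\<^sup>+x. (\<integral>\<^sup>+t. f ((g x (e * t + b x))(n := e * t + b x)) \<partial>lborel) * ennreal ((cmod e)\<^sup>2) \<partial>cprod {..<n})"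
        unfolding lin by (rule nn_integral_multc[symmetric])
    qed
    also have "\<dots> = (\<integral>\<^sup>+x. \<integral>\<^sup>+t. f ((g x t)(n := t)) \<partial>lborel \<partial>cprod {..<n})"
    proof (rule nn_integral_cong)
      fix x assume x: "x \<in> space (cprod {..<n})"
      have "(\<lambda>t. f ((g x t)(n := t))) \<in> borel_measurable borel"
        using measurable_Pair2[OF fgm x] by simp
      from nn_integral_complex_affine[OF e this, of "b x"]
      show "(\<integral>\<^sup>+t. f ((g x (e * t + b x))(n := e * t + b x)) \<partial>lborel) * ennreal ((cmod e)\<^sup>2) = (\<integral>\<^sup>+t. f ((g x t)(n := t)) \<partial>lborel)" .
    qed
    also have "\<dots> = (\<integral>\<^sup>+t. \<integral>\<^sup>+x. f ((g x t)(n := t)) \<partial>cprod {..<n} \<partial>lborel)"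
    proof -
      interpret pair_sigma_finite "cprod {..<n}" "lborel :: complex measure"
        by (intro pair_sigma_finite.intro sigma_finite_cprod lborel.sigma_finite_measure_axioms) auto
      show ?thesis by (rule Fubini'[OF fgm, symmetric])
    qed
    finally have 1: "(\<integral>\<^sup>+x. f (lin_app (Suc n) A x) \<partial>cprod {..<Suc n}) * ennreal ((cmod e)\<^sup>2)
       = (\<integral>\<^sup>+t. \<integral>\<^sup>+x. f ((g x t)(n := t)) \<partial>cprod {..<n} \<partial>lborel)" .
    have 2: "ennreal ((cmod (Determinant.det S))\<^sup>2) * (\<integral>\<^sup>+x. f ((g x t)(n := t)) \<partial>cprod {..<n}) = (\<integral>\<^sup>+x. f (x(n := t)) \<partial>cprod {..<n})" for t
    proof -
      have m1: "(\<lambda>x. f (x(n := t))) \<in> borel_measurable (cprod {..<n})" using measurable_Pair1[OF fm, of t] by simp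
      have sh: "(\<lambda>x. \<lambda>i\<in>{..<n}. x i + A $$ (i, n) * t / e) \<in> measurable (cprod {..<n}) (cprod {..<n})"
        by (rule measurable_restrict) measurable
      have "(\<integral>\<^sup>+x. f (x(n := t)) \<partial>cprod {..<n}) = (\<integral>\<^sup>+x. f ((\<lambda>i\<in>{..<n}. x i + A $$ (i, n) * t / e)(n := t)) \<partial>cprod {..<n})"
        by (rule nn_integral_cprod_shift[symmetric, OF _ m1]) simp
      also have "\<dots> = ennreal ((cmod (Determinant.det S))\<^sup>2) * (\<integral>\<^sup>+x. f ((g x t)(n := t)) \<partial>cprod {..<n})"
        unfolding g_def by (rule Suc.IH[OF S dS]) (rule measurable_compose[OF sh m1])
      finally show ?thesis ..
    qed
    have m3: "(\<lambda>t. \<integral>\<^sup>+x. f ((g x t)(n := t)) \<partial>cprod {..<n}) \<in> borel_measurable lborel"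
    proof -
      interpret sigma_finite_measure "cprod {..<n}" by (rule sigma_finite_cprod) simp
      have "(\<lambda>(t, x). f ((g x t)(n := t))) \<in> borel_measurable (lborel \<Otimes>\<^sub>M cprod {..<n})"
        using measurable_compose[OF measurable_pair_swap' fgm] by (simp add: split_beta')
      then show ?thesis by (rule borel_measurable_nn_integral)
    qed
    have "ennreal ((cmod (Determinant.det A))\<^sup>2) * (\<integral>\<^sup>+x. f (lin_app (Suc n) A x) \<partial>cprod {..<Suc n})
       = ennreal ((cmod (Determinant.det S))\<^sup>2) * ((\<integral>\<^sup>+x. f (lin_app (Suc n) A x) \<partial>cprod {..<Suc n}) * ennreal ((cmod e)\<^sup>2))"
      unfolding dA norm_mult power_mult_distrib by (subst ennreal_mult') (auto simp: mult_ac)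
    also have "\<dots> = (\<integral>\<^sup>+t. \<integral>\<^sup>+x. f (x(n := t)) \<partial>cprod {..<n} \<partial>lborel)"
      unfolding 1 2[symmetric] by (rule nn_integral_cmult[symmetric, OF m3])
    also have "\<dots> = (\<integral>\<^sup>+x. f x \<partial>cprod {..<Suc n})" by (rule nn_integral_cprod_insert_rev[symmetric, OF f])
    finally show ?thesis ..
  qed
  show ?case
  proof (cases "A $$ (n, n) = 0")
    case False then show ?thesis using pivot Suc.prems by blast
  next
    case True
    note A = Suc.prems(1) and det = Suc.prems(2) and f = Suc.prems(3)
    have "\<exists>k<n. A $$ (k, n) \<noteq> 0"
    proof (rule ccontr)
      assume "\<not> ?thesis"
      then have "\<And>k. k < Suc n \<Longrightarrow> A $$ (k, n) = 0" using True by (auto simp: less_Suc_eq)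
      then have "Determinant.det A = 0"
        by (subst laplace_expansion_column[OF A, of n]) auto
      then show False using det by simp
    qed
    then obtain k where k: "k < n" "A $$ (k, n) \<noteq> 0" by auto
    define p where "p = Transposition.transpose k n"
    have p: "bij_betw p {..<Suc n} {..<Suc n}"
      unfolding p_def by (rule bij_betwI[where g="Transposition.transpose k n"]) (use k in \<open>auto simp: Transposition.transpose_def\<close>)
    have pp: "p (p i) = i" for i by (simp add: p_def)
    define A' where "A' = swaprows k n A"
    have A': "A' \<in> carrier_mat (Suc n) (Suc n)" using A by (simp add: A'_def)
    have dA': "Determinant.det A' = - Determinant.det A"
      unfolding A'_def by (rule det_swaprows[OF _ _ _ A]) (use k in auto)
    have A'nn: "A' $$ (n, n) \<noteq> 0" using k A by (auto simp: A'_def)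
    define f' where "f' x = f (\<lambda>i\<in>{..<Suc n}. x (p i))" for x
    have pm: "(\<lambda>x. \<lambda>i\<in>{..<Suc n}. x (p i)) \<in> measurable (cprod {..<Suc n}) (cprod {..<Suc n})"
    proof (rule measurable_restrict)
      fix i assume "i \<in> {..<Suc n}"
      then have "p i \<in> {..<Suc n}" using p by (auto simp: bij_betw_def)
      then show "(\<lambda>x. x (p i)) \<in> measurable (cprod {..<Suc n}) lborel" by (rule measurable_component_singleton)
    qed
    have f': "f' \<in> borel_measurable (cprod {..<Suc n})" unfolding f'_def by (rule measurable_compose[OF pm f])
    have lin: "f' (lin_app (Suc n) A' x) = f (lin_app (Suc n) A x)" for x
    proof -
      have "(\<lambda>i\<in>{..<Suc n}. lin_app (Suc n) A' x (p i)) = lin_app (Suc n) A x"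
        unfolding lin_app_def using k A
        by (auto simp: restrict_def fun_eq_iff p_def Transposition.transpose_def A'_def intro!: sum.cong)
      then show ?thesis by (simp add: f'_def)
    qed
    have "(\<integral>\<^sup>+x. f x \<partial>cprod {..<Suc n}) = (\<integral>\<^sup>+x. f' x \<partial>cprod {..<Suc n})"
      unfolding f'_def by (rule nn_integral_cprod_reindex[OF _ _ p f]) auto
    also have "\<dots> = ennreal ((cmod (Determinant.det A'))\<^sup>2) * (\<integral>\<^sup>+x. f' (lin_app (Suc n) A' x) \<partial>cprod {..<Suc n})"
      by (rule pivot[OF A' _ A'nn f']) (use dA' det in simp)
    finally show ?thesis unfolding lin dA' by simp
  qed
qed

section \<open>Characteristic polynomials and measurability of root events\<close>

definition cpoly :: "nat \<Rightarrow> (nat \<times> nat \<Rightarrow> complex) \<Rightarrow> complex poly" where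
  "cpoly n G = char_poly (Matrix.mat n n G)"

lemma cdet_eq_det: "cdet n A = Determinant.det (Matrix.mat n n A)"
proof -
  have "Determinant.det (Matrix.mat n n A) = (\<Sum>p | p permutes {0..<n}. signof p * (\<Prod>i = 0..<n. A (i, p i)))"
    unfolding Determinant.det_def
    by (auto intro!: sum.cong prod.cong simp: permutes_in_image dest: permutes_in_image)
  then show ?thesis unfolding cdet_def by (simp add: lessThan_atLeast0)
qed

lemma poly_cpoly: "poly (cpoly n G) z = cdet n (\<lambda>(i, j). (if i = j then z else 0) - G (i, j))"
proof -
  have "poly (cpoly n G) z = Determinant.det (map_mat (\<lambda>p. poly p z) (char_poly_matrix (Matrix.mat n n G)))"
    unfolding cpoly_def char_poly_def by (rule poly_det_cong[where n=n]) (auto simp: char_poly_matrix_def)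
  also have "map_mat (\<lambda>p. poly p z) (char_poly_matrix (Matrix.mat n n G)) = Matrix.mat n n (\<lambda>(i, j). (if i = j then z else 0) - G (i, j))"
    by (rule eq_matI) (auto simp: char_poly_matrix_def)
  finally show ?thesis by (simp add: cdet_eq_det)
qed

lemma is_eigenvalue_cpoly: "is_eigenvalue n G z \<longleftrightarrow> poly (cpoly n G) z = 0"
  unfolding is_eigenvalue_def poly_cpoly ..

lemma cpoly_cong: "(\<And>i j. i < n \<Longrightarrow> j < n \<Longrightarrow> G (i, j) = H (i, j)) \<Longrightarrow> cpoly n G = cpoly n H"
  unfolding cpoly_def by (rule arg_cong[where f=char_poly]) (auto intro!: cong_mat)

lemma monic_cpoly: "degree (cpoly n G) = n" "lead_coeff (cpoly n G) = 1" "cpoly n G \<noteq> 0"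
proof -
  show *: "degree (cpoly n G) = n" "lead_coeff (cpoly n G) = 1"
    using degree_monic_char_poly[of "Matrix.mat n n G" n] by (auto simp: cpoly_def)
  then show "cpoly n G \<noteq> 0" by auto
qed

lemma cpoly_factorized: "\<exists>as. cpoly n G = (\<Prod>a\<leftarrow>as. [:- a, 1:]) \<and> length as = n"
  unfolding cpoly_def by (rule char_poly_factorized) simp

lemma borel_measurable_cdet:
  assumes "\<And>i j. i < n \<Longrightarrow> j < n \<Longrightarrow> (\<lambda>x. F x (i, j)) \<in> borel_measurable M"
  shows "(\<lambda>x. cdet n (F x)) \<in> borel_measurable M"
  unfolding cdet_def
proof (intro borel_measurable_sum borel_measurable_times borel_measurable_const borel_measurable_prod assms)
  fix p i assume "p \<in> {p. p permutes {..<n}}" "i \<in> {..<n}"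
  then show "i < n" "p i < n" by (auto dest: permutes_in_image)
qed

lemma borel_measurable_poly_cpoly:
  assumes "\<And>i j. i < n \<Longrightarrow> j < n \<Longrightarrow> (\<lambda>x. F x (i, j)) \<in> borel_measurable M" "g \<in> borel_measurable M"
  shows "(\<lambda>x. poly (cpoly n (F x)) (g x)) \<in> borel_measurable M"
  unfolding poly_cpoly by (rule borel_measurable_cdet) (use assms in \<open>auto intro!: borel_measurable_diff\<close>)

text \<open>The open complement of \<open>S\<close> is a countable union of compact sets. A
  polynomial has no root in a compact set iff its modulus is bounded below there, and by continuity
  such a bound can be tested on a countable dense subset. The event becomes a countable combination
  of measurable conditions.\<close>

lemma sets_roots:
  assumes F: "\<And>i j. i < n \<Longrightarrow> j < n \<Longrightarrow> (\<lambda>x. F x (i, j)) \<in> borel_measurable M" and S: "closed S"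
  shows "{x \<in> space M. \<forall>z. poly (cpoly n (F x)) z = 0 \<longrightarrow> z \<in> S} \<in> sets M"
proof -
  have "open (- S)" using S by auto
  then obtain C :: "nat \<Rightarrow> complex set" where C: "\<And>k. compact (C k)" "\<And>k. C k \<subseteq> - S" "\<Union>(range C) = - S"
    using open_Union_compact_subsets[of "- S"] by metis
  have "\<exists>T. countable T \<and> T \<subseteq> C k \<and> C k \<subseteq> closure T" for k
    using separable[of "C k"] by metis
  then obtain T where T: "\<And>k. countable (T k) \<and> T k \<subseteq> C k \<and> C k \<subseteq> closure (T k)" by metis
  have iff: "(\<forall>z. poly p z = 0 \<longrightarrow> z \<in> S) \<longleftrightarrow> (\<forall>k. \<exists>m::nat. \<forall>z\<in>T k. 1 / real (Suc m) \<le> cmod (poly p z))" for p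
  proof
    assume L: "\<forall>z. poly p z = 0 \<longrightarrow> z \<in> S"
    show "\<forall>k. \<exists>m::nat. \<forall>z\<in>T k. 1 / real (Suc m) \<le> cmod (poly p z)"
    proof
      fix k
      show "\<exists>m::nat. \<forall>z\<in>T k. 1 / real (Suc m) \<le> cmod (poly p z)"
      proof (cases "C k = {}")
        case True then show ?thesis using T by blast
      next
        case False
        have "continuous_on (C k) (\<lambda>z. cmod (poly p z))" by (intro continuous_intros)
        then obtain z0 where z0: "z0 \<in> C k" "\<forall>z\<in>C k. cmod (poly p z0) \<le> cmod (poly p z)"
          using continuous_attains_inf[OF C(1) False] by metis
        have "poly p z0 \<noteq> 0" using L z0(1) C(2) by blast
        then obtain m where "inverse (real (Suc m)) < cmod (poly p z0)" using reals_Archimedean by (metis zero_less_norm_iff)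
        then show ?thesis using z0(2) T[of k] by (intro exI[of _ m]) (auto simp: inverse_eq_divide, meson less_le_trans less_imp_le subsetD)
      qed
    qed
  next
    assume R: "\<forall>k. \<exists>m::nat. \<forall>z\<in>T k. 1 / real (Suc m) \<le> cmod (poly p z)"
    show "\<forall>z. poly p z = 0 \<longrightarrow> z \<in> S"
    proof (intro allI impI, rule ccontr)
      fix z assume z: "poly p z = 0" "z \<notin> S"
      then obtain k where k: "z \<in> C k" using C(3) by blast
      obtain m where m: "\<forall>z\<in>T k. 1 / real (Suc m) \<le> cmod (poly p z)" using R by blast
      have "closed {z. 1 / real (Suc m) \<le> cmod (poly p z)}" by (intro closed_Collect_le continuous_intros)
      then have "closure (T k) \<subseteq> {z. 1 / real (Suc m) \<le> cmod (poly p z)}" using m by (intro closure_minimal) auto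
      then have "1 / real (Suc m) \<le> cmod (poly p z)" using k T[of k] by blast
      then show False using z by simp
    qed
  qed
  have m: "(\<lambda>x. cmod (poly (cpoly n (F x)) z)) \<in> borel_measurable M" for z
    using borel_measurable_poly_cpoly[of n F M "\<lambda>_. z", OF F] by measurable
  show ?thesis unfolding iff
  proof (intro sets.sets_Collect_countable_All sets.sets_Collect_countable_Ex)
    fix k m
    have "{x \<in> space M. \<forall>z\<in>T k. 1 / real (Suc m) \<le> cmod (poly (cpoly n (F x)) z)} = space M \<inter> (\<Inter>z\<in>T k. {x \<in> space M. 1 / real (Suc m) \<le> cmod (poly (cpoly n (F x)) z)})" by auto
    also have "\<dots> \<in> sets M"
    proof (cases "T k = {}")
      case False
      then show ?thesis using T[of k] m by (intro sets.Int sets.top sets.countable_INT') auto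
    qed auto
    finally show "{x \<in> space M. \<forall>z\<in>T k. 1 / real (Suc m) \<le> cmod (poly (cpoly n (F x)) z)} \<in> sets M" .
  qed
qed

section \<open>Splitting off an eigenvector\<close>

text \<open>\<open>hQ n u\<close> is the unitary matrix that maps the last basis vector to the direction of \<open>(u, 1)\<close>
  and fixes the orthogonal complement of both vectors.\<close>

definition hr :: "nat \<Rightarrow> (nat \<Rightarrow> complex) \<Rightarrow> complex" where
  "hr n u = complex_of_real (sqrt (1 + (\<Sum>j<n. (cmod (u j))\<^sup>2)))"

definition hQ :: "nat \<Rightarrow> (nat \<Rightarrow> complex) \<Rightarrow> nat \<times> nat \<Rightarrow> complex" where
  "hQ n u = (\<lambda>(i, j). if i < n then if j < n then (if i = j then 1 else 0) - u i * cnj (u j) / (hr n u * (hr n u + 1)) else u i / hr n u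
     else if j < n then - cnj (u j) / hr n u else 1 / hr n u)"

lemma hr_props:
  "hr n u \<noteq> 0" "hr n u + 1 \<noteq> 0" "cnj (hr n u) = hr n u" "(\<Sum>j<n. u j * cnj (u j)) = (hr n u)\<^sup>2 - 1"
proof -
  have nn: "0 \<le> (\<Sum>j<n. (cmod (u j))\<^sup>2)" by (intro sum_nonneg) auto
  have gt: "sqrt (1 + (\<Sum>j<n. (cmod (u j))\<^sup>2)) > 0" using nn by simp
  show "hr n u \<noteq> 0" using gt by (auto simp: hr_def)
  have "hr n u + 1 = complex_of_real (sqrt (1 + (\<Sum>j<n. (cmod (u j))\<^sup>2)) + 1)" by (simp add: hr_def)
  then show "hr n u + 1 \<noteq> 0" using gt by (simp only: of_real_eq_0_iff)
  show "cnj (hr n u) = hr n u" by (simp add: hr_def)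
  have "(hr n u)\<^sup>2 = complex_of_real (1 + (\<Sum>j<n. (cmod (u j))\<^sup>2))"
    unfolding hr_def of_real_power[symmetric] using nn by (subst real_sqrt_pow2) auto
  then show "(\<Sum>j<n. u j * cnj (u j)) = (hr n u)\<^sup>2 - 1"
    unfolding complex_norm_square[symmetric] by simp
qed

text \<open>With r = \<open>hr n u\<close>, every case reduces to |u|^2 = r^2 - 1 and an identity
  between rational functions of r, where r^2 - 1 = (r - 1) (r + 1) cancels against the
  denominators.\<close>

lemma hQ_orthonormal:
  assumes "k < Suc n" "l < Suc n"
  shows "(\<Sum>i<Suc n. cnj (hQ n u (i, k)) * hQ n u (i, l)) = (if k = l then 1 else 0)"
proof -
  define r where "r = hr n u"
  note r = hr_props[where n=n and u=u, folded r_def]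
  have s: "(\<Sum>j<n. u j * cnj (u j)) = r\<^sup>2 - 1" by (rule r(4))
  define q where "q = 1 / (r * (r + 1))"
  have qc: "cnj q = q" using r by (simp add: q_def)
  have hq: "hQ n u (i, j) = (if i = j then 1 else 0) - q * u i * cnj (u j)" if "i < n" "j < n" for i j
    using that by (simp add: hQ_def r_def[symmetric] q_def)
  have hn: "hQ n u (i, n) = u i / r" if "i < n" for i
    using that by (simp add: hQ_def r_def[symmetric])
  consider "k < n" "l < n" | "k < n" "l = n" | "k = n" "l < n" | "k = n" "l = n" using assms by linarith
  then show ?thesis
  proof cases
    case 1
    have "(\<Sum>i<n. cnj (hQ n u (i, k)) * hQ n u (i, l))
      = (\<Sum>i<n. (if i = k then (if k = l then 1 else 0) else 0) - (if i = k then q * u k * cnj (u l) else 0) - (if i = l then q * u k * cnj (u l) else 0)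
         + q * q * u k * cnj (u l) * (u i * cnj (u i)))"
      by (rule sum.cong) (use 1 in \<open>auto simp: hq qc algebra_simps\<close>)
    also have "\<dots> = (if k = l then 1 else 0) - 2 * (q * u k * cnj (u l)) + q * q * u k * cnj (u l) * (r\<^sup>2 - 1)"
      using 1 by (simp add: sum.distrib sum_subtractf sum_distrib_left[symmetric] s)
    finally have "(\<Sum>i<Suc n. cnj (hQ n u (i, k)) * hQ n u (i, l)) = (if k = l then 1 else 0) + u k * cnj (u l) * (- 2 * q + q * q * (r\<^sup>2 - 1) + 1 / r\<^sup>2)"
      using 1 r by (simp add: hQ_def r_def[symmetric] algebra_simps power2_eq_square)
    also have "- 2 * q + q * q * (r\<^sup>2 - 1) + 1 / r\<^sup>2 = 0"
      unfolding q_def using r(1,2) by (simp add: divide_simps power2_eq_square) (simp add: algebra_simps)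
    finally show ?thesis by simp
  next
    case 2
    have "(\<Sum>i<n. cnj (hQ n u (i, k)) * hQ n u (i, l)) = (\<Sum>i<n. (if i = k then u k / r else 0) - q * u k / r * (u i * cnj (u i)))"
      by (rule sum.cong) (use 2 in \<open>auto simp: hq qc hn algebra_simps diff_divide_distrib\<close>)
    also have "\<dots> = u k / r - q * u k / r * (r\<^sup>2 - 1)"
      unfolding sum_subtractf sum_distrib_left[symmetric] s using 2 by simp
    finally have S: "(\<Sum>i<n. cnj (hQ n u (i, k)) * hQ n u (i, l)) = u k / r - q * u k / r * (r\<^sup>2 - 1)" .
    have "(\<Sum>i<Suc n. cnj (hQ n u (i, k)) * hQ n u (i, l)) = u k / r - q * u k / r * (r\<^sup>2 - 1) + cnj (hQ n u (n, k)) * hQ n u (n, l)"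
      by (simp only: sum.lessThan_Suc S)
    also have "\<dots> = u k / r * (1 - q * (r\<^sup>2 - 1) - 1 / r)"
      using 2 r by (simp add: hQ_def r_def[symmetric] field_simps power2_eq_square)
    also have "1 - q * (r\<^sup>2 - 1) - 1 / r = 0"
      unfolding q_def using r(1,2) by (simp add: divide_simps power2_eq_square) (simp add: algebra_simps)
    finally show ?thesis using 2 by simp
  next
    case 3
    have "(\<Sum>i<n. cnj (hQ n u (i, k)) * hQ n u (i, l)) = (\<Sum>i<n. (if i = l then cnj (u l) / r else 0) - q * cnj (u l) / r * (u i * cnj (u i)))"
      by (rule sum.cong) (use 3 in \<open>auto simp: hq qc hn r(3) algebra_simps diff_divide_distrib\<close>)
    also have "\<dots> = cnj (u l) / r - q * cnj (u l) / r * (r\<^sup>2 - 1)"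
      unfolding sum_subtractf sum_distrib_left[symmetric] s using 3 by simp
    finally have S: "(\<Sum>i<n. cnj (hQ n u (i, k)) * hQ n u (i, l)) = cnj (u l) / r - q * cnj (u l) / r * (r\<^sup>2 - 1)" .
    have "(\<Sum>i<Suc n. cnj (hQ n u (i, k)) * hQ n u (i, l)) = cnj (u l) / r - q * cnj (u l) / r * (r\<^sup>2 - 1) + cnj (hQ n u (n, k)) * hQ n u (n, l)"
      by (simp only: sum.lessThan_Suc S)
    also have "\<dots> = cnj (u l) / r * (1 - q * (r\<^sup>2 - 1) - 1 / r)"
      using 3 r by (simp add: hQ_def r_def[symmetric] field_simps power2_eq_square)
    also have "1 - q * (r\<^sup>2 - 1) - 1 / r = 0"
      unfolding q_def using r(1,2) by (simp add: divide_simps power2_eq_square) (simp add: algebra_simps)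
    finally show ?thesis using 3 by simp
  next
    case 4
    have "(\<Sum>i<n. cnj (hQ n u (i, k)) * hQ n u (i, l)) = (\<Sum>i<n. 1 / r\<^sup>2 * (u i * cnj (u i)))"
      by (rule sum.cong) (use 4 r in \<open>auto simp: hQ_def r_def[symmetric] field_simps power2_eq_square\<close>)
    also have "\<dots> = 1 / r\<^sup>2 * (r\<^sup>2 - 1)" by (simp only: sum_distrib_left[symmetric] s)
    finally show ?thesis
      using 4 r by (simp add: hQ_def r_def[symmetric] field_simps power2_eq_square)
  qed
qed

definition mQ :: "nat \<Rightarrow> (nat \<Rightarrow> complex) \<Rightarrow> complex mat" where
  "mQ n u = Matrix.mat (Suc n) (Suc n) (hQ n u)"

definition mQh :: "nat \<Rightarrow> (nat \<Rightarrow> complex) \<Rightarrow> complex mat" where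
  "mQh n u = Matrix.mat (Suc n) (Suc n) (\<lambda>(i, j). cnj (hQ n u (j, i)))"

text \<open>The conjugated upper left block of the unitary matrix. This is the matrix by which the
  substitution \<open>hX\<close> acts on each row of its argument.\<close>

definition mB :: "nat \<Rightarrow> (nat \<Rightarrow> complex) \<Rightarrow> complex mat" where
  "mB n u = Matrix.mat n n (\<lambda>p. cnj (hQ n u p))"

lemma mQ_carrier [simp]: "mQ n u \<in> carrier_mat (Suc n) (Suc n)" "mQh n u \<in> carrier_mat (Suc n) (Suc n)" "mB n u \<in> carrier_mat n n"
  by (simp_all add: mQ_def mQh_def mB_def)

lemma mQh_mQ: "mQh n u * mQ n u = 1\<^sub>m (Suc n)"
proof (rule eq_matI)
  fix i j assume "i < dim_row (1\<^sub>m (Suc n) :: complex mat)" "j < dim_col (1\<^sub>m (Suc n) :: complex mat)"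
  then have ij: "i < Suc n" "j < Suc n" by auto
  have "(mQh n u * mQ n u) $$ (i, j) = (\<Sum>k<Suc n. cnj (hQ n u (k, i)) * hQ n u (k, j))"
    using ij by (simp add: mQ_def mQh_def scalar_prod_def lessThan_atLeast0 del: sum.lessThan_Suc)
  also have "\<dots> = (if i = j then 1 else 0)" by (rule hQ_orthonormal[OF ij])
  finally show "(mQh n u * mQ n u) $$ (i, j) = 1\<^sub>m (Suc n) $$ (i, j)" using ij by simp
qed (auto simp: mQ_def mQh_def)

lemma mQ_mQh: "mQ n u * mQh n u = 1\<^sub>m (Suc n)"
  by (rule mat_mult_left_right_inverse[OF _ _ mQh_mQ]) auto

lemma det_mQ: "Determinant.det (mQ n u) \<noteq> 0"
proof
  assume "Determinant.det (mQ n u) = 0"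
  then have "Determinant.det (mQh n u * mQ n u) = 0" by (subst det_mult[where n="Suc n"]) auto
  then show False by (simp add: mQh_mQ)
qed

text \<open>The matrix is a rank one perturbation of the identity, and \<open>E\<close> is its
  inverse by the Sherman-Morrison formula: with q = 1 / (r (r + 1)), the coefficient q / (1 - q (r^2
  - 1)) simplifies to 1 / (r + 1).\<close>

lemma det_mB: "Determinant.det (mB n u) \<noteq> 0"
proof
  assume d: "Determinant.det (mB n u) = 0"
  define r where "r = hr n u"
  note r = hr_props[where n=n and u=u, folded r_def]
  define E where "E = Matrix.mat n n (\<lambda>(i, j). (if i = j then 1 else 0) + cnj (u i) * u j / (r + 1))"
  have E: "E \<in> carrier_mat n n" by (simp add: E_def)
  have s: "(\<Sum>j<n. u j * cnj (u j)) = r\<^sup>2 - 1" by (rule r(4))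
  define q where "q = 1 / (r * (r + 1))"
  define p where "p = 1 / (r + 1)"
  have qc: "cnj q = q" using r by (simp add: q_def)
  have hq: "hQ n u (i, j) = (if i = j then 1 else 0) - q * u i * cnj (u j)" if "i < n" "j < n" for i j
    using that by (simp add: hQ_def r_def[symmetric] q_def)
  have "mB n u * E = 1\<^sub>m n"
  proof (rule eq_matI)
    fix i j assume "i < dim_row (1\<^sub>m n :: complex mat)" "j < dim_col (1\<^sub>m n :: complex mat)"
    then have ij: "i < n" "j < n" by auto
    have "(mB n u * E) $$ (i, j) = (\<Sum>k<n. cnj (hQ n u (i, k)) * ((if k = j then 1 else 0) + p * cnj (u k) * u j))"
      using ij by (simp add: mB_def E_def p_def scalar_prod_def lessThan_atLeast0)
    also have "\<dots> = (\<Sum>k<n. (if k = i then (if i = j then 1 else 0) else 0) + (if k = i then p * cnj (u i) * u j else 0)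
        - (if k = j then q * cnj (u i) * u j else 0) - q * p * cnj (u i) * u j * (u k * cnj (u k)))"
      by (rule sum.cong) (use ij in \<open>auto simp: hq qc algebra_simps\<close>)
    also have "\<dots> = (if i = j then 1 else 0) + p * cnj (u i) * u j - q * cnj (u i) * u j - q * p * cnj (u i) * u j * (r\<^sup>2 - 1)"
      unfolding sum.distrib sum_subtractf sum_distrib_left[symmetric] s using ij by simp
    also have "\<dots> = (if i = j then 1 else 0)"
    proof -
      have "p - q - q * p * (r\<^sup>2 - 1) = 0"
        unfolding p_def q_def using r(1,2) by (simp add: divide_simps power2_eq_square) (simp add: algebra_simps)
      then have "cnj (u i) * u j * (p - q - q * p * (r\<^sup>2 - 1)) = 0" by simp
      then show ?thesis by (simp add: algebra_simps)
    qed
    finally show "(mB n u * E) $$ (i, j) = 1\<^sub>m n $$ (i, j)" using ij by simp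
  qed (auto simp: mB_def E_def)
  moreover have "Determinant.det (mB n u * E) = 0" using d E by (subst det_mult[where n=n]) auto
  ultimately show False by simp
qed

lemma hQ_isometry:
  "(\<Sum>i<Suc n. (cmod (\<Sum>k<Suc n. hQ n u (i, k) * a k))\<^sup>2) = (\<Sum>k<Suc n. (cmod (a k))\<^sup>2)"
proof -
  have "complex_of_real (\<Sum>i<Suc n. (cmod (\<Sum>k<Suc n. hQ n u (i, k) * a k))\<^sup>2)
     = (\<Sum>i<Suc n. (\<Sum>l<Suc n. hQ n u (i, l) * a l) * cnj (\<Sum>k<Suc n. hQ n u (i, k) * a k))"
    by (simp only: of_real_sum complex_norm_square)
  also have "\<dots> = (\<Sum>i<Suc n. \<Sum>l<Suc n. \<Sum>k<Suc n. (a l * cnj (a k)) * (cnj (hQ n u (i, k)) * hQ n u (i, l)))"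
    unfolding cnj_sum sum_product by (intro sum.cong refl) (simp add: mult_ac)
  also have "\<dots> = (\<Sum>l<Suc n. \<Sum>k<Suc n. \<Sum>i<Suc n. (a l * cnj (a k)) * (cnj (hQ n u (i, k)) * hQ n u (i, l)))"
  proof -
    have "(\<Sum>i\<in>I. \<Sum>l\<in>I. \<Sum>k\<in>I. F i l k) = (\<Sum>l\<in>I. \<Sum>k\<in>I. \<Sum>i\<in>I. F i l k)" for I :: "nat set" and F :: "nat \<Rightarrow> nat \<Rightarrow> nat \<Rightarrow> complex"
    proof -
      have "(\<Sum>i\<in>I. \<Sum>l\<in>I. \<Sum>k\<in>I. F i l k) = (\<Sum>l\<in>I. \<Sum>i\<in>I. \<Sum>k\<in>I. F i l k)" by (rule sum.swap)
      also have "\<dots> = (\<Sum>l\<in>I. \<Sum>k\<in>I. \<Sum>i\<in>I. F i l k)" by (intro sum.cong refl sum.swap)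
      finally show ?thesis .
    qed
    then show ?thesis .
  qed
  also have "\<dots> = (\<Sum>l<Suc n. \<Sum>k<Suc n. (a l * cnj (a k)) * (if k = l then 1 else 0))"
    by (intro sum.cong refl) (simp only: sum_distrib_left[symmetric] hQ_orthonormal lessThan_iff)
  also have "\<dots> = (\<Sum>l<Suc n. a l * cnj (a l))"
    by (intro sum.cong refl) (simp add: if_distrib[of "\<lambda>x. _ * x"] cong: if_cong del: sum.lessThan_Suc)
  also have "\<dots> = complex_of_real (\<Sum>l<Suc n. (cmod (a l))\<^sup>2)"
    by (simp only: of_real_sum complex_norm_square)
  finally show ?thesis by (simp only: of_real_eq_iff)
qed

section \<open>Matrices assembled from their columns, with a prescribed eigenvector\<close>

text \<open>\<open>X\<close> supplies the first \<open>n\<close> columns, including their bottom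
  entries, \<open>c\<close> the last column above the corner, and \<open>a\<close> the corner. The
  corner is kept apart because it is the variable to be traded for an eigenvalue.\<close>

definition asm :: "nat \<Rightarrow> (nat \<times> nat \<Rightarrow> complex) \<Rightarrow> (nat \<Rightarrow> complex) \<Rightarrow> complex \<Rightarrow> nat \<times> nat \<Rightarrow> complex" where
  "asm n X c a = (\<lambda>p\<in>{..<Suc n}\<times>{..<Suc n}. if snd p < n then X p else if fst p < n then c (fst p) else a)"

text \<open>In the Laplace expansion along the last column only the corner term involves
  \<open>a\<close>, and its cofactor is the characteristic polynomial of the leading block. Hence an
  eigenvalue \<open>z\<close> determines the corner as a rational function of \<open>z\<close> with
  denominator \<open>cpoly n X\<close>.\<close>

lemma poly_cpoly_asm: "poly (cpoly (Suc n) (asm n X c a)) z = poly (cpoly (Suc n) (asm n X c 0)) z - a * poly (cpoly n X) z"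
proof -
  define A where "A a = Matrix.mat (Suc n) (Suc n) (\<lambda>(i, j). (if i = j then z else 0) - asm n X c a (i, j))" for a
  have A: "A a \<in> carrier_mat (Suc n) (Suc n)" for a by (simp add: A_def)
  have P: "poly (cpoly (Suc n) (asm n X c a)) z = Determinant.det (A a)" for a
    by (simp add: poly_cpoly cdet_eq_det A_def)
  define c0 where "c0 i = cofactor (A 0) i n" for i
  have cof: "cofactor (A a) i n = c0 i" for i a
    unfolding cofactor_def c0_def
    by (rule arg_cong[where f="\<lambda>M. (-1) ^ (i + n) * Determinant.det M"]) (auto simp: mat_delete_def A_def asm_def intro!: cong_mat)
  have cn: "c0 n = poly (cpoly n X) z"
  proof -
    have "mat_delete (A 0) n n = Matrix.mat n n (\<lambda>(i, j). (if i = j then z else 0) - X (i, j))"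
      by (auto simp: mat_delete_def A_def asm_def intro!: cong_mat)
    then show ?thesis by (simp add: c0_def cofactor_def poly_cpoly cdet_eq_det)
  qed
  have exp: "Determinant.det (A a) = (\<Sum>i<n. A a $$ (i, n) * cofactor (A a) i n) + A a $$ (n, n) * cofactor (A a) n n" for a
    using laplace_expansion_column[OF A, of n a] by simp
  have "(\<Sum>i<n. A a $$ (i, n) * cofactor (A a) i n) = (\<Sum>i<n. A 0 $$ (i, n) * cofactor (A 0) i n)"
    by (intro sum.cong refl) (auto simp: cof, auto simp: A_def asm_def)
  then have "Determinant.det (A a) - Determinant.det (A 0) = (A a $$ (n, n) - A 0 $$ (n, n)) * poly (cpoly n X) z"
    unfolding exp[of a] exp[of 0] cof cn by (simp add: algebra_simps)
  also have "A a $$ (n, n) - A 0 $$ (n, n) = - a" by (simp add: A_def asm_def)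
  finally show ?thesis unfolding P by (simp add: algebra_simps)
qed

text \<open>The last column is chosen so that (u, 1) is an eigenvector for \<open>z\<close>.\<close>

lemma poly_cpoly_asm_eigen:
  "poly (cpoly (Suc n) (asm n X (\<lambda>i. z * u i - (\<Sum>j<n. X (i, j) * u j)) (z - (\<Sum>j<n. X (n, j) * u j)))) z = 0"
proof -
  define G where "G = asm n X (\<lambda>i. z * u i - (\<Sum>j<n. X (i, j) * u j)) (z - (\<Sum>j<n. X (n, j) * u j))"
  define M where "M = Matrix.mat (Suc n) (Suc n) (\<lambda>(i, j). (if i = j then z else 0) - G (i, j))"
  define v where "v = vec (Suc n) (\<lambda>i. if i < n then u i else 1)"
  have M: "M \<in> carrier_mat (Suc n) (Suc n)" by (simp add: M_def)
  have v: "v \<in> carrier_vec (Suc n)" by (simp add: v_def)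
  have "v $ n = 1" by (simp add: v_def)
  then have v0: "v \<noteq> 0\<^sub>v (Suc n)" by auto
  have "M *\<^sub>v v = 0\<^sub>v (Suc n)"
  proof (rule eq_vecI)
    fix i assume "i < dim_vec (0\<^sub>v (Suc n) :: complex vec)"
    then have i: "i < Suc n" by simp
    have "(M *\<^sub>v v) $ i = (\<Sum>j<Suc n. M $$ (i, j) * v $ j)"
      using i M v by (simp add: scalar_prod_def lessThan_atLeast0 del: sum.lessThan_Suc)
    also have "\<dots> = (\<Sum>j<n. ((if i = j then z else 0) - X (i, j)) * u j) + ((if i = n then z else 0) - G (i, n))"
      using i by (simp add: M_def v_def G_def asm_def)
    also have "(\<Sum>j<n. ((if i = j then z else 0) - X (i, j)) * u j) = (\<Sum>j<n. (if i = j then z * u i else 0) - X (i, j) * u j)"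
      by (intro sum.cong refl) (auto simp: algebra_simps)
    also have "\<dots> = (if i < n then z * u i else 0) - (\<Sum>j<n. X (i, j) * u j)" by (simp add: sum_subtractf)
    also have "\<dots> + ((if i = n then z else 0) - G (i, n)) = 0"
      using i by (cases "i = n") (auto simp: G_def asm_def)
    finally show "(M *\<^sub>v v) $ i = 0\<^sub>v (Suc n) $ i" using i by simp
  qed (simp add: M_def)
  then have "Determinant.det M = 0" using det_0_iff_vec_prod_zero[OF M] v v0 by blast
  then show ?thesis unfolding G_def[symmetric] by (simp add: poly_cpoly cdet_eq_det M_def)
qed

text \<open>\<open>hX\<close> collects the first \<open>n\<close> columns of \<open>Q T Q*\<close>, where \<open>T\<close> has first columns \<open>Z\<close> and last column
  \<open>(0, z)\<close>; the last column is then forced by the eigenvalue equation, as in \<open>hG\<close>.\<close>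

definition hX :: "nat \<Rightarrow> complex \<Rightarrow> (nat \<Rightarrow> complex) \<Rightarrow> (nat \<times> nat \<Rightarrow> complex) \<Rightarrow> nat \<times> nat \<Rightarrow> complex" where
  "hX n z u Z = (\<lambda>p\<in>{..<Suc n}\<times>{..<n}. \<Sum>k<Suc n. hQ n u (fst p, k) *
     ((\<Sum>l<n. cnj (hQ n u (snd p, l)) * Z (k, l)) + (if k = n then z * cnj (u (snd p)) / hr n u else 0)))"

definition hG :: "nat \<Rightarrow> complex \<Rightarrow> (nat \<Rightarrow> complex) \<Rightarrow> (nat \<times> nat \<Rightarrow> complex) \<Rightarrow> nat \<times> nat \<Rightarrow> complex" where
  "hG n z u X = asm n X (\<lambda>i. z * u i - (\<Sum>j<n. X (i, j) * u j)) (z - (\<Sum>j<n. X (n, j) * u j))"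

definition mT :: "nat \<Rightarrow> complex \<Rightarrow> (nat \<times> nat \<Rightarrow> complex) \<Rightarrow> complex mat" where
  "mT n z Z = Matrix.mat (Suc n) (Suc n) (\<lambda>(i, j). if j < n then Z (i, j) else if i < n then 0 else z)"

lemma mT_carrier [simp]: "mT n z Z \<in> carrier_mat (Suc n) (Suc n)"
  by (simp add: mT_def)

text \<open>The first \<open>n\<close> columns agree by the definition of \<open>hX\<close>. Both
  matrices also send (u, 1) to z times itself: the adjoint of the unitary matrix takes (u, 1) to a
  multiple of the last basis vector, which \<open>mT\<close> multiplies by z. Since the last entry
  of (u, 1) is 1, this determines the last column.\<close>

lemma hG_hX_eq: "Matrix.mat (Suc n) (Suc n) (hG n z u (hX n z u Z)) = mQ n u * mT n z Z * mQh n u"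
proof -
  define r where "r = hr n u"
  note r = hr_props[where n=n and u=u, folded r_def]
  define X where "X = hX n z u Z"
  define M where "M = mQ n u * mT n z Z * mQh n u"
  have M: "M \<in> carrier_mat (Suc n) (Suc n)" unfolding M_def by (auto intro!: mult_carrier_mat[where n="Suc n"])
  have M': "M = mQ n u * (mT n z Z * mQh n u)" unfolding M_def by (rule assoc_mult_mat[OF mQ_carrier(1) mT_carrier mQ_carrier(2)])
  have TQ: "(mT n z Z * mQh n u) $$ (k, j) = (\<Sum>l<n. cnj (hQ n u (j, l)) * Z (k, l)) + (if k = n then z * cnj (u j) / r else 0)"
    if "k < Suc n" "j < n" for k j
  proof -
    have "(mT n z Z * mQh n u) $$ (k, j) = (\<Sum>l<Suc n. mT n z Z $$ (k, l) * mQh n u $$ (l, j))"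
      using that by (simp add: mT_def mQh_def scalar_prod_def lessThan_atLeast0 del: sum.lessThan_Suc)
    also have "\<dots> = (\<Sum>l<n. cnj (hQ n u (j, l)) * Z (k, l)) + mT n z Z $$ (k, n) * mQh n u $$ (n, j)"
      unfolding sum.lessThan_Suc using that by (intro arg_cong2[where f="(+)"] sum.cong refl) (auto simp: mT_def mQh_def)
    also have "mT n z Z $$ (k, n) * mQh n u $$ (n, j) = (if k = n then z * cnj (u j) / r else 0)"
      using that r by (auto simp: mT_def mQh_def hQ_def r_def[symmetric])
    finally show ?thesis .
  qed
  have MX: "M $$ (i, j) = X (i, j)" if "i < Suc n" "j < n" for i j
  proof -
    have "M $$ (i, j) = (\<Sum>k<Suc n. mQ n u $$ (i, k) * (mT n z Z * mQh n u) $$ (k, j))"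
      unfolding M' using that by (simp add: mT_def mQh_def mQ_def scalar_prod_def lessThan_atLeast0 del: sum.lessThan_Suc)
    also have "\<dots> = X (i, j)"
      unfolding X_def hX_def using that by (auto simp: TQ mQ_def r_def[symmetric] simp del: sum.lessThan_Suc intro!: sum.cong)
    finally show ?thesis .
  qed
  define v where "v = vec (Suc n) (\<lambda>i. if i < n then u i else 1)"
  have v: "v \<in> carrier_vec (Suc n)" by (simp add: v_def)
  have rv: "r * hQ n u (i, n) = v $ i" if "i < Suc n" for i using that r by (auto simp: v_def hQ_def r_def[symmetric])
  have Qv: "mQh n u *\<^sub>v v = vec (Suc n) (\<lambda>i. if i = n then r else 0)"
  proof (rule eq_vecI)
    fix i assume "i < dim_vec (vec (Suc n) (\<lambda>i. if i = n then r else 0))"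
    then have i: "i < Suc n" by simp
    have "(mQh n u *\<^sub>v v) $ i = (\<Sum>j<Suc n. cnj (hQ n u (j, i)) * v $ j)"
      using i v by (simp add: mQh_def scalar_prod_def lessThan_atLeast0 del: sum.lessThan_Suc)
    also have "\<dots> = (\<Sum>j<Suc n. r * (cnj (hQ n u (j, i)) * hQ n u (j, n)))"
      by (intro sum.cong refl) (use rv in \<open>simp add: mult_ac flip: rv\<close>)
    also have "\<dots> = r * (if i = n then 1 else 0)"
      unfolding sum_distrib_left[symmetric] using i by (simp only: hQ_orthonormal lessI)
    finally show "(mQh n u *\<^sub>v v) $ i = vec (Suc n) (\<lambda>i. if i = n then r else 0) $ i" using i by simp
  qed (simp add: mQh_def)
  have Tv: "mT n z Z *\<^sub>v vec (Suc n) (\<lambda>i. if i = n then r else 0) = vec (Suc n) (\<lambda>i. if i = n then z * r else 0)"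
  proof (rule eq_vecI)
    fix i assume "i < dim_vec (vec (Suc n) (\<lambda>i. if i = n then z * r else 0))"
    then have i: "i < Suc n" by simp
    have "(mT n z Z *\<^sub>v vec (Suc n) (\<lambda>i. if i = n then r else 0)) $ i = (\<Sum>j<Suc n. mT n z Z $$ (i, j) * (if j = n then r else 0))"
      using i by (simp add: mT_def scalar_prod_def lessThan_atLeast0 del: sum.lessThan_Suc)
    also have "\<dots> = mT n z Z $$ (i, n) * r" by simp
    finally show "(mT n z Z *\<^sub>v vec (Suc n) (\<lambda>i. if i = n then r else 0)) $ i = vec (Suc n) (\<lambda>i. if i = n then z * r else 0) $ i"
      using i by (auto simp: mT_def)
  qed (simp add: mT_def)
  have Mv: "M *\<^sub>v v = mQ n u *\<^sub>v vec (Suc n) (\<lambda>i. if i = n then z * r else 0)"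
  proof -
    have "M *\<^sub>v v = (mQ n u * mT n z Z) *\<^sub>v (mQh n u *\<^sub>v v)" unfolding M_def
      by (rule assoc_mult_mat_vec[OF mult_carrier_mat[OF mQ_carrier(1) mT_carrier] mQ_carrier(2) v])
    also have "\<dots> = mQ n u *\<^sub>v (mT n z Z *\<^sub>v (mQh n u *\<^sub>v v))"
      by (rule assoc_mult_mat_vec[OF mQ_carrier(1) mT_carrier mult_mat_vec_carrier[OF mQ_carrier(2) v]])
    finally show ?thesis by (simp only: Qv Tv)
  qed
  have Mlast: "M $$ (i, n) = z * v $ i - (\<Sum>j<n. X (i, j) * u j)" if i: "i < Suc n" for i
  proof -
    have "(M *\<^sub>v v) $ i = (\<Sum>j<Suc n. M $$ (i, j) * v $ j)"
      using i M v by (simp add: scalar_prod_def lessThan_atLeast0 del: sum.lessThan_Suc)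
    also have "\<dots> = (\<Sum>j<n. X (i, j) * u j) + M $$ (i, n)"
      using i by (simp add: MX v_def)
    finally have 1: "(M *\<^sub>v v) $ i = (\<Sum>j<n. X (i, j) * u j) + M $$ (i, n)" .
    have "(M *\<^sub>v v) $ i = (\<Sum>j<Suc n. hQ n u (i, j) * (if j = n then z * r else 0))"
      unfolding Mv using i by (simp add: mQ_def scalar_prod_def lessThan_atLeast0 del: sum.lessThan_Suc)
    also have "\<dots> = z * (r * hQ n u (i, n))" by simp
    finally show ?thesis using 1 rv[OF i] by (simp add: algebra_simps)
  qed
  show ?thesis unfolding X_def[symmetric] M_def[symmetric]
  proof (rule eq_matI)
    fix i j assume "i < dim_row M" "j < dim_col M"
    then have ij: "i < Suc n" "j < Suc n" using M by auto
    show "Matrix.mat (Suc n) (Suc n) (hG n z u X) $$ (i, j) = M $$ (i, j)"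
      using ij by (cases "j < n") (auto simp: hG_def asm_def MX Mlast v_def less_Suc_eq)
  qed (use M in auto)
qed

text \<open>The assembled matrix is similar to the block triangular \<open>mT\<close>, so the factor
  for \<open>z\<close> splits off and only the square part of \<open>Z\<close> is left.\<close>

lemma cpoly_hG_hX: "cpoly (Suc n) (hG n z u (hX n z u Z)) = [:- z, 1:] * cpoly n Z"
proof -
  have "similar_mat (mQ n u * mT n z Z * mQh n u) (mT n z Z)"
  proof (rule similar_matI[OF _ mQ_mQh mQh_mQ refl])
    show "{mQ n u * mT n z Z * mQh n u, mT n z Z, mQ n u, mQh n u} \<subseteq> carrier_mat (Suc n) (Suc n)"
      using mult_carrier_mat[OF mult_carrier_mat[OF mQ_carrier(1) mT_carrier] mQ_carrier(2)] by simp
  qed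
  then have "cpoly (Suc n) (hG n z u (hX n z u Z)) = char_poly (mT n z Z)"
    unfolding cpoly_def hG_hX_eq by (rule char_poly_similar)
  moreover have "poly (char_poly (mT n z Z)) x = poly ([:- z, 1:] * cpoly n Z) x" for x
  proof -
    have "poly (char_poly (mT n z Z)) x = Determinant.det (Matrix.mat (Suc n) (Suc n) (\<lambda>(i, j). (if i = j then x else 0) - (if j < n then Z (i, j) else if i < n then 0 else z)))"
      using poly_cpoly[of "Suc n" "\<lambda>(i, j). if j < n then Z (i, j) else if i < n then 0 else z" x]
      by (simp add: cpoly_def cdet_eq_det mT_def)
    also have "Matrix.mat (Suc n) (Suc n) (\<lambda>(i, j). (if i = j then x else 0) - (if j < n then Z (i, j) else if i < n then 0 else z))
       = four_block_mat (Matrix.mat n n (\<lambda>(i, j). (if i = j then x else 0) - Z (i, j))) (0\<^sub>m n 1) (Matrix.mat 1 n (\<lambda>(i, j). - Z (n, j))) (Matrix.mat 1 1 (\<lambda>_. x - z))"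
      by (rule eq_matI) (auto simp: less_Suc_eq)
    also have "Determinant.det \<dots> = Determinant.det (Matrix.mat n n (\<lambda>(i, j). (if i = j then x else 0) - Z (i, j))) * Determinant.det (Matrix.mat 1 1 (\<lambda>_. x - z))"
      by (rule det_four_block_mat_upper_right_zero[of _ n]) auto
    also have "Determinant.det (Matrix.mat 1 1 (\<lambda>_. x - z)) = x - z" by (subst det_single) auto
    finally show ?thesis by (simp add: poly_cpoly cdet_eq_det algebra_simps)
  qed
  ultimately show ?thesis by (simp add: poly_eq_poly_eq_iff[symmetric] fun_eq_iff)
qed

text \<open>Unitary invariance of the Frobenius norm, applied first to columns and then to rows. It
  makes the Gaussian weight a product in the new coordinates: one factor for \<open>z\<close>, one
  for the square part of \<open>Z\<close>, one for its bottom row.\<close>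

lemma frob_hG_hX:
  "(\<Sum>i<Suc n. \<Sum>j<Suc n. (cmod (hG n z u (hX n z u Z) (i, j)))\<^sup>2) = (cmod z)\<^sup>2 + (\<Sum>i<Suc n. \<Sum>j<n. (cmod (Z (i, j)))\<^sup>2)"
proof -
  have ent: "hG n z u (hX n z u Z) (i, j) = (\<Sum>k<Suc n. hQ n u (i, k) * (mT n z Z * mQh n u) $$ (k, j))" if "i < Suc n" "j < Suc n" for i j
  proof -
    have "hG n z u (hX n z u Z) (i, j) = (mQ n u * mT n z Z * mQh n u) $$ (i, j)"
      using that by (simp flip: hG_hX_eq)
    also have "mQ n u * mT n z Z * mQh n u = mQ n u * (mT n z Z * mQh n u)" by (rule assoc_mult_mat[OF mQ_carrier(1) mT_carrier mQ_carrier(2)])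
    finally show ?thesis using that by (simp add: mQ_def mT_def mQh_def scalar_prod_def lessThan_atLeast0 del: sum.lessThan_Suc)
  qed
  have ent2: "(mT n z Z * mQh n u) $$ (k, j) = cnj (\<Sum>l<Suc n. hQ n u (j, l) * cnj (mT n z Z $$ (k, l)))" if "k < Suc n" "j < Suc n" for k j
    using that by (simp add: mT_def mQh_def scalar_prod_def lessThan_atLeast0 mult.commute del: sum.lessThan_Suc)
  have "(\<Sum>i<Suc n. \<Sum>j<Suc n. (cmod (hG n z u (hX n z u Z) (i, j)))\<^sup>2)
     = (\<Sum>j<Suc n. \<Sum>i<Suc n. (cmod (\<Sum>k<Suc n. hQ n u (i, k) * (mT n z Z * mQh n u) $$ (k, j)))\<^sup>2)"
    by (subst sum.swap, intro sum.cong refl) (simp only: ent lessThan_iff)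
  also have "\<dots> = (\<Sum>j<Suc n. \<Sum>k<Suc n. (cmod ((mT n z Z * mQh n u) $$ (k, j)))\<^sup>2)"
    by (simp only: hQ_isometry)
  also have "\<dots> = (\<Sum>k<Suc n. \<Sum>j<Suc n. (cmod (\<Sum>l<Suc n. hQ n u (j, l) * cnj (mT n z Z $$ (k, l))))\<^sup>2)"
    by (subst sum.swap, intro sum.cong refl) (simp only: ent2 lessThan_iff complex_mod_cnj)
  also have "\<dots> = (\<Sum>k<Suc n. \<Sum>l<Suc n. (cmod (cnj (mT n z Z $$ (k, l))))\<^sup>2)"
    by (simp only: hQ_isometry)
  also have "\<dots> = (\<Sum>k<Suc n. (\<Sum>l<n. (cmod (Z (k, l)))\<^sup>2) + (cmod (if k < n then 0 else z))\<^sup>2)"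
    by (intro sum.cong refl) (simp add: mT_def)
  also have "\<dots> = (cmod z)\<^sup>2 + (\<Sum>i<Suc n. \<Sum>j<n. (cmod (Z (i, j)))\<^sup>2)"
    by (simp add: sum.distrib)
  finally show ?thesis .
qed

section \<open>Row and column operations in integrals over matrices\<close>

lemma borel_measurable_cmod_power2: "f \<in> borel_measurable M \<Longrightarrow> (\<lambda>x. (cmod (f x))\<^sup>2) \<in> borel_measurable M"
  by measurable

lemma borel_measurable_exp_neg: "f \<in> borel_measurable M \<Longrightarrow> (\<lambda>x. exp (- f x) :: real) \<in> borel_measurable M"
  by measurable

text \<open>Every row is transformed by the same \<open>B\<close>, so induction over the set of rows
  collects one factor |det B|^2 per row.\<close>

lemma nn_integral_cprod_rows:
  fixes I :: "'i set"
  assumes "finite I" and B: "B \<in> carrier_mat n n" "Determinant.det B \<noteq> 0" and "f \<in> borel_measurable (cprod (I \<times> {..<n}))"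
  shows "(\<integral>\<^sup>+X. f X \<partial>cprod (I \<times> {..<n})) = ennreal ((cmod (Determinant.det B))\<^sup>2) ^ card I *
    (\<integral>\<^sup>+X. f (\<lambda>p\<in>I\<times>{..<n}. \<Sum>k<n. B $$ (snd p, k) * X (fst p, k)) \<partial>cprod (I \<times> {..<n}))"
  using assms(1,4)
proof (induction I arbitrary: f)
  case empty
  then show ?case by (simp add: PiM_empty nn_integral_count_space_finite)
next
  case (insert i I)
  let ?J = "{..<n}"
  let ?K = "insert i I \<times> ?J"
  let ?d = "ennreal ((cmod (Determinant.det B))\<^sup>2)"
  define s where "s p = (if fst p = i then Inr (snd p) else Inl p)" for p :: "'i \<times> nat"
  have s: "bij_betw s ?K ((I \<times> ?J) <+> ?J)"
    unfolding bij_betw_def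
  proof
    show "inj_on s ?K" by (auto simp: inj_on_def s_def split: if_splits)
    show "s ` ?K = (I \<times> ?J) <+> ?J"
    proof (intro Set.equalityI subsetI)
      fix y assume "y \<in> s ` ?K" then show "y \<in> (I \<times> ?J) <+> ?J" by (auto simp: s_def)
    next
      fix y assume y: "y \<in> (I \<times> ?J) <+> ?J"
      then consider p where "y = Inl p" "p \<in> I \<times> ?J" | j where "y = Inr j" "j \<in> ?J" by auto
      then show "y \<in> s ` ?K"
      proof cases
        case 1 then show ?thesis using insert.hyps by (intro image_eqI[of _ _ p]) (auto simp: s_def)
      next
        case 2 then show ?thesis by (intro image_eqI[of _ _ "(i, j)"]) (auto simp: s_def)
      qed
    qed
  qed
  define mg where "mg x y = (\<lambda>k\<in>?K. case s k of Inl p \<Rightarrow> x p | Inr j \<Rightarrow> (y j :: complex))" for x y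
  have fin: "finite (I \<times> ?J)" "finite ?J" "finite ?K" using insert.hyps by auto
  have mgm: "(\<lambda>(x, y). mg x y) \<in> measurable (cprod (I \<times> ?J) \<Otimes>\<^sub>M cprod ?J) (cprod ?K)"
    unfolding mg_def by (rule cprod_sum_distr(2)[OF fin s])
  have eq: "(\<integral>\<^sup>+X. g X \<partial>cprod ?K) = (\<integral>\<^sup>+x. \<integral>\<^sup>+y. g (mg x y) \<partial>cprod ?J \<partial>cprod (I \<times> ?J))" if "g \<in> borel_measurable (cprod ?K)" for g
    unfolding mg_def by (rule nn_integral_cprod_sum[OF fin s that])
  let ?rw = "\<lambda>(I::'i set) X. \<lambda>p\<in>I\<times>?J. \<Sum>k<n. B $$ (snd p, k) * X (fst p, k)"
  have rwm: "?rw I \<in> measurable (cprod (I \<times> ?J)) (cprod (I \<times> ?J))" for I :: "'i set"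
    by (rule measurable_restrict) (auto intro!: borel_measurable_sum borel_measurable_times measurable_component_singleton[where M="\<lambda>_. lborel", simplified])
  have rwmg: "?rw (insert i I) (mg x y) = mg (?rw I x) (lin_app n B y)" for x y
    unfolding mg_def lin_app_def using insert.hyps by (auto simp: restrict_def fun_eq_iff s_def intro!: sum.cong)
  note f = insert.prems
  have fm: "(\<lambda>(x, y). f (mg x y)) \<in> borel_measurable (cprod (I \<times> ?J) \<Otimes>\<^sub>M cprod ?J)"
    using measurable_compose[OF mgm f] by (simp add: split_beta')
  have fm2: "(\<lambda>(x, y). f (mg x (lin_app n B y))) \<in> borel_measurable (cprod (I \<times> ?J) \<Otimes>\<^sub>M cprod ?J)"
  proof -
    have "(\<lambda>p. (fst p, lin_app n B (snd p))) \<in> measurable (cprod (I \<times> ?J) \<Otimes>\<^sub>M cprod ?J) (cprod (I \<times> ?J) \<Otimes>\<^sub>M cprod ?J)" by measurable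
    from measurable_compose[OF this fm] show ?thesis by (simp add: split_beta')
  qed
  interpret J: sigma_finite_measure "cprod ?J" by (rule sigma_finite_cprod) simp
  have m1: "(\<lambda>x. \<integral>\<^sup>+y. f (mg x (lin_app n B y)) \<partial>cprod ?J) \<in> borel_measurable (cprod (I \<times> ?J))"
    by (rule J.borel_measurable_nn_integral[OF fm2])
  have "(\<integral>\<^sup>+X. f X \<partial>cprod ?K) = (\<integral>\<^sup>+x. \<integral>\<^sup>+y. f (mg x y) \<partial>cprod ?J \<partial>cprod (I \<times> ?J))" by (rule eq[OF f])
  also have "\<dots> = (\<integral>\<^sup>+x. ?d * (\<integral>\<^sup>+y. f (mg x (lin_app n B y)) \<partial>cprod ?J) \<partial>cprod (I \<times> ?J))"
    by (intro nn_integral_cong nn_integral_linear_change B) (rule measurable_Pair2[OF fm, simplified])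
  also have "\<dots> = ?d * (\<integral>\<^sup>+x. \<integral>\<^sup>+y. f (mg x (lin_app n B y)) \<partial>cprod ?J \<partial>cprod (I \<times> ?J))"
    by (rule nn_integral_cmult[OF m1])
  also have "\<dots> = ?d * (?d ^ card I * (\<integral>\<^sup>+x. \<integral>\<^sup>+y. f (mg (?rw I x) (lin_app n B y)) \<partial>cprod ?J \<partial>cprod (I \<times> ?J)))"
    by (subst insert.IH[OF m1]) simp
  also have "\<dots> = ?d ^ card (insert i I) * (\<integral>\<^sup>+X. f (?rw (insert i I) X) \<partial>cprod ?K)"
    by (subst eq[OF measurable_compose[OF rwm f]]) (use insert.hyps in \<open>simp add: rwmg mult_ac\<close>)
  finally show ?case .
qed

lemma nn_integral_cprod_cols:
  assumes "finite J" and Q: "Q \<in> carrier_mat m m" "Determinant.det Q \<noteq> 0" and f: "f \<in> borel_measurable (cprod ({..<m} \<times> J))"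
  shows "(\<integral>\<^sup>+X. f X \<partial>cprod ({..<m} \<times> J)) = ennreal ((cmod (Determinant.det Q))\<^sup>2) ^ card J *
    (\<integral>\<^sup>+X. f (\<lambda>p\<in>{..<m}\<times>J. \<Sum>k<m. Q $$ (fst p, k) * X (k, snd p)) \<partial>cprod ({..<m} \<times> J))"
proof -
  let ?I = "J \<times> {..<m}" and ?K = "{..<m} \<times> J"
  define sw where "sw x = (\<lambda>p\<in>?K. x (snd p, fst p) :: complex)" for x
  have bij: "bij_betw (\<lambda>p. (snd p, fst p)) ?K ?I"
    by (rule bij_betwI[where g="\<lambda>p. (snd p, fst p)"]) auto
  have eq: "(\<integral>\<^sup>+X. g X \<partial>cprod ?K) = (\<integral>\<^sup>+X. g (sw X) \<partial>cprod ?I)" if "g \<in> borel_measurable (cprod ?K)" for g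
    unfolding sw_def by (rule nn_integral_cprod_reindex[OF _ _ bij that]) (use assms in auto)
  have swm: "sw \<in> measurable (cprod ?I) (cprod ?K)"
    unfolding sw_def by (rule measurable_restrict) (auto intro!: measurable_component_singleton[where M="\<lambda>_. lborel", simplified])
  define cl where "cl X = (\<lambda>p\<in>?K. \<Sum>k<m. Q $$ (fst p, k) * X (k, snd p))" for X
  have clm: "cl \<in> measurable (cprod ?K) (cprod ?K)"
    unfolding cl_def by (rule measurable_restrict) (auto intro!: borel_measurable_sum borel_measurable_times measurable_component_singleton[where M="\<lambda>_. lborel", simplified])
  have "(\<integral>\<^sup>+X. f X \<partial>cprod ?K) = ennreal ((cmod (Determinant.det Q))\<^sup>2) ^ card J *
     (\<integral>\<^sup>+X. f (sw (\<lambda>p\<in>J\<times>{..<m}. \<Sum>k<m. Q $$ (snd p, k) * X (fst p, k))) \<partial>cprod ?I)"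
    unfolding eq[OF f] by (rule nn_integral_cprod_rows[OF assms(1) Q measurable_compose[OF swm f]])
  also have "(\<integral>\<^sup>+X. f (sw (\<lambda>p\<in>J\<times>{..<m}. \<Sum>k<m. Q $$ (snd p, k) * X (fst p, k))) \<partial>cprod ?I) = (\<integral>\<^sup>+X. f (cl (sw X)) \<partial>cprod ?I)"
    by (intro nn_integral_cong arg_cong[where f=f]) (auto simp: sw_def cl_def restrict_def fun_eq_iff intro!: sum.cong)
  also have "\<dots> = (\<integral>\<^sup>+X. f (cl X) \<partial>cprod ?K)"
    by (rule eq[symmetric, OF measurable_compose[OF clm f]])
  finally show ?thesis unfolding cl_def .
qed

lemma nn_integral_asm:
  assumes f: "f \<in> borel_measurable (cprod ({..<Suc n} \<times> {..<Suc n}))"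
  shows "(\<integral>\<^sup>+G. f G \<partial>cprod ({..<Suc n} \<times> {..<Suc n})) =
    (\<integral>\<^sup>+X. \<integral>\<^sup>+c. \<integral>\<^sup>+a. f (asm n X c a) \<partial>lborel \<partial>cprod {..<n} \<partial>cprod ({..<Suc n} \<times> {..<n}))"
proof -
  let ?I = "{..<Suc n} \<times> {..<n}" and ?J = "{..<Suc n}" and ?K = "{..<Suc n} \<times> {..<Suc n}"
  define s where "s p = (if snd p = n then Inr (fst p) else Inl p)" for p :: "nat \<times> nat"
  have s: "bij_betw s ?K (?I <+> ?J)"
    unfolding bij_betw_def
  proof
    show "inj_on s ?K" by (auto simp: inj_on_def s_def split: if_splits)
    show "s ` ?K = ?I <+> ?J"
    proof (intro Set.equalityI subsetI)
      fix y assume "y \<in> s ` ?K" then show "y \<in> ?I <+> ?J" by (auto simp: s_def less_Suc_eq)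
    next
      fix y assume y: "y \<in> ?I <+> ?J"
      then consider p where "y = Inl p" "p \<in> ?I" | j where "y = Inr j" "j \<in> ?J" by auto
      then show "y \<in> s ` ?K"
      proof cases
        case 1 then show ?thesis by (intro image_eqI[of _ _ p]) (auto simp: s_def)
      next
        case 2 then show ?thesis by (intro image_eqI[of _ _ "(j, n)"]) (auto simp: s_def)
      qed
    qed
  qed
  define mg where "mg x y = (\<lambda>k\<in>?K. case s k of Inl p \<Rightarrow> x p | Inr j \<Rightarrow> (y j :: complex))" for x y
  have mgm: "(\<lambda>(x, y). mg x y) \<in> measurable (cprod ?I \<Otimes>\<^sub>M cprod ?J) (cprod ?K)"
    unfolding mg_def by (rule cprod_sum_distr(2)[OF _ _ _ s]) auto
  have fm: "(\<lambda>(x, y). f (mg x y)) \<in> borel_measurable (cprod ?I \<Otimes>\<^sub>M cprod ?J)"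
    using measurable_compose[OF mgm f] by (simp add: split_beta')
  have "(\<integral>\<^sup>+G. f G \<partial>cprod ?K) = (\<integral>\<^sup>+x. \<integral>\<^sup>+y. f (mg x y) \<partial>cprod ?J \<partial>cprod ?I)"
    unfolding mg_def by (rule nn_integral_cprod_sum[OF _ _ _ s f]) auto
  also have "\<dots> = (\<integral>\<^sup>+x. \<integral>\<^sup>+c. \<integral>\<^sup>+a. f (mg x (c(n := a))) \<partial>lborel \<partial>cprod {..<n} \<partial>cprod ?I)"
    by (intro nn_integral_cong nn_integral_cprod_insert) (rule measurable_Pair2[OF fm, simplified])
  also have "\<dots> = (\<integral>\<^sup>+X. \<integral>\<^sup>+c. \<integral>\<^sup>+a. f (asm n X c a) \<partial>lborel \<partial>cprod {..<n} \<partial>cprod ?I)"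
    by (intro nn_integral_cong arg_cong[where f=f]) (auto simp: mg_def asm_def s_def restrict_def fun_eq_iff less_Suc_eq)
  finally show ?thesis .
qed

text \<open>The derivative is a pointwise limit of difference quotients with steps 1 / (k + 1),
  whose measurability is already known.\<close>

lemma borel_measurable_pderiv_cpoly:
  assumes "\<And>i j. i < n \<Longrightarrow> j < n \<Longrightarrow> (\<lambda>x. F x (i, j)) \<in> borel_measurable M" and g: "g \<in> borel_measurable M"
  shows "(\<lambda>x. poly (pderiv (cpoly n (F x))) (g x)) \<in> borel_measurable M"
proof (rule borel_measurable_LIMSEQ_metric)
  let ?q = "\<lambda>k x. (poly (cpoly n (F x)) (g x + 1 / of_nat (Suc k)) - poly (cpoly n (F x)) (g x)) / (1 / of_nat (Suc k))"
  have "(\<lambda>x. g x + 1 / of_nat (Suc k)) \<in> borel_measurable M" for k using g by measurable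
  then show "?q k \<in> borel_measurable M" for k
    by (intro borel_measurable_divide borel_measurable_diff borel_measurable_poly_cpoly assms) auto
  fix x
  have "((\<lambda>h. (poly (cpoly n (F x)) (g x + h) - poly (cpoly n (F x)) (g x)) / h) \<longlongrightarrow> poly (pderiv (cpoly n (F x))) (g x)) (at 0)"
    using poly_DERIV[of "cpoly n (F x)" "g x"] by (simp add: DERIV_def)
  moreover have "filterlim (\<lambda>k. 1 / of_nat (Suc k) :: complex) (at 0) sequentially"
    using LIMSEQ_Suc[OF lim_1_over_n[where 'a=complex]] by (simp add: filterlim_at del: of_nat_Suc)
  ultimately show "(\<lambda>k. ?q k x) \<longlonglongrightarrow> poly (pderiv (cpoly n (F x))) (g x)"
    by (rule filterlim_compose)
qed

section \<open>The eigenvalue recursion\<close>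

text \<open>The list \<open>ms\<close> records the eigenvalues that have already been split off.\<close>

definition Psi :: "nat \<Rightarrow> complex set \<Rightarrow> complex list \<Rightarrow> (nat \<times> nat \<Rightarrow> complex) \<Rightarrow> ennreal" where
  "Psi n S ms G = (if \<forall>z. poly (cpoly n G) z = 0 \<longrightarrow> z \<in> S
     then ennreal (exp (- (\<Sum>i<n. \<Sum>j<n. (cmod (G (i, j)))\<^sup>2)) * (\<Prod>m\<leftarrow>ms. (cmod (poly (cpoly n G) m))\<^sup>2)) else 0)"

lemma borel_measurable_Psi:
  assumes F: "\<And>i j. i < n \<Longrightarrow> j < n \<Longrightarrow> (\<lambda>x. F x (i, j)) \<in> borel_measurable M" and S: "closed S"
  shows "(\<lambda>x. Psi n S ms (F x)) \<in> borel_measurable M"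
proof -
  have p: "(\<lambda>x. \<Prod>m\<leftarrow>ms. (cmod (poly (cpoly n (F x)) m))\<^sup>2) \<in> borel_measurable M"
  proof (induction ms)
    case (Cons a ms)
    have "(\<lambda>x. poly (cpoly n (F x)) a) \<in> borel_measurable M"
      using borel_measurable_poly_cpoly[of n F M "\<lambda>_. a", OF F] by simp
    then show ?case using Cons by simp
  qed simp
  have e: "(\<lambda>x. exp (- (\<Sum>i<n. \<Sum>j<n. (cmod (F x (i, j)))\<^sup>2))) \<in> borel_measurable M"
    by (intro borel_measurable_exp_neg borel_measurable_sum borel_measurable_cmod_power2 F) auto
  have "(\<lambda>x. ennreal (exp (- (\<Sum>i<n. \<Sum>j<n. (cmod (F x (i, j)))\<^sup>2)) * (\<Prod>m\<leftarrow>ms. (cmod (poly (cpoly n (F x)) m))\<^sup>2))) \<in> borel_measurable M"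
    using p e by measurable
  then show ?thesis unfolding Psi_def
    by (rule measurable_If) (auto intro!: sets_roots simp: F S)
qed

text \<open>For \<open>ms = []\<close> this is pi^(n^2) times the probability that all eigenvalues
  of the Gaussian matrix lie in \<open>S\<close>. The list contributes the factors left behind by
  eigenvalues that were split off before.\<close>

definition A_int :: "nat \<Rightarrow> complex set \<Rightarrow> complex list \<Rightarrow> ennreal" where
  "A_int n S ms = (\<integral>\<^sup>+G. Psi n S ms G \<partial>cprod ({..<n} \<times> {..<n}))"

lemma cprod_component: "k \<in> K \<Longrightarrow> (\<lambda>x. x k) \<in> borel_measurable (cprod K)"
  using measurable_component_singleton[of k K "\<lambda>_. lborel :: complex measure"] by simp

lemma borel_measurable_A_int:
  assumes S: "closed S"
  shows "(\<lambda>z. A_int n S (z # ms)) \<in> borel_measurable borel"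
proof -
  interpret sigma_finite_measure "cprod ({..<n} \<times> {..<n})" by (rule sigma_finite_cprod) simp
  have ent: "(\<lambda>x. snd x (i, j)) \<in> borel_measurable (borel \<Otimes>\<^sub>M cprod ({..<n} \<times> {..<n}))" if "i < n" "j < n" for i j
    by (rule measurable_compose[OF measurable_snd cprod_component]) (use that in auto)
  have eq: "Psi n S (z # ms) G = ennreal ((cmod (poly (cpoly n G) z))\<^sup>2) * Psi n S ms G" for z G
    by (auto simp: Psi_def ennreal_mult'[symmetric] mult_ac prod_list_nonneg)
  have "(\<lambda>x. poly (cpoly n (snd x)) (fst x)) \<in> borel_measurable (borel \<Otimes>\<^sub>M cprod ({..<n} \<times> {..<n}))"
    by (rule borel_measurable_poly_cpoly) (simp_all add: ent)
  moreover have "(\<lambda>x. Psi n S ms (snd x)) \<in> borel_measurable (borel \<Otimes>\<^sub>M cprod ({..<n} \<times> {..<n}))"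
    by (rule borel_measurable_Psi) (simp_all add: ent S)
  ultimately have "(\<lambda>(z, G). Psi n S (z # ms) G) \<in> borel_measurable (borel \<Otimes>\<^sub>M cprod ({..<n} \<times> {..<n}))"
    unfolding eq split_beta' by measurable
  then show ?thesis unfolding A_int_def by (rule borel_measurable_nn_integral)
qed

text \<open>For fixed \<open>X\<close> and \<open>c\<close>, \<open>r\<close> sends z to the corner
  entry for which z is an eigenvalue; its derivative is the derivative of the resulting
  characteristic polynomial divided by the denominator, up to sign conventions absorbed in the
  modulus. A corner value has at most \<open>Suc n\<close> preimages, and at least one unless all
  roots of its characteristic polynomial are zeros of the denominator.\<close>

lemma asm_area:
  fixes X :: "nat \<times> nat \<Rightarrow> complex" and c :: "nat \<Rightarrow> complex" and n :: nat
  assumes h: "h \<in> borel_measurable borel"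
  defines "r \<equiv> (\<lambda>z. poly (cpoly (Suc n) (asm n X c 0)) z / poly (cpoly n X) z)"
  defines "K \<equiv> (\<integral>\<^sup>+z. h (r z) * (ennreal ((cmod (poly (pderiv (cpoly (Suc n) (asm n X c (r z)))) z))\<^sup>2) *
       (if poly (cpoly n X) z \<noteq> 0 then ennreal (1 / (cmod (poly (cpoly n X) z))\<^sup>2) else 0)) \<partial>lborel)"
  shows "(\<integral>\<^sup>+a. h a \<partial>lborel) \<le> K" "K \<le> of_nat (Suc n) * (\<integral>\<^sup>+a. h a \<partial>lborel)"
proof -
  define P where "P a = cpoly (Suc n) (asm n X c a)" for a
  define D where "D = cpoly n X"
  define W where "W = {z. poly D z \<noteq> 0}"
  have D0: "D \<noteq> 0" unfolding D_def by (rule monic_cpoly)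
  have P: "P a = P 0 - Polynomial.smult a D" for a
  proof -
    have "poly (P a) = poly (P 0 - Polynomial.smult a D)"
      unfolding P_def D_def by (rule ext) (simp add: poly_cpoly_asm[of n X c a])
    then show ?thesis by (simp only: poly_eq_poly_eq_iff)
  qed
  have r: "r z = poly (P 0) z / poly D z" for z unfolding r_def P_def D_def ..
  have "closed {z. poly D z = 0}" by (intro closed_Collect_eq continuous_intros)
  moreover have "W = - {z. poly D z = 0}" by (auto simp: W_def)
  ultimately have oW: "open W" by auto
  have dr: "(r has_field_derivative poly (pderiv (P (r z))) z / poly D z) (at z)" if "z \<in> W" for z
  proof -
    have nz: "poly D z \<noteq> 0" using that by (simp add: W_def)
    have "((\<lambda>z. poly (P 0) z / poly D z) has_field_derivative
       (poly (pderiv (P 0)) z * poly D z - poly (P 0) z * poly (pderiv D) z) / (poly D z * poly D z)) (at z)"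
      by (rule DERIV_divide[OF poly_DERIV poly_DERIV nz])
    moreover have "(poly (pderiv (P 0)) z * poly D z - poly (P 0) z * poly (pderiv D) z) / (poly D z * poly D z)
      = poly (pderiv (P (r z))) z / poly D z"
      unfolding P[of "r z"] using nz by (simp add: r pderiv_diff pderiv_smult field_simps)
    moreover have "(\<lambda>z. poly (P 0) z / poly D z) = r" by (rule ext) (simp only: r)
    ultimately show ?thesis by (simp only:)
  qed
  have hol: "r holomorphic_on W"
    unfolding holomorphic_on_def field_differentiable_def using dr by (meson has_field_derivative_at_within)
  have Kd: "K = (\<integral>\<^sup>+z. h (r z) * ((jac_sq r z) * indicator W z) \<partial>lborel)"
    unfolding K_def
  proof (intro nn_integral_cong)
    fix z
    show "h (r z) * (ennreal ((cmod (poly (pderiv (cpoly (Suc n) (asm n X c (r z)))) z))\<^sup>2) *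
       (if poly (cpoly n X) z \<noteq> 0 then ennreal (1 / (cmod (poly (cpoly n X) z))\<^sup>2) else 0))
       = h (r z) * ((jac_sq r z) * indicator W z)"
    proof (cases "z \<in> W")
      case True
      have "deriv r z = poly (pderiv (P (r z))) z / poly D z" using dr[OF True] by (rule DERIV_imp_deriv)
      then show ?thesis using True
        by (simp add: W_def D_def P_def norm_divide power_divide ennreal_mult'[symmetric])
    next
      case False
      then show ?thesis by (simp add: W_def D_def)
    qed
  qed
  have root: "r z = a \<longleftrightarrow> poly (P a) z = 0" if "z \<in> W" for z a
    unfolding P[of a] using that by (auto simp: r W_def field_simps)
  have degP: "degree (P a) = Suc n" "P a \<noteq> 0" for a unfolding P_def by (rule monic_cpoly)+
  show "(\<integral>\<^sup>+a. h a \<partial>lborel) \<le> K" unfolding Kd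
  proof (rule area_formula_lower[OF oW hol h])
    define Rt where "Rt = {z. poly D z = 0}"
    have fR: "finite Rt" unfolding Rt_def by (rule poly_roots_finite[OF D0])
    \<comment> \<open>Exceptional corner values yield a product of \<open>Suc n\<close> linear
      factors with roots among the finitely many zeros of \<open>D\<close>. There are finitely many
      such products and \<open>P\<close> is injective, so the exceptional values form a null
      set.\<close>
    define FF where "FF = (\<lambda>as. \<Prod>a\<leftarrow>as. [:- a, 1:]) ` {as. set as \<subseteq> Rt \<and> length as = Suc n}"
    have fF: "finite FF" unfolding FF_def by (intro finite_imageI finite_lists_length_eq fR)
    have inj: "inj P"
    proof (rule injI)
      fix a b assume "P a = P b"
      then have "Polynomial.smult a D = Polynomial.smult b D" unfolding P[of a] P[of b] by simp
      then have "Polynomial.smult (a - b) D = 0" by (simp add: smult_diff_left)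
      then show "a = b" using D0 by simp
    qed
    have "{a. a \<notin> r ` W} \<subseteq> P -` FF"
    proof
      fix a assume "a \<in> {a. a \<notin> r ` W}"
      then have na: "\<And>z. z \<in> W \<Longrightarrow> r z \<noteq> a" by blast
      obtain as where as: "P a = (\<Prod>a\<leftarrow>as. [:- a, 1:])" "length as = Suc n"
        using cpoly_factorized unfolding P_def by metis
      have "set as \<subseteq> Rt"
      proof
        fix b assume "b \<in> set as"
        then have "poly (P a) b = 0" unfolding as by (auto simp: poly_prod_list prod_list_zero_iff)
        then have "b \<notin> W" using na root by blast
        then show "b \<in> Rt" by (simp add: W_def Rt_def)
      qed
      then show "a \<in> P -` FF" using as unfolding FF_def by auto
    qed
    moreover have "finite (P -` FF)" using fF inj by (rule finite_vimageI)
    ultimately have "finite {a. a \<notin> r ` W}" by (rule finite_subset)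
    then have "{a. a \<notin> r ` W} \<in> null_sets lborel" by (rule finite_imp_null_set_lborel)
    then show "AE a in lborel. a \<in> r ` W" by (rule AE_I') auto
  qed
  show "K \<le> of_nat (Suc n) * (\<integral>\<^sup>+a. h a \<partial>lborel)" unfolding Kd
  proof (rule area_formula_upper[OF oW hol h])
    fix a
    have "{z\<in>W. r z = a} \<subseteq> {z. poly (P a) z = 0}" using root by auto
    moreover have "finite {z. poly (P a) z = 0}" by (rule poly_roots_finite[OF degP(2)])
    moreover have "card {z. poly (P a) z = 0} \<le> Suc n" using card_poly_roots_bound[OF degP(2), of a] degP(1) by metis
    ultimately show "finite {z\<in>W. r z = a} \<and> card {z\<in>W. r z = a} \<le> Suc n"
      by (meson card_mono finite_subset le_trans)
  qed
qed

section \<open>The Jacobian of the eigenvector coordinates\<close>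

definition jac :: "nat \<Rightarrow> (nat \<Rightarrow> complex) \<Rightarrow> ennreal" where
  "jac n u = ennreal ((cmod (Determinant.det (mQ n u)))\<^sup>2) ^ n * ennreal ((cmod (Determinant.det (mB n u)))\<^sup>2) ^ Suc n"

lemma measurable_hr: "hr n \<in> borel_measurable (cprod {..<n})"
proof -
  have [measurable]: "(\<lambda>u. \<Sum>j<n. (cmod (u j))\<^sup>2) \<in> borel_measurable (cprod {..<n})"
    by (intro borel_measurable_sum borel_measurable_cmod_power2 cprod_component) auto
  show ?thesis unfolding hr_def[abs_def] by measurable
qed

lemma borel_measurable_jac: "jac n \<in> borel_measurable (cprod {..<n})"
proof -
  have cnj: "cnj \<in> borel_measurable borel" by (intro borel_measurable_continuous_onI continuous_intros)
  have cj: "(\<lambda>u. cnj (u j)) \<in> borel_measurable (cprod {..<n})" if "j < n" for j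
    by (rule measurable_compose[OF cprod_component cnj]) (use that in auto)
  have hQ: "(\<lambda>u. hQ n u (i, j)) \<in> borel_measurable (cprod {..<n})" if "i < Suc n" "j < Suc n" for i j
  proof -
    have "i < n \<or> i = n" "j < n \<or> j = n" using that by auto
    then consider "i < n" "j < n" | "i < n" "j = n" | "i = n" "j < n" | "i = n" "j = n" by blast
    then show ?thesis
    proof cases
      case 1
      have "(\<lambda>u. hQ n u (i, j)) = (\<lambda>u. (if i = j then 1 else 0) - u i * cnj (u j) / (hr n u * (hr n u + 1)))"
        using 1 by (simp add: hQ_def)
      moreover have "(\<lambda>u. (if i = j then 1 else 0) - u i * cnj (u j) / (hr n u * (hr n u + 1))) \<in> borel_measurable (cprod {..<n})"
        using 1 by (intro borel_measurable_diff borel_measurable_const borel_measurable_divide borel_measurable_times borel_measurable_add borel_measurable_uminus measurable_hr cj cprod_component) auto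
      ultimately show ?thesis by (simp only:)
    next
      case 2
      have "(\<lambda>u. hQ n u (i, j)) = (\<lambda>u. u i / hr n u)"
        using 2 by (simp add: hQ_def)
      moreover have "(\<lambda>u. u i / hr n u) \<in> borel_measurable (cprod {..<n})"
        using 2 by (intro borel_measurable_diff borel_measurable_const borel_measurable_divide borel_measurable_times borel_measurable_add borel_measurable_uminus measurable_hr cj cprod_component) auto
      ultimately show ?thesis by (simp only:)
    next
      case 3
      have "(\<lambda>u. hQ n u (i, j)) = (\<lambda>u. - cnj (u j) / hr n u)"
        using 3 by (simp add: hQ_def)
      moreover have "(\<lambda>u. - cnj (u j) / hr n u) \<in> borel_measurable (cprod {..<n})"
        using 3 by (intro borel_measurable_diff borel_measurable_const borel_measurable_divide borel_measurable_times borel_measurable_add borel_measurable_uminus measurable_hr cj cprod_component) auto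
      ultimately show ?thesis by (simp only:)
    next
      case 4
      have "(\<lambda>u. hQ n u (i, j)) = (\<lambda>u. 1 / hr n u)"
        using 4 by (simp add: hQ_def)
      moreover have "(\<lambda>u. 1 / hr n u) \<in> borel_measurable (cprod {..<n})"
        by (intro borel_measurable_const borel_measurable_divide measurable_hr)
      ultimately show ?thesis by (simp only:)
    qed
  qed
  have q: "(\<lambda>u. Determinant.det (mQ n u)) \<in> borel_measurable (cprod {..<n})"
    unfolding mQ_def cdet_eq_det[symmetric] by (rule borel_measurable_cdet) (rule hQ)
  have b: "(\<lambda>u. Determinant.det (mB n u)) \<in> borel_measurable (cprod {..<n})"
    unfolding mB_def cdet_eq_det[symmetric]
    by (rule borel_measurable_cdet) (intro measurable_compose[OF hQ cnj], auto)
  show ?thesis unfolding jac_def using q b by measurable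
qed

text \<open>\<open>hX\<close> is a row operation followed by a translation and a column operation.
  The eigenvalue \<open>z\<close> enters only the translation, so the Jacobian depends on
  \<open>u\<close> alone and can be integrated out into the constant
  \<open>eig_const\<close>.\<close>

lemma nn_integral_hX:
  assumes g: "g \<in> borel_measurable (cprod ({..<Suc n} \<times> {..<n}))"
  shows "(\<integral>\<^sup>+X. g X \<partial>cprod ({..<Suc n} \<times> {..<n})) = jac n u * (\<integral>\<^sup>+Z. g (hX n z u Z) \<partial>cprod ({..<Suc n} \<times> {..<n}))"
proof -
  let ?I = "{..<Suc n} \<times> {..<n}"
  define cl where "cl X = (\<lambda>p\<in>?I. \<Sum>k<Suc n. mQ n u $$ (fst p, k) * X (k, snd p))" for X
  define sh where "sh X = (\<lambda>p\<in>?I. X p + (if fst p = n then z * cnj (u (snd p)) / hr n u else 0))" for X :: "nat \<times> nat \<Rightarrow> complex"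
  define rw where "rw X = (\<lambda>p\<in>?I. \<Sum>k<n. mB n u $$ (snd p, k) * X (fst p, k))" for X
  have clm: "cl \<in> measurable (cprod ?I) (cprod ?I)"
    unfolding cl_def by (rule measurable_restrict) (auto intro!: borel_measurable_sum borel_measurable_times cprod_component)
  have shm: "sh \<in> measurable (cprod ?I) (cprod ?I)"
    unfolding sh_def by (rule measurable_restrict) (auto intro!: borel_measurable_add cprod_component)
  have eq: "cl (sh (rw Z)) = hX n z u Z" for Z
    unfolding cl_def sh_def rw_def hX_def
    by (rule restrict_ext, rule sum.cong) (auto simp: mQ_def mB_def intro!: sum.cong)
  have "(\<integral>\<^sup>+X. g X \<partial>cprod ?I) = ennreal ((cmod (Determinant.det (mQ n u)))\<^sup>2) ^ card {..<n} * (\<integral>\<^sup>+X. g (cl X) \<partial>cprod ?I)"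
    unfolding cl_def by (rule nn_integral_cprod_cols[OF _ mQ_carrier(1) det_mQ g]) simp
  also have "(\<integral>\<^sup>+X. g (cl X) \<partial>cprod ?I) = (\<integral>\<^sup>+X. g (cl (sh X)) \<partial>cprod ?I)"
    unfolding sh_def by (rule nn_integral_cprod_shift[symmetric, OF _ measurable_compose[OF clm g]]) simp
  also have "\<dots> = ennreal ((cmod (Determinant.det (mB n u)))\<^sup>2) ^ card {..<Suc n} * (\<integral>\<^sup>+X. g (cl (sh (rw X))) \<partial>cprod ?I)"
    unfolding rw_def
    by (rule nn_integral_cprod_rows[OF _ mQ_carrier(3) det_mB measurable_compose[OF shm measurable_compose[OF clm g]]]) simp
  finally show ?thesis unfolding eq jac_def by (simp add: mult_ac)
qed

definition gconst :: "nat \<Rightarrow> ennreal" where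
  "gconst n = (\<integral>\<^sup>+b. ennreal (exp (- (\<Sum>j<n. (cmod (b j))\<^sup>2))) \<partial>cprod {..<n})"

text \<open>The integrand sees the bottom row only through its Gaussian factor, so by Fubini that
  row integrates to a constant and a square matrix remains.\<close>

lemma nn_integral_last_row:
  assumes g: "g \<in> borel_measurable (cprod ({..<n} \<times> {..<n}))" and gc: "\<And>G H. (\<And>i j. i < n \<Longrightarrow> j < n \<Longrightarrow> G (i, j) = H (i, j)) \<Longrightarrow> g G = g H"
  shows "(\<integral>\<^sup>+Z. ennreal (exp (- (\<Sum>j<n. (cmod (Z (n, j)))\<^sup>2))) * g Z \<partial>cprod ({..<Suc n} \<times> {..<n}))
    = gconst n * (\<integral>\<^sup>+H. g H \<partial>cprod ({..<n} \<times> {..<n}))"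
proof -
  let ?I = "{..<n} \<times> {..<n}" and ?J = "{..<n}" and ?K = "{..<Suc n} \<times> {..<n}"
  define s where "s p = (if fst p = n then Inr (snd p) else Inl p)" for p :: "nat \<times> nat"
  have s: "bij_betw s ?K (?I <+> ?J)"
    unfolding bij_betw_def
  proof
    show "inj_on s ?K" by (auto simp: inj_on_def s_def split: if_splits)
    show "s ` ?K = ?I <+> ?J"
    proof (intro Set.equalityI subsetI)
      fix y assume "y \<in> s ` ?K" then show "y \<in> ?I <+> ?J" by (auto simp: s_def less_Suc_eq)
    next
      fix y assume y: "y \<in> ?I <+> ?J"
      then consider p where "y = Inl p" "p \<in> ?I" | j where "y = Inr j" "j \<in> ?J" by auto
      then show "y \<in> s ` ?K"
      proof cases
        case 1 then show ?thesis by (intro image_eqI[of _ _ p]) (auto simp: s_def)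
      next
        case 2 then show ?thesis by (intro image_eqI[of _ _ "(n, j)"]) (auto simp: s_def)
      qed
    qed
  qed
  define rs where "rs Z = restrict Z ?I" for Z :: "nat \<times> nat \<Rightarrow> complex"
  have rsm: "rs \<in> measurable (cprod ?K) (cprod ?I)"
    unfolding rs_def[abs_def] by (rule measurable_restrict_subset) auto
  have grs: "g Z = g (rs Z)" for Z by (rule gc) (simp add: rs_def)
  have gm: "g \<in> borel_measurable (cprod ?K)"
    using measurable_compose[OF rsm g] by (simp flip: grs)
  have fm: "(\<lambda>Z. ennreal (exp (- (\<Sum>j<n. (cmod (Z (n, j)))\<^sup>2))) * g Z) \<in> borel_measurable (cprod ?K)"
  proof -
    have "(\<lambda>Z. exp (- (\<Sum>j<n. (cmod (Z (n, j)))\<^sup>2))) \<in> borel_measurable (cprod ?K)"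
      by (intro borel_measurable_exp_neg borel_measurable_sum borel_measurable_cmod_power2 cprod_component) auto
    then show ?thesis using gm by measurable
  qed
  have em: "(\<lambda>b. ennreal (exp (- (\<Sum>j<n. (cmod (b j))\<^sup>2)))) \<in> borel_measurable (cprod ?J)"
    by (intro measurable_compose[OF _ measurable_ennreal] borel_measurable_exp_neg borel_measurable_sum borel_measurable_cmod_power2 cprod_component) auto
  have "(\<integral>\<^sup>+Z. ennreal (exp (- (\<Sum>j<n. (cmod (Z (n, j)))\<^sup>2))) * g Z \<partial>cprod ?K)
    = (\<integral>\<^sup>+x. \<integral>\<^sup>+y. ennreal (exp (- (\<Sum>j<n. (cmod (y j))\<^sup>2))) * g x \<partial>cprod ?J \<partial>cprod ?I)"
    by (subst nn_integral_cprod_sum[OF _ _ _ s fm])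
       (auto intro!: nn_integral_cong arg_cong2[where f="(*)"] gc simp: s_def)
  also have "\<dots> = (\<integral>\<^sup>+x. gconst n * g x \<partial>cprod ?I)"
    unfolding gconst_def by (intro nn_integral_cong nn_integral_multc em)
  also have "\<dots> = gconst n * (\<integral>\<^sup>+x. g x \<partial>cprod ?I)" by (rule nn_integral_cmult[OF g])
  finally show ?thesis .
qed

text \<open>Since the characteristic polynomial factors, its derivative at the split root is
  \<open>poly (cpoly n Z) z\<close>, whose squared modulus turns \<open>z\<close> into a new entry
  of the list. Each earlier point \<open>m\<close> releases a factor |m - z|^2, and the Gaussian
  weight splits by \<open>frob_hG_hX\<close>.\<close>

lemma Psi_hG_hX:
  "Psi (Suc n) S ms (hG n z u (hX n z u Z)) * ennreal ((cmod (poly (pderiv (cpoly (Suc n) (hG n z u (hX n z u Z)))) z))\<^sup>2)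
   = (if z \<in> S then ennreal (exp (- (cmod z)\<^sup>2) * (\<Prod>m\<leftarrow>ms. (cmod (m - z))\<^sup>2)) else 0) *
     (ennreal (exp (- (\<Sum>j<n. (cmod (Z (n, j)))\<^sup>2))) * Psi n S (z # ms) Z)"
proof -
  have pd: "poly (pderiv (cpoly (Suc n) (hG n z u (hX n z u Z)))) z = poly (cpoly n Z) z"
    unfolding cpoly_hG_hX pderiv_mult poly_add poly_mult by (simp add: pderiv_pCons)
  have pr: "(\<Prod>m\<leftarrow>ms. (cmod (poly (cpoly (Suc n) (hG n z u (hX n z u Z))) m))\<^sup>2)
     = (\<Prod>m\<leftarrow>ms. (cmod (m - z))\<^sup>2) * (\<Prod>m\<leftarrow>ms. (cmod (poly (cpoly n Z) m))\<^sup>2)"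
  proof -
    have pm: "poly ([:- z, 1:] * cpoly n Z) m = (m - z) * poly (cpoly n Z) m" for m
      unfolding poly_mult by simp
    show ?thesis unfolding cpoly_hG_hX pm
      by (induction ms) (simp_all add: norm_mult power_mult_distrib mult_ac)
  qed
  have rt: "(\<forall>x. poly (cpoly (Suc n) (hG n z u (hX n z u Z))) x = 0 \<longrightarrow> x \<in> S) \<longleftrightarrow> z \<in> S \<and> (\<forall>x. poly (cpoly n Z) x = 0 \<longrightarrow> x \<in> S)"
    unfolding cpoly_hG_hX by auto
  have key: "ennreal (exp (- (a + (b + c))) * (p1 * p2)) * ennreal p = ennreal (exp (- a) * p1) * (ennreal (exp (- c)) * ennreal (exp (- b) * (p * p2)))"
    if "0 \<le> p1" "0 \<le> p2" "0 \<le> p" for a b c p1 p2 p :: real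
    unfolding minus_add_distrib exp_add using that by (simp add: ennreal_mult mult_ac)
  have nn: "0 \<le> (\<Prod>m\<leftarrow>ms. (cmod (m - z))\<^sup>2)" "0 \<le> (\<Prod>m\<leftarrow>ms. (cmod (poly (cpoly n Z) m))\<^sup>2)"
    by (auto intro!: prod_list_nonneg)
  show ?thesis
    using key[OF nn, of "(cmod (poly (cpoly n Z) z))\<^sup>2" "(cmod z)\<^sup>2" "\<Sum>i<n. \<Sum>j<n. (cmod (Z (i, j)))\<^sup>2" "\<Sum>j<n. (cmod (Z (n, j)))\<^sup>2"]
    unfolding Psi_def rt frob_hG_hX pr pd by auto
qed

definition X_int :: "nat \<Rightarrow> complex set \<Rightarrow> complex list \<Rightarrow> ennreal" where
  "X_int n S ms = (\<integral>\<^sup>+z. (if z \<in> S then ennreal (exp (- (cmod z)\<^sup>2) * (\<Prod>m\<leftarrow>ms. (cmod (m - z))\<^sup>2)) else 0) * A_int n S (z # ms) \<partial>lborel)"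

definition eig_const :: "nat \<Rightarrow> ennreal" where
  "eig_const n = (\<integral>\<^sup>+u. jac n u \<partial>cprod {..<n}) * gconst n"

lemma Psi_cong:
  assumes "\<And>i j. i < n \<Longrightarrow> j < n \<Longrightarrow> G (i, j) = H (i, j)"
  shows "Psi n S ms G = Psi n S ms H"
proof -
  have "cpoly n G = cpoly n H" by (rule cpoly_cong) (use assms in auto)
  moreover have "(\<Sum>i<n. \<Sum>j<n. (cmod (G (i, j)))\<^sup>2) = (\<Sum>i<n. \<Sum>j<n. (cmod (H (i, j)))\<^sup>2)"
    by (intro sum.cong refl) (use assms in auto)
  ultimately show ?thesis unfolding Psi_def by (simp only:)
qed

lemma borel_measurable_X_weight:
  assumes "closed S"
  shows "(\<lambda>z. (if z \<in> S then ennreal (exp (- (cmod z)\<^sup>2) * (\<Prod>m\<leftarrow>ms. (cmod (m - z))\<^sup>2)) else 0)) \<in> borel_measurable borel"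
proof -
  have [measurable]: "S \<in> sets borel" using assms by auto
  have [measurable]: "(\<lambda>z. \<Prod>m\<leftarrow>ms. (cmod (m - z))\<^sup>2) \<in> borel_measurable borel"
    by (induction ms) auto
  show ?thesis by measurable
qed

lemma borel_measurable_asm:
  assumes "\<And>i j. i < Suc n \<Longrightarrow> j < n \<Longrightarrow> (\<lambda>x. F x (i, j)) \<in> borel_measurable M" "\<And>i. i < n \<Longrightarrow> (\<lambda>x. G x i) \<in> borel_measurable M"
    "h \<in> borel_measurable M" "i < Suc n" "j < Suc n"
  shows "(\<lambda>x. asm n (F x) (G x) (h x) (i, j)) \<in> borel_measurable M"
proof (cases "j < n")
  case True
  then have "(\<lambda>x. asm n (F x) (G x) (h x) (i, j)) = (\<lambda>x. F x (i, j))" using assms(4,5) by (simp add: asm_def)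
  then show ?thesis using assms(1)[OF assms(4) True] by (simp only:)
next
  case False
  show ?thesis
  proof (cases "i < n")
    case True
    then have "(\<lambda>x. asm n (F x) (G x) (h x) (i, j)) = (\<lambda>x. G x i)" using False assms(4,5) by (simp add: asm_def)
    then show ?thesis using assms(2)[OF True] by (simp only:)
  next
    case F2: False
    then have "(\<lambda>x. asm n (F x) (G x) (h x) (i, j)) = h" using False assms(4,5) by (simp add: asm_def)
    then show ?thesis using assms(3) by (simp only:)
  qed
qed

text \<open>Three substitutions are composed: the corner is replaced by an eigenvalue, the rest of
  the last column by the vector \<open>u\<close> of an eigenvector (u, 1), and the first columns by
  coordinates adapted to that vector. Only the first one is inexact.\<close>

theorem A_int_step:
  assumes S: "closed S"
  shows "A_int (Suc n) S ms \<le> eig_const n * X_int n S ms"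
    and "eig_const n * X_int n S ms \<le> of_nat (Suc n) * A_int (Suc n) S ms"
proof -
  let ?M = "cprod ({..<Suc n} \<times> {..<Suc n})" and ?X = "cprod ({..<Suc n} \<times> {..<n})" and ?c = "cprod {..<n}"
  define f where "f = Psi (Suc n) S ms"
  define PD where "PD G z = ennreal ((cmod (poly (pderiv (cpoly (Suc n) G)) z))\<^sup>2)" for G z
  define r where "r X c z = poly (cpoly (Suc n) (asm n X c 0)) z / poly (cpoly n X) z" for X c z
  define ind where "ind X z = (if poly (cpoly n X) z \<noteq> 0 then ennreal (1 / (cmod (poly (cpoly n X) z))\<^sup>2) else 0)" for X z
  define k where "k X c z a = f (asm n X c a) * (PD (asm n X c a) z * ind X z)" for X c z a
  define H where "H X z u = f (hG n z u X) * PD (hG n z u X) z" for X z u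
  interpret X: sigma_finite_measure ?X by (rule sigma_finite_cprod) simp
  interpret c: sigma_finite_measure ?c by (rule sigma_finite_cprod) simp
  have ent: "(\<lambda>x. asm n (F x) (G x) (h x) (i, j)) \<in> borel_measurable M"
    if "\<And>i j. i < Suc n \<Longrightarrow> j < n \<Longrightarrow> (\<lambda>x. F x (i, j)) \<in> borel_measurable M" "\<And>i. i < n \<Longrightarrow> (\<lambda>x. G x i) \<in> borel_measurable M" "h \<in> borel_measurable M" "i < Suc n" "j < Suc n"
    for F :: "'z \<Rightarrow> _" and G h and M :: "'z measure" and i j
    by (rule borel_measurable_asm) (simp_all add: that)
  have fa: "(\<lambda>x. f (asm n (F x) (G x) (h x))) \<in> borel_measurable M"
    if "\<And>i j. i < Suc n \<Longrightarrow> j < n \<Longrightarrow> (\<lambda>x. F x (i, j)) \<in> borel_measurable M" "\<And>i. i < n \<Longrightarrow> (\<lambda>x. G x i) \<in> borel_measurable M" "h \<in> borel_measurable M"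
    for F :: "'z \<Rightarrow> _" and G h and M :: "'z measure"
    unfolding f_def by (rule borel_measurable_Psi) (simp_all add: ent that S)
  have PDa: "(\<lambda>x. PD (asm n (F x) (G x) (h x)) (z x)) \<in> borel_measurable M"
    if "\<And>i j. i < Suc n \<Longrightarrow> j < n \<Longrightarrow> (\<lambda>x. F x (i, j)) \<in> borel_measurable M" "\<And>i. i < n \<Longrightarrow> (\<lambda>x. G x i) \<in> borel_measurable M" "h \<in> borel_measurable M" "z \<in> borel_measurable M"
    for F :: "'z \<Rightarrow> _" and G h z and M :: "'z measure"
    unfolding PD_def
    by (rule measurable_compose[OF _ measurable_ennreal], rule borel_measurable_cmod_power2, rule borel_measurable_pderiv_cpoly) (simp_all add: ent that)
  have inda: "(\<lambda>x. ind (F x) (z x)) \<in> borel_measurable M"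
    if "\<And>i j. i < Suc n \<Longrightarrow> j < n \<Longrightarrow> (\<lambda>x. F x (i, j)) \<in> borel_measurable M" "z \<in> borel_measurable M"
    for F :: "'z \<Rightarrow> _" and z and M :: "'z measure"
  proof -
    have [measurable]: "(\<lambda>x. poly (cpoly n (F x)) (z x)) \<in> borel_measurable M"
      by (rule borel_measurable_poly_cpoly) (simp_all add: that)
    show ?thesis unfolding ind_def by measurable
  qed
  have ra: "(\<lambda>x. r (F x) (G x) (z x)) \<in> borel_measurable M"
    if "\<And>i j. i < Suc n \<Longrightarrow> j < n \<Longrightarrow> (\<lambda>x. F x (i, j)) \<in> borel_measurable M" "\<And>i. i < n \<Longrightarrow> (\<lambda>x. G x i) \<in> borel_measurable M" "z \<in> borel_measurable M"
    for F :: "'z \<Rightarrow> _" and G z and M :: "'z measure"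
    unfolding r_def
    by (rule borel_measurable_divide; rule borel_measurable_poly_cpoly) (simp_all add: ent that)
  have ka: "(\<lambda>x. k (F x) (G x) (z x) (h x)) \<in> borel_measurable M"
    if "\<And>i j. i < Suc n \<Longrightarrow> j < n \<Longrightarrow> (\<lambda>x. F x (i, j)) \<in> borel_measurable M" "\<And>i. i < n \<Longrightarrow> (\<lambda>x. G x i) \<in> borel_measurable M" "h \<in> borel_measurable M" "z \<in> borel_measurable M"
    for F :: "'z \<Rightarrow> _" and G h z and M :: "'z measure"
  proof -
    have [measurable]: "(\<lambda>x. f (asm n (F x) (G x) (h x))) \<in> borel_measurable M" by (rule fa) (simp_all add: that)
    have [measurable]: "(\<lambda>x. PD (asm n (F x) (G x) (h x)) (z x)) \<in> borel_measurable M" by (rule PDa) (simp_all add: that)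
    have [measurable]: "(\<lambda>x. ind (F x) (z x)) \<in> borel_measurable M" by (rule inda) (simp_all add: that)
    show ?thesis unfolding k_def by measurable
  qed
  have Ha: "(\<lambda>x. H (F x) (z x) (u x)) \<in> borel_measurable M"
    if F: "\<And>i j. i < Suc n \<Longrightarrow> j < n \<Longrightarrow> (\<lambda>x. F x (i, j)) \<in> borel_measurable M" and u: "\<And>i. i < n \<Longrightarrow> (\<lambda>x. u x i) \<in> borel_measurable M" and z: "z \<in> borel_measurable M"
    for F :: "'z \<Rightarrow> _" and u z and M :: "'z measure"
  proof -
    have s: "(\<lambda>x. \<Sum>j<n. F x (i, j) * u x j) \<in> borel_measurable M" if "i < Suc n" for i
      by (rule borel_measurable_sum, rule borel_measurable_times) (simp_all add: F u that)
    have c: "(\<lambda>x. z x * u x i - (\<Sum>j<n. F x (i, j) * u x j)) \<in> borel_measurable M" if "i < n" for i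
      using that by (intro borel_measurable_diff borel_measurable_times z u s) auto
    have d: "(\<lambda>x. z x - (\<Sum>j<n. F x (n, j) * u x j)) \<in> borel_measurable M"
      by (intro borel_measurable_diff z s) auto
    have [measurable]: "(\<lambda>x. f (hG n (z x) (u x) (F x))) \<in> borel_measurable M"
      unfolding hG_def by (rule fa[OF _ _ d]) (simp_all add: F c)
    have [measurable]: "(\<lambda>x. PD (hG n (z x) (u x) (F x)) (z x)) \<in> borel_measurable M"
      unfolding hG_def by (rule PDa[OF _ _ d z]) (simp_all add: F c)
    show ?thesis unfolding H_def by measurable
  qed
  have fm: "f \<in> borel_measurable ?M"
    unfolding f_def by (rule borel_measurable_Psi[OF _ S]) (auto intro!: cprod_component)
  \<comment> \<open>\<open>K\<close> is the integral after the passage from the corner to the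
    eigenvalue. Everything that leads from \<open>K\<close> to \<open>X_int\<close> is an
    identity.\<close>
  define K where "K = (\<integral>\<^sup>+X. \<integral>\<^sup>+c. \<integral>\<^sup>+z. k X c z (r X c z) \<partial>lborel \<partial>?c \<partial>?X)"
  have cX: "(\<lambda>x. snd x i) \<in> borel_measurable (N \<Otimes>\<^sub>M ?c)" if "i < n" for i and N :: "'z measure"
    by (rule measurable_compose[OF measurable_snd cprod_component]) (use that in auto)
  have fX: "(\<lambda>x. fst x (i, j)) \<in> borel_measurable (?X \<Otimes>\<^sub>M N)" if "i < Suc n" "j < n" for i j and N :: "'z measure"
    by (rule measurable_compose[OF measurable_fst cprod_component]) (use that in auto)
  have I_eq: "A_int (Suc n) S ms = (\<integral>\<^sup>+X. \<integral>\<^sup>+c. \<integral>\<^sup>+a. f (asm n X c a) \<partial>lborel \<partial>?c \<partial>?X)"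
    unfolding A_int_def f_def[symmetric] by (rule nn_integral_asm[OF fm])
  have hm: "(\<lambda>a. f (asm n X c a)) \<in> borel_measurable borel" for X c by (rule fa) auto
  have a1: "(\<integral>\<^sup>+a. f (asm n X c a) \<partial>lborel) \<le> (\<integral>\<^sup>+z. k X c z (r X c z) \<partial>lborel)" for X c
    unfolding k_def r_def PD_def ind_def by (rule asm_area(1)[OF hm])
  have a2: "(\<integral>\<^sup>+z. k X c z (r X c z) \<partial>lborel) \<le> of_nat (Suc n) * (\<integral>\<^sup>+a. f (asm n X c a) \<partial>lborel)" for X c
    unfolding k_def r_def PD_def ind_def by (rule asm_area(2)[OF hm])
  have le1: "A_int (Suc n) S ms \<le> K"
    unfolding I_eq K_def by (rule nn_integral_mono, rule nn_integral_mono, rule a1)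
  have le2: "K \<le> of_nat (Suc n) * A_int (Suc n) S ms"
  proof -
    have m1: "(\<lambda>(y, a). f (asm n (fst y) (snd y) a)) \<in> borel_measurable ((?X \<Otimes>\<^sub>M ?c) \<Otimes>\<^sub>M lborel)"
      unfolding split_beta' by (rule fa) (auto intro!: measurable_compose[OF measurable_fst fX] measurable_compose[OF measurable_fst cX])
    have m2: "(\<lambda>(X, c). \<integral>\<^sup>+a. f (asm n X c a) \<partial>lborel) \<in> borel_measurable (?X \<Otimes>\<^sub>M ?c)"
      using lborel.borel_measurable_nn_integral[OF m1] by (simp add: split_beta')
    have m3: "(\<lambda>X. \<integral>\<^sup>+c. \<integral>\<^sup>+a. f (asm n X c a) \<partial>lborel \<partial>?c) \<in> borel_measurable ?X"
      by (rule c.borel_measurable_nn_integral[OF m2])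
    have "K \<le> (\<integral>\<^sup>+X. \<integral>\<^sup>+c. of_nat (Suc n) * (\<integral>\<^sup>+a. f (asm n X c a) \<partial>lborel) \<partial>?c \<partial>?X)"
      unfolding K_def by (rule nn_integral_mono, rule nn_integral_mono, rule a2)
    also have "\<dots> = (\<integral>\<^sup>+X. of_nat (Suc n) * (\<integral>\<^sup>+c. (\<integral>\<^sup>+a. f (asm n X c a) \<partial>lborel) \<partial>?c) \<partial>?X)"
      by (intro nn_integral_cong nn_integral_cmult) (rule measurable_Pair2[OF m2, simplified])
    also have "\<dots> = of_nat (Suc n) * A_int (Suc n) S ms"
      unfolding I_eq by (rule nn_integral_cmult[OF m3])
    finally show ?thesis .
  qed
  \<comment> \<open>For fixed \<open>z\<close> the last column is parametrised by \<open>u\<close>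
    through the matrix z - X. The Jacobian |det (z - X)|^2 cancels the denominator in the derivative
    of the corner function.\<close>
  have inner: "(\<integral>\<^sup>+c. \<integral>\<^sup>+z. k X c z (r X c z) \<partial>lborel \<partial>?c) = (\<integral>\<^sup>+z. \<integral>\<^sup>+u. H X z u \<partial>?c \<partial>lborel)" for X
  proof -
    interpret P: pair_sigma_finite ?c "lborel :: complex measure"
      by (intro pair_sigma_finite.intro c.sigma_finite_measure_axioms lborel.sigma_finite_measure_axioms)
    have "(\<lambda>(c, z). k X c z (r X c z)) \<in> borel_measurable (?c \<Otimes>\<^sub>M lborel)"
      unfolding split_beta'
      by (intro ka ra) (auto intro!: measurable_compose[OF measurable_fst cprod_component])
    then have "(\<integral>\<^sup>+c. \<integral>\<^sup>+z. k X c z (r X c z) \<partial>lborel \<partial>?c) = (\<integral>\<^sup>+z. \<integral>\<^sup>+c. k X c z (r X c z) \<partial>?c \<partial>lborel)"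
      by (rule P.Fubini'[symmetric])
    also have "\<dots> = (\<integral>\<^sup>+z. \<integral>\<^sup>+u. H X z u \<partial>?c \<partial>lborel)"
    proof (rule nn_integral_cong_AE)
      have "finite {z. poly (cpoly n X) z = 0}" by (rule poly_roots_finite[OF monic_cpoly(3)])
      then have "{z. poly (cpoly n X) z = 0} \<in> null_sets lborel" by (rule finite_imp_null_set_lborel)
      then have "AE z in lborel. poly (cpoly n X) z \<noteq> 0" by (rule AE_I') auto
      then show "AE z in lborel. (\<integral>\<^sup>+c. k X c z (r X c z) \<partial>?c) = (\<integral>\<^sup>+u. H X z u \<partial>?c)"
      proof eventually_elim
        fix z assume nz: "poly (cpoly n X) z \<noteq> 0"
        define B where "B = Matrix.mat n n (\<lambda>(i, j). (if i = j then z else 0) - X (i, j))"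
        have B: "B \<in> carrier_mat n n" by (simp add: B_def)
        have dB: "Determinant.det B = poly (cpoly n X) z" by (simp add: B_def poly_cpoly cdet_eq_det)
        have km: "(\<lambda>c. k X c z (r X c z)) \<in> borel_measurable ?c"
          by (intro ka ra) (auto intro!: cprod_component)
        have asm_eq: "asm n X (lin_app n B u) a = asm n X (\<lambda>i. z * u i - (\<Sum>j<n. X (i, j) * u j)) a" for u a
        proof -
          have "lin_app n B u i = z * u i - (\<Sum>j<n. X (i, j) * u j)" if "i < n" for i
          proof -
            have "lin_app n B u i = (\<Sum>j<n. (if i = j then z * u i else 0) - X (i, j) * u j)"
              unfolding lin_app_def using that by (auto simp: B_def algebra_simps intro!: sum.cong)
            then show ?thesis using that by (simp add: sum_subtractf)
          qed
          then show ?thesis by (auto simp: asm_def restrict_def fun_eq_iff)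
        qed
        have rz: "r X (lin_app n B u) z = z - (\<Sum>j<n. X (n, j) * u j)" for u
        proof -
          have "poly (cpoly (Suc n) (asm n X (lin_app n B u) (z - (\<Sum>j<n. X (n, j) * u j)))) z = 0"
            unfolding asm_eq by (rule poly_cpoly_asm_eigen)
          then have "poly (cpoly (Suc n) (asm n X (lin_app n B u) 0)) z = (z - (\<Sum>j<n. X (n, j) * u j)) * poly (cpoly n X) z"
            by (subst (asm) poly_cpoly_asm) simp
          then show ?thesis unfolding r_def using nz by simp
        qed
        have nn: "ennreal ((cmod (poly (cpoly n X) z))\<^sup>2) * ind X z = 1"
          unfolding ind_def using nz by (simp add: ennreal_mult'[symmetric])
        have kH: "ennreal ((cmod (poly (cpoly n X) z))\<^sup>2) * k X (lin_app n B u) z (r X (lin_app n B u) z) = H X z u" for u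
        proof -
          have "k X (lin_app n B u) z (r X (lin_app n B u) z) = H X z u * ind X z"
            unfolding k_def rz asm_eq H_def hG_def by (simp add: mult_ac)
          then have "ennreal ((cmod (poly (cpoly n X) z))\<^sup>2) * k X (lin_app n B u) z (r X (lin_app n B u) z)
             = H X z u * (ennreal ((cmod (poly (cpoly n X) z))\<^sup>2) * ind X z)" by (simp add: mult_ac)
          then show ?thesis unfolding nn by simp
        qed
        have "(\<integral>\<^sup>+c. k X c z (r X c z) \<partial>?c) = ennreal ((cmod (poly (cpoly n X) z))\<^sup>2) * (\<integral>\<^sup>+u. k X (lin_app n B u) z (r X (lin_app n B u) z) \<partial>?c)"
          using nn_integral_linear_change[OF B _ km] nz unfolding dB by simp
        also have "\<dots> = (\<integral>\<^sup>+u. ennreal ((cmod (poly (cpoly n X) z))\<^sup>2) * k X (lin_app n B u) z (r X (lin_app n B u) z) \<partial>?c)"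
          by (rule nn_integral_cmult[symmetric]) (rule measurable_compose[OF measurable_lin_app km])
        finally show "(\<integral>\<^sup>+c. k X c z (r X c z) \<partial>?c) = (\<integral>\<^sup>+u. H X z u \<partial>?c)" unfolding kH .
      qed
    qed
    finally show ?thesis .
  qed
  define w where "w z = (if z \<in> S then ennreal (exp (- (cmod z)\<^sup>2) * (\<Prod>m\<leftarrow>ms. (cmod (m - z))\<^sup>2)) else 0)" for z
  have wA: "(\<lambda>z. w z * A_int n S (z # ms)) \<in> borel_measurable borel"
    using borel_measurable_X_weight[OF S, of ms] borel_measurable_A_int[OF S, of n ms] unfolding w_def by measurable
  have HZ: "(\<integral>\<^sup>+X. H X z u \<partial>?X) = jac n u * (gconst n * (w z * A_int n S (z # ms)))" for z u
  proof -
    have Hm: "(\<lambda>X. H X z u) \<in> borel_measurable ?X" by (rule Ha) (auto intro!: cprod_component)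
    have pm: "Psi n S (z # ms) \<in> borel_measurable (cprod ({..<n} \<times> {..<n}))"
      by (rule borel_measurable_Psi[OF _ S]) (auto intro!: cprod_component)
    have pm2: "(\<lambda>Z. ennreal (exp (- (\<Sum>j<n. (cmod (Z (n, j)))\<^sup>2))) * Psi n S (z # ms) Z) \<in> borel_measurable ?X"
    proof -
      have [measurable]: "(\<lambda>Z. ennreal (exp (- (\<Sum>j<n. (cmod (Z (n, j)))\<^sup>2)))) \<in> borel_measurable ?X"
        by (intro measurable_compose[OF _ measurable_ennreal] borel_measurable_exp_neg borel_measurable_sum borel_measurable_cmod_power2 cprod_component) auto
      have [measurable]: "(\<lambda>Z. Psi n S (z # ms) Z) \<in> borel_measurable ?X"
        by (rule borel_measurable_Psi[OF _ S]) (auto intro!: cprod_component)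
      show ?thesis by measurable
    qed
    have "(\<integral>\<^sup>+X. H X z u \<partial>?X) = jac n u * (\<integral>\<^sup>+Z. H (hX n z u Z) z u \<partial>?X)" by (rule nn_integral_hX[OF Hm])
    also have "(\<integral>\<^sup>+Z. H (hX n z u Z) z u \<partial>?X) = (\<integral>\<^sup>+Z. w z * (ennreal (exp (- (\<Sum>j<n. (cmod (Z (n, j)))\<^sup>2))) * Psi n S (z # ms) Z) \<partial>?X)"
      unfolding H_def f_def PD_def Psi_hG_hX w_def ..
    also have "\<dots> = w z * (\<integral>\<^sup>+Z. (ennreal (exp (- (\<Sum>j<n. (cmod (Z (n, j)))\<^sup>2))) * Psi n S (z # ms) Z) \<partial>?X)"
      by (rule nn_integral_cmult[OF pm2])
    also have "(\<integral>\<^sup>+Z. (ennreal (exp (- (\<Sum>j<n. (cmod (Z (n, j)))\<^sup>2))) * Psi n S (z # ms) Z) \<partial>?X) = gconst n * A_int n S (z # ms)"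
      unfolding A_int_def by (rule nn_integral_last_row[OF pm]) (rule Psi_cong)
    finally show ?thesis by (simp add: mult_ac)
  qed
  have "K = (\<integral>\<^sup>+X. \<integral>\<^sup>+z. \<integral>\<^sup>+u. H X z u \<partial>?c \<partial>lborel \<partial>?X)" unfolding K_def inner ..
  also have "\<dots> = (\<integral>\<^sup>+z. \<integral>\<^sup>+X. \<integral>\<^sup>+u. H X z u \<partial>?c \<partial>?X \<partial>lborel)"
  proof -
    interpret P: pair_sigma_finite ?X "lborel :: complex measure"
      by (intro pair_sigma_finite.intro X.sigma_finite_measure_axioms lborel.sigma_finite_measure_axioms)
    have "(\<lambda>(y, u). H (fst y) (snd y) u) \<in> borel_measurable ((?X \<Otimes>\<^sub>M lborel) \<Otimes>\<^sub>M ?c)"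
      unfolding split_beta' by (rule Ha) (auto intro!: measurable_compose[OF measurable_fst fX] cX)
    from c.borel_measurable_nn_integral[OF this]
    have "(\<lambda>(X, z). \<integral>\<^sup>+u. H X z u \<partial>?c) \<in> borel_measurable (?X \<Otimes>\<^sub>M lborel)" by (simp add: split_beta')
    then show ?thesis by (rule P.Fubini'[symmetric])
  qed
  also have "\<dots> = (\<integral>\<^sup>+z. \<integral>\<^sup>+u. \<integral>\<^sup>+X. H X z u \<partial>?X \<partial>?c \<partial>lborel)"
  proof (rule nn_integral_cong)
    fix z
    interpret P: pair_sigma_finite ?X ?c
      by (intro pair_sigma_finite.intro X.sigma_finite_measure_axioms c.sigma_finite_measure_axioms)
    have "(\<lambda>(X, u). H X z u) \<in> borel_measurable (?X \<Otimes>\<^sub>M ?c)"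
      unfolding split_beta' by (rule Ha) (auto intro!: fX cX)
    then show "(\<integral>\<^sup>+X. \<integral>\<^sup>+u. H X z u \<partial>?c \<partial>?X) = (\<integral>\<^sup>+u. \<integral>\<^sup>+X. H X z u \<partial>?X \<partial>?c)" by (rule P.Fubini'[symmetric])
  qed
  also have "\<dots> = (\<integral>\<^sup>+z. (\<integral>\<^sup>+u. jac n u \<partial>?c) * (gconst n * (w z * A_int n S (z # ms))) \<partial>lborel)"
    unfolding HZ by (intro nn_integral_cong nn_integral_multc borel_measurable_jac)
  also have "\<dots> = eig_const n * (\<integral>\<^sup>+z. w z * A_int n S (z # ms) \<partial>lborel)"
    unfolding eig_const_def using wA by (subst nn_integral_cmult[symmetric]) (auto simp: mult_ac)
  also have "(\<integral>\<^sup>+z. w z * A_int n S (z # ms) \<partial>lborel) = X_int n S ms"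
    unfolding X_int_def w_def ..
  finally have K: "K = eig_const n * X_int n S ms" .
  show "A_int (Suc n) S ms \<le> eig_const n * X_int n S ms" using le1 unfolding K .
  show "eig_const n * X_int n S ms \<le> of_nat (Suc n) * A_int (Suc n) S ms" using le2 unfolding K .
qed

section \<open>Gaussian integrals and the Ginibre ensemble\<close>

lemma area_cball: "0 \<le> r \<Longrightarrow> emeasure lborel (cball (c::complex) r) = ennreal (pi * r\<^sup>2)"
  by (simp add: emeasure_cball unit_ball_vol_2)

text \<open>Layer cake: exp (- |z|^2) is the integral of exp (- s) over s \<ge> |z|^2, and the disc
  |z|^2 \<le> s has area pi s. What remains is the integral of s exp (- s), which is 1.\<close>

lemma gaussian_integral_complex: "(\<integral>\<^sup>+z. ennreal (exp (- (cmod z)\<^sup>2)) \<partial>lborel) = ennreal pi"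
proof -
  have tail: "ennreal (exp (- a)) = (\<integral>\<^sup>+s. ennreal (exp (- s)) * indicator {a..} s \<partial>lborel)" for a :: real
  proof -
    have "((\<lambda>s::real. exp (- s)) \<longlongrightarrow> 0) at_top" by (rule filterlim_compose[OF exp_at_bot filterlim_uminus_at_bot_at_top])
    from tendsto_minus[OF this] have "((\<lambda>s::real. - exp (- s)) \<longlongrightarrow> 0) at_top" by simp
    then have "(\<integral>\<^sup>+s. ennreal (exp (- s)) * indicator {a..} s \<partial>lborel) = ennreal (0 - (- exp (- a)))"
      by (intro nn_integral_FTC_atLeast) (auto intro!: derivative_eq_intros)
    then show ?thesis by simp
  qed
  have "(\<integral>\<^sup>+z. ennreal (exp (- (cmod z)\<^sup>2)) \<partial>(lborel::complex measure)) = (\<integral>\<^sup>+z. \<integral>\<^sup>+s. ennreal (exp (- s)) * indicator {(cmod z)\<^sup>2..} s \<partial>lborel \<partial>(lborel::complex measure))"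
    by (rule nn_integral_cong, rule tail)
  also have "\<dots> = (\<integral>\<^sup>+s. \<integral>\<^sup>+z. ennreal (exp (- s)) * indicator {(cmod z)\<^sup>2..} s \<partial>(lborel::complex measure) \<partial>lborel)"
  proof -
    have "Measurable.pred (borel \<Otimes>\<^sub>M borel) (\<lambda>x::complex \<times> real. (cmod (fst x))\<^sup>2 \<le> snd x)" by measurable
    then have "(\<lambda>(z::complex, s). ennreal (exp (- s)) * (if (cmod z)\<^sup>2 \<le> s then 1 else 0)) \<in> borel_measurable (lborel \<Otimes>\<^sub>M lborel)"
      unfolding split_beta' by measurable
    also have "(\<lambda>(z::complex, s). ennreal (exp (- s)) * (if (cmod z)\<^sup>2 \<le> s then 1 else 0)) = (\<lambda>(z, s). ennreal (exp (- s)) * indicator {(cmod z)\<^sup>2..} s)"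
      by (auto simp: indicator_def)
    finally show ?thesis by (rule lborel_pair.Fubini'[symmetric])
  qed
  also have "\<dots> = (\<integral>\<^sup>+s. ennreal pi * (ennreal (s ^ 1 * exp (- s)) * indicator {0..} s) \<partial>lborel)"
  proof (intro nn_integral_cong)
    fix s :: real
    have "(\<integral>\<^sup>+z. ennreal (exp (- s)) * indicator {(cmod z)\<^sup>2..} s \<partial>(lborel::complex measure)) = (\<integral>\<^sup>+z. ennreal (exp (- s)) * indicator {z::complex. (cmod z)\<^sup>2 \<le> s} z \<partial>lborel)"
      by (intro nn_integral_cong) (auto simp: indicator_def)
    also have "\<dots> = ennreal (exp (- s)) * emeasure lborel {z::complex. (cmod z)\<^sup>2 \<le> s}"
      by (rule nn_integral_cmult_indicator) measurable
    also have "\<dots> = ennreal pi * (ennreal (s ^ 1 * exp (- s)) * indicator {0..} s)"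
    proof (cases "0 \<le> s")
      case True
      have "{z::complex. (cmod z)\<^sup>2 \<le> s} = cball 0 (sqrt s)"
        by (auto simp: real_le_rsqrt) (metis abs_norm_cancel real_sqrt_abs real_sqrt_le_iff real_le_rsqrt real_sqrt_le_mono True real_sqrt_pow2 power_mono norm_ge_zero)
      then show ?thesis using True by (simp add: area_cball ennreal_mult'[symmetric] mult_ac)
    next
      case False
      then have "{z::complex. (cmod z)\<^sup>2 \<le> s} = {}" by (auto simp: not_le) (meson le_less_trans zero_le_power2 not_less)
      then show ?thesis using False by simp
    qed
    finally show "(\<integral>\<^sup>+z. ennreal (exp (- s)) * indicator {(cmod z)\<^sup>2..} s \<partial>(lborel::complex measure)) = ennreal pi * (ennreal (s ^ 1 * exp (- s)) * indicator {0..} s)" .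
  qed
  also have "\<dots> = ennreal pi * (\<integral>\<^sup>+s. ennreal (s ^ 1 * exp (- s)) * indicator {0..} s \<partial>lborel)"
    by (rule nn_integral_cmult) measurable
  also have "(\<integral>\<^sup>+s. ennreal (s ^ 1 * exp (- s)) * indicator {0..} s \<partial>lborel) = 1"
    by (subst nn_intergal_power_times_exp_Ici) simp
  finally show ?thesis by simp
qed

lemma emeasure_complex_gaussian: "emeasure complex_gaussian UNIV = 1"
proof -
  have "emeasure complex_gaussian UNIV = (\<integral>\<^sup>+z. ennreal (exp (- (cmod z)\<^sup>2)) * ennreal (1 / pi) \<partial>lborel)"
    unfolding complex_gaussian_def
    by (subst emeasure_density) (auto simp: ennreal_mult'[symmetric] divide_inverse mult_ac intro!: nn_integral_cong)
  also have "\<dots> = ennreal pi * ennreal (1 / pi)"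
    by (subst nn_integral_multc) (auto simp: gaussian_integral_complex)
  finally show ?thesis by (simp add: ennreal_mult'[symmetric])
qed

interpretation gauss: prob_space complex_gaussian
  by (rule prob_spaceI) (simp add: emeasure_complex_gaussian complex_gaussian_def[THEN arg_cong[where f=space]])

interpretation gauss_prod: product_sigma_finite "\<lambda>_. complex_gaussian" ..

lemma sets_complex_gaussian [simp, measurable_cong]: "sets complex_gaussian = sets borel"
  by (simp add: complex_gaussian_def)

lemma ginibre_density:
  "ginibre n = density (cprod ({..<n} \<times> {..<n})) (\<lambda>G. \<Prod>p\<in>{..<n}\<times>{..<n}. ennreal (exp (- (cmod (G p))\<^sup>2) / pi))"
proof -
  let ?I = "{..<n} \<times> {..<n}"
  let ?w = "\<lambda>z::complex. ennreal (exp (- (cmod z)\<^sup>2) / pi)"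
  have [measurable]: "(\<lambda>G. \<Prod>p\<in>?I. ?w (G p)) \<in> borel_measurable (cprod ?I)"
    by (intro borel_measurable_prod_ennreal measurable_compose[OF cprod_component]) auto
  have "density (cprod ?I) (\<lambda>G. \<Prod>p\<in>?I. ?w (G p)) = Pi\<^sub>M ?I (\<lambda>_. complex_gaussian)"
  proof (rule gauss_prod.PiM_eqI)
    show "sets (density (cprod ?I) (\<lambda>G. \<Prod>p\<in>?I. ?w (G p))) = sets (Pi\<^sub>M ?I (\<lambda>_. complex_gaussian))"
      unfolding sets_density by (rule sets_PiM_cong) simp_all
    fix A :: "_ \<Rightarrow> complex set" assume A: "\<And>i. i \<in> ?I \<Longrightarrow> A i \<in> sets complex_gaussian"
    then have Ab: "\<And>i. i \<in> ?I \<Longrightarrow> A i \<in> sets borel" by simp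
    have "emeasure (density (cprod ?I) (\<lambda>G. \<Prod>p\<in>?I. ?w (G p))) (Pi\<^sub>E ?I A)
       = (\<integral>\<^sup>+G. (\<Prod>p\<in>?I. ?w (G p)) * indicator (Pi\<^sub>E ?I A) G \<partial>cprod ?I)"
      by (rule emeasure_density) (use Ab in \<open>auto intro!: sets_PiM_I_finite\<close>)
    also have "\<dots> = (\<integral>\<^sup>+G. (\<Prod>p\<in>?I. ?w (G p) * indicator (A p) (G p)) \<partial>cprod ?I)"
    proof (intro nn_integral_cong)
      fix G :: "nat \<times> nat \<Rightarrow> complex" assume "G \<in> space (cprod ?I)"
      then have "indicator (Pi\<^sub>E ?I A) G = (\<Prod>p\<in>?I. indicator (A p) (G p) :: ennreal)"
      proof (cases "\<forall>p\<in>?I. G p \<in> A p")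
        case True
        then have "(\<Prod>p\<in>?I. indicator (A p) (G p) :: ennreal) = (\<Prod>p\<in>?I. 1)" by (intro prod.cong refl indicator_simps(1)) blast
        moreover have "G \<in> Pi\<^sub>E ?I A" using True \<open>G \<in> space (cprod ?I)\<close> unfolding space_PiM PiE_iff by blast
        ultimately show ?thesis by simp
      next
        case False
        then obtain p where p: "p \<in> ?I" "G p \<notin> A p" by blast
        then have "(\<Prod>p\<in>?I. indicator (A p) (G p) :: ennreal) = 0"
          by (intro prod_zero bexI[of _ p]) simp_all
        moreover have "G \<notin> Pi\<^sub>E ?I A" using p unfolding PiE_iff by blast
        ultimately show ?thesis by simp
      qed
      then show "(\<Prod>p\<in>?I. ?w (G p)) * indicator (Pi\<^sub>E ?I A) G = (\<Prod>p\<in>?I. ?w (G p) * indicator (A p) (G p))"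
        by (simp add: prod.distrib)
    qed
    also have "\<dots> = (\<Prod>p\<in>?I. \<integral>\<^sup>+z. ?w z * indicator (A p) z \<partial>lborel)"
      by (rule cprod.product_nn_integral_prod) (use Ab in \<open>auto intro!: borel_measurable_times_ennreal\<close>)
    also have "\<dots> = (\<Prod>p\<in>?I. emeasure complex_gaussian (A p))"
      unfolding complex_gaussian_def by (intro prod.cong refl emeasure_density[symmetric]) (use Ab in auto)
    finally show "emeasure (density (cprod ?I) (\<lambda>G. \<Prod>p\<in>?I. ?w (G p))) (Pi\<^sub>E ?I A) = (\<Prod>p\<in>?I. emeasure complex_gaussian (A p))" .
  qed simp
  then show ?thesis unfolding ginibre_def ..
qed

lemma emeasure_ginibre_roots:
  assumes S: "closed S"
  shows "emeasure (ginibre n) {G \<in> space (ginibre n). \<forall>z. poly (cpoly n G) z = 0 \<longrightarrow> z \<in> S} = A_int n S [] * ennreal (1 / pi ^ (n * n))"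
proof -
  let ?I = "{..<n} \<times> {..<n}"
  have sp: "space (ginibre n) = space (cprod ?I)" by (simp add: ginibre_density)
  have ev: "{G \<in> space (cprod ?I). \<forall>z. poly (cpoly n G) z = 0 \<longrightarrow> z \<in> S} \<in> sets (cprod ?I)"
    by (rule sets_roots[OF _ S]) (auto intro!: cprod_component)
  have pm: "Psi n S [] \<in> borel_measurable (cprod ?I)"
    by (rule borel_measurable_Psi[OF _ S]) (auto intro!: cprod_component)
  have wm: "(\<lambda>G. \<Prod>p\<in>?I. ennreal (exp (- (cmod (G p))\<^sup>2) / pi)) \<in> borel_measurable (cprod ?I)"
    by (intro borel_measurable_prod_ennreal measurable_compose[OF cprod_component]) auto
  have prod: "(\<Prod>p\<in>?I. ennreal (exp (- (cmod (G p))\<^sup>2) / pi)) = ennreal (exp (- (\<Sum>i<n. \<Sum>j<n. (cmod (G (i, j)))\<^sup>2))) * ennreal (1 / pi ^ (n * n))" for G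
  proof -
    have "(\<Prod>p\<in>?I. ennreal (exp (- (cmod (G p))\<^sup>2) / pi)) = ennreal (\<Prod>p\<in>?I. exp (- (cmod (G p))\<^sup>2) / pi)"
      by (rule prod_ennreal) auto
    also have "(\<Prod>p\<in>?I. exp (- (cmod (G p))\<^sup>2) / pi) = (\<Prod>p\<in>?I. exp (- (cmod (G p))\<^sup>2)) / pi ^ (n * n)"
      by (simp add: prod_dividef)
    also have "(\<Prod>p\<in>?I. exp (- (cmod (G p))\<^sup>2)) = exp (- (\<Sum>i<n. \<Sum>j<n. (cmod (G (i, j)))\<^sup>2))"
      by (simp add: exp_sum[symmetric] sum_negf sum.cartesian_product)
    finally show ?thesis by (simp add: ennreal_mult'[symmetric])
  qed
  have "emeasure (ginibre n) {G \<in> space (ginibre n). \<forall>z. poly (cpoly n G) z = 0 \<longrightarrow> z \<in> S}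
     = (\<integral>\<^sup>+G. (\<Prod>p\<in>?I. ennreal (exp (- (cmod (G p))\<^sup>2) / pi)) * indicator {G \<in> space (cprod ?I). \<forall>z. poly (cpoly n G) z = 0 \<longrightarrow> z \<in> S} G \<partial>cprod ?I)"
    unfolding sp unfolding ginibre_density by (rule emeasure_density[OF wm ev])
  also have "\<dots> = (\<integral>\<^sup>+G. Psi n S [] G * ennreal (1 / pi ^ (n * n)) \<partial>cprod ?I)"
    by (intro nn_integral_cong) (auto simp: prod Psi_def)
  also have "\<dots> = A_int n S [] * ennreal (1 / pi ^ (n * n))"
    unfolding A_int_def by (rule nn_integral_multc[OF pm])
  finally show ?thesis .
qed

lemma A_int_UNIV: "A_int n UNIV [] = ennreal (pi ^ (n * n))"
proof -
  interpret G: prob_space "ginibre n" unfolding ginibre_def by (rule prob_space_PiM) (rule gauss.prob_space_axioms)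
  have "A_int n UNIV [] * ennreal (1 / pi ^ (n * n)) = 1"
    using emeasure_ginibre_roots[of UNIV n] G.emeasure_space_1 by simp
  then have "A_int n UNIV [] * ennreal (1 / pi ^ (n * n)) * ennreal (pi ^ (n * n)) = ennreal (pi ^ (n * n))" by simp
  then show ?thesis by (simp add: mult.assoc ennreal_mult'[symmetric])
qed

section \<open>Rescaling of the eigenvalue plane\<close>

definition scl :: "real \<Rightarrow> complex set \<Rightarrow> complex set" where
  "scl s S = {z. z / complex_of_real s \<in> S}"

text \<open>Marked points and the admissible set are measured in the rescaled plane, while the
  matrix stays unscaled. This keeps \<open>S\<close> fixed when s = sqrt n varies.\<close>

definition B_int :: "real \<Rightarrow> nat \<Rightarrow> complex set \<Rightarrow> complex list \<Rightarrow> ennreal" where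
  "B_int s n S ms = A_int n (scl s S) (map (\<lambda>m. of_real s * m) ms)"

lemma closed_scl: "closed S \<Longrightarrow> closed (scl s S)"
  unfolding scl_def using continuous_closed_vimage[of S "\<lambda>z. z / complex_of_real s"]
  by (simp add: vimage_def divide_inverse)

definition B_weight :: "real \<Rightarrow> complex set \<Rightarrow> complex list \<Rightarrow> complex \<Rightarrow> ennreal" where
  "B_weight s S ms w = (if w \<in> S then ennreal (exp (- s\<^sup>2 * (cmod w)\<^sup>2) * (\<Prod>m\<leftarrow>ms. (cmod (m - w))\<^sup>2)) else 0)"

lemma borel_measurable_B_weight:
  assumes "closed S" shows "B_weight s S ms \<in> borel_measurable borel"
proof -
  have [measurable]: "S \<in> sets borel" using assms by auto
  have [measurable]: "(\<lambda>z. \<Prod>m\<leftarrow>ms. (cmod (m - z))\<^sup>2) \<in> borel_measurable borel"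
    by (induction ms) auto
  show ?thesis unfolding B_weight_def by measurable
qed

lemma borel_measurable_B_int:
  assumes "closed S" shows "(\<lambda>w. B_int s n S (w # ms)) \<in> borel_measurable borel"
proof -
  have "(\<lambda>z. A_int n (scl s S) (z # map (\<lambda>m. of_real s * m) ms)) \<in> borel_measurable borel"
    by (rule borel_measurable_A_int[OF closed_scl[OF assms]])
  moreover have "(\<lambda>w. complex_of_real s * w) \<in> borel_measurable borel" by measurable
  ultimately have "(\<lambda>w. A_int n (scl s S) (complex_of_real s * w # map (\<lambda>m. of_real s * m) ms)) \<in> borel_measurable borel"
    by (rule measurable_compose[rotated])
  then show ?thesis by (simp add: B_int_def)
qed

text \<open>Two powers of \<open>s\<close> come from the area element and two from each marked
  point, by homogeneity of |m - z|^2.\<close>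

lemma X_int_scl:
  assumes s: "s > 0" and S: "closed S"
  shows "X_int n (scl s S) (map (\<lambda>m. of_real s * m) ms) =
    ennreal (s ^ (2 + 2 * length ms)) * (\<integral>\<^sup>+w. B_weight s S ms w * B_int s n S (w # ms) \<partial>lborel)"
proof -
  define h where "h z = (if z \<in> scl s S then ennreal (exp (- (cmod z)\<^sup>2) * (\<Prod>m\<leftarrow>map (\<lambda>m. of_real s * m) ms. (cmod (m - z))\<^sup>2)) else 0)
     * A_int n (scl s S) (z # map (\<lambda>m. of_real s * m) ms)" for z
  have hm: "h \<in> borel_measurable borel"
    unfolding h_def using borel_measurable_X_weight[OF closed_scl[OF S, of s], of "map (\<lambda>m. of_real s * m) ms"] borel_measurable_A_int[OF closed_scl[OF S, of s], of n "map (\<lambda>m. of_real s * m) ms"]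
    by measurable
  have prod: "(\<Prod>m\<leftarrow>map (\<lambda>m. of_real s * m) ms. (cmod (m - of_real s * w))\<^sup>2) = s ^ (2 * length ms) * (\<Prod>m\<leftarrow>ms. (cmod (m - w))\<^sup>2)" for w
  proof (induction ms)
    case (Cons a ms)
    have "cmod (of_real s * a - of_real s * w) = s * cmod (a - w)"
      using s by (simp add: norm_mult flip: right_diff_distrib)
    then show ?case using Cons by (simp add: power_mult_distrib algebra_simps power2_eq_square)
  qed simp
  have hs: "h (of_real s * w) = ennreal (s ^ (2 * length ms)) * (B_weight s S ms w * B_int s n S (w # ms))" for w
  proof -
    have "of_real s * w \<in> scl s S \<longleftrightarrow> w \<in> S" using s by (simp add: scl_def)
    moreover have "(cmod (of_real s * w))\<^sup>2 = s\<^sup>2 * (cmod w)\<^sup>2" using s by (simp add: norm_mult power_mult_distrib)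
    moreover have "0 \<le> (\<Prod>m\<leftarrow>ms. (cmod (m - w))\<^sup>2)" by (auto intro!: prod_list_nonneg)
    ultimately show ?thesis using s unfolding h_def prod B_weight_def B_int_def
      by (simp add: ennreal_mult mult_ac)
  qed
  have "X_int n (scl s S) (map (\<lambda>m. of_real s * m) ms) = (\<integral>\<^sup>+z. h z \<partial>lborel)"
    unfolding X_int_def h_def ..
  also have "\<dots> = (\<integral>\<^sup>+w. h (of_real s * w + 0) \<partial>lborel) * ennreal ((cmod (of_real s))\<^sup>2)"
    by (rule nn_integral_complex_affine[symmetric, OF _ hm]) (use s in simp)
  also have "(\<integral>\<^sup>+w. h (of_real s * w + 0) \<partial>lborel) = ennreal (s ^ (2 * length ms)) * (\<integral>\<^sup>+w. B_weight s S ms w * B_int s n S (w # ms) \<partial>lborel)"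
    unfolding add_0_right hs
    by (rule nn_integral_cmult) (use borel_measurable_B_weight[OF S] borel_measurable_B_int[OF S] in measurable)
  finally have "X_int n (scl s S) (map (\<lambda>m. of_real s * m) ms) =
    ennreal (s ^ (2 * length ms)) * (\<integral>\<^sup>+w. B_weight s S ms w * B_int s n S (w # ms) \<partial>lborel) * ennreal ((cmod (of_real s))\<^sup>2)" .
  moreover have "ennreal (s ^ (2 + 2 * length ms)) = ennreal (s\<^sup>2) * ennreal (s ^ (2 * length ms))"
    unfolding power_add by (rule ennreal_mult) (use s in auto)
  ultimately show ?thesis using s by (simp only: norm_of_real power2_abs mult_ac)
qed

text \<open>The constants gathered along the whole recursion; \<open>m\<close> is the number of
  points already split off. They depend on how many points there are, but neither on their positions
  nor on \<open>S\<close>, and can therefore cancel between two sets.\<close>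

primrec G_const :: "real \<Rightarrow> nat \<Rightarrow> nat \<Rightarrow> ennreal" where
  "G_const s 0 m = 1"
| "G_const s (Suc n) m = eig_const n * ennreal (s ^ (2 + 2 * m)) * G_const s n (Suc m)"

lemma B_int_step:
  fixes n :: nat and ms :: "complex list"
  assumes s: "s > 0" and S: "closed S"
  defines "K \<equiv> eig_const n * ennreal (s ^ (2 + 2 * length ms)) * (\<integral>\<^sup>+w. B_weight s S ms w * B_int s n S (w # ms) \<partial>lborel)"
  shows "B_int s (Suc n) S ms \<le> K" "K \<le> of_nat (Suc n) * B_int s (Suc n) S ms"
  using A_int_step[OF closed_scl[OF S, of s], of n "map (\<lambda>m. of_real s * m) ms"]
  unfolding X_int_scl[OF s S] K_def B_int_def by (simp_all add: mult.assoc)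

lemma B_int_0: "B_int s 0 S ms = 1"
proof -
  have "cpoly 0 G = 1" for G
  proof -
    obtain c where "cpoly 0 G = [:c:]" using monic_cpoly(1)[of 0 G] degree_eq_zeroE by blast
    with monic_cpoly(2)[of 0 G] show ?thesis by (simp add: one_pCons)
  qed
  then have "Psi 0 S' ms' G = 1" for S' ms' G by (simp add: Psi_def map_replicate_const)
  then show ?thesis by (simp add: B_int_def A_int_def PiM_empty nn_integral_count_space_finite)
qed

section \<open>Pointwise upper bound and Jensen lower bound for the iterated recursion\<close>

text \<open>The unnormalised joint eigenvalue density with Gaussian strength \<open>c\<close>:
  multiplied out, it is the product of the factors exp (- c |w|^2) and the squared modulus of a
  Vandermonde determinant.\<close>

primrec T_weight :: "real \<Rightarrow> complex list \<Rightarrow> real" where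
  "T_weight c [] = 1"
| "T_weight c (w # ms) = exp (- c * (cmod w)\<^sup>2) * (\<Prod>m\<leftarrow>ms. (cmod (m - w))\<^sup>2) * T_weight c ms"

lemma T_weight_nonneg: "0 \<le> T_weight c ms"
  by (induction ms) (auto intro!: prod_list_nonneg mult_nonneg_nonneg)

text \<open>The exponent is split as s^2 = 1 + (s^2 - 1). One unit yields a Gaussian integral pi at
  each step. The rest is stored in \<open>T_weight\<close>, which becomes complete once all
  \<open>n\<close> points have been chosen and is only then replaced by its bound
  \<open>b\<close>.\<close>

lemma B_int_upper:
  assumes s: "s > 0" and S: "closed S" and b: "0 \<le> b"
    and bd: "\<And>zs. length zs = n \<Longrightarrow> set zs \<subseteq> S \<Longrightarrow> T_weight (s\<^sup>2 - 1) (zs @ ms) \<le> b"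
  shows "B_int s n S ms * ennreal (T_weight (s\<^sup>2 - 1) ms) \<le> G_const s n (length ms) * (ennreal pi ^ n * ennreal b)"
  using bd
proof (induction n arbitrary: ms)
  case 0
  from "0.prems"[of "[]"] show ?case by (simp add: B_int_0 ennreal_leI)
next
  case (Suc n)
  let ?T = "T_weight (s\<^sup>2 - 1)"
  let ?C = "eig_const n * ennreal (s ^ (2 + 2 * length ms))"
  let ?R = "G_const s n (Suc (length ms)) * (ennreal pi ^ n * ennreal b)"
  note [measurable] = borel_measurable_B_weight[OF S] borel_measurable_B_int[OF S]
  have IH: "B_int s n S (w # ms) * ennreal (?T (w # ms)) \<le> ?R" if "w \<in> S" for w
  proof -
    have "?T (zs @ w # ms) \<le> b" if "length zs = n" "set zs \<subseteq> S" for zs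
      using Suc.prems[of "zs @ [w]"] that \<open>w \<in> S\<close> by simp
    from Suc.IH[OF this] show ?thesis by simp
  qed
  have pw: "B_weight s S ms w * B_int s n S (w # ms) * ennreal (?T ms) \<le> ennreal (exp (- (cmod w)\<^sup>2)) * ?R" for w
  proof (cases "w \<in> S")
    case True
    have nn: "0 \<le> (\<Prod>m\<leftarrow>ms. (cmod (m - w))\<^sup>2)" by (auto intro!: prod_list_nonneg)
    have e: "exp (- s\<^sup>2 * (cmod w)\<^sup>2) = exp (- (cmod w)\<^sup>2) * exp (- (s\<^sup>2 - 1) * (cmod w)\<^sup>2)"
      by (simp add: algebra_simps flip: exp_add)
    have "B_weight s S ms w * B_int s n S (w # ms) * ennreal (?T ms) = ennreal (exp (- (cmod w)\<^sup>2)) * (B_int s n S (w # ms) * ennreal (?T (w # ms)))"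
      using True nn T_weight_nonneg[of "s\<^sup>2 - 1" ms] unfolding B_weight_def T_weight.simps e
      by (simp add: ennreal_mult mult_ac)
    also have "\<dots> \<le> ennreal (exp (- (cmod w)\<^sup>2)) * ?R" by (intro mult_left_mono IH True) simp
    finally show ?thesis .
  qed (simp add: B_weight_def)
  have "B_int s (Suc n) S ms * ennreal (?T ms) \<le> ?C * (\<integral>\<^sup>+w. B_weight s S ms w * B_int s n S (w # ms) \<partial>lborel) * ennreal (?T ms)"
    by (intro mult_right_mono B_int_step(1)[OF s S]) simp
  also have "\<dots> = ?C * (\<integral>\<^sup>+w. B_weight s S ms w * B_int s n S (w # ms) * ennreal (?T ms) \<partial>lborel)"
    by (subst nn_integral_multc) (auto simp: mult_ac)
  also have "\<dots> \<le> ?C * (\<integral>\<^sup>+w. ennreal (exp (- (cmod w)\<^sup>2)) * ?R \<partial>lborel)"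
    by (intro mult_left_mono nn_integral_mono pw) simp
  also have "\<dots> = ?C * (ennreal pi * ?R)"
    by (subst nn_integral_multc) (auto simp: gaussian_integral_complex)
  finally show ?case by (simp add: mult_ac)
qed

text \<open>At each step Lebesgue measure is bounded below by \<open>\<sigma>\<close> divided by
  \<open>M\<close>, which costs ln M in the exponent, and then Jensen's inequality is applied. The
  function \<open>p\<close> is minus the logarithmic potential of \<open>\<sigma>\<close>. Each of
  the n (n - 1) / 2 pairs of new points contributes twice the integral of \<open>p\<close>, each
  pair of a new and a marked point contributes 2 p m. The factors \<open>Suc n\<close> of the
  recursion accumulate to \<open>fact n\<close>.\<close>

lemma B_int_lower:
  fixes \<sigma> :: "complex measure" and p :: "complex \<Rightarrow> real"
  assumes s: "s > 0" and S: "closed S"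
    and \<rho>: "\<rho> \<in> borel_measurable borel" "\<And>z. 0 \<le> \<rho> z" "\<And>z. \<rho> z \<le> M" "\<And>z. z \<notin> S \<Longrightarrow> \<rho> z = 0" and M: "M > 0"
    and \<sigma>: "\<sigma> = density lborel (\<lambda>z. ennreal (\<rho> z))" "prob_space \<sigma>"
    and p: "\<And>m. integrable \<sigma> (\<lambda>w. ln (cmod (m - w)))" "\<And>m. p m = (\<integral>w. ln (cmod (m - w)) \<partial>\<sigma>)"
    and ip: "integrable \<sigma> p" and iq: "integrable \<sigma> (\<lambda>w. (cmod w)\<^sup>2)"
  shows "G_const s n (length ms) * ennreal (exp (real n * (2 * (\<Sum>m\<leftarrow>ms. p m)) + real n * (real n - 1) * (\<integral>w. p w \<partial>\<sigma>) - s\<^sup>2 * real n * (\<integral>w. (cmod w)\<^sup>2 \<partial>\<sigma>) - real n * ln M))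
    \<le> fact n * B_int s n S ms"
proof (induction n arbitrary: ms)
  case 0
  then show ?case by (simp add: B_int_0)
next
  case (Suc n)
  interpret \<sigma>: prob_space \<sigma> by fact
  note [measurable] = borel_measurable_B_weight[OF S] borel_measurable_B_int[OF S] \<rho>(1)
  have sets\<sigma>[measurable_cong]: "sets \<sigma> = sets borel" unfolding \<sigma>(1) by simp
  define L where "L = (\<integral>w. p w \<partial>\<sigma>)"
  define q where "q = (\<integral>w. (cmod w)\<^sup>2 \<partial>\<sigma>)"
  define P where "P = (\<Sum>m\<leftarrow>ms. p m)"
  let ?C = "eig_const n * ennreal (s ^ (2 + 2 * length ms))"
  define e0 where "e0 = real n * (2 * P) + real n * (real n - 1) * L - s\<^sup>2 * real n * q - real n * ln M"
  \<comment> \<open>\<open>E w\<close> collects all that depends on the new point: its own weight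
    and, through the induction hypothesis, the factor exp (2 n p w) that \<open>w\<close>
    contributes as a marked point for the \<open>n\<close> remaining steps.\<close>
  define E where "E w = - s\<^sup>2 * (cmod w)\<^sup>2 + 2 * (\<Sum>m\<leftarrow>ms. ln (cmod (m - w))) + 2 * real n * p w" for w
  have iS: "integrable \<sigma> (\<lambda>w. \<Sum>m\<leftarrow>ms. ln (cmod (m - w))) \<and> (\<integral>w. (\<Sum>m\<leftarrow>ms. ln (cmod (m - w))) \<partial>\<sigma>) = P"
    unfolding P_def by (induction ms) (auto simp: p)
  have iE: "integrable \<sigma> E" unfolding E_def using iS ip iq by (intro Bochner_Integration.integrable_add integrable_mult_right) auto
  have vE: "(\<integral>w. E w \<partial>\<sigma>) = - s\<^sup>2 * q + 2 * P + 2 * real n * L"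
    unfolding E_def q_def L_def using iS ip iq by simp
  define a where "a = (\<integral>w. E w \<partial>\<sigma>)"
  have [measurable]: "E \<in> borel_measurable \<sigma>" using iE by auto
  \<comment> \<open>Jensen's inequality through the tangent line of exp at the mean
    \<open>a\<close>. The maximum with 0 allows the passage to a nonnegative integral.\<close>
  have jensen: "ennreal (exp a) \<le> (\<integral>\<^sup>+w. ennreal (exp (E w)) \<partial>\<sigma>)"
  proof -
    have i2: "integrable \<sigma> (\<lambda>w. exp a * (1 + E w - a))" using iE by auto
    have "(\<integral>w. exp a * (1 + E w - a) \<partial>\<sigma>) = exp a"
      using iE by (simp add: a_def \<sigma>.prob_space)
    then have "ennreal (exp a) = ennreal (\<integral>w. exp a * (1 + E w - a) \<partial>\<sigma>)" by simp
    also have "\<dots> \<le> ennreal (\<integral>w. max 0 (exp a * (1 + E w - a)) \<partial>\<sigma>)"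
      by (intro ennreal_leI integral_mono i2 integrable_max) auto
    also have "\<dots> = (\<integral>\<^sup>+w. ennreal (max 0 (exp a * (1 + E w - a))) \<partial>\<sigma>)"
      by (rule nn_integral_eq_integral[symmetric]) (use i2 in auto)
    also have "\<dots> \<le> (\<integral>\<^sup>+w. ennreal (exp (E w)) \<partial>\<sigma>)"
    proof (intro nn_integral_mono ennreal_leI)
      fix w
      have "1 + (E w - a) \<le> exp (E w - a)" by (rule exp_ge_add_one_self)
      then have "exp a * (1 + (E w - a)) \<le> exp a * exp (E w - a)" by (intro mult_left_mono) auto
      also have "\<dots> = exp (E w)" by (simp flip: exp_add)
      finally show "max 0 (exp a * (1 + E w - a)) \<le> exp (E w)" by (simp add: algebra_simps)
    qed
    finally show ?thesis .
  qed
  \<comment> \<open>At a marked point the true factor is 0, while \<open>ln 0 = 0\<close> would give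
    1; these finitely many points are removed as a null set.\<close>
  have AEm: "AE w in lborel. w \<notin> set ms"
  proof -
    have "set ms \<in> null_sets lborel" by (rule finite_imp_null_set_lborel) simp
    then show ?thesis by (rule AE_not_in)
  qed
  have "ennreal (exp (e0 + a - ln M)) = ennreal (exp e0) * (ennreal (1 / M) * ennreal (exp a))"
    using M by (simp add: exp_add exp_diff ennreal_mult'[symmetric] mult_ac)
  also have "\<dots> \<le> ennreal (exp e0) * (ennreal (1 / M) * (\<integral>\<^sup>+w. ennreal (exp (E w)) \<partial>\<sigma>))"
    by (intro mult_left_mono jensen) auto
  also have "(\<integral>\<^sup>+w. ennreal (exp (E w)) \<partial>\<sigma>) = (\<integral>\<^sup>+w. ennreal (\<rho> w) * ennreal (exp (E w)) \<partial>lborel)"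
    unfolding \<sigma>(1) by (rule nn_integral_density) (use \<open>E \<in> borel_measurable \<sigma>\<close> sets\<sigma> in \<open>auto simp: measurable_cong_sets[OF sets\<sigma> refl]\<close>)
  also have "ennreal (exp e0) * (ennreal (1 / M) * (\<integral>\<^sup>+w. ennreal (\<rho> w) * ennreal (exp (E w)) \<partial>lborel))
      = (\<integral>\<^sup>+w. ennreal (exp e0) * ennreal (1 / M) * (ennreal (\<rho> w) * ennreal (exp (E w))) \<partial>lborel)"
    using \<open>E \<in> borel_measurable \<sigma>\<close> by (subst nn_integral_cmult) (auto simp: mult_ac measurable_cong_sets[OF sets\<sigma> refl])
  finally have J: "ennreal (exp (e0 + a - ln M)) \<le> (\<integral>\<^sup>+w. ennreal (exp e0) * ennreal (1 / M) * (ennreal (\<rho> w) * ennreal (exp (E w))) \<partial>lborel)" .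
  have e_eq: "real n * (2 * (\<Sum>m\<leftarrow>w # ms. p m)) + real n * (real n - 1) * L - s\<^sup>2 * real n * q - real n * ln M = e0 + 2 * real n * p w" for w
    by (simp add: e0_def P_def algebra_simps)
  have pw: "AE w in lborel. G_const s n (Suc (length ms)) * (ennreal (exp e0) * ennreal (1 / M) * (ennreal (\<rho> w) * ennreal (exp (E w))))
      \<le> fact n * (B_weight s S ms w * B_int s n S (w # ms))"
    using AEm
  proof eventually_elim
    fix w assume w: "w \<notin> set ms"
    show "G_const s n (Suc (length ms)) * (ennreal (exp e0) * ennreal (1 / M) * (ennreal (\<rho> w) * ennreal (exp (E w))))
      \<le> fact n * (B_weight s S ms w * B_int s n S (w # ms))"
    proof (cases "w \<in> S")
      case False then show ?thesis using \<rho>(4) by simp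
    next
      case True
      have pr: "(\<Prod>m\<leftarrow>ms. (cmod (m - w))\<^sup>2) = exp (2 * (\<Sum>m\<leftarrow>ms. ln (cmod (m - w))))"
        using w
      proof (induction ms)
        case (Cons a ms)
        have "exp (ln (cmod (a - w))) = cmod (a - w)" using Cons.prems by (intro exp_ln) auto
        with Cons show ?case by (simp add: distrib_left exp_add exp_double)
      qed simp
      have "ennreal (1 / M) * ennreal (\<rho> w) \<le> 1"
        using \<rho>(2,3)[of w] M by (simp add: ennreal_mult'[symmetric])
      then have "G_const s n (Suc (length ms)) * (ennreal (exp e0) * ennreal (1 / M) * (ennreal (\<rho> w) * ennreal (exp (E w))))
         \<le> G_const s n (Suc (length ms)) * (ennreal (exp e0) * ennreal (exp (E w)) * 1)"
      proof -
        have "ennreal (1 / M) * (ennreal (\<rho> w) * ennreal (exp (E w))) \<le> ennreal (exp (E w))"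
          using mult_right_mono[OF \<open>ennreal (1 / M) * ennreal (\<rho> w) \<le> 1\<close>, of "ennreal (exp (E w))"] by (simp add: mult.assoc)
        then show ?thesis unfolding mult.assoc mult_1_right by (intro mult_left_mono) auto
      qed
      also have "\<dots> = ennreal (exp (- s\<^sup>2 * (cmod w)\<^sup>2) * (\<Prod>m\<leftarrow>ms. (cmod (m - w))\<^sup>2)) * (G_const s n (Suc (length ms)) * ennreal (exp (e0 + 2 * real n * p w)))"
        unfolding pr E_def by (simp add: ennreal_mult'[symmetric] exp_add[symmetric] mult_ac) (simp add: ennreal_mult'[symmetric] mult.assoc exp_add[symmetric] mult.left_commute algebra_simps)
      also have "\<dots> \<le> ennreal (exp (- s\<^sup>2 * (cmod w)\<^sup>2) * (\<Prod>m\<leftarrow>ms. (cmod (m - w))\<^sup>2)) * (fact n * B_int s n S (w # ms))"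
        using Suc.IH[of "w # ms"] unfolding L_def[symmetric] q_def[symmetric] e_eq by (intro mult_left_mono) auto
      finally show ?thesis using True by (simp add: B_weight_def mult_ac)
    qed
  qed
  have "G_const s (Suc n) (length ms) * ennreal (exp (e0 + a - ln M))
     \<le> ?C * (G_const s n (Suc (length ms)) * (\<integral>\<^sup>+w. ennreal (exp e0) * ennreal (1 / M) * (ennreal (\<rho> w) * ennreal (exp (E w))) \<partial>lborel))"
    using mult_left_mono[OF J zero_le, of "?C * G_const s n (Suc (length ms))"] by (simp only: G_const.simps mult.assoc)
  also have "\<dots> = ?C * (\<integral>\<^sup>+w. G_const s n (Suc (length ms)) * (ennreal (exp e0) * ennreal (1 / M) * (ennreal (\<rho> w) * ennreal (exp (E w)))) \<partial>lborel)"
    using \<open>E \<in> borel_measurable \<sigma>\<close> by (subst nn_integral_cmult) (auto simp: measurable_cong_sets[OF sets\<sigma> refl])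
  also have "\<dots> \<le> ?C * (\<integral>\<^sup>+w. fact n * (B_weight s S ms w * B_int s n S (w # ms)) \<partial>lborel)"
    by (intro mult_left_mono nn_integral_mono_AE pw) simp
  also have "\<dots> = fact n * (?C * (\<integral>\<^sup>+w. B_weight s S ms w * B_int s n S (w # ms) \<partial>lborel))"
    by (subst nn_integral_cmult) (auto simp: mult_ac)
  also have "\<dots> \<le> fact n * (of_nat (Suc n) * B_int s (Suc n) S ms)"
    by (intro mult_left_mono B_int_step(2)[OF s S]) simp
  also have "\<dots> = fact (Suc n) * B_int s (Suc n) S ms" by (simp add: mult_ac)
  also have "e0 + a - ln M = real (Suc n) * (2 * (\<Sum>m\<leftarrow>ms. p m)) + real (Suc n) * (real (Suc n) - 1) * (\<integral>w. p w \<partial>\<sigma>) - s\<^sup>2 * real (Suc n) * (\<integral>w. (cmod w)\<^sup>2 \<partial>\<sigma>) - real (Suc n) * ln M"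
    unfolding a_def vE e0_def P_def[symmetric] L_def[symmetric] q_def[symmetric] by (simp add: algebra_simps)
  finally show ?case .
qed

lemma hole_prob_eq:
  assumes U: "open U" and n: "n > 0"
  shows "ennreal (hole_prob n U) = B_int (sqrt n) n (- U) [] * ennreal (1 / pi ^ (n * n))" and "B_int (sqrt n) n UNIV [] = ennreal (pi ^ (n * n))"
proof -
  let ?s = "sqrt (real n)"
  have s: "?s > 0" using n by simp
  interpret G: prob_space "ginibre n" unfolding ginibre_def by (rule prob_space_PiM) (rule gauss.prob_space_axioms)
  have ev: "(\<forall>z \<in> (\<lambda>w. complex_of_real ?s * w) ` U. \<not> is_eigenvalue n G z) \<longleftrightarrow> (\<forall>z. poly (cpoly n G) z = 0 \<longrightarrow> z \<in> scl ?s (- U))" for G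
  proof -
    have "z \<in> (\<lambda>w. complex_of_real ?s * w) ` U \<longleftrightarrow> z / complex_of_real ?s \<in> U" for z
      using s by (auto simp: image_iff intro!: bexI[of _ "z / complex_of_real ?s"])
    then have "scl ?s (- U) = - ((\<lambda>w. complex_of_real ?s * w) ` U)" unfolding scl_def by blast
    then show ?thesis unfolding is_eigenvalue_cpoly by blast
  qed
  have "closed (- U)" using U by auto
  then have "closed (scl ?s (- U))" by (rule closed_scl)
  from emeasure_ginibre_roots[OF this, of n]
  show "ennreal (hole_prob n U) = B_int ?s n (- U) [] * ennreal (1 / pi ^ (n * n))"
    unfolding hole_prob_def ev G.emeasure_eq_measure[symmetric] B_int_def by simp
  have "scl ?s UNIV = UNIV" by (simp add: scl_def)
  then show "B_int ?s n UNIV [] = ennreal (pi ^ (n * n))" by (simp add: B_int_def A_int_UNIV)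
qed

section \<open>Compactness of measures on a disc\<close>

text \<open>Schoenberg's curve maps the Cantor set onto the unit square. Pulling measures back to parameters in the
  unit interval reduces weak compactness in the plane to Helly selection on the line.\<close>

definition sch_g :: "real \<Rightarrow> real" where
  "sch_g t = max 0 (min 1 (1 / 2 - cos (pi * t)))"

definition sch :: "nat \<Rightarrow> real \<Rightarrow> real" where
  "sch j t = (\<Sum>k. (1 / 2) ^ Suc k * sch_g (3 ^ (2 * k + j) * t))"

lemma sch_g_bounds: "0 \<le> sch_g t" "sch_g t \<le> 1"
  by (auto simp: sch_g_def)

lemma summable_half: "summable (\<lambda>k. (1 / 2 :: real) ^ Suc k)"
  by (subst summable_Suc_iff) simp

lemma continuous_sch: "continuous_on UNIV (sch j)"
proof (rule uniform_limit_theorem)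
  show "\<forall>\<^sub>F n in sequentially. continuous_on UNIV (\<lambda>t. \<Sum>k<n. (1 / 2) ^ Suc k * sch_g (3 ^ (2 * k + j) * t))"
    unfolding sch_g_def by (intro always_eventually allI continuous_intros)
  show "uniform_limit UNIV (\<lambda>n t. \<Sum>k<n. (1 / 2) ^ Suc k * sch_g (3 ^ (2 * k + j) * t)) (sch j) sequentially"
    unfolding sch_def
  proof (rule Weierstrass_m_test[OF _ summable_half])
    fix n :: nat and t :: real
    show "norm ((1 / 2) ^ Suc n * sch_g (3 ^ (2 * n + j) * t)) \<le> (1 / 2) ^ Suc n"
      using sch_g_bounds[of "3 ^ (2 * n + j) * t"] by (auto simp: abs_mult intro!: mult_left_le)
  qed
qed auto

text \<open>The digits are differences of the floors of 2^n a at successive levels. The strict bound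
  on \<open>a\<close> makes the integer part vanish.\<close>

lemma binary_expansion:
  fixes a :: real
  assumes "0 \<le> a" "a < 1"
  shows "\<exists>d::nat \<Rightarrow> real. (\<forall>k. d k = 0 \<or> d k = 1) \<and> (\<lambda>k. (1 / 2) ^ Suc k * d k) sums a"
proof -
  define f where "f n = \<lfloor>2 ^ n * a\<rfloor>" for n :: nat
  define d :: "nat \<Rightarrow> real" where "d n = of_int (f (Suc n) - 2 * f n)" for n
  have "d k = 0 \<or> d k = 1" for k
  proof -
    have "2 * (2 ^ k * a) = 2 ^ Suc k * a" by simp
    then have "f (Suc k) = 2 * f k \<or> f (Suc k) = 2 * f k + 1" unfolding f_def by linarith
    then show ?thesis by (auto simp: d_def)
  qed
  moreover have ps: "(\<Sum>k<n. (1 / 2) ^ Suc k * d k) = of_int (f n) / 2 ^ n" for n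
  proof (induction n)
    case 0
    have "f 0 = 0" using assms by (simp add: f_def floor_eq_iff)
    then show ?case by simp
  next
    case (Suc n)
    then show ?case by (simp add: d_def field_simps power_one_over)
  qed
  have "(\<lambda>n. of_int (f n) / 2 ^ n) \<longlonglongrightarrow> a"
  proof (rule real_tendsto_sandwich)
    show "\<forall>\<^sub>F n in sequentially. a - (1 / 2) ^ n \<le> of_int (f n) / 2 ^ n"
    proof (intro always_eventually allI)
      fix n :: nat
      have "2 ^ n * a - 1 \<le> of_int (f n)" unfolding f_def by linarith
      then have "(2 ^ n * a - 1) / 2 ^ n \<le> of_int (f n) / 2 ^ n" by (intro divide_right_mono) auto
      moreover have "(2 ^ n * a - 1) / 2 ^ n = a - (1 / 2) ^ n" by (simp add: diff_divide_distrib power_one_over)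
      ultimately show "a - (1 / 2) ^ n \<le> of_int (f n) / 2 ^ n" by simp
    qed
    show "\<forall>\<^sub>F n in sequentially. of_int (f n) / 2 ^ n \<le> a"
    proof (intro always_eventually allI)
      fix n :: nat
      have "of_int (f n) \<le> 2 ^ n * a" unfolding f_def by linarith
      then show "of_int (f n) / 2 ^ n \<le> a" by (simp add: field_simps)
    qed
    have "(\<lambda>n. a - (1 / 2) ^ n) \<longlonglongrightarrow> a - 0" by (intro tendsto_intros LIMSEQ_realpow_zero) auto
    then show "(\<lambda>n. a - (1 / 2) ^ n) \<longlonglongrightarrow> a" by simp
  qed simp
  then have "(\<lambda>k. (1 / 2) ^ Suc k * d k) sums a" unfolding sums_def ps .
  ultimately show ?thesis by blast
qed

text \<open>\<open>sch_g\<close> has period 2, vanishes on [0, 1/3] and equals 1 on [2/3, 1].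
  Multiplying a number with ternary digits 0 and 2 by 3^m turns the digits before place m into an
  even integer, and the remaining fraction lies in the first or the last third according to digit
  m.\<close>

lemma sch_g_ternary:
  fixes c :: "nat \<Rightarrow> real"
  assumes c: "\<And>k. c k = 0 \<or> c k = 1"
  shows "sch_g (3 ^ m * (\<Sum>k. 2 * c k / 3 ^ Suc k)) = c m"
proof -
  have cb: "0 \<le> c k" "c k \<le> 1" for k using c[of k] by auto
  have gs: "(\<lambda>k. 2 / 3 ^ Suc (k + m)) sums ((1 / 3 ^ m) :: real)" for m
  proof -
    have "(\<lambda>k. (2 / 3 ^ Suc m) * (1 / 3) ^ k) sums ((2 / 3 ^ Suc m) * (1 / (1 - 1 / 3 :: real)))"
      by (intro sums_mult geometric_sums) auto
    then show ?thesis by (simp add: power_one_over power_add field_simps)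
  qed
  have sm: "summable (\<lambda>k. 2 * c k / 3 ^ Suc k)"
  proof (rule summable_comparison_test_ev)
    show "summable (\<lambda>k. 2 / 3 ^ Suc k :: real)" using gs[of 0] by (simp add: sums_iff)
    show "\<forall>\<^sub>F n in sequentially. norm (2 * c n / 3 ^ Suc n) \<le> 2 / 3 ^ Suc n"
      using cb by (auto simp: divide_right_mono)
  qed
  define r where "r = (\<Sum>k. 2 * c (k + Suc m) / 3 ^ Suc (k + Suc m))"
  have r0: "0 \<le> r" unfolding r_def
    using sm cb by (intro suminf_nonneg summable_ignore_initial_segment) auto
  have r1: "r \<le> 1 / 3 ^ Suc m"
  proof -
    have "r \<le> (\<Sum>k. 2 / 3 ^ Suc (k + Suc m))" unfolding r_def
    proof (rule suminf_le)
      show "2 * c (k + Suc m) / 3 ^ Suc (k + Suc m) \<le> 2 / 3 ^ Suc (k + Suc m)" for k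
        using cb by (intro divide_right_mono) auto
      show "summable (\<lambda>k. 2 * c (k + Suc m) / 3 ^ Suc (k + Suc m))" using sm by (rule summable_ignore_initial_segment)
      show "summable (\<lambda>k. 2 / 3 ^ Suc (k + Suc m) :: real)" using gs[of "Suc m"] by (simp add: sums_iff)
    qed
    then show ?thesis using gs[of "Suc m"] by (simp add: sums_iff)
  qed
  have split: "(\<Sum>k. 2 * c k / 3 ^ Suc k) = r + (\<Sum>k<Suc m. 2 * c k / 3 ^ Suc k)"
    unfolding r_def by (rule suminf_split_initial_segment[OF sm])
  have "\<exists>i::int. 3 ^ m * (\<Sum>k<m. 2 * c k / 3 ^ Suc k) = 2 * of_int i"
  proof -
    have "3 ^ m * (\<Sum>k<m. 2 * c k / 3 ^ Suc k) = (\<Sum>k<m. 2 * of_int ((if c k = 1 then 1 else 0) * 3 ^ (m - Suc k)))"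
      unfolding sum_distrib_left
    proof (rule sum.cong[OF refl])
      fix k assume "k \<in> {..<m}"
      then have "m = (m - Suc k) + Suc k" by auto
      then have "(3::real) ^ m = 3 ^ ((m - Suc k) + Suc k)" by (rule arg_cong)
      then have "(3::real) ^ m = 3 ^ (m - Suc k) * 3 ^ Suc k" by (simp only: power_add)
      then show "3 ^ m * (2 * c k / 3 ^ Suc k) = 2 * of_int ((if c k = 1 then 1 else 0) * 3 ^ (m - Suc k))"
        using c[of k] by auto
    qed
    also have "\<dots> = 2 * of_int (\<Sum>k<m. (if c k = 1 then 1 else 0) * 3 ^ (m - Suc k))"
      by (simp add: sum_distrib_left)
    finally show ?thesis by blast
  qed
  then obtain i :: int where i: "3 ^ m * (\<Sum>k<m. 2 * c k / 3 ^ Suc k) = 2 * of_int i" by blast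
  define \<theta> where "\<theta> = 2 * c m / 3 + 3 ^ m * r"
  have "3 ^ m * (\<Sum>k. 2 * c k / 3 ^ Suc k) = \<theta> + 2 * of_int i"
    unfolding split \<theta>_def i[symmetric] by (simp add: algebra_simps)
  then have "cos (pi * (3 ^ m * (\<Sum>k. 2 * c k / 3 ^ Suc k))) = cos (pi * \<theta> + 2 * pi * of_int i)"
    by (simp add: algebra_simps)
  also have "\<dots> = cos (pi * \<theta>)" by (simp add: cos_add)
  finally have cs: "cos (pi * (3 ^ m * (\<Sum>k. 2 * c k / 3 ^ Suc k))) = cos (pi * \<theta>)" .
  have mr: "0 \<le> 3 ^ m * r" "3 ^ m * r \<le> 1 / 3" using r0 r1 by (auto simp: field_simps)
  show ?thesis
  proof (cases "c m = 0")
    case True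
    then have "cos (pi / 3) \<le> cos (pi * \<theta>)" using mr by (intro cos_monotone_0_pi_le) (auto simp: \<theta>_def field_simps)
    then show ?thesis unfolding sch_g_def cs using True by (simp add: cos_60)
  next
    case False
    then have c1: "c m = 1" using c by blast
    have "cos (pi * \<theta>) \<le> cos (2 * pi / 3)"
      using mr c1 by (intro cos_monotone_0_pi_le) (auto simp: \<theta>_def field_simps)
    also have "cos (2 * pi / 3) = - 1 / 2" by (simp add: cos_120)
    finally show ?thesis unfolding sch_g_def cs using c1 by simp
  qed
qed

text \<open>Interleaving: the ternary digits of \<open>t\<close> at even places carry the binary
  digits of \<open>a\<close>, those at odd places the digits of \<open>b\<close>.\<close>

lemma sch_surj:
  assumes "0 \<le> a" "a < 1" "0 \<le> b" "b < 1"
  shows "\<exists>t\<in>{0..1}. sch 0 t = a \<and> sch 1 t = b"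
proof -
  obtain d where d: "\<And>k. d k = 0 \<or> d k = 1" "(\<lambda>k. (1 / 2) ^ Suc k * d k) sums a"
    using binary_expansion[OF assms(1,2)] by blast
  obtain e where e: "\<And>k. e k = 0 \<or> e k = 1" "(\<lambda>k. (1 / 2) ^ Suc k * e k) sums b"
    using binary_expansion[OF assms(3,4)] by blast
  define c where "c k = (if even k then d (k div 2) else e (k div 2))" for k
  have c: "c k = 0 \<or> c k = 1" for k using d(1) e(1) by (simp add: c_def)
  define t where "t = (\<Sum>k. 2 * c k / 3 ^ Suc k)"
  have g: "sch_g (3 ^ m * t) = c m" for m unfolding t_def by (rule sch_g_ternary[OF c])
  have "sch 0 t = a" unfolding sch_def g using d(2) by (simp add: c_def sums_iff)
  moreover have "sch 1 t = b" unfolding sch_def g using e(2) by (simp add: c_def sums_iff)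
  moreover have "t \<in> {0..1}"
  proof -
    have s: "(\<lambda>k. 2 / 3 ^ Suc k) sums (1 :: real)"
    proof -
      have "(\<lambda>k. (2 / 3) * (1 / 3) ^ k) sums ((2 / 3) * (1 / (1 - 1 / 3 :: real)))"
        by (intro sums_mult geometric_sums) auto
      then show ?thesis by (simp add: power_one_over field_simps)
    qed
    have cb: "0 \<le> c k" "c k \<le> 1" for k using c[of k] by auto
    have sm: "summable (\<lambda>k. 2 * c k / 3 ^ Suc k)"
    proof (rule summable_comparison_test_ev)
      show "summable (\<lambda>k. 2 / 3 ^ Suc k :: real)" using s by (simp add: sums_iff)
      show "\<forall>\<^sub>F n in sequentially. norm (2 * c n / 3 ^ Suc n) \<le> 2 / 3 ^ Suc n"
        using cb by (auto simp: divide_right_mono)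
    qed
    have "0 \<le> t" unfolding t_def using cb by (intro suminf_nonneg sm) auto
    moreover have "t \<le> (\<Sum>k. 2 / 3 ^ Suc k)" unfolding t_def
      using cb s by (intro suminf_le sm) (auto simp: sums_iff intro!: divide_right_mono)
    ultimately show ?thesis using s by (simp add: sums_iff)
  qed
  ultimately show ?thesis by blast
qed

lemma space_filling_curve:
  assumes "M > 0"
  shows "\<exists>\<phi>::real \<Rightarrow> complex. continuous_on UNIV \<phi> \<and> (\<forall>z\<in>cball 0 M. \<exists>t\<in>{0..1}. \<phi> t = z)"
proof -
  \<comment> \<open>The factor 2 M, rather than M, places the disc in the middle of the square, so
    that the parameters stay strictly below 1, as the binary expansion requires.\<close>
  define \<phi> where "\<phi> t = Complex ((2 * M) * (2 * sch 0 t - 1)) ((2 * M) * (2 * sch 1 t - 1))" for t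
  have "continuous_on UNIV \<phi>"
    unfolding \<phi>_def Complex_eq by (intro continuous_intros continuous_on_subset[OF continuous_sch]) auto
  moreover have "\<exists>t\<in>{0..1}. \<phi> t = z" if "z \<in> cball 0 M" for z
  proof -
    have "\<bar>Re z\<bar> \<le> M" "\<bar>Im z\<bar> \<le> M"
      using that abs_Re_le_cmod[of z] abs_Im_le_cmod[of z] by auto
    then have "0 \<le> (Re z / (2 * M) + 1) / 2" "(Re z / (2 * M) + 1) / 2 < 1" "0 \<le> (Im z / (2 * M) + 1) / 2" "(Im z / (2 * M) + 1) / 2 < 1"
      using assms by (auto simp: field_simps)
    from sch_surj[OF this] obtain t where t: "t \<in> {0..1}" "sch 0 t = (Re z / (2 * M) + 1) / 2" "sch 1 t = (Im z / (2 * M) + 1) / 2" by blast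
    then have "2 * sch 0 t - 1 = Re z / (2 * M)" "2 * sch 1 t - 1 = Im z / (2 * M)" by simp_all
    then have "\<phi> t = z" unfolding \<phi>_def using assms by (simp only:) (simp add: complex_eq_iff)
    then show ?thesis using t by blast
  qed
  ultimately show ?thesis by blast
qed

text \<open>Every function on a \<open>measure_pmf\<close> is measurable, so an arbitrary right
  inverse \<open>\<tau>\<close> of the curve can be used to pull the measures back to [0, 1], where
  they are tight. Skorohod's representation replaces weak convergence by pointwise convergence of
  random points. This passes through the continuous curve and lets double integrals be treated by
  dominated convergence.\<close>

theorem uniform_measures_subsequence:
  fixes T :: "nat \<Rightarrow> complex set"
  assumes T: "\<And>j. finite (T j)" "\<And>j. T j \<noteq> {}" "\<And>j. T j \<subseteq> cball 0 M" and M: "M > 0"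
  shows "\<exists>(r::nat \<Rightarrow> nat) (\<Omega>::real measure) Y Z. strict_mono r \<and> prob_space \<Omega> \<and>
     (\<forall>j. Y j \<in> borel_measurable \<Omega>) \<and> Z \<in> borel_measurable \<Omega> \<and>
     (\<forall>j. distr \<Omega> borel (Y j) = distr (measure_pmf (pmf_of_set (T (r j)))) borel (\<lambda>z. z)) \<and>
     (\<forall>\<omega>\<in>space \<Omega>. (\<lambda>j. Y j \<omega>) \<longlonglongrightarrow> (Z \<omega> :: complex))"
proof -
  obtain \<phi> :: "real \<Rightarrow> complex" where \<phi>: "continuous_on UNIV \<phi>" "\<forall>z\<in>cball 0 M. \<exists>t\<in>{0..1}. \<phi> t = z"
    using space_filling_curve[OF M] by (elim exE conjE)
  then have "\<forall>z. \<exists>t. z \<in> cball 0 M \<longrightarrow> t \<in> {0..1} \<and> \<phi> t = z" by blast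
  then obtain \<tau> where "\<forall>z. z \<in> cball 0 M \<longrightarrow> \<tau> z \<in> {0..1} \<and> \<phi> (\<tau> z) = z" by (rule choice[THEN exE])
  then have \<tau>: "\<And>z. z \<in> cball 0 M \<Longrightarrow> \<tau> z \<in> {0..1} \<and> \<phi> (\<tau> z) = z" by blast
  have \<phi>m[measurable]: "\<phi> \<in> borel_measurable borel" using \<phi>(1) by (rule borel_measurable_continuous_onI)
  define \<mu> where "\<mu> j = distr (measure_pmf (pmf_of_set (T j))) borel \<tau>" for j
  have rd: "real_distribution (\<mu> j)" for j
    unfolding \<mu>_def by (rule prob_space.real_distribution_distr) (auto simp: measure_pmf.prob_space_axioms)
  have "tight \<mu>"
    unfolding tight_def
  proof (intro conjI allI impI rd)
    fix e :: real assume e: "e > 0"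
    have "measure (\<mu> j) {-1<..2} = 1" for j
    proof -
      have "measure (\<mu> j) {-1<..2} = measure (measure_pmf (pmf_of_set (T j))) (\<tau> -` {-1<..2})"
        unfolding \<mu>_def by (subst measure_distr) auto
      also have "\<dots> = 1"
      proof (subst measure_pmf.prob_eq_1)
        show "AE z in measure_pmf (pmf_of_set (T j)). z \<in> \<tau> -` {-1<..2}"
          using T \<tau> by (subst AE_measure_pmf_iff) (fastforce simp: set_pmf_of_set)
      qed simp
      finally show ?thesis .
    qed
    then show "\<exists>a b. a < b \<and> (\<forall>n. 1 - e < measure (\<mu> n) {a<..b})"
      using e by (intro exI[of _ "-1"] exI[of _ 2]) auto
  qed
  then obtain r M' where r: "strict_mono r" "real_distribution M'" "weak_conv_m (\<mu> \<circ> id \<circ> r) M'"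
    using tight_imp_convergent_subsubsequence[of \<mu> id] by (auto simp: strict_mono_def)
  have "real_distribution ((\<mu> \<circ> id \<circ> r) n)" for n using rd by simp
  from Skorohod[OF this r(2,3)] obtain \<Omega> :: "real measure" and Y Z where "prob_space \<Omega> \<and> (\<forall>n. Y n \<in> borel_measurable \<Omega>) \<and>
     (\<forall>n. distr \<Omega> borel (Y n) = (\<mu> \<circ> id \<circ> r) n) \<and> Z \<in> \<Omega> \<rightarrow>\<^sub>M lborel \<and> distr \<Omega> borel Z = M' \<and>
     (\<forall>x\<in>space \<Omega>. (\<lambda>n. Y n x) \<longlonglongrightarrow> Z x)" by (elim exE)
  then have Y: "prob_space \<Omega>" "\<And>n. Y n \<in> borel_measurable \<Omega>" "\<And>n. distr \<Omega> borel (Y n) = \<mu> (r n)"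
     "Z \<in> \<Omega> \<rightarrow>\<^sub>M lborel" "\<And>x. x \<in> space \<Omega> \<Longrightarrow> (\<lambda>n. Y n x) \<longlonglongrightarrow> Z x"
    by simp_all
  have Zm: "Z \<in> borel_measurable \<Omega>" using Y(4) by simp
  show ?thesis
  proof (intro exI[of _ r] exI[of _ \<Omega>] exI[of _ "\<lambda>n x. \<phi> (Y n x)"] exI[of _ "\<lambda>x. \<phi> (Z x)"] conjI allI ballI r Y)
    show "(\<lambda>x. \<phi> (Y j x)) \<in> borel_measurable \<Omega>" for j using Y(2) by measurable
    show "(\<lambda>x. \<phi> (Z x)) \<in> borel_measurable \<Omega>" using Zm by measurable
    fix j
    have "distr \<Omega> borel (\<lambda>x. \<phi> (Y j x)) = distr (distr \<Omega> borel (Y j)) borel \<phi>"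
      by (subst distr_distr) (use Y(2) in \<open>auto simp: comp_def\<close>)
    also have "\<dots> = distr (measure_pmf (pmf_of_set (T (r j)))) borel (\<lambda>z. \<phi> (\<tau> z))"
      unfolding Y(3) \<mu>_def by (subst distr_distr) (auto simp: comp_def)
    also have "\<dots> = distr (measure_pmf (pmf_of_set (T (r j)))) borel (\<lambda>z. z)"
    proof (rule distr_cong_AE)
      show "AE z in measure_pmf (pmf_of_set (T (r j))). \<phi> (\<tau> z) = z"
        using T \<tau> by (subst AE_measure_pmf_iff) (auto simp: set_pmf_of_set dest!: T(3)[THEN subsetD])
    qed auto
    finally show "distr \<Omega> borel (\<lambda>x. \<phi> (Y j x)) = distr (measure_pmf (pmf_of_set (T (r j)))) borel (\<lambda>z. z)" .
  next
    fix x assume "x \<in> space \<Omega>"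
    then have "(\<lambda>n. Y n x) \<longlonglongrightarrow> Z x" by (rule Y(5))
    then show "(\<lambda>n. \<phi> (Y n x)) \<longlonglongrightarrow> \<phi> (Z x)"
      using \<phi>(1) by (intro continuous_on_tendsto_compose[OF \<phi>(1)]) auto
  qed
qed

section \<open>Logarithmic energy\<close>

abbreviation log_dist :: "complex \<times> complex \<Rightarrow> real" where
  "log_dist p \<equiv> ln (cmod (fst p - snd p))"

lemma cprobI:
  "sets \<mu> = sets borel \<Longrightarrow> prob_space \<mu> \<Longrightarrow> compact K \<Longrightarrow> K \<subseteq> E \<Longrightarrow> emeasure \<mu> K = 1 \<Longrightarrow> \<mu> \<in> cprob E"
  by (auto simp: cprob_def)

lemma cprobD:
  assumes "\<mu> \<in> cprob E"
  shows "sets \<mu> = sets borel" "prob_space \<mu>"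
    and "\<exists>M>0. \<exists>K. compact K \<and> K \<subseteq> E \<and> K \<subseteq> cball 0 M \<and> (AE z in \<mu>. z \<in> K)"
proof -
  show 1: "sets \<mu> = sets borel" "prob_space \<mu>" using assms by (auto simp: cprob_def)
  interpret prob_space \<mu> by fact
  obtain K where K: "compact K" "K \<subseteq> E" "emeasure \<mu> K = 1" using assms by (auto simp: cprob_def)
  have "AE z in \<mu>. z \<in> K"
    using K(3) K(1) 1 by (intro AE_prob_1) (simp add: measure_def)
  moreover obtain M where "M > 0" "K \<subseteq> cball 0 M"
    using compact_imp_bounded[OF K(1)] unfolding bounded_pos by (metis mem_cball_0 subsetI)
  ultimately show "\<exists>M>0. \<exists>K. compact K \<and> K \<subseteq> E \<and> K \<subseteq> cball 0 M \<and> (AE z in \<mu>. z \<in> K)" using K by blast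
qed

lemma cprob_mono: "E \<subseteq> F \<Longrightarrow> cprob E \<subseteq> cprob F"
  by (auto simp: cprob_def)

lemma ln_upper: "x \<ge> 0 \<Longrightarrow> ln x \<le> x" for x :: real
  by (cases "x = 0") (auto intro: order.trans[OF ln_le_minus_one])

text \<open>Compact support bounds the positive part of the logarithm, so \<open>N\<close> is finite
  and the subtraction in \<open>ereal\<close> is never \<infinity> - \<infinity>. The iterated
  integrals of the definition are rewritten over the product measure.\<close>

lemma log_energy_pos_fin:
  assumes "\<mu> \<in> cprob UNIV"
  defines "P \<equiv> (\<integral>\<^sup>+p. (if fst p = snd p then \<infinity> else ennreal (max 0 (- log_dist p))) \<partial>(\<mu> \<Otimes>\<^sub>M \<mu>))"
    and "N \<equiv> (\<integral>\<^sup>+p. ennreal (max 0 (log_dist p)) \<partial>(\<mu> \<Otimes>\<^sub>M \<mu>))"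
  shows "log_energy \<mu> = enn2ereal P - enn2ereal N" "N < \<infinity>" "R_measure \<mu> = log_energy \<mu> + ereal (\<integral>z. (cmod z)\<^sup>2 \<partial>\<mu>)"
    and "integrable \<mu> (\<lambda>z. (cmod z)\<^sup>2)"
proof -
  note [measurable_cong] = cprobD(1)[OF assms(1)]
  interpret prob_space \<mu> using cprobD[OF assms(1)] by simp
  interpret pair_sigma_finite \<mu> \<mu> ..
  interpret PP: pair_prob_space \<mu> \<mu> ..
  obtain M K where M: "M > 0" "K \<subseteq> cball 0 M" "AE z in \<mu>. z \<in> K" using cprobD(3)[OF assms(1)] by blast
  then have AEM: "AE z in \<mu>. cmod z \<le> M" by (auto elim!: eventually_mono)
  have AEp: "AE p in \<mu> \<Otimes>\<^sub>M \<mu>. cmod (fst p) \<le> M \<and> cmod (snd p) \<le> M"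
  proof -
    have "AE z in \<mu>. AE w in \<mu>. cmod z \<le> M \<and> cmod w \<le> M" using AEM by (auto elim!: eventually_mono)
    then show ?thesis by (subst (asm) AE_pair_iff) (auto simp: split_beta')
  qed
  have m1: "Measurable.pred (\<mu> \<Otimes>\<^sub>M \<mu>) (\<lambda>p. fst p = snd p)" by measurable
  have [measurable]: "(\<lambda>p. if fst p = snd p then \<infinity> else ennreal (max 0 (- log_dist p))) \<in> borel_measurable (\<mu> \<Otimes>\<^sub>M \<mu>)"
    using m1 by measurable
  show e1: "log_energy \<mu> = enn2ereal P - enn2ereal N"
  proof -
    have sf: "sigma_finite_measure \<mu>" by (rule prob_space_imp_sigma_finite[OF cprobD(2)[OF assms(1)]])
    have "(\<integral>\<^sup>+z. \<integral>\<^sup>+w. (if z = w then \<infinity> else ennreal (max 0 (- ln (cmod (z - w))))) \<partial>\<mu> \<partial>\<mu>) = P"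
      unfolding P_def using sigma_finite_measure.nn_integral_fst[OF sf, of "\<lambda>p. if fst p = snd p then \<infinity> else ennreal (max 0 (- log_dist p))" \<mu>] unfolding fst_conv snd_conv by simp
    moreover have "(\<integral>\<^sup>+z. \<integral>\<^sup>+w. ennreal (max 0 (ln (cmod (z - w)))) \<partial>\<mu> \<partial>\<mu>) = N"
      unfolding N_def using sigma_finite_measure.nn_integral_fst[OF sf, of "\<lambda>p. ennreal (max 0 (log_dist p))" \<mu>] by simp
    ultimately show ?thesis unfolding log_energy_def by simp
  qed
  have "N \<le> (\<integral>\<^sup>+p. ennreal (2 * M) \<partial>(\<mu> \<Otimes>\<^sub>M \<mu>))" unfolding N_def
  proof (rule nn_integral_mono_AE, use AEp in eventually_elim)
    fix p :: "complex \<times> complex" assume "cmod (fst p) \<le> M \<and> cmod (snd p) \<le> M"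
    then have "cmod (fst p - snd p) \<le> 2 * M" using norm_triangle_ineq4[of "fst p" "snd p"] by linarith
    then have "log_dist p \<le> 2 * M" using ln_upper[of "cmod (fst p - snd p)"] by (auto intro: order.trans)
    then show "ennreal (max 0 (log_dist p)) \<le> ennreal (2 * M)" using M by (intro ennreal_leI) auto
  qed
  also have "\<dots> < \<infinity>" by (simp add: PP.emeasure_space_1 ennreal_mult_less_top)
  finally show "N < \<infinity>" .
  show iq: "integrable \<mu> (\<lambda>z. (cmod z)\<^sup>2)"
    by (rule integrable_const_bound[where B="M\<^sup>2"]) (use AEM in \<open>auto elim!: eventually_mono intro!: power_mono\<close>)
  have "(\<integral>\<^sup>+z. ennreal ((cmod z)\<^sup>2) \<partial>\<mu>) = ennreal (\<integral>z. (cmod z)\<^sup>2 \<partial>\<mu>)"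
    by (rule nn_integral_eq_integral[OF iq]) auto
  then show "R_measure \<mu> = log_energy \<mu> + ereal (\<integral>z. (cmod z)\<^sup>2 \<partial>\<mu>)"
    unfolding R_measure_def by (simp add: enn2ereal_ennreal)
qed

text \<open>The truncated kernels increase to the logarithmic kernel as \<delta> decreases to 0,
  also on the diagonal, where they tend to \<infinity>. Monotone convergence thus turns the uniform
  bound into a bound for the energy and in particular shows that the energy is not
  \<infinity>.\<close>

lemma R_measure_le_of_truncated:
  assumes \<mu>: "\<mu> \<in> cprob UNIV"
    and bd: "\<And>\<delta>. 0 < \<delta> \<Longrightarrow> \<delta> \<le> 1 \<Longrightarrow> (\<integral>p. - ln (max \<delta> (cmod (fst p - snd p))) \<partial>(\<mu> \<Otimes>\<^sub>M \<mu>)) + (\<integral>z. (cmod z)\<^sup>2 \<partial>\<mu>) \<le> R"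
  shows "R_measure \<mu> \<le> ereal R"
proof -
  note [measurable_cong] = cprobD(1)[OF \<mu>]
  interpret prob_space \<mu> using cprobD[OF \<mu>] by simp
  interpret pair_sigma_finite \<mu> \<mu> ..
  interpret PP: pair_prob_space \<mu> \<mu> ..
  define P where "P = (\<integral>\<^sup>+p. (if fst p = snd p then \<infinity> else ennreal (max 0 (- log_dist p))) \<partial>(\<mu> \<Otimes>\<^sub>M \<mu>))"
  define N where "N = (\<integral>\<^sup>+p. ennreal (max 0 (log_dist p)) \<partial>(\<mu> \<Otimes>\<^sub>M \<mu>))"
  note E = log_energy_pos_fin[OF \<mu>, folded P_def N_def]
  define q where "q = (\<integral>z. (cmod z)\<^sup>2 \<partial>\<mu>)"
  have iN: "integrable (\<mu> \<Otimes>\<^sub>M \<mu>) (\<lambda>p. max 0 (log_dist p))"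
    by (rule integrableI_nonneg) (use E(2) in \<open>auto simp: N_def\<close>)
  define n where "n = (\<integral>p. max 0 (log_dist p) \<partial>(\<mu> \<Otimes>\<^sub>M \<mu>))"
  have Nn: "N = ennreal n" unfolding N_def n_def by (rule nn_integral_eq_integral[OF iN]) auto
  have n0: "0 \<le> n" unfolding n_def by (rule integral_nonneg_AE) auto
  define f where "f k p = max 0 (- ln (max (1 / real (Suc k)) (cmod (fst p - snd p))))" for k :: nat and p :: "complex \<times> complex"
  have fm[measurable]: "f k \<in> borel_measurable (\<mu> \<Otimes>\<^sub>M \<mu>)" for k unfolding f_def by measurable
  have fb: "f k p \<le> ln (real (Suc k))" "0 \<le> f k p" for k p
  proof -
    have "ln (1 / real (Suc k)) \<le> ln (max (1 / real (Suc k)) (cmod (fst p - snd p)))"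
      by (subst ln_le_cancel_iff) (auto simp: less_max_iff_disj)
    then have "- ln (max (1 / real (Suc k)) (cmod (fst p - snd p))) \<le> - ln (1 / real (Suc k))" by simp
    then show "f k p \<le> ln (real (Suc k))" by (simp add: f_def ln_div)
  qed (simp add: f_def)
  have fi: "integrable (\<mu> \<Otimes>\<^sub>M \<mu>) (f k)" for k
    by (rule PP.integrable_const_bound[where B="ln (real (Suc k))"]) (use fb[of k] in \<open>auto simp del: of_nat_Suc\<close>)
  have fle: "(\<integral>\<^sup>+p. ennreal (f k p) \<partial>(\<mu> \<Otimes>\<^sub>M \<mu>)) \<le> ennreal (R + n - q)" for k
  proof -
    \<comment> \<open>A truncation level of at most 1 changes only values below 1, so the positive
      part of the logarithm separates from the truncation once and for all.\<close>
    have eq: "- ln (max (1 / real (Suc k)) (cmod (fst p - snd p))) = f k p - max 0 (log_dist p)" for p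
    proof (cases "cmod (fst p - snd p) \<le> 1")
      case True
      moreover have "0 < max (1 / real (Suc k)) (cmod (fst p - snd p))" by (rule less_le_trans[OF _ max.cobounded1]) simp
      ultimately have "ln (max (1 / real (Suc k)) (cmod (fst p - snd p))) \<le> 0" by (subst ln_le_zero_iff) auto
      moreover have "log_dist p \<le> 0" using True by (cases "fst p = snd p") auto
      ultimately show ?thesis by (simp add: f_def)
    next
      case False
      moreover have "1 / real (Suc k) \<le> 1" by simp
      ultimately have "max (1 / real (Suc k)) (cmod (fst p - snd p)) = cmod (fst p - snd p)" by linarith
      moreover have "0 \<le> log_dist p" using False by simp
      ultimately show ?thesis by (simp add: f_def)
    qed
    have "(\<integral>p. - ln (max (1 / real (Suc k)) (cmod (fst p - snd p))) \<partial>(\<mu> \<Otimes>\<^sub>M \<mu>)) = (\<integral>p. f k p \<partial>(\<mu> \<Otimes>\<^sub>M \<mu>)) - n"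
      unfolding eq n_def by (rule Bochner_Integration.integral_diff[OF fi iN])
    then have "(\<integral>p. f k p \<partial>(\<mu> \<Otimes>\<^sub>M \<mu>)) \<le> R + n - q" using bd[of "1 / real (Suc k)"] by (simp add: q_def)
    then show ?thesis by (subst nn_integral_eq_integral[OF fi]) (auto simp: fb intro: ennreal_leI)
  qed
  have sup: "(if fst p = snd p then \<infinity> else ennreal (max 0 (- log_dist p))) = (SUP k. ennreal (f k p))" for p :: "complex \<times> complex"
  proof (rule LIMSEQ_unique[OF _ LIMSEQ_SUP])
    show "incseq (\<lambda>k. ennreal (f k p))"
    proof (intro monoI ennreal_leI)
      fix k l :: nat assume "k \<le> l"
      then have "1 / real (Suc l) \<le> 1 / real (Suc k)" by (simp add: frac_le)
      then have "max (1 / real (Suc l)) (cmod (fst p - snd p)) \<le> max (1 / real (Suc k)) (cmod (fst p - snd p))" by auto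
      moreover have "0 < max (1 / real (Suc l)) (cmod (fst p - snd p))" by (rule less_le_trans[OF _ max.cobounded1]) simp
      ultimately have "ln (max (1 / real (Suc l)) (cmod (fst p - snd p))) \<le> ln (max (1 / real (Suc k)) (cmod (fst p - snd p)))" by simp
      then show "f k p \<le> f l p" unfolding f_def by linarith
    qed
    show "(\<lambda>k. ennreal (f k p)) \<longlonglongrightarrow> (if fst p = snd p then \<infinity> else ennreal (max 0 (- log_dist p)))"
    proof (cases "fst p = snd p")
      case True
      have "f k p = ln (real (Suc k))" for k using True by (simp add: f_def ln_div)
      moreover have "filterlim (\<lambda>k. ln (real (Suc k))) at_top sequentially"
        by (intro filterlim_compose[OF ln_at_top] filterlim_compose[OF filterlim_real_sequentially] filterlim_Suc)
      ultimately show ?thesis using True by (simp add: ennreal_tendsto_top_eq_at_top)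
    next
      case False
      then have pos: "0 < cmod (fst p - snd p)" by simp
      have "\<forall>\<^sub>F k in sequentially. 1 / real (Suc k) < cmod (fst p - snd p)"
        by (rule order_tendstoD(2)[OF LIMSEQ_Suc[OF lim_1_over_n] pos])
      then have "\<forall>\<^sub>F k in sequentially. ennreal (max 0 (- log_dist p)) = ennreal (f k p)"
        by eventually_elim (simp add: f_def max_def)
      then show ?thesis using False by (simp add: tendsto_eventually eventually_mono[OF _ sym])
    qed
  qed
  have "P = (\<integral>\<^sup>+p. (SUP k. ennreal (f k p)) \<partial>(\<mu> \<Otimes>\<^sub>M \<mu>))" unfolding P_def sup ..
  also have "\<dots> = (SUP k. \<integral>\<^sup>+p. ennreal (f k p) \<partial>(\<mu> \<Otimes>\<^sub>M \<mu>))"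
  proof (rule nn_integral_monotone_convergence_SUP)
    show "incseq (\<lambda>k p. ennreal (f k p))"
    proof (intro monoI le_funI ennreal_leI)
      fix k l :: nat and p assume "k \<le> l"
      then have "1 / real (Suc l) \<le> 1 / real (Suc k)" by (simp add: frac_le)
      then have "max (1 / real (Suc l)) (cmod (fst p - snd p)) \<le> max (1 / real (Suc k)) (cmod (fst p - snd p))" by auto
      moreover have "0 < max (1 / real (Suc l)) (cmod (fst p - snd p))" by (rule less_le_trans[OF _ max.cobounded1]) simp
      ultimately have "ln (max (1 / real (Suc l)) (cmod (fst p - snd p))) \<le> ln (max (1 / real (Suc k)) (cmod (fst p - snd p)))" by simp
      then show "f k p \<le> f l p" unfolding f_def by linarith
    qed
  qed measurable
  also have "\<dots> \<le> ennreal (R + n - q)" by (rule SUP_least) (rule fle)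
  finally have Ple: "P \<le> ennreal (R + n - q)" .
  have "0 \<le> (\<integral>p. f 0 p \<partial>(\<mu> \<Otimes>\<^sub>M \<mu>))" by (rule integral_nonneg_AE) (auto simp: fb)
  \<comment> \<open>The real bound has to be nonnegative before it can leave \<open>ennreal\<close>.
    This follows from the level \<delta> = 1, at which the truncated kernel consists of the positive
    part of the logarithm alone.\<close>
  have "0 \<le> R + n - q"
  proof -
    have "(\<integral>p. - ln (max 1 (cmod (fst p - snd p))) \<partial>(\<mu> \<Otimes>\<^sub>M \<mu>)) = (\<integral>p. - max 0 (log_dist p) \<partial>(\<mu> \<Otimes>\<^sub>M \<mu>))"
    proof (rule Bochner_Integration.integral_cong[OF refl])
      fix p :: "complex \<times> complex"
      show "- ln (max 1 (cmod (fst p - snd p))) = - max 0 (log_dist p)"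
        by (cases "fst p = snd p"; cases "cmod (fst p - snd p) \<le> 1") (auto simp: max_def)
    qed
    then show ?thesis using bd[of 1] iN by (simp add: q_def n_def)
  qed
  then have "enn2ereal P \<le> ereal (R + n - q)" using Ple by (metis enn2ereal_ennreal less_eq_ennreal.rep_eq)
  then have "enn2ereal P - ereal n \<le> ereal (R - q)"
    by (cases "enn2ereal P") auto
  then have "log_energy \<mu> \<le> ereal (R - q)" unfolding E(1) Nn using n0 by (simp add: enn2ereal_ennreal)
  then show ?thesis unfolding E(3) q_def[symmetric] by (cases "log_energy \<mu>") auto
qed

text \<open>The kernel is infinite on the diagonal, so finite energy makes the diagonal a null set.
  From then on the convention \<open>ln 0 = 0\<close> in \<open>log_dist\<close> does no
  harm.\<close>

lemma log_energy_finite: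
  assumes \<mu>: "\<mu> \<in> cprob UNIV" and fin: "log_energy \<mu> \<noteq> \<infinity>"
  shows "integrable (\<mu> \<Otimes>\<^sub>M \<mu>) log_dist" "AE p in \<mu> \<Otimes>\<^sub>M \<mu>. fst p \<noteq> snd p" "log_energy \<mu> = ereal (- (\<integral>p. log_dist p \<partial>(\<mu> \<Otimes>\<^sub>M \<mu>)))"
proof -
  note [measurable_cong] = cprobD(1)[OF \<mu>]
  interpret prob_space \<mu> using cprobD[OF \<mu>] by simp
  interpret pair_sigma_finite \<mu> \<mu> ..
  define P where "P = (\<integral>\<^sup>+p. (if fst p = snd p then \<infinity> else ennreal (max 0 (- log_dist p))) \<partial>(\<mu> \<Otimes>\<^sub>M \<mu>))"
  define N where "N = (\<integral>\<^sup>+p. ennreal (max 0 (log_dist p)) \<partial>(\<mu> \<Otimes>\<^sub>M \<mu>))"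
  note E = log_energy_pos_fin[OF \<mu>, folded P_def N_def]
  have m1: "Measurable.pred (\<mu> \<Otimes>\<^sub>M \<mu>) (\<lambda>p. fst p = snd p)" by measurable
  have [measurable]: "(\<lambda>p. if fst p = snd p then \<infinity> else ennreal (max 0 (- log_dist p))) \<in> borel_measurable (\<mu> \<Otimes>\<^sub>M \<mu>)"
    using m1 by measurable
  have Pf: "P \<noteq> \<infinity>" using fin E(1,2) by (cases P; cases N) (auto simp: enn2ereal_ennreal)
  have "AE p in \<mu> \<Otimes>\<^sub>M \<mu>. (if fst p = snd p then \<infinity> else ennreal (max 0 (- log_dist p))) \<noteq> \<infinity>"
    by (rule nn_integral_noteq_infinite) (use Pf in \<open>auto simp: P_def\<close>)
  then show ne: "AE p in \<mu> \<Otimes>\<^sub>M \<mu>. fst p \<noteq> snd p" by (rule eventually_mono) auto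
  have P2: "P = (\<integral>\<^sup>+p. ennreal (max 0 (- log_dist p)) \<partial>(\<mu> \<Otimes>\<^sub>M \<mu>))"
    unfolding P_def by (rule nn_integral_cong_AE) (use ne in \<open>auto elim!: eventually_mono\<close>)
  have iP: "integrable (\<mu> \<Otimes>\<^sub>M \<mu>) (\<lambda>p. max 0 (- log_dist p))"
    by (rule integrableI_nonneg) (use Pf P2 in \<open>auto simp: less_top\<close>)
  have iN: "integrable (\<mu> \<Otimes>\<^sub>M \<mu>) (\<lambda>p. max 0 (log_dist p))"
    by (rule integrableI_nonneg) (use E(2) in \<open>auto simp: N_def\<close>)
  have dec: "log_dist p = max 0 (log_dist p) - max 0 (- log_dist p)" for p by auto
  show "integrable (\<mu> \<Otimes>\<^sub>M \<mu>) log_dist" by (subst dec) (intro Bochner_Integration.integrable_diff iN iP)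
  have "(\<integral>p. log_dist p \<partial>(\<mu> \<Otimes>\<^sub>M \<mu>)) = (\<integral>p. max 0 (log_dist p) \<partial>(\<mu> \<Otimes>\<^sub>M \<mu>)) - (\<integral>p. max 0 (- log_dist p) \<partial>(\<mu> \<Otimes>\<^sub>M \<mu>))"
    by (subst dec) (rule Bochner_Integration.integral_diff[OF iN iP])
  moreover have "P = ennreal (\<integral>p. max 0 (- log_dist p) \<partial>(\<mu> \<Otimes>\<^sub>M \<mu>))" unfolding P2 by (rule nn_integral_eq_integral[OF iP]) auto
  moreover have "N = ennreal (\<integral>p. max 0 (log_dist p) \<partial>(\<mu> \<Otimes>\<^sub>M \<mu>))" unfolding N_def by (rule nn_integral_eq_integral[OF iN]) auto
  moreover have "0 \<le> (\<integral>p. max 0 (- log_dist p) \<partial>(\<mu> \<Otimes>\<^sub>M \<mu>))" "0 \<le> (\<integral>p. max 0 (log_dist p) \<partial>(\<mu> \<Otimes>\<^sub>M \<mu>))"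
    by (auto intro!: integral_nonneg_AE)
  ultimately show "log_energy \<mu> = ereal (- (\<integral>p. log_dist p \<partial>(\<mu> \<Otimes>\<^sub>M \<mu>)))"
    unfolding E(1) by (simp add: enn2ereal_ennreal)
qed

lemma log_energy_of_integrable:
  assumes \<mu>: "\<mu> \<in> cprob UNIV" and int: "integrable (\<mu> \<Otimes>\<^sub>M \<mu>) log_dist" and ne: "AE p in \<mu> \<Otimes>\<^sub>M \<mu>. fst p \<noteq> snd p"
  shows "log_energy \<mu> = ereal (- (\<integral>p. log_dist p \<partial>(\<mu> \<Otimes>\<^sub>M \<mu>)))"
proof -
  define P where "P = (\<integral>\<^sup>+p. (if fst p = snd p then \<infinity> else ennreal (max 0 (- log_dist p))) \<partial>(\<mu> \<Otimes>\<^sub>M \<mu>))"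
  define N where "N = (\<integral>\<^sup>+p. ennreal (max 0 (log_dist p)) \<partial>(\<mu> \<Otimes>\<^sub>M \<mu>))"
  note E = log_energy_pos_fin[OF \<mu>, folded P_def N_def]
  have iP: "integrable (\<mu> \<Otimes>\<^sub>M \<mu>) (\<lambda>p. max 0 (- log_dist p))" using int by (intro integrable_max) auto
  have "P = (\<integral>\<^sup>+p. ennreal (max 0 (- log_dist p)) \<partial>(\<mu> \<Otimes>\<^sub>M \<mu>))"
    unfolding P_def by (rule nn_integral_cong_AE) (use ne in \<open>auto elim!: eventually_mono\<close>)
  also have "\<dots> = ennreal (\<integral>p. max 0 (- log_dist p) \<partial>(\<mu> \<Otimes>\<^sub>M \<mu>))" by (rule nn_integral_eq_integral[OF iP]) auto
  finally have "enn2ereal P \<noteq> \<infinity>" by (auto intro!: integral_nonneg_AE simp: enn2ereal_ennreal)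
  then have "log_energy \<mu> \<noteq> \<infinity>" using E(1,2) by (cases P; cases N) (auto simp: enn2ereal_ennreal)
  then show ?thesis using log_energy_finite[OF \<mu>] by simp
qed

section \<open>Discrete energy of point configurations\<close>

text \<open>The quadratic potential is shared equally between the two points of a pair, so that a
  single double sum over distinct points carries both the interaction and the potential.\<close>

definition ker :: "complex \<Rightarrow> complex \<Rightarrow> real" where
  "ker z w = ((cmod z)\<^sup>2 + (cmod w)\<^sup>2) / 2 - ln (cmod (z - w))"

definition disc_energy :: "complex set \<Rightarrow> real" where
  "disc_energy Z = (\<Sum>z\<in>Z. \<Sum>w\<in>Z - {z}. ker z w)"

lemma cmod_diff_sq_le: "(cmod (z - w))\<^sup>2 \<le> 2 * ((cmod z)\<^sup>2 + (cmod w)\<^sup>2)"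
proof -
  have "(cmod (z - w))\<^sup>2 \<le> (cmod z + cmod w)\<^sup>2" by (intro power_mono norm_triangle_ineq4) auto
  also have "\<dots> \<le> 2 * ((cmod z)\<^sup>2 + (cmod w)\<^sup>2)"
    using zero_le_power2[of "cmod z - cmod w"] by (simp add: power2_eq_square algebra_simps)
  finally show ?thesis .
qed

lemma ln_le_sq: "x \<ge> 0 \<Longrightarrow> ln x \<le> x\<^sup>2 / 4" "x \<ge> 0 \<Longrightarrow> ln x \<le> x\<^sup>2 / 8 + 1" for x :: real
proof -
  assume x: "x \<ge> 0"
  show "ln x \<le> x\<^sup>2 / 4"
  proof (cases "x = 0")
    case False
    then have "ln (x / 2) \<le> x / 2 - 1" using x by (intro ln_le_minus_one) auto
    moreover have "ln x = ln (x / 2) + ln 2" using x False by (simp add: ln_div)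
    moreover have "ln (2::real) \<le> 2 / 2" using ln_2_less_1 by simp
    ultimately have "ln x \<le> x / 2 + (ln 2 - 1)" by linarith
    moreover have "ln (2::real) \<le> 3 / 4" using ln2_le_25_over_36 by simp
    ultimately have "ln x \<le> x / 2 - 1 / 4" by linarith
    also have "\<dots> \<le> x\<^sup>2 / 4" using zero_le_power2[of "x - 1"] by (simp add: power2_eq_square algebra_simps)
    finally show ?thesis .
  qed simp
  show "ln x \<le> x\<^sup>2 / 8 + 1"
  proof (cases "x = 0")
    case False
    then have "ln (x / 2) \<le> x / 2 - 1" using x by (intro ln_le_minus_one) auto
    moreover have "ln x = ln (x / 2) + ln 2" using x False by (simp add: ln_div)
    moreover have "ln (2::real) \<le> 1" using ln_2_less_1 by simp
    ultimately have "ln x \<le> x / 2" by linarith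
    also have "\<dots> \<le> x\<^sup>2 / 8 + 1" using zero_le_power2[of "x - 2"] by (simp add: power2_eq_square algebra_simps)
    finally show ?thesis .
  qed simp
qed

text \<open>Nonnegativity permits discarding points without raising the energy. The coercive bound
  then forces all but a small fraction of the points of a low-energy configuration into a fixed
  disc. Both follow from bounding the logarithm by a small multiple of the squared distance.\<close>

lemma ker_nonneg: "0 \<le> ker z w" and ker_lower: "((cmod z)\<^sup>2 + (cmod w)\<^sup>2) / 4 - 1 \<le> ker z w"
  using ln_le_sq[OF norm_ge_zero, of "z - w"] cmod_diff_sq_le[of z w] unfolding ker_def by linarith+

lemma disc_energy_nonneg: "0 \<le> disc_energy Z"
  unfolding disc_energy_def by (intro sum_nonneg ker_nonneg)

lemma disc_energy_mono: "finite Z \<Longrightarrow> T \<subseteq> Z \<Longrightarrow> disc_energy T \<le> disc_energy Z"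
proof -
  assume Z: "finite Z" "T \<subseteq> Z"
  have "disc_energy T \<le> (\<Sum>z\<in>T. \<Sum>w\<in>Z - {z}. ker z w)" unfolding disc_energy_def
    using Z by (intro sum_mono sum_mono2 ker_nonneg) auto
  also have "\<dots> \<le> disc_energy Z" unfolding disc_energy_def
    using Z by (intro sum_mono2 sum_nonneg ker_nonneg) auto
  finally show ?thesis .
qed

lemma sum_offdiag:
  fixes g :: "complex \<Rightarrow> real"
  assumes "finite Z"
  shows "(\<Sum>z\<in>Z. \<Sum>w\<in>Z - {z}. (g z + g w) / 2) = (real (card Z) - 1) * (\<Sum>z\<in>Z. g z)"
proof (cases "Z = {}")
  case False
  then have c: "1 \<le> card Z" using assms by (simp add: Suc_le_eq card_gt_0_iff)
  have inner: "(\<Sum>w\<in>Z - {z}. (g z + g w) / 2) = ((real (card Z) - 2) * g z + (\<Sum>w\<in>Z. g w)) / 2" if "z \<in> Z" for z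
  proof -
    have "(\<Sum>w\<in>Z - {z}. g z + g w) = real (card Z - 1) * g z + (\<Sum>w\<in>Z - {z}. g w)"
      using that assms by (simp add: sum.distrib card_Diff_singleton)
    also have "(\<Sum>w\<in>Z - {z}. g w) = (\<Sum>w\<in>Z. g w) - g z" using that assms by (simp add: sum_diff1)
    finally show ?thesis using c by (simp add: sum_divide_distrib[symmetric] of_nat_diff algebra_simps)
  qed
  have "(\<Sum>z\<in>Z. \<Sum>w\<in>Z - {z}. (g z + g w) / 2) = (\<Sum>z\<in>Z. ((real (card Z) - 2) * g z + (\<Sum>w\<in>Z. g w)) / 2)"
    by (rule sum.cong[OF refl inner])
  also have "\<dots> = ((real (card Z) - 2) * (\<Sum>z\<in>Z. g z) + real (card Z) * (\<Sum>w\<in>Z. g w)) / 2"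
    by (simp add: sum_divide_distrib[symmetric] sum.distrib sum_distrib_left[symmetric])
  finally show ?thesis by (simp add: algebra_simps)
qed simp

lemma disc_energy_alt:
  assumes "finite Z"
  shows "disc_energy Z = (real (card Z) - 1) * (\<Sum>z\<in>Z. (cmod z)\<^sup>2) - (\<Sum>z\<in>Z. \<Sum>w\<in>Z - {z}. ln (cmod (z - w)))"
  unfolding disc_energy_def ker_def sum_subtractf using sum_offdiag[OF assms, of "\<lambda>z. (cmod z)\<^sup>2"] by simp

lemma T_weight_distinct:
  "distinct zs \<Longrightarrow> T_weight c zs = exp (- c * (\<Sum>z\<in>set zs. (cmod z)\<^sup>2) + (\<Sum>z\<in>set zs. \<Sum>w\<in>set zs - {z}. ln (cmod (z - w))))"
proof (induction zs)
  case (Cons w ms)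
  let ?Z = "set ms"
  have w: "w \<notin> ?Z" "finite ?Z" using Cons.prems by auto
  have "(\<Sum>z\<in>insert w ?Z. \<Sum>v\<in>insert w ?Z - {z}. ln (cmod (z - v))) = (\<Sum>v\<in>?Z. ln (cmod (w - v))) + (\<Sum>z\<in>?Z. ln (cmod (z - w)) + (\<Sum>v\<in>?Z - {z}. ln (cmod (z - v))))"
  proof -
    have "(\<Sum>v\<in>insert w ?Z - {z}. ln (cmod (z - v))) = ln (cmod (z - w)) + (\<Sum>v\<in>?Z - {z}. ln (cmod (z - v)))" if "z \<in> ?Z" for z
    proof -
      have "insert w ?Z - {z} = insert w (?Z - {z})" using w that by auto
      then show ?thesis using w by simp
    qed
    moreover have "insert w ?Z - {w} = ?Z" using w by auto
    ultimately show ?thesis using w by simp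
  qed
  also have "\<dots> = 2 * (\<Sum>v\<in>?Z. ln (cmod (v - w))) + (\<Sum>z\<in>?Z. \<Sum>v\<in>?Z - {z}. ln (cmod (z - v)))"
    by (simp add: sum.distrib norm_minus_commute[of w])
  finally have S: "(\<Sum>z\<in>insert w ?Z. \<Sum>v\<in>insert w ?Z - {z}. ln (cmod (z - v))) = 2 * (\<Sum>v\<in>?Z. ln (cmod (v - w))) + (\<Sum>z\<in>?Z. \<Sum>v\<in>?Z - {z}. ln (cmod (z - v)))" .
  have "(\<Prod>m\<leftarrow>ms. (cmod (m - w))\<^sup>2) = (\<Prod>m\<in>?Z. (cmod (m - w))\<^sup>2)"
    using Cons.prems by (simp add: prod.distinct_set_conv_list)
  also have "\<dots> = (\<Prod>m\<in>?Z. exp (2 * ln (cmod (m - w))))"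
  proof (rule prod.cong[OF refl])
    fix m assume "m \<in> ?Z"
    then have "exp (ln (cmod (m - w))) = cmod (m - w)" using w by (intro exp_ln) auto
    then show "(cmod (m - w))\<^sup>2 = exp (2 * ln (cmod (m - w)))" by (simp add: exp_double)
  qed
  also have "\<dots> = exp (2 * (\<Sum>v\<in>?Z. ln (cmod (v - w))))" by (simp add: exp_sum sum_distrib_left)
  finally have P: "(\<Prod>m\<leftarrow>ms. (cmod (m - w))\<^sup>2) = exp (2 * (\<Sum>v\<in>?Z. ln (cmod (v - w))))" .
  have "T_weight c (w # ms) = exp (- c * (cmod w)\<^sup>2) * exp (2 * (\<Sum>v\<in>?Z. ln (cmod (v - w)))) * exp (- c * (\<Sum>z\<in>?Z. (cmod z)\<^sup>2) + (\<Sum>z\<in>?Z. \<Sum>w\<in>?Z - {z}. ln (cmod (z - w))))"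
    using Cons by (simp add: P)
  also have "\<dots> = exp (- c * ((cmod w)\<^sup>2 + (\<Sum>z\<in>?Z. (cmod z)\<^sup>2)) + (2 * (\<Sum>v\<in>?Z. ln (cmod (v - w))) + (\<Sum>z\<in>?Z. \<Sum>w\<in>?Z - {z}. ln (cmod (z - w)))))"
    by (simp only: exp_add[symmetric]) (simp add: algebra_simps)
  finally show ?case unfolding list.set S using w by simp
qed simp

lemma T_weight_not_distinct: "\<not> distinct zs \<Longrightarrow> T_weight c zs = 0"
proof (induction zs)
  case (Cons w ms)
  show ?case
  proof (cases "w \<in> set ms")
    case True
    then have "(\<Prod>m\<leftarrow>ms. (cmod (m - w))\<^sup>2) = 0" by (auto simp: prod_list_zero_iff)
    then show ?thesis by simp
  next
    case False
    then show ?thesis using Cons by simp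
  qed
qed simp

text \<open>The strength N - 1 is the coefficient of the quadratic term in
  \<open>disc_energy_alt\<close>, so for distinct points the exponent is exactly minus the discrete
  energy. Repeated points give weight 0.\<close>

lemma T_weight_energy:
  assumes "length zs = N"
  shows "T_weight (real N - 1) zs \<le> exp (- disc_energy (set zs)) \<and> (T_weight (real N - 1) zs \<noteq> 0 \<longrightarrow> card (set zs) = N)"
proof (cases "distinct zs")
  case True
  then have "card (set zs) = N" using assms by (simp add: distinct_card)
  then show ?thesis using True by (simp add: T_weight_distinct disc_energy_alt algebra_simps)
qed (simp add: T_weight_not_distinct)

section \<open>From discrete to continuous energy\<close>

text \<open>Along a subsequence the uniform measures on \<open>T j\<close> are laws of random points
  that converge pointwise. The kernel truncated at \<delta> is bounded and continuous on the compact
  set, so its double integral passes to the limit. The diagonal pairs, absent from the discrete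
  energy, add at most \<open>C\<close> per point, which disappears after division by the squared
  number of points.\<close>

lemma R_measure_weak_limit:
  assumes S: "closed S" and M: "M > 0"
    and T: "\<And>j. finite (T j)" "\<And>j. T j \<noteq> {}" "\<And>j. T j \<subseteq> S \<inter> cball 0 M"
    and en: "\<And>j. disc_energy (T j) \<le> R * (real (card (T j)))\<^sup>2"
    and inf: "filterlim (\<lambda>j. card (T j)) at_top sequentially"
  shows "\<exists>\<mu>\<in>cprob S. R_measure \<mu> \<le> ereal R"
proof -
  have TM: "\<And>j. T j \<subseteq> cball 0 M" using T(3) by blast
  obtain r :: "nat \<Rightarrow> nat" and \<Omega> :: "real measure" and Y Z where "strict_mono r \<and> prob_space \<Omega> \<and>
     (\<forall>j. Y j \<in> borel_measurable \<Omega>) \<and> Z \<in> borel_measurable \<Omega> \<and>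
     (\<forall>j. distr \<Omega> borel (Y j) = distr (measure_pmf (pmf_of_set (T (r j)))) borel (\<lambda>z. z)) \<and>
     (\<forall>\<omega>\<in>space \<Omega>. (\<lambda>j. Y j \<omega>) \<longlonglongrightarrow> (Z \<omega> :: complex))"
    using uniform_measures_subsequence[of T M, OF T(1,2) TM M] by (elim exE)
  then have r: "strict_mono r" and "prob_space \<Omega>"
    and Ym: "\<And>j. Y j \<in> borel_measurable \<Omega>" and Zm: "Z \<in> borel_measurable \<Omega>"
    and dY: "\<And>j. distr \<Omega> borel (Y j) = distr (measure_pmf (pmf_of_set (T (r j)))) borel (\<lambda>z. z)"
    and lim: "\<And>\<omega>. \<omega> \<in> space \<Omega> \<Longrightarrow> (\<lambda>j. Y j \<omega>) \<longlonglongrightarrow> (Z \<omega> :: complex)"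
    by blast+
  interpret \<Omega>: prob_space \<Omega> by fact
  note [measurable] = Ym Zm
  let ?K = "S \<inter> cball 0 M"
  have K: "compact ?K" using S by (simp add: closed_Int_compact)
  then have [measurable]: "?K \<in> sets borel" by (auto intro: borel_closed compact_imp_closed)
  have YK: "AE \<omega> in \<Omega>. Y j \<omega> \<in> ?K" for j
  proof -
    have "AE z in distr (measure_pmf (pmf_of_set (T (r j)))) borel (\<lambda>z. z). z \<in> ?K"
    proof (subst AE_distr_iff)
      have "{z \<in> space borel. z \<in> ?K} = ?K" by (simp only: space_borel UNIV_I simp_thms Collect_mem_eq)
      then show "{z \<in> space borel. z \<in> ?K} \<in> sets borel" using \<open>?K \<in> sets borel\<close> by (simp only:)
      show "AE z in measure_pmf (pmf_of_set (T (r j))). z \<in> ?K"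
        using T[of "r j"] by (auto simp: AE_measure_pmf_iff set_pmf_of_set)
    qed simp
    then show ?thesis unfolding dY[symmetric] by (rule AE_distrD[OF Ym])
  qed
  have YKa: "AE \<omega> in \<Omega>. \<forall>j. Y j \<omega> \<in> ?K" using YK by (simp add: AE_all_countable)
  have ZK: "AE \<omega> in \<Omega>. Z \<omega> \<in> ?K"
    using YKa AE_space
  proof eventually_elim
    fix \<omega> assume "\<forall>j. Y j \<omega> \<in> ?K" "\<omega> \<in> space \<Omega>"
    then have "\<And>j. Y j \<omega> \<in> ?K" "(\<lambda>j. Y j \<omega>) \<longlonglongrightarrow> Z \<omega>" using lim by blast+
    then show "Z \<omega> \<in> ?K" by (rule closed_sequentially[OF compact_imp_closed[OF K]])
  qed
  define \<mu> where "\<mu> = distr \<Omega> borel Z"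
  have s\<mu>: "sets \<mu> = sets borel" by (simp add: \<mu>_def)
  interpret \<mu>: prob_space \<mu> unfolding \<mu>_def by (rule \<Omega>.prob_space_distr[OF Zm])
  have AE\<mu>: "AE z in \<mu>. z \<in> ?K"
    unfolding \<mu>_def
  proof (subst AE_distr_iff[OF Zm])
    have "{z \<in> space borel. z \<in> ?K} = ?K" by (simp only: space_borel UNIV_I simp_thms Collect_mem_eq)
    then show "{z \<in> space borel. z \<in> ?K} \<in> sets borel" using \<open>?K \<in> sets borel\<close> by (simp only:)
    show "AE \<omega> in \<Omega>. Z \<omega> \<in> ?K" by (rule ZK)
  qed
  have "emeasure \<mu> ?K = 1" using AE\<mu> s\<mu> by (intro \<mu>.emeasure_eq_1_AE) auto
  then have \<mu>S: "\<mu> \<in> cprob S" using K s\<mu> \<mu>.prob_space_axioms by (intro cprobI[of \<mu> ?K]) auto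
  have \<mu>U: "\<mu> \<in> cprob UNIV" using \<mu>S cprob_mono[of S UNIV] by auto
  note [measurable_cong] = s\<mu>
  interpret PO: pair_prob_space \<Omega> \<Omega> ..
  interpret PP: pair_prob_space \<mu> \<mu> ..
  have "R_measure \<mu> \<le> ereal R"
  proof (rule R_measure_le_of_truncated[OF \<mu>U])
    fix \<delta> :: real assume \<delta>: "0 < \<delta>" "\<delta> \<le> 1"
    define k where "k z w = ((cmod z)\<^sup>2 + (cmod w)\<^sup>2) / 2 - ln (max \<delta> (cmod (z - w)))" for z w
    define C where "C = M\<^sup>2 + \<bar>ln \<delta>\<bar> + 2 * M"
    have C0: "0 \<le> C" using M by (simp add: C_def)
    have mx: "0 < max \<delta> x" for x using \<delta> by (simp add: less_max_iff_disj)
    have kb: "\<bar>k z w\<bar> \<le> C" if "z \<in> ?K" "w \<in> ?K" for z w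
    proof -
      have zw: "cmod z \<le> M" "cmod w \<le> M" using that by auto
      then have sq: "(cmod z)\<^sup>2 \<le> M\<^sup>2" "(cmod w)\<^sup>2 \<le> M\<^sup>2" by (auto intro!: power_mono)
      have "cmod (z - w) \<le> 2 * M" using norm_triangle_ineq4[of z w] zw by linarith
      then have "max \<delta> (cmod (z - w)) \<le> 1 + 2 * M" using \<delta> M by auto
      moreover have "ln (max \<delta> (cmod (z - w))) \<le> max \<delta> (cmod (z - w)) - 1" by (rule ln_le_minus_one[OF mx])
      ultimately have u: "ln (max \<delta> (cmod (z - w))) \<le> 2 * M" by linarith
      have l: "ln \<delta> \<le> ln (max \<delta> (cmod (z - w)))" using \<delta> mx by (subst ln_le_cancel_iff) auto
      have nn: "0 \<le> (cmod z)\<^sup>2" "0 \<le> (cmod w)\<^sup>2" by simp_all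
      have "- \<bar>ln \<delta>\<bar> \<le> ln (max \<delta> (cmod (z - w)))" using l abs_ge_minus_self[of "ln \<delta>"] by linarith
      moreover have "((cmod z)\<^sup>2 + (cmod w)\<^sup>2) / 2 \<le> M\<^sup>2" "0 \<le> ((cmod z)\<^sup>2 + (cmod w)\<^sup>2) / 2" using sq nn by (simp_all del: zero_le_power2 add: field_simps)
      moreover have "0 \<le> \<bar>ln \<delta>\<bar>" "0 \<le> M\<^sup>2" by simp_all
      ultimately show ?thesis unfolding k_def C_def using u M by (intro abs_leI) linarith+
    qed
    have kc: "((\<lambda>j. k (x j) (y j)) \<longlongrightarrow> k a b) sequentially" if "x \<longlonglongrightarrow> a" "y \<longlonglongrightarrow> b" for x y a b
      unfolding k_def using mx[of "cmod (a - b)"] by (intro tendsto_intros that) auto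
    have km[measurable]: "(\<lambda>p. k (f p) (g p)) \<in> borel_measurable N" if [measurable]: "f \<in> borel_measurable N" "g \<in> borel_measurable N" for f g and N :: "'z measure"
      unfolding k_def by measurable
    let ?I = "\<lambda>X. \<integral>p. k (X (fst p)) (X (snd p)) \<partial>(\<Omega> \<Otimes>\<^sub>M \<Omega>)"
    have Pair_AE: "AE p in \<Omega> \<Otimes>\<^sub>M \<Omega>. X (fst p) \<in> ?K \<and> X (snd p) \<in> ?K" if "AE \<omega> in \<Omega>. X \<omega> \<in> ?K" and [measurable]: "X \<in> borel_measurable \<Omega>" for X
    proof -
      have "AE x in \<Omega>. AE y in \<Omega>. X x \<in> ?K \<and> X y \<in> ?K" using that(1) by (auto elim!: eventually_mono)
      moreover have "{p \<in> space (\<Omega> \<Otimes>\<^sub>M \<Omega>). X (fst p) \<in> ?K \<and> X (snd p) \<in> ?K} \<in> sets (\<Omega> \<Otimes>\<^sub>M \<Omega>)" by measurable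
      ultimately show ?thesis by (subst PO.AE_pair_iff[symmetric]) (auto simp: split_beta')
    qed
    have conv: "(\<lambda>j. ?I (Y j)) \<longlonglongrightarrow> ?I Z"
    proof (rule integral_dominated_convergence[where w="\<lambda>_. C"])
      show "AE p in \<Omega> \<Otimes>\<^sub>M \<Omega>. (\<lambda>j. k (Y j (fst p)) (Y j (snd p))) \<longlonglongrightarrow> k (Z (fst p)) (Z (snd p))"
        using AE_space by eventually_elim (auto simp: space_pair_measure intro!: kc lim)
      show "AE p in \<Omega> \<Otimes>\<^sub>M \<Omega>. norm (k (Y j (fst p)) (Y j (snd p))) \<le> C" for j
        using Pair_AE[OF YK Ym, of j] by eventually_elim (auto intro!: kb)
    qed auto
    have val: "?I (Y j) = (\<Sum>z\<in>T (r j). \<Sum>w\<in>T (r j). k z w) / (real (card (T (r j))))\<^sup>2" for j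
    proof -
      let ?p = "measure_pmf (pmf_of_set (T (r j)))"
      let ?c = "real (card (T (r j)))"
      have "AE p in \<Omega> \<Otimes>\<^sub>M \<Omega>. norm (k (Y j (fst p)) (Y j (snd p))) \<le> C"
        using Pair_AE[OF YK Ym, of j] by eventually_elim (auto intro!: kb)
      then have ii: "integrable (\<Omega> \<Otimes>\<^sub>M \<Omega>) (\<lambda>p. k (Y j (fst p)) (Y j (snd p)))"
        by (rule PO.integrable_const_bound) measurable
      have d: "(\<integral>\<omega>. f (Y j \<omega>) \<partial>\<Omega>) = (\<Sum>w\<in>T (r j). f w) / ?c" if [measurable]: "f \<in> borel_measurable borel" for f :: "complex \<Rightarrow> real"
      proof -
        have "(\<integral>\<omega>. f (Y j \<omega>) \<partial>\<Omega>) = (\<integral>z. f z \<partial>distr \<Omega> borel (Y j))" by (rule integral_distr[symmetric]) auto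
        also have "\<dots> = (\<integral>z. f z \<partial>?p)" unfolding dY by (rule integral_distr) auto
        also have "\<dots> = (\<Sum>w\<in>T (r j). f w) / ?c" by (rule integral_pmf_of_set[OF T(2,1)])
        finally show ?thesis .
      qed
      have "?I (Y j) = (\<integral>x. \<integral>y. k (Y j x) (Y j y) \<partial>\<Omega> \<partial>\<Omega>)"
        using PO.integral_fst'[OF ii] by simp
      also have "\<dots> = (\<integral>x. (\<Sum>w\<in>T (r j). k (Y j x) w) / ?c \<partial>\<Omega>)" by (subst d) auto
      also have "\<dots> = (\<Sum>z\<in>T (r j). (\<Sum>w\<in>T (r j). k z w) / ?c) / ?c" by (subst d) auto
      finally show ?thesis by (simp add: sum_divide_distrib[symmetric] power2_eq_square)
    qed
    have bound: "?I (Y j) \<le> R + C / real (card (T (r j)))" for j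
    proof -
      let ?T = "T (r j)"
      let ?c = "real (card ?T)"
      have c: "?c > 0" using T(1,2)[of "r j"] by (simp add: card_gt_0_iff)
      have "(\<Sum>w\<in>?T. k z w) \<le> C + (\<Sum>w\<in>?T - {z}. ker z w)" if z: "z \<in> ?T" for z
      proof -
        have "(\<Sum>w\<in>?T. k z w) = k z z + (\<Sum>w\<in>?T - {z}. k z w)" using T(1) z by (simp add: sum.remove)
        also have "k z z \<le> C" using kb[of z z] z T(3)[of "r j"] by (auto simp: abs_le_iff subset_iff)
        also have "(\<Sum>w\<in>?T - {z}. k z w) \<le> (\<Sum>w\<in>?T - {z}. ker z w)"
        proof (rule sum_mono)
          fix w assume "w \<in> ?T - {z}"
          then have "ln (cmod (z - w)) \<le> ln (max \<delta> (cmod (z - w)))" using mx by (subst ln_le_cancel_iff) auto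
          then show "k z w \<le> ker z w" by (simp add: k_def ker_def)
        qed
        finally show ?thesis by simp
      qed
      then have "(\<Sum>z\<in>?T. \<Sum>w\<in>?T. k z w) \<le> (\<Sum>z\<in>?T. C + (\<Sum>w\<in>?T - {z}. ker z w))" by (rule sum_mono)
      also have "\<dots> = ?c * C + disc_energy ?T" by (simp add: sum.distrib disc_energy_def)
      also have "\<dots> \<le> ?c * C + R * ?c\<^sup>2" using en[of "r j"] by simp
      finally have "?I (Y j) \<le> (?c * C + R * ?c\<^sup>2) / ?c\<^sup>2" unfolding val by (intro divide_right_mono) auto
      also have "\<dots> = R + C / ?c" using c by (simp add: field_simps power2_eq_square)
      finally show ?thesis .
    qed
    have "filterlim (\<lambda>j. real (card (T (r j)))) at_top sequentially"
      by (intro filterlim_compose[OF filterlim_real_sequentially] filterlim_compose[OF inf] filterlim_subseq r)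
    then have "(\<lambda>j. R + C / real (card (T (r j)))) \<longlonglongrightarrow> R + 0"
      by (intro tendsto_intros real_tendsto_divide_at_top[where c=C]) auto
    then have IZ: "?I Z \<le> R" using LIMSEQ_le[OF conv] bound by auto
    have ii: "integrable (\<mu> \<Otimes>\<^sub>M \<mu>) (\<lambda>p. k (fst p) (snd p))"
    proof (rule PP.integrable_const_bound[where B=C])
      have "AE x in \<mu>. AE y in \<mu>. x \<in> ?K \<and> y \<in> ?K" using AE\<mu> by (auto elim!: eventually_mono)
      moreover have "{p \<in> space (\<mu> \<Otimes>\<^sub>M \<mu>). fst p \<in> ?K \<and> snd p \<in> ?K} \<in> sets (\<mu> \<Otimes>\<^sub>M \<mu>)" by measurable
      ultimately have "AE p in \<mu> \<Otimes>\<^sub>M \<mu>. fst p \<in> ?K \<and> snd p \<in> ?K"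
        by (subst PP.AE_pair_iff[symmetric]) (auto simp: split_beta')
      then show "AE p in \<mu> \<Otimes>\<^sub>M \<mu>. norm (k (fst p) (snd p)) \<le> C" by eventually_elim (auto intro!: kb)
    qed measurable
    have IO: "integrable (\<Omega> \<Otimes>\<^sub>M \<Omega>) (\<lambda>p. k (Z (fst p)) (Z (snd p)))"
      by (rule PO.integrable_const_bound[where B=C]) (rule eventually_mono[OF Pair_AE[OF ZK Zm]], simp only: real_norm_def kb, measurable)
    have "?I Z = (\<integral>x. \<integral>y. k (Z x) (Z y) \<partial>\<Omega> \<partial>\<Omega>)" using PO.integral_fst'[OF IO] by simp
    also have "\<dots> = (\<integral>x. \<integral>w. k (Z x) w \<partial>\<mu> \<partial>\<Omega>)" unfolding \<mu>_def by (subst integral_distr) auto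
    also have "\<dots> = (\<integral>z. \<integral>w. k z w \<partial>\<mu> \<partial>\<mu>)"
    proof -
      define h where "h z = (\<integral>w. k z w \<partial>\<mu>)" for z
      have "h \<in> borel_measurable borel" unfolding h_def[abs_def] by measurable
      then have "(\<integral>z. h z \<partial>distr \<Omega> borel Z) = (\<integral>x. h (Z x) \<partial>\<Omega>)" by (rule integral_distr[OF Zm])
      then show ?thesis unfolding h_def \<mu>_def[symmetric] by (rule sym)
    qed
    also have "\<dots> = (\<integral>p. k (fst p) (snd p) \<partial>(\<mu> \<Otimes>\<^sub>M \<mu>))" using PP.integral_fst'[OF ii] by simp
    finally have kR: "(\<integral>p. k (fst p) (snd p) \<partial>(\<mu> \<Otimes>\<^sub>M \<mu>)) \<le> R" using IZ by simp
    note iq = log_energy_pos_fin(4)[OF \<mu>U]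
    have i1: "integrable (\<mu> \<Otimes>\<^sub>M \<mu>) (\<lambda>p. (cmod (fst p))\<^sup>2)" "(\<integral>p. (cmod (fst p))\<^sup>2 \<partial>(\<mu> \<Otimes>\<^sub>M \<mu>)) = (\<integral>z. (cmod z)\<^sup>2 \<partial>\<mu>)"
      and i2: "integrable (\<mu> \<Otimes>\<^sub>M \<mu>) (\<lambda>p. (cmod (snd p))\<^sup>2)" "(\<integral>p. (cmod (snd p))\<^sup>2 \<partial>(\<mu> \<Otimes>\<^sub>M \<mu>)) = (\<integral>z. (cmod z)\<^sup>2 \<partial>\<mu>)"
    proof -
      have f: "distr (\<mu> \<Otimes>\<^sub>M \<mu>) \<mu> fst = \<mu>" by (rule \<mu>.distr_pair_fst)
      have s: "distr (\<mu> \<Otimes>\<^sub>M \<mu>) \<mu> snd = \<mu>"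
        using PP.distr_pair_swap by (subst PP.distr_pair_swap) (subst distr_distr, auto simp: comp_def split_beta' f[unfolded comp_def])
      show "integrable (\<mu> \<Otimes>\<^sub>M \<mu>) (\<lambda>p. (cmod (fst p))\<^sup>2)" using iq by (subst (asm) f[symmetric], subst (asm) integrable_distr_eq) auto
      show "(\<integral>p. (cmod (fst p))\<^sup>2 \<partial>(\<mu> \<Otimes>\<^sub>M \<mu>)) = (\<integral>z. (cmod z)\<^sup>2 \<partial>\<mu>)" by (subst (2) f[symmetric], subst integral_distr) auto
      show "integrable (\<mu> \<Otimes>\<^sub>M \<mu>) (\<lambda>p. (cmod (snd p))\<^sup>2)" using iq by (subst (asm) s[symmetric], subst (asm) integrable_distr_eq) auto
      show "(\<integral>p. (cmod (snd p))\<^sup>2 \<partial>(\<mu> \<Otimes>\<^sub>M \<mu>)) = (\<integral>z. (cmod z)\<^sup>2 \<partial>\<mu>)" by (subst (2) s[symmetric], subst integral_distr) auto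
    qed
    have "(\<integral>p. - ln (max \<delta> (cmod (fst p - snd p))) \<partial>(\<mu> \<Otimes>\<^sub>M \<mu>)) = (\<integral>p. k (fst p) (snd p) - ((cmod (fst p))\<^sup>2 / 2 + (cmod (snd p))\<^sup>2 / 2) \<partial>(\<mu> \<Otimes>\<^sub>M \<mu>))"
      by (rule Bochner_Integration.integral_cong[OF refl]) (simp add: k_def field_simps)
    also have "\<dots> = (\<integral>p. k (fst p) (snd p) \<partial>(\<mu> \<Otimes>\<^sub>M \<mu>)) - (\<integral>z. (cmod z)\<^sup>2 \<partial>\<mu>)"
      using ii i1 i2 by simp
    finally show "(\<integral>p. - ln (max \<delta> (cmod (fst p - snd p))) \<partial>(\<mu> \<Otimes>\<^sub>M \<mu>)) + (\<integral>z. (cmod z)\<^sup>2 \<partial>\<mu>) \<le> R" using kR by simp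
  qed
  then show ?thesis using \<mu>S by blast
qed

text \<open>Otherwise there are arbitrarily large configurations of energy below R N^2. Discarding
  their far points leaves configurations in a fixed disc, and a limit measure whose energy is at
  most some \<open>R'\<close> still below the infimum.\<close>

theorem disc_energy_lower_bound:
  assumes S: "closed S" and R: "ereal R < (INF \<mu>\<in>cprob S. R_measure \<mu>)"
  shows "\<exists>N0. \<forall>N\<ge>N0. \<forall>Z. finite Z \<longrightarrow> Z \<subseteq> S \<longrightarrow> card Z = N \<longrightarrow> R * (real N)\<^sup>2 \<le> disc_energy Z"
proof (rule ccontr)
  assume neg: "\<not> ?thesis"
  \<comment> \<open>At least two points are demanded so that (N - 1) / 2 is no smaller than N / 4 in
    the moment estimate.\<close>
  have "\<exists>Z. finite Z \<and> Z \<subseteq> S \<and> card Z \<ge> j + 2 \<and> disc_energy Z < R * (real (card Z))\<^sup>2" for j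
  proof -
    obtain N Z where "N \<ge> j + 2" "finite Z" "Z \<subseteq> S" "card Z = N" "\<not> R * (real N)\<^sup>2 \<le> disc_energy Z" using neg by blast
    then show ?thesis by (intro exI[of _ Z]) auto
  qed
  then obtain Z where Z: "\<And>j. finite (Z j)" "\<And>j. Z j \<subseteq> S" "\<And>j. card (Z j) \<ge> j + 2" "\<And>j. disc_energy (Z j) < R * (real (card (Z j)))\<^sup>2"
    by metis
  have R0: "R > 0"
  proof -
    have "0 < R * (real (card (Z 0)))\<^sup>2" using disc_energy_nonneg[of "Z 0"] Z(4)[of 0] by linarith
    then show ?thesis by (simp add: zero_less_mult_iff)
  qed
  obtain R' where R': "R < R'" "ereal R' < (INF \<mu>\<in>cprob S. R_measure \<mu>)"
    using ereal_dense2[OF R] by auto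
  \<comment> \<open>The fraction of points that may be lost: R / R' = 1 - 2 \<theta> is at most (1 -
    \<theta>)^2, so the energy per squared number of remaining points stays below
    \<open>R'\<close>.\<close>
  define \<theta> where "\<theta> = (1 - R / R') / 2"
  have \<theta>: "0 < \<theta>" "\<theta> < 1" using R0 R' by (auto simp: \<theta>_def field_simps)
  have "1 - 2 * \<theta> \<le> (1 - \<theta>)\<^sup>2" by (simp add: power2_eq_square algebra_simps)
  then have \<theta>R: "R \<le> R' * (1 - \<theta>)\<^sup>2" using R0 R' by (simp add: \<theta>_def field_simps)
  \<comment> \<open>The sum of squared moduli will turn out to be at most 4 (R + 1) N; for this
    radius at most \<theta> N points can then lie outside the disc.\<close>
  define M where "M = sqrt (4 * (R + 1) / \<theta>)"
  have M: "M > 0" "M\<^sup>2 = 4 * (R + 1) / \<theta>" using R0 \<theta> by (auto simp: M_def)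
  define T where "T j = Z j \<inter> cball 0 M" for j
  have cT: "(1 - \<theta>) * real (card (Z j)) \<le> real (card (T j))" for j
  proof -
    let ?N = "real (card (Z j))"
    have N2: "?N \<ge> 2" using Z(3)[of j] by simp
    have "(?N - 1) / 2 * (\<Sum>z\<in>Z j. (cmod z)\<^sup>2) - (\<Sum>z\<in>Z j. \<Sum>w\<in>Z j - {z}. 1) \<le> disc_energy (Z j)"
    proof -
      have "(\<Sum>z\<in>Z j. \<Sum>w\<in>Z j - {z}. ((cmod z)\<^sup>2 + (cmod w)\<^sup>2) / 4 - 1) \<le> disc_energy (Z j)"
        unfolding disc_energy_def by (intro sum_mono ker_lower)
      moreover have "(\<Sum>z\<in>Z j. \<Sum>w\<in>Z j - {z}. ((cmod z)\<^sup>2 + (cmod w)\<^sup>2) / 4) = (?N - 1) / 2 * (\<Sum>z\<in>Z j. (cmod z)\<^sup>2)"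
        using sum_offdiag[OF Z(1), of "\<lambda>z. (cmod z)\<^sup>2 / 2" j] by (simp add: sum_divide_distrib[symmetric] add_divide_distrib)
      ultimately show ?thesis by (simp add: sum_subtractf)
    qed
    moreover have "(\<Sum>z\<in>Z j. \<Sum>w\<in>Z j - {z}. 1) \<le> ?N\<^sup>2"
    proof -
      have "(\<Sum>z\<in>Z j. \<Sum>w\<in>Z j - {z}. (1::real)) \<le> (\<Sum>z\<in>Z j. ?N)"
        using Z(1)[of j] by (intro sum_mono) (simp add: card_mono)
      then show ?thesis by (simp add: power2_eq_square)
    qed
    ultimately have "(?N - 1) / 2 * (\<Sum>z\<in>Z j. (cmod z)\<^sup>2) \<le> (R + 1) * ?N\<^sup>2"
      using Z(4)[of j] by (simp add: algebra_simps)
    moreover have "?N / 4 * (\<Sum>z\<in>Z j. (cmod z)\<^sup>2) \<le> (?N - 1) / 2 * (\<Sum>z\<in>Z j. (cmod z)\<^sup>2)"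
      using N2 by (intro mult_right_mono sum_nonneg) auto
    ultimately have "?N / 4 * (\<Sum>z\<in>Z j. (cmod z)\<^sup>2) \<le> (R + 1) * ?N\<^sup>2" by (rule order_trans[rotated])
    also have "(R + 1) * ?N\<^sup>2 = ?N / 4 * (4 * (R + 1) * ?N)" by (simp add: power2_eq_square)
    finally have "?N / 4 * (\<Sum>z\<in>Z j. (cmod z)\<^sup>2) \<le> ?N / 4 * (4 * (R + 1) * ?N)" .
    then have s: "(\<Sum>z\<in>Z j. (cmod z)\<^sup>2) \<le> 4 * (R + 1) * ?N" using N2 by (subst (asm) mult_le_cancel_left_pos) auto
    have "real (card (Z j - T j)) * M\<^sup>2 = (\<Sum>z\<in>Z j - T j. M\<^sup>2)" by simp
    also have "\<dots> \<le> (\<Sum>z\<in>Z j - T j. (cmod z)\<^sup>2)"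
      using M by (intro sum_mono power_mono) (auto simp: T_def)
    also have "\<dots> \<le> (\<Sum>z\<in>Z j. (cmod z)\<^sup>2)" using Z(1) by (intro sum_mono2) auto
    also have "\<dots> \<le> \<theta> * ?N * M\<^sup>2" using s M \<theta> by (simp add: mult.commute)
    finally have "real (card (Z j - T j)) \<le> \<theta> * ?N" using M(1) by (subst (asm) mult_le_cancel_right_pos) auto
    moreover have "real (card (Z j - T j)) = ?N - real (card (T j))"
    proof -
      have "card (T j) \<le> card (Z j)" "card (Z j - T j) = card (Z j) - card (T j)"
        using Z(1)[of j] by (auto simp: T_def card_mono intro!: card_Diff_subset)
      then show ?thesis by (simp add: of_nat_diff)
    qed
    ultimately show ?thesis by (simp add: algebra_simps)
  qed
  have cpos: "card (T j) > 0" for j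
  proof -
    have "0 < (1 - \<theta>) * real (card (Z j))" using \<theta> Z(3)[of j] by (intro mult_pos_pos) auto
    then show ?thesis using cT[of j] by simp
  qed
  have "\<exists>\<mu>\<in>cprob S. R_measure \<mu> \<le> ereal R'"
  proof (rule R_measure_weak_limit[OF S M(1)])
    show "finite (T j)" for j using Z(1) by (simp add: T_def)
    show "T j \<noteq> {}" for j using cpos[of j] by auto
    show "T j \<subseteq> S \<inter> cball 0 M" for j using Z(2) by (auto simp: T_def)
    show "disc_energy (T j) \<le> R' * (real (card (T j)))\<^sup>2" for j
    proof -
      have "disc_energy (T j) \<le> disc_energy (Z j)" by (rule disc_energy_mono[OF Z(1)]) (simp add: T_def)
      also have "\<dots> \<le> R * (real (card (Z j)))\<^sup>2" using Z(4)[of j] by simp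
      also have "\<dots> \<le> (R' * (1 - \<theta>)\<^sup>2) * (real (card (Z j)))\<^sup>2" by (intro mult_right_mono \<theta>R) simp
      also have "\<dots> = R' * ((1 - \<theta>) * real (card (Z j)))\<^sup>2" by (simp add: power_mult_distrib)
      also have "\<dots> \<le> R' * (real (card (T j)))\<^sup>2"
        using cT[of j] \<theta> R0 R' by (intro mult_left_mono power_mono) auto
      finally show ?thesis .
    qed
    show "filterlim (\<lambda>j. card (T j)) at_top sequentially"
    proof -
      have A: "filterlim (\<lambda>j. (1 - \<theta>) * real j) at_top sequentially"
        using \<theta> by (intro filterlim_tendsto_pos_mult_at_top[OF tendsto_const _ filterlim_real_sequentially]) auto
      have B: "(1 - \<theta>) * real j \<le> real (card (T j))" for j
      proof -
        have "(1 - \<theta>) * real j \<le> (1 - \<theta>) * real (card (Z j))" using \<theta> Z(3)[of j] by (intro mult_left_mono) auto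
        then show ?thesis using cT[of j] by linarith
      qed
      have "filterlim (\<lambda>j. real (card (T j))) at_top sequentially"
        by (rule filterlim_at_top_mono[OF A always_eventually[OF allI[OF B]]])
      then show ?thesis by (simp add: filterlim_sequentially_iff_filterlim_real)
    qed
  qed
  then obtain \<mu> where "\<mu> \<in> cprob S" "R_measure \<mu> \<le> ereal R'" by blast
  then have "(INF \<mu>\<in>cprob S. R_measure \<mu>) \<le> ereal R'" by (meson INF_lower order_trans)
  then show False using R'(2) by simp
qed

section \<open>Positivity of the logarithmic kernel\<close>

text \<open>By Frullani's integral \<open>- ln |z|\<close> is a superposition of Gaussian kernels and constants; the former are positive
  definite and the latter drop out for neutral measures.\<close>

lemma frullani_nn:
  fixes a b :: real
  assumes "0 < a" "a \<le> b"
  shows "(\<integral>\<^sup>+t. ennreal ((exp (- t * a) - exp (- t * b)) / t) * indicator {0<..} t \<partial>lborel) = ennreal (ln b - ln a)"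
proof -
  have s1: "ennreal ((exp (- t * a) - exp (- t * b)) / t) * indicator {0<..} t = (\<integral>\<^sup>+s. ennreal (exp (- t * s)) * indicator {a..b} s * indicator {0<..} t \<partial>lborel)" for t
  proof (cases "t > 0")
    case True
    have "(\<integral>\<^sup>+s. ennreal (exp (- t * s)) * indicator {a..b} s \<partial>lborel) = ennreal ((- exp (- t * b) / t) - (- exp (- t * a) / t))"
      by (rule nn_integral_FTC_Icc) (use True assms in \<open>auto intro!: derivative_eq_intros simp: field_simps\<close>)
    then show ?thesis using True by (simp add: diff_divide_distrib)
  qed simp
  have s2: "(\<integral>\<^sup>+t. ennreal (exp (- t * s)) * indicator {a..b} s * indicator {0<..} t \<partial>lborel) = ennreal (1 / s) * indicator {a..b} s" for s
  proof (cases "s \<in> {a..b}")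
    case True
    then have s: "s > 0" using assms by auto
    have lim: "((\<lambda>t. - exp (- t * s) / s) \<longlongrightarrow> 0) at_top"
    proof -
      have "filterlim (\<lambda>t. s * t) at_top at_top" using s by (intro filterlim_tendsto_pos_mult_at_top[OF tendsto_const _ filterlim_ident])
      then have "filterlim (\<lambda>t. - (s * t)) at_bot at_top" by (simp add: filterlim_uminus_at_top)
      then have "((\<lambda>t. exp (- (s * t))) \<longlongrightarrow> 0) at_top" by (rule filterlim_compose[OF exp_at_bot])
      then have "((\<lambda>t. - exp (- (s * t)) / s) \<longlongrightarrow> - 0 / s) at_top" using s by (intro tendsto_intros) auto
      then show ?thesis by (simp add: mult.commute)
    qed
    have "(\<integral>\<^sup>+t. ennreal (exp (- t * s)) * indicator {0..} t \<partial>lborel) = ennreal (0 - (- exp (- 0 * s) / s))"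
      by (rule nn_integral_FTC_atLeast[OF _ _ _ lim]) (use s in \<open>auto intro!: derivative_eq_intros simp: field_simps\<close>)
    moreover have "(\<integral>\<^sup>+t. ennreal (exp (- t * s)) * indicator {0..} t \<partial>lborel) = (\<integral>\<^sup>+t. ennreal (exp (- t * s)) * indicator {a..b} s * indicator {0<..} t \<partial>lborel)"
    proof (rule nn_integral_cong_AE)
      have "AE t in lborel. t \<noteq> (0::real)" by (rule AE_lborel_singleton)
      then show "AE t in lborel. ennreal (exp (- t * s)) * indicator {0..} t = ennreal (exp (- t * s)) * indicator {a..b} s * indicator {0<..} t"
        by eventually_elim (use True in \<open>auto simp: indicator_def\<close>)
    qed
    ultimately show ?thesis using True by simp
  qed simp
  have "(\<integral>\<^sup>+t. ennreal ((exp (- t * a) - exp (- t * b)) / t) * indicator {0<..} t \<partial>lborel)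
     = (\<integral>\<^sup>+t. \<integral>\<^sup>+s. ennreal (exp (- t * s)) * indicator {a..b} s * indicator {0<..} t \<partial>lborel \<partial>lborel)"
    by (rule nn_integral_cong, rule s1)
  also have "\<dots> = (\<integral>\<^sup>+s. \<integral>\<^sup>+t. ennreal (exp (- t * s)) * indicator {a..b} s * indicator {0<..} t \<partial>lborel \<partial>lborel)"
    by (rule lborel_pair.Fubini'[symmetric]) measurable
  also have "\<dots> = (\<integral>\<^sup>+s. ennreal (1 / s) * indicator {a..b} s \<partial>lborel)"
    by (rule nn_integral_cong, rule s2)
  also have "\<dots> = ennreal (ln b - ln a)"
    by (rule nn_integral_FTC_Icc) (use assms in \<open>auto intro!: derivative_eq_intros simp: field_simps\<close>)
  finally show ?thesis .
qed

text \<open>The Frullani integrand with second parameter 1, so that its integral is - ln a. It is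
  nonnegative in t for a \<le> 1 and nonpositive for a \<ge> 1; the constant sign gives its absolute
  integral as well.\<close>

definition frk :: "real \<Rightarrow> real \<Rightarrow> real" where
  "frk a t = (exp (- t * a) - exp (- t)) / t * indicator {0<..} t"

lemma frullani:
  assumes "0 < a"
  shows "integrable lborel (frk a)" "(\<integral>t. frk a t \<partial>lborel) = - ln a" "(\<integral>\<^sup>+t. ennreal \<bar>frk a t\<bar> \<partial>lborel) = ennreal \<bar>ln a\<bar>"
proof -
  have m[measurable]: "frk a \<in> borel_measurable borel" unfolding frk_def by measurable
  have "integrable lborel (frk a) \<and> (\<integral>t. frk a t \<partial>lborel) = - ln a \<and> (\<integral>\<^sup>+t. ennreal \<bar>frk a t\<bar> \<partial>lborel) = ennreal \<bar>ln a\<bar>"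
  proof (cases "a \<le> 1")
    case True
    have nn: "0 \<le> frk a t" for t
    proof (cases "t > 0")
      case t: True
      then have "exp (- t) \<le> exp (- t * a)" using True by simp
      then show ?thesis using t by (simp add: frk_def)
    qed (simp add: frk_def)
    have "(\<integral>\<^sup>+t. ennreal (frk a t) \<partial>lborel) = (\<integral>\<^sup>+t. ennreal ((exp (- t * a) - exp (- t * 1)) / t) * indicator {0<..} t \<partial>lborel)"
      by (rule nn_integral_cong) (auto simp: frk_def indicator_def)
    also have "\<dots> = ennreal (ln 1 - ln a)" by (rule frullani_nn[OF assms True])
    finally have I: "(\<integral>\<^sup>+t. ennreal (frk a t) \<partial>lborel) = ennreal (- ln a)" by simp
    have la: "ln a \<le> 0" using True assms by simp
    have "has_bochner_integral lborel (frk a) (- ln a)"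
      by (rule has_bochner_integral_nn_integral) (use nn la I in auto)
    then show ?thesis using I nn la by (auto simp: has_bochner_integral_iff abs_of_nonneg)
  next
    case False
    have nn: "0 \<le> - frk a t" for t
    proof (cases "t > 0")
      case t: True
      then have "exp (- t * a) \<le> exp (- t)" using False by simp
      then show ?thesis using t by (simp add: frk_def divide_nonpos_pos)
    qed (simp add: frk_def)
    have "(\<integral>\<^sup>+t. ennreal (- frk a t) \<partial>lborel) = (\<integral>\<^sup>+t. ennreal ((exp (- t * 1) - exp (- t * a)) / t) * indicator {0<..} t \<partial>lborel)"
    proof (rule nn_integral_cong)
      fix t
      have "- ((exp (- t * a) - exp (- t)) / t) = (exp (- t * 1) - exp (- t * a)) / t" by (simp add: diff_divide_distrib)
      then show "ennreal (- frk a t) = ennreal ((exp (- t * 1) - exp (- t * a)) / t) * indicator {0<..} t"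
        by (cases "t > 0") (simp_all only: frk_def indicator_simps greaterThan_iff mult_1_right mult_zero_right minus_zero ennreal_0 if_False not_False_eq_True)
    qed
    also have "\<dots> = ennreal (ln a - ln 1)" by (rule frullani_nn) (use False in auto)
    finally have I: "(\<integral>\<^sup>+t. ennreal (- frk a t) \<partial>lborel) = ennreal (ln a)" by simp
    have la: "ln a \<ge> 0" using False assms by simp
    have "has_bochner_integral lborel (\<lambda>t. - frk a t) (ln a)"
      by (rule has_bochner_integral_nn_integral) (use nn la I in auto)
    then have "has_bochner_integral lborel (\<lambda>t. - (- frk a t)) (- ln a)" by (rule has_bochner_integral_minus)
    moreover have "\<bar>frk a t\<bar> = - frk a t" for t using nn[of t] by simp
    ultimately show ?thesis using I la by (simp add: has_bochner_integral_iff)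
  qed
  then show "integrable lborel (frk a)" "(\<integral>t. frk a t \<partial>lborel) = - ln a" "(\<integral>\<^sup>+t. ennreal \<bar>frk a t\<bar> \<partial>lborel) = ennreal \<bar>ln a\<bar>"
    by auto
qed

definition gk :: "real \<Rightarrow> complex \<times> complex \<Rightarrow> real" where
  "gk t p = exp (- t * (cmod (fst p - snd p))\<^sup>2)"

text \<open>By the parallelogram identity a Gaussian kernel with parameter t is a convolution of two
  with parameter 2 t. The factor 4 t / pi compensates for the integral of exp (- 4 t |x|^2).\<close>

lemma gaussian_square_root:
  assumes "t > 0"
  shows "ennreal (gk t (z, w)) = ennreal (4 * t / pi) * (\<integral>\<^sup>+x. ennreal (exp (- 2 * t * (cmod (z - x))\<^sup>2)) * ennreal (exp (- 2 * t * (cmod (w - x))\<^sup>2)) \<partial>lborel)"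
proof -
  define s where "s = 2 * sqrt t"
  have s: "s > 0" "s\<^sup>2 = 4 * t" using assms by (auto simp: s_def power_mult_distrib)
  have id: "2 * t * (cmod (z - x))\<^sup>2 + 2 * t * (cmod (w - x))\<^sup>2 = t * (cmod (z - w))\<^sup>2 + (cmod (complex_of_real s * x + - (complex_of_real s * ((z + w) / 2))))\<^sup>2" for x
  proof -
    have "complex_of_real s * x + - (complex_of_real s * ((z + w) / 2)) = complex_of_real s * (x - (z + w) / 2)" by (simp add: algebra_simps)
    then have "(cmod (complex_of_real s * x + - (complex_of_real s * ((z + w) / 2))))\<^sup>2 = 4 * t * (cmod (x - (z + w) / 2))\<^sup>2"
      using s by (simp only: norm_mult power_mult_distrib norm_of_real power2_abs)
    also have "\<dots> = 2 * t * (cmod (z - x))\<^sup>2 + 2 * t * (cmod (w - x))\<^sup>2 - t * (cmod (z - w))\<^sup>2"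
      unfolding cmod_power2 by (simp add: power2_eq_square field_simps)
    finally show ?thesis by simp
  qed
  have "(\<integral>\<^sup>+x. ennreal (exp (- 2 * t * (cmod (z - x))\<^sup>2)) * ennreal (exp (- 2 * t * (cmod (w - x))\<^sup>2)) \<partial>lborel)
     = (\<integral>\<^sup>+x. ennreal (gk t (z, w)) * ennreal (exp (- (cmod (complex_of_real s * x + - (complex_of_real s * ((z + w) / 2))))\<^sup>2)) \<partial>lborel)"
  proof (rule nn_integral_cong)
    fix x
    have "exp (- 2 * t * (cmod (z - x))\<^sup>2) * exp (- 2 * t * (cmod (w - x))\<^sup>2) = exp (- (2 * t * (cmod (z - x))\<^sup>2 + 2 * t * (cmod (w - x))\<^sup>2))"
      by (simp flip: exp_add)
    also have "\<dots> = gk t (z, w) * exp (- (cmod (complex_of_real s * x + - (complex_of_real s * ((z + w) / 2))))\<^sup>2)"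
      unfolding id gk_def by (simp flip: exp_add)
    finally show "ennreal (exp (- 2 * t * (cmod (z - x))\<^sup>2)) * ennreal (exp (- 2 * t * (cmod (w - x))\<^sup>2)) = ennreal (gk t (z, w)) * ennreal (exp (- (cmod (complex_of_real s * x + - (complex_of_real s * ((z + w) / 2))))\<^sup>2))"
      by (simp add: ennreal_mult'[symmetric] gk_def)
  qed
  also have "\<dots> = ennreal (gk t (z, w)) * (\<integral>\<^sup>+x. ennreal (exp (- (cmod (complex_of_real s * x + - (complex_of_real s * ((z + w) / 2))))\<^sup>2)) \<partial>lborel)"
    by (rule nn_integral_cmult) measurable
  finally have 1: "(\<integral>\<^sup>+x. ennreal (exp (- 2 * t * (cmod (z - x))\<^sup>2)) * ennreal (exp (- 2 * t * (cmod (w - x))\<^sup>2)) \<partial>lborel)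
     = ennreal (gk t (z, w)) * (\<integral>\<^sup>+x. ennreal (exp (- (cmod (complex_of_real s * x + - (complex_of_real s * ((z + w) / 2))))\<^sup>2)) \<partial>lborel)" .
  have 2: "(\<integral>\<^sup>+x. ennreal (exp (- (cmod (complex_of_real s * x + - (complex_of_real s * ((z + w) / 2))))\<^sup>2)) \<partial>lborel) * ennreal (4 * t) = ennreal pi"
    using nn_integral_complex_affine[of "complex_of_real s" "\<lambda>y. ennreal (exp (- (cmod y)\<^sup>2))" "- (complex_of_real s * ((z + w) / 2))"] s
    by (simp add: gaussian_integral_complex)
  have "ennreal (4 * t / pi) * (ennreal (gk t (z, w)) * J) = ennreal (gk t (z, w)) * (ennreal (1 / pi) * (J * ennreal (4 * t)))" for J
  proof -
    have "ennreal (4 * t / pi) = ennreal (1 / pi) * ennreal (4 * t)" using assms by (simp add: ennreal_mult'[symmetric])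
    then show ?thesis by (simp add: mult_ac)
  qed
  then show ?thesis unfolding 1 by (simp only: 2) (simp add: ennreal_mult'[symmetric] gk_def)
qed

text \<open>Through the convolution square root, each double integral becomes an integral of a
  product of smoothed measures \<open>f\<close>, and the claim is the integrated form of 2 a b \<le>
  a^2 + b^2. In this form no subtraction is required in \<open>ennreal\<close>.\<close>

lemma gaussian_kernel_pd:
  assumes \<mu>: "sets \<mu> = sets borel" "prob_space \<mu>" and \<sigma>: "sets \<sigma> = sets borel" "prob_space \<sigma>" and t: "t > 0"
  shows "2 * (\<integral>p. gk t p \<partial>(\<mu> \<Otimes>\<^sub>M \<sigma>)) \<le> (\<integral>p. gk t p \<partial>(\<mu> \<Otimes>\<^sub>M \<mu>)) + (\<integral>p. gk t p \<partial>(\<sigma> \<Otimes>\<^sub>M \<sigma>))"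
proof -
  note [measurable_cong] = \<mu>(1) \<sigma>(1)
  define f where "f \<nu> x = (\<integral>\<^sup>+z. ennreal (exp (- 2 * t * (cmod (z - x))\<^sup>2)) \<partial>\<nu>)" for \<nu> and x :: complex
  have key: "ennreal (\<integral>p. gk t p \<partial>(\<alpha> \<Otimes>\<^sub>M \<beta>)) = ennreal (4 * t / pi) * (\<integral>\<^sup>+x. f \<alpha> x * f \<beta> x \<partial>lborel)"
    and fm: "f \<alpha> \<in> borel_measurable borel"
    if a: "sets \<alpha> = sets borel" "prob_space \<alpha>" and b: "sets \<beta> = sets borel" "prob_space \<beta>" for \<alpha> \<beta>
  proof -
    note [measurable_cong] = a(1) b(1)
    interpret a: prob_space \<alpha> by fact
    interpret b: prob_space \<beta> by fact
    interpret ab: pair_prob_space \<alpha> \<beta> ..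
    have fa[measurable]: "f \<alpha> \<in> borel_measurable borel" unfolding f_def by measurable
    then show "f \<alpha> \<in> borel_measurable borel" .
    have fb[measurable]: "f \<beta> \<in> borel_measurable borel" unfolding f_def by measurable
    have [measurable]: "gk t \<in> borel_measurable (\<alpha> \<Otimes>\<^sub>M \<beta>)" unfolding gk_def[abs_def] by measurable
    have gi: "integrable (\<alpha> \<Otimes>\<^sub>M \<beta>) (gk t)"
      by (rule ab.integrable_const_bound[where B=1]) (use t in \<open>auto simp: gk_def\<close>)
    have "ennreal (\<integral>p. gk t p \<partial>(\<alpha> \<Otimes>\<^sub>M \<beta>)) = (\<integral>\<^sup>+p. ennreal (gk t p) \<partial>(\<alpha> \<Otimes>\<^sub>M \<beta>))"
      by (rule nn_integral_eq_integral[symmetric, OF gi]) (simp add: gk_def)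
    also have "\<dots> = (\<integral>\<^sup>+z. \<integral>\<^sup>+w. ennreal (gk t (z, w)) \<partial>\<beta> \<partial>\<alpha>)"
      by (rule b.nn_integral_fst[symmetric]) (simp add: gk_def)
    also have "\<dots> = (\<integral>\<^sup>+z. \<integral>\<^sup>+w. ennreal (4 * t / pi) * (\<integral>\<^sup>+x. ennreal (exp (- 2 * t * (cmod (z - x))\<^sup>2)) * ennreal (exp (- 2 * t * (cmod (w - x))\<^sup>2)) \<partial>lborel) \<partial>\<beta> \<partial>\<alpha>)"
      by (simp only: gaussian_square_root[OF t])
    also have "\<dots> = (\<integral>\<^sup>+z. ennreal (4 * t / pi) * (\<integral>\<^sup>+x. ennreal (exp (- 2 * t * (cmod (z - x))\<^sup>2)) * f \<beta> x \<partial>lborel) \<partial>\<alpha>)"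
    proof (rule nn_integral_cong)
      fix z
      interpret P: pair_sigma_finite \<beta> "lborel :: complex measure" ..
      have "(\<integral>\<^sup>+w. ennreal (4 * t / pi) * (\<integral>\<^sup>+x. ennreal (exp (- 2 * t * (cmod (z - x))\<^sup>2)) * ennreal (exp (- 2 * t * (cmod (w - x))\<^sup>2)) \<partial>lborel) \<partial>\<beta>)
        = ennreal (4 * t / pi) * (\<integral>\<^sup>+w. \<integral>\<^sup>+x. ennreal (exp (- 2 * t * (cmod (z - x))\<^sup>2)) * ennreal (exp (- 2 * t * (cmod (w - x))\<^sup>2)) \<partial>lborel \<partial>\<beta>)"
        by (rule nn_integral_cmult) measurable
      also have "(\<integral>\<^sup>+w. \<integral>\<^sup>+x. ennreal (exp (- 2 * t * (cmod (z - x))\<^sup>2)) * ennreal (exp (- 2 * t * (cmod (w - x))\<^sup>2)) \<partial>lborel \<partial>\<beta>)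
        = (\<integral>\<^sup>+x. \<integral>\<^sup>+w. ennreal (exp (- 2 * t * (cmod (z - x))\<^sup>2)) * ennreal (exp (- 2 * t * (cmod (w - x))\<^sup>2)) \<partial>\<beta> \<partial>lborel)"
        by (rule P.Fubini'[symmetric]) measurable
      also have "\<dots> = (\<integral>\<^sup>+x. ennreal (exp (- 2 * t * (cmod (z - x))\<^sup>2)) * f \<beta> x \<partial>lborel)"
        unfolding f_def by (rule nn_integral_cong, rule nn_integral_cmult) measurable
      finally show "(\<integral>\<^sup>+w. ennreal (4 * t / pi) * (\<integral>\<^sup>+x. ennreal (exp (- 2 * t * (cmod (z - x))\<^sup>2)) * ennreal (exp (- 2 * t * (cmod (w - x))\<^sup>2)) \<partial>lborel) \<partial>\<beta>)
        = ennreal (4 * t / pi) * (\<integral>\<^sup>+x. ennreal (exp (- 2 * t * (cmod (z - x))\<^sup>2)) * f \<beta> x \<partial>lborel)" .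
    qed
    also have "\<dots> = ennreal (4 * t / pi) * (\<integral>\<^sup>+z. \<integral>\<^sup>+x. ennreal (exp (- 2 * t * (cmod (z - x))\<^sup>2)) * f \<beta> x \<partial>lborel \<partial>\<alpha>)"
      by (rule nn_integral_cmult) measurable
    also have "(\<integral>\<^sup>+z. \<integral>\<^sup>+x. ennreal (exp (- 2 * t * (cmod (z - x))\<^sup>2)) * f \<beta> x \<partial>lborel \<partial>\<alpha>) = (\<integral>\<^sup>+x. f \<alpha> x * f \<beta> x \<partial>lborel)"
    proof -
      interpret P: pair_sigma_finite \<alpha> "lborel :: complex measure" ..
      have "(\<integral>\<^sup>+z. \<integral>\<^sup>+x. ennreal (exp (- 2 * t * (cmod (z - x))\<^sup>2)) * f \<beta> x \<partial>lborel \<partial>\<alpha>) = (\<integral>\<^sup>+x. \<integral>\<^sup>+z. ennreal (exp (- 2 * t * (cmod (z - x))\<^sup>2)) * f \<beta> x \<partial>\<alpha> \<partial>lborel)"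
        by (rule P.Fubini'[symmetric]) measurable
      also have "\<dots> = (\<integral>\<^sup>+x. f \<alpha> x * f \<beta> x \<partial>lborel)"
        unfolding f_def[of \<alpha>] by (rule nn_integral_cong, rule nn_integral_multc) measurable
      finally show ?thesis .
    qed
    finally show "ennreal (\<integral>p. gk t p \<partial>(\<alpha> \<Otimes>\<^sub>M \<beta>)) = ennreal (4 * t / pi) * (\<integral>\<^sup>+x. f \<alpha> x * f \<beta> x \<partial>lborel)" .
  qed
  have [measurable]: "f \<mu> \<in> borel_measurable borel" "f \<sigma> \<in> borel_measurable borel" using fm[OF \<mu> \<mu>] fm[OF \<sigma> \<sigma>] by auto
  have nn: "0 \<le> (\<integral>p. gk t p \<partial>N)" for N by (rule integral_nonneg_AE) (simp add: gk_def)
  have fin: "f \<nu> x < \<top>" if "prob_space \<nu>" for \<nu> x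
  proof -
    interpret prob_space \<nu> by fact
    have "f \<nu> x \<le> (\<integral>\<^sup>+z. 1 \<partial>\<nu>)" unfolding f_def using t by (intro nn_integral_mono) (auto simp flip: ennreal_1 intro!: ennreal_leI)
    also have "\<dots> < \<top>" by (simp add: emeasure_space_1)
    finally show ?thesis .
  qed
  have pt: "2 * (f \<mu> x * f \<sigma> x) \<le> f \<mu> x * f \<mu> x + f \<sigma> x * f \<sigma> x" for x
  proof -
    obtain a where a: "f \<mu> x = ennreal a" "0 \<le> a" using fin[OF \<mu>(2), of x] by (cases "f \<mu> x") auto
    obtain b where b: "f \<sigma> x = ennreal b" "0 \<le> b" using fin[OF \<sigma>(2), of x] by (cases "f \<sigma> x") auto
    have "2 * (a * b) \<le> a * a + b * b" using zero_le_square[of "a - b"] by (simp add: algebra_simps)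
    then have "ennreal (2 * (a * b)) \<le> ennreal (a * a + b * b)" by (rule ennreal_leI)
    then show ?thesis unfolding a b using a b by (simp add: ennreal_mult' ennreal_plus)
  qed
  have "ennreal (2 * (\<integral>p. gk t p \<partial>(\<mu> \<Otimes>\<^sub>M \<sigma>))) = ennreal (4 * t / pi) * (\<integral>\<^sup>+x. 2 * (f \<mu> x * f \<sigma> x) \<partial>lborel)"
    using nn key[OF \<mu> \<sigma>] by (subst nn_integral_cmult) (auto simp: ennreal_mult' mult_ac)
  also have "\<dots> \<le> ennreal (4 * t / pi) * (\<integral>\<^sup>+x. f \<mu> x * f \<mu> x + f \<sigma> x * f \<sigma> x \<partial>lborel)"
    by (intro mult_left_mono nn_integral_mono pt) simp
  also have "\<dots> = ennreal ((\<integral>p. gk t p \<partial>(\<mu> \<Otimes>\<^sub>M \<mu>)) + (\<integral>p. gk t p \<partial>(\<sigma> \<Otimes>\<^sub>M \<sigma>)))"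
    using nn key[OF \<mu> \<mu>] key[OF \<sigma> \<sigma>] by (subst nn_integral_add) (auto simp: distrib_left ennreal_plus)
  finally show ?thesis using nn by (subst (asm) ennreal_le_iff) (auto intro!: add_nonneg_nonneg)
qed

text \<open>The Frullani integral is taken at a = |z - w|^2, whence the factor 2. Its absolute
  integral over t is twice the absolute value of the logarithm, so integrability of
  \<open>log_dist\<close> is exactly what Fubini asks for.\<close>

lemma log_integral_frullani:
  assumes \<mu>: "sets \<mu> = sets borel" "prob_space \<mu>" and \<sigma>: "sets \<sigma> = sets borel" "prob_space \<sigma>"
    and int: "integrable (\<mu> \<Otimes>\<^sub>M \<sigma>) log_dist" and ne: "AE p in \<mu> \<Otimes>\<^sub>M \<sigma>. fst p \<noteq> snd p"
  shows "integrable lborel (\<lambda>t. ((\<integral>p. gk t p \<partial>(\<mu> \<Otimes>\<^sub>M \<sigma>)) - exp (- t)) / t * indicator {0<..} t)"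
    and "(\<integral>t. ((\<integral>p. gk t p \<partial>(\<mu> \<Otimes>\<^sub>M \<sigma>)) - exp (- t)) / t * indicator {0<..} t \<partial>lborel) = - 2 * (\<integral>p. log_dist p \<partial>(\<mu> \<Otimes>\<^sub>M \<sigma>))"
proof -
  note [measurable_cong] = \<mu>(1) \<sigma>(1)
  interpret a: prob_space \<mu> by fact
  interpret b: prob_space \<sigma> by fact
  interpret ab: pair_prob_space \<mu> \<sigma> ..
  interpret P: pair_sigma_finite "\<mu> \<Otimes>\<^sub>M \<sigma>" "lborel :: real measure" ..
  define F where "F p t = frk ((cmod (fst p - snd p))\<^sup>2) t" for p :: "complex \<times> complex" and t
  have Fm[measurable]: "(\<lambda>(p, t). F p t) \<in> borel_measurable ((\<mu> \<Otimes>\<^sub>M \<sigma>) \<Otimes>\<^sub>M lborel)"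
    unfolding F_def frk_def by measurable
  have ln2: "ln ((cmod (fst p - snd p))\<^sup>2) = 2 * log_dist p" for p :: "complex \<times> complex" by (simp add: ln_realpow)
  have Ft: "integrable lborel (F p)" "(\<integral>t. F p t \<partial>lborel) = - 2 * log_dist p" "(\<integral>t. norm (F p t) \<partial>lborel) = \<bar>2 * log_dist p\<bar>" if "fst p \<noteq> snd p" for p
  proof -
    have pos: "0 < (cmod (fst p - snd p))\<^sup>2" using that by simp
    note fr = frullani[OF pos]
    show "integrable lborel (F p)" using fr(1) unfolding F_def[abs_def] .
    show "(\<integral>t. F p t \<partial>lborel) = - 2 * log_dist p" using fr(2) unfolding F_def ln2 by simp
    have "ennreal (\<integral>t. norm (F p t) \<partial>lborel) = ennreal \<bar>2 * log_dist p\<bar>"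
      using fr(3) nn_integral_eq_integral[OF integrable_norm[OF fr(1)]] unfolding F_def ln2 by simp
    then show "(\<integral>t. norm (F p t) \<partial>lborel) = \<bar>2 * log_dist p\<bar>" by (subst (asm) ennreal_inj) (auto intro!: integral_nonneg_AE)
  qed
  have FI: "integrable ((\<mu> \<Otimes>\<^sub>M \<sigma>) \<Otimes>\<^sub>M lborel) (\<lambda>(p, t). F p t)"
  proof (rule P.Fubini_integrable)
    show "integrable (\<mu> \<Otimes>\<^sub>M \<sigma>) (\<lambda>x. \<integral>y. norm (case (x, y) of (p, t) \<Rightarrow> F p t) \<partial>lborel)"
    proof (rule integrable_cong_AE_imp[where g="\<lambda>p. \<bar>2 * log_dist p\<bar>"])
      show "integrable (\<mu> \<Otimes>\<^sub>M \<sigma>) (\<lambda>p. \<bar>2 * log_dist p\<bar>)" using int by auto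
      show "AE p in \<mu> \<Otimes>\<^sub>M \<sigma>. \<bar>2 * log_dist p\<bar> = (\<integral>y. norm (case (p, y) of (p, t) \<Rightarrow> F p t) \<partial>lborel)"
        using ne by eventually_elim (use Ft in simp)
    qed measurable
    show "AE x in \<mu> \<Otimes>\<^sub>M \<sigma>. integrable lborel (\<lambda>y. case (x, y) of (p, t) \<Rightarrow> F p t)"
      using ne by eventually_elim (use Ft in simp)
  qed measurable
  have val: "(\<integral>p. F p t \<partial>(\<mu> \<Otimes>\<^sub>M \<sigma>)) = ((\<integral>p. gk t p \<partial>(\<mu> \<Otimes>\<^sub>M \<sigma>)) - exp (- t)) / t * indicator {0<..} t" for t
  proof (cases "t > 0")
    case True
    have [measurable]: "gk t \<in> borel_measurable (\<mu> \<Otimes>\<^sub>M \<sigma>)" unfolding gk_def[abs_def] by measurable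
    have "integrable (\<mu> \<Otimes>\<^sub>M \<sigma>) (gk t)"
      by (rule ab.integrable_const_bound[where B=1]) (use True in \<open>auto simp: gk_def\<close>)
    then have "(\<integral>p. (gk t p - exp (- t)) / t \<partial>(\<mu> \<Otimes>\<^sub>M \<sigma>)) = ((\<integral>p. gk t p \<partial>(\<mu> \<Otimes>\<^sub>M \<sigma>)) - exp (- t)) / t"
      by (simp add: ab.prob_space)
    then show ?thesis using True by (simp add: F_def frk_def gk_def)
  qed (simp add: F_def frk_def)
  show "integrable lborel (\<lambda>t. ((\<integral>p. gk t p \<partial>(\<mu> \<Otimes>\<^sub>M \<sigma>)) - exp (- t)) / t * indicator {0<..} t)"
    using P.integrable_snd[OF FI] unfolding val .
  have "(\<integral>t. \<integral>p. F p t \<partial>(\<mu> \<Otimes>\<^sub>M \<sigma>) \<partial>lborel) = (\<integral>p. \<integral>t. F p t \<partial>lborel \<partial>(\<mu> \<Otimes>\<^sub>M \<sigma>))"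
    by (rule P.Fubini_integral[OF FI])
  also have "\<dots> = (\<integral>p. - 2 * log_dist p \<partial>(\<mu> \<Otimes>\<^sub>M \<sigma>))"
    by (rule integral_cong_AE) (use ne Ft in \<open>auto elim!: eventually_mono\<close>)
  finally show "(\<integral>t. ((\<integral>p. gk t p \<partial>(\<mu> \<Otimes>\<^sub>M \<sigma>)) - exp (- t)) / t * indicator {0<..} t \<partial>lborel) = - 2 * (\<integral>p. log_dist p \<partial>(\<mu> \<Otimes>\<^sub>M \<sigma>))"
    unfolding val by simp
qed

theorem log_kernel_positive:
  assumes \<mu>: "sets \<mu> = sets borel" "prob_space \<mu>" and \<sigma>: "sets \<sigma> = sets borel" "prob_space \<sigma>"
    and i1: "integrable (\<mu> \<Otimes>\<^sub>M \<mu>) log_dist" "AE p in \<mu> \<Otimes>\<^sub>M \<mu>. fst p \<noteq> snd p"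
    and i2: "integrable (\<sigma> \<Otimes>\<^sub>M \<sigma>) log_dist" "AE p in \<sigma> \<Otimes>\<^sub>M \<sigma>. fst p \<noteq> snd p"
    and i3: "integrable (\<mu> \<Otimes>\<^sub>M \<sigma>) log_dist" "AE p in \<mu> \<Otimes>\<^sub>M \<sigma>. fst p \<noteq> snd p"
  shows "(\<integral>p. log_dist p \<partial>(\<mu> \<Otimes>\<^sub>M \<mu>)) + (\<integral>p. log_dist p \<partial>(\<sigma> \<Otimes>\<^sub>M \<sigma>)) \<le> 2 * (\<integral>p. log_dist p \<partial>(\<mu> \<Otimes>\<^sub>M \<sigma>))"
proof -
  let ?h = "\<lambda>N t. ((\<integral>p. gk t p \<partial>N) - exp (- t)) / t * indicator {0<..} t"
  note a = log_integral_frullani[OF \<mu> \<mu> i1] and b = log_integral_frullani[OF \<sigma> \<sigma> i2] and c = log_integral_frullani[OF \<mu> \<sigma> i3]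
  have "(\<integral>t. 2 * ?h (\<mu> \<Otimes>\<^sub>M \<sigma>) t \<partial>lborel) \<le> (\<integral>t. ?h (\<mu> \<Otimes>\<^sub>M \<mu>) t + ?h (\<sigma> \<Otimes>\<^sub>M \<sigma>) t \<partial>lborel)"
  proof (rule integral_mono)
    show "integrable lborel (\<lambda>t. 2 * ?h (\<mu> \<Otimes>\<^sub>M \<sigma>) t)" using c(1) by (rule integrable_mult_right)
    show "integrable lborel (\<lambda>t. ?h (\<mu> \<Otimes>\<^sub>M \<mu>) t + ?h (\<sigma> \<Otimes>\<^sub>M \<sigma>) t)" using a(1) b(1) by (rule Bochner_Integration.integrable_add)
    fix t :: real
    show "2 * ?h (\<mu> \<Otimes>\<^sub>M \<sigma>) t \<le> ?h (\<mu> \<Otimes>\<^sub>M \<mu>) t + ?h (\<sigma> \<Otimes>\<^sub>M \<sigma>) t"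
    proof (cases "t > 0")
      case True
      have "2 * ((\<integral>p. gk t p \<partial>(\<mu> \<Otimes>\<^sub>M \<sigma>)) - exp (- t)) \<le> ((\<integral>p. gk t p \<partial>(\<mu> \<Otimes>\<^sub>M \<mu>)) - exp (- t)) + ((\<integral>p. gk t p \<partial>(\<sigma> \<Otimes>\<^sub>M \<sigma>)) - exp (- t))"
        using gaussian_kernel_pd[OF \<mu> \<sigma> True] by simp
      then have "2 * ((\<integral>p. gk t p \<partial>(\<mu> \<Otimes>\<^sub>M \<sigma>)) - exp (- t)) / t \<le> (((\<integral>p. gk t p \<partial>(\<mu> \<Otimes>\<^sub>M \<mu>)) - exp (- t)) + ((\<integral>p. gk t p \<partial>(\<sigma> \<Otimes>\<^sub>M \<sigma>)) - exp (- t))) / t"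
        by (rule divide_right_mono) (use True in simp)
      then show ?thesis using True unfolding add_divide_distrib by (simp only: indicator_simps greaterThan_iff mult_1_right times_divide_eq_right)
    qed simp
  qed
  also have "(\<integral>t. 2 * ?h (\<mu> \<Otimes>\<^sub>M \<sigma>) t \<partial>lborel) = 2 * (- 2 * (\<integral>p. log_dist p \<partial>(\<mu> \<Otimes>\<^sub>M \<sigma>)))"
    unfolding c(2)[symmetric] by (rule integral_mult_right_zero)
  also have "(\<integral>t. ?h (\<mu> \<Otimes>\<^sub>M \<mu>) t + ?h (\<sigma> \<Otimes>\<^sub>M \<sigma>) t \<partial>lborel) = - 2 * (\<integral>p. log_dist p \<partial>(\<mu> \<Otimes>\<^sub>M \<mu>)) + - 2 * (\<integral>p. log_dist p \<partial>(\<sigma> \<Otimes>\<^sub>M \<sigma>))"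
    unfolding a(2)[symmetric] b(2)[symmetric] by (rule Bochner_Integration.integral_add[OF a(1) b(1)])
  finally show ?thesis by simp
qed

section \<open>Logarithmic potential of discs\<close>

lemma ball_cball_borel [measurable]: "ball (a::complex) r \<in> sets borel" "cball (a::complex) r \<in> sets borel"
  by auto

lemma AE_cmod_neq: "AE w in lborel. cmod (w::complex) \<noteq> r"
proof -
  have "sphere (0::complex) r \<in> null_sets lebesgue"
    using negligible_sphere[of "0::complex" r] by (simp add: negligible_iff_null_sets)
  then have "emeasure lborel (sphere (0::complex) r) = 0"
    by (simp add: null_sets_def main_part_sets)
  then have "sphere (0::complex) r \<in> null_sets lborel" by (simp add: null_sets_def)
  from AE_not_in[OF this] show ?thesis by eventually_elim simp
qed

text \<open>Layer cake in the radius: - ln x is the integral of 1 / s over [x, 1], and a disc of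
  radius s has area pi s^2. The case r = 0 controls the singularity of the logarithm; r = |z| gives
  the potential of the disc at z.\<close>

lemma nn_integral_log_max:
  assumes r: "0 \<le> r" "r \<le> 1"
  shows "(\<integral>\<^sup>+w. ennreal (- ln (max r (cmod w))) * indicator (cball 0 1) w \<partial>lborel) = ennreal (pi * (1 - r\<^sup>2) / 2)"
proof -
  let ?g = "\<lambda>(s::real) (w::complex). ennreal (1 / s) * indicator {r..1} s * (if cmod w \<le> s then 1 else 0)"
  have pt: "ennreal (- ln (max r (cmod w))) * indicator (cball 0 1) w = (\<integral>\<^sup>+s. ?g s w \<partial>lborel)" if "w \<noteq> 0" for w
  proof (cases "cmod w \<le> 1")
    case True
    let ?m = "max r (cmod w)"
    have m: "0 < ?m" "?m \<le> 1" using that True r by (auto simp: less_max_iff_disj)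
    have "(\<integral>\<^sup>+s. ?g s w \<partial>lborel) = (\<integral>\<^sup>+s. ennreal (1 / s) * indicator {?m..1} s \<partial>lborel)"
      by (rule nn_integral_cong) (auto simp: indicator_def)
    also have "\<dots> = ennreal (ln 1 - ln ?m)"
      by (rule nn_integral_FTC_Icc) (use m in \<open>auto intro!: derivative_eq_intros simp: field_simps\<close>)
    finally show ?thesis using True by simp
  next
    case False
    then have "?g s w = 0" for s by (auto simp: indicator_def)
    then have "(\<integral>\<^sup>+s. ?g s w \<partial>lborel) = (\<integral>\<^sup>+s. 0 \<partial>(lborel :: real measure))" by (intro nn_integral_cong)
    then show ?thesis using False by (simp only: nn_integral_const) simp
  qed
  have "AE w in lborel. w \<noteq> (0::complex)" by (rule AE_lborel_singleton)
  then have "AE w in lborel. ennreal (- ln (max r (cmod w))) * indicator (cball 0 1) w = (\<integral>\<^sup>+s. ?g s w \<partial>lborel)"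
    by eventually_elim (rule pt)
  then have "(\<integral>\<^sup>+w. ennreal (- ln (max r (cmod w))) * indicator (cball 0 1) w \<partial>lborel) = (\<integral>\<^sup>+w. \<integral>\<^sup>+s. ?g s w \<partial>lborel \<partial>lborel)"
    by (rule nn_integral_cong_AE)
  also have "\<dots> = (\<integral>\<^sup>+s. \<integral>\<^sup>+w. ?g s w \<partial>lborel \<partial>lborel)"
    by (rule lborel_pair.Fubini') measurable
  also have "\<dots> = (\<integral>\<^sup>+s. ennreal (pi * s) * indicator {r..1} s \<partial>lborel)"
  proof (rule nn_integral_cong_AE)
    have "AE s in lborel. s \<noteq> (0::real)" by (rule AE_lborel_singleton)
    then show "AE s in lborel. (\<integral>\<^sup>+w. ?g s w \<partial>lborel) = ennreal (pi * s) * indicator {r..1} s"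
    proof eventually_elim
      fix s :: real assume s0: "s \<noteq> 0"
      show "(\<integral>\<^sup>+w. ?g s w \<partial>lborel) = ennreal (pi * s) * indicator {r..1} s"
      proof (cases "s \<in> {r..1}")
        case True
        then have s: "0 < s" using r s0 by auto
        have "(\<integral>\<^sup>+w. ?g s w \<partial>lborel) = (\<integral>\<^sup>+w. ennreal (1 / s) * indicator (cball (0::complex) s) w \<partial>lborel)"
          using True by (intro nn_integral_cong) (auto simp: indicator_def)
        also have "\<dots> = ennreal (1 / s) * emeasure lborel (cball (0::complex) s)" by (rule nn_integral_cmult_indicator) simp
        also have "\<dots> = ennreal (pi * s)" using s by (simp add: area_cball ennreal_mult'[symmetric] power2_eq_square)
        finally show ?thesis using True by simp
      qed simp
    qed
  qed
  also have "\<dots> = ennreal (pi * 1\<^sup>2 / 2 - pi * r\<^sup>2 / 2)"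
    by (rule nn_integral_FTC_Icc) (use r in \<open>auto intro!: derivative_eq_intros simp: power2_eq_square\<close>)
  finally show ?thesis by (simp add: field_simps)
qed

lemma nn_integral_neg_log: "(\<integral>\<^sup>+w. ennreal (max 0 (- ln (cmod (z - w)))) \<partial>lborel) = ennreal (pi / 2)"
proof -
  let ?h = "\<lambda>u::complex. ennreal (- ln (max 0 (cmod u))) * indicator (cball 0 1) u"
  have "(\<integral>\<^sup>+w. ennreal (max 0 (- ln (cmod (z - w)))) \<partial>lborel) = (\<integral>\<^sup>+w. ?h (- 1 * w + z) \<partial>lborel)"
  proof (rule nn_integral_cong)
    fix w
    have "- 1 * w + z = z - w" by simp
    moreover have "max 0 (- ln (cmod u)) = 0" if "\<not> cmod u \<le> 1" for u :: complex using that by simp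
    moreover have "max 0 (- ln (cmod u)) = - ln (cmod u)" if "cmod u \<le> 1" for u :: complex
      using that by (cases "u = 0") simp_all
    ultimately show "ennreal (max 0 (- ln (cmod (z - w)))) = ?h (- 1 * w + z)"
      by (cases "cmod (z - w) \<le> 1") (simp_all only:, simp_all add: indicator_def)
  qed
  also have "\<dots> = (\<integral>\<^sup>+u. ?h u \<partial>lborel)"
  proof -
    have "?h \<in> borel_measurable borel" by measurable
    from nn_integral_complex_affine[OF _ this, of "- 1" z] show ?thesis by simp
  qed
  also have "\<dots> = ennreal (pi / 2)" by (subst nn_integral_log_max) simp_all
  finally show ?thesis .
qed

text \<open>The negative part of the logarithm is integrated against Lebesgue measure at the price
  of the density bound \<open>M\<close>; the positive part is at most |z| + R on the support. The
  bound is uniform for bounded \<open>z\<close>, as the later uses of Fubini require.\<close>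

lemma nn_integral_abs_log_le:
  assumes [measurable]: "\<rho> \<in> borel_measurable borel" and \<rho>: "\<And>w. 0 \<le> \<rho> w" "\<And>w. \<rho> w \<le> M" "\<And>w. R < cmod w \<Longrightarrow> \<rho> w = 0"
    and R: "0 \<le> R" and mass: "(\<integral>\<^sup>+w. ennreal (\<rho> w) \<partial>lborel) \<le> 1"
  shows "(\<integral>\<^sup>+w. ennreal \<bar>ln (cmod (z - w))\<bar> \<partial>density lborel (\<lambda>w. ennreal (\<rho> w))) \<le> ennreal (M * (pi / 2) + (cmod z + R))"
proof -
  have M: "0 \<le> M" using \<rho>(1,2)[of 0] by linarith
  have pt: "ennreal (\<rho> w) * ennreal \<bar>ln (cmod (z - w))\<bar> \<le> ennreal M * ennreal (max 0 (- ln (cmod (z - w)))) + ennreal (cmod z + R) * ennreal (\<rho> w)" for w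
  proof -
    have "\<rho> w * \<bar>ln (cmod (z - w))\<bar> \<le> M * max 0 (- ln (cmod (z - w))) + (cmod z + R) * \<rho> w"
    proof (cases "R < cmod w")
      case False
      have "ln (cmod (z - w)) \<le> cmod (z - w)" by (rule ln_upper) simp
      also have "\<dots> \<le> cmod z + R" using norm_triangle_ineq4[of z w] False by linarith
      finally have "\<bar>ln (cmod (z - w))\<bar> \<le> max 0 (- ln (cmod (z - w))) + (cmod z + R)" using R by (auto simp: max_def)
      from mult_left_mono[OF this \<rho>(1)[of w]]
      have "\<rho> w * \<bar>ln (cmod (z - w))\<bar> \<le> \<rho> w * max 0 (- ln (cmod (z - w))) + (cmod z + R) * \<rho> w" by (simp add: algebra_simps)
      moreover have "\<rho> w * max 0 (- ln (cmod (z - w))) \<le> M * max 0 (- ln (cmod (z - w)))" by (rule mult_right_mono[OF \<rho>(2)]) simp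
      ultimately show ?thesis by linarith
    qed (use M \<rho> in simp)
    from ennreal_leI[OF this] show ?thesis using \<rho> M R
      by (subst (asm) ennreal_plus) (auto simp: ennreal_mult)
  qed
  have "(\<integral>\<^sup>+w. ennreal \<bar>ln (cmod (z - w))\<bar> \<partial>density lborel (\<lambda>w. ennreal (\<rho> w))) = (\<integral>\<^sup>+w. ennreal (\<rho> w) * ennreal \<bar>ln (cmod (z - w))\<bar> \<partial>lborel)"
    by (rule nn_integral_density) measurable
  also have "\<dots> \<le> (\<integral>\<^sup>+w. ennreal M * ennreal (max 0 (- ln (cmod (z - w)))) + ennreal (cmod z + R) * ennreal (\<rho> w) \<partial>lborel)"
    by (rule nn_integral_mono) (rule pt)
  also have "\<dots> = ennreal M * (\<integral>\<^sup>+w. ennreal (max 0 (- ln (cmod (z - w)))) \<partial>lborel) + ennreal (cmod z + R) * (\<integral>\<^sup>+w. ennreal (\<rho> w) \<partial>lborel)"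
    by (subst nn_integral_add) (simp_all add: nn_integral_cmult)
  also have "\<dots> \<le> ennreal M * ennreal (pi / 2) + ennreal (cmod z + R) * 1"
    unfolding nn_integral_neg_log by (intro add_left_mono mult_left_mono mass) simp
  also have "\<dots> = ennreal (M * (pi / 2) + (cmod z + R))" using M R by (simp add: ennreal_plus ennreal_mult[symmetric])
  finally show ?thesis .
qed

section \<open>Averages of the logarithm over circles and discs\<close>

text \<open>Ln (1 - a u) is holomorphic on the closed unit disc and vanishes at u = 0, so Cauchy's
  formula makes its mean over the unit circle vanish; the claim is the real part.\<close>

lemma circle_mean_log:
  assumes a: "cmod a < 1"
  shows "set_integrable lborel {0..1} (\<lambda>t. ln (cmod (1 - a * exp (2 * of_real pi * \<i> * of_real t))))"
    and "(LINT t:{0..1}|lborel. ln (cmod (1 - a * exp (2 * of_real pi * \<i> * of_real t)))) = 0"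
proof -
  let ?q = "\<lambda>t::real. exp (2 * of_real pi * \<i> * of_real t)"
  let ?f = "\<lambda>t. ln (cmod (1 - a * ?q t))"
  have nz: "1 - a * u \<notin> \<real>\<^sub>\<le>\<^sub>0" if "cmod u \<le> 1" for u
  proof -
    have "cmod a * cmod u \<le> cmod a * 1" using that by (intro mult_left_mono) auto
    then have "cmod (a * u) < 1" using a by (simp add: norm_mult)
    then have "Re (a * u) < 1" using complex_Re_le_cmod[of "a * u"] by linarith
    then show ?thesis by (simp add: complex_nonpos_Reals_iff)
  qed
  have q1: "cmod (?q t) = 1" for t by (simp add: norm_exp)
  have hol: "(\<lambda>u. Ln (1 - a * u)) holomorphic_on cball 0 1"
    by (intro holomorphic_intros) (use nz in auto)
  have "((\<lambda>u. Ln (1 - a * u) / (u - 0)) has_contour_integral (2 * of_real pi * \<i> * Ln (1 - a * 0))) (circlepath 0 1)"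
    by (rule Cauchy_integral_circlepath_simple[OF hol]) simp
  then have "((\<lambda>u. Ln (1 - a * u) / u) has_contour_integral 0) (circlepath 0 1)" by simp
  then have "((\<lambda>x. Ln (1 - a * circlepath 0 1 x) / circlepath 0 1 x * vector_derivative (circlepath 0 1) (at x within {0..1})) has_integral 0) {0..1}"
    by (simp only: has_contour_integral_def)
  then have "((\<lambda>x. 2 * of_real pi * \<i> * Ln (1 - a * ?q x)) has_integral 0) {0..1}"
  proof (rule has_integral_eq[rotated])
    fix x :: real assume "x \<in> {0..1}"
    then show "Ln (1 - a * circlepath 0 1 x) / circlepath 0 1 x * vector_derivative (circlepath 0 1) (at x within {0..1}) = 2 * of_real pi * \<i> * Ln (1 - a * ?q x)"
      by (subst vector_derivative_circlepath01) (simp_all add: circlepath)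
  qed
  from has_integral_mult_right[OF this, of "1 / (2 * of_real pi * \<i>)"]
  have "((\<lambda>x. Ln (1 - a * ?q x)) has_integral 0) {0..1}" by (simp add: mult.assoc[symmetric])
  from has_integral_linear[OF this bounded_linear_Re]
  have "((\<lambda>x. Re (Ln (1 - a * ?q x))) has_integral 0) {0..1}" by (simp add: o_def)
  moreover have "Re (Ln (1 - a * ?q x)) = ?f x" for x
    using nz[of "?q x"] q1[of x] by (subst Re_Ln) auto
  ultimately have hi: "(?f has_integral 0) {0..1}" by simp
  have pos: "0 < cmod (1 - a * ?q t)" for t using nz[of "?q t"] q1[of t] by auto
  have "continuous_on {0..1} ?f"
    by (intro continuous_intros) (use pos in \<open>auto simp: less_le\<close>)
  then show si: "set_integrable lborel {0..1} ?f"
    unfolding set_integrable_def by (rule borel_integrable_compact[OF compact_Icc])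
  show "(LINT t:{0..1}|lborel. ?f t) = 0"
    using set_borel_integral_eq_integral(2)[OF si] integral_unique[OF hi] by simp
qed

definition unif_circle :: "real measure" where
  "unif_circle = density lborel (\<lambda>t. ennreal (indicator {0..1} t))"

definition unif_disc :: "real \<Rightarrow> complex measure" where
  "unif_disc r = density lborel (\<lambda>w. ennreal (indicator (ball 0 r) w / (pi * r\<^sup>2)))"

lemma unif_disc_density: "(\<lambda>w. ennreal (indicator (ball (0::complex) r) w / (pi * r\<^sup>2))) \<in> borel_measurable lborel"
  by measurable

lemma sets_unif_disc [simp, measurable_cong]: "sets (unif_disc r) = sets borel"
  by (simp add: unif_disc_def)

lemma sets_unif_circle [simp, measurable_cong]: "sets unif_circle = sets borel"
  by (simp add: unif_circle_def)

lemma area_ball: "0 \<le> r \<Longrightarrow> emeasure lborel (ball (0::complex) r) = ennreal (pi * r\<^sup>2)"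
proof -
  assume r: "0 \<le> r"
  have "emeasure lborel (ball (0::complex) r) = emeasure lborel (cball (0::complex) r)"
    by (rule emeasure_eq_AE) (use AE_cmod_neq[of r] in \<open>auto elim!: eventually_mono\<close>)
  then show ?thesis using r by (simp add: area_cball)
qed

lemma nn_integral_unif_disc_density:
  assumes "0 < r"
  shows "(\<integral>\<^sup>+w. ennreal (indicator (ball (0::complex) r) w / (pi * r\<^sup>2)) \<partial>lborel) = 1"
proof -
  have "(\<integral>\<^sup>+w. ennreal (indicator (ball (0::complex) r) w / (pi * r\<^sup>2)) \<partial>lborel)
    = (\<integral>\<^sup>+w. ennreal (1 / (pi * r\<^sup>2)) * indicator (ball (0::complex) r) w \<partial>lborel)"
    by (rule nn_integral_cong) (auto simp: indicator_def)
  also have "\<dots> = ennreal (1 / (pi * r\<^sup>2)) * emeasure lborel (ball (0::complex) r)" by (rule nn_integral_cmult_indicator) simp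
  also have "\<dots> = 1" using assms by (simp add: area_ball ennreal_mult'[symmetric])
  finally show ?thesis .
qed

lemma prob_space_unif_disc: "0 < r \<Longrightarrow> prob_space (unif_disc r)"
  using nn_integral_unif_disc_density[of r]
  by (intro prob_spaceI) (simp add: unif_disc_def emeasure_density[OF unif_disc_density])

lemma prob_space_unif_circle: "prob_space unif_circle"
proof
  have "emeasure unif_circle (space unif_circle) = (\<integral>\<^sup>+t. indicator {0..1::real} t \<partial>lborel)"
    by (auto simp: unif_circle_def emeasure_density indicator_def intro!: nn_integral_cong)
  then show "emeasure unif_circle (space unif_circle) = 1" by simp
qed

lemma AE_unif_disc: "AE w in unif_disc r. cmod w < r"
  unfolding unif_disc_def by (subst AE_density[OF unif_disc_density]) (auto simp: indicator_def)

lemma AE_unif_disc_lborel: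
  "{w. \<not> P w} \<in> sets borel \<Longrightarrow> AE w in lborel. P w \<Longrightarrow> AE w in unif_disc r. P w"
  unfolding unif_disc_def by (subst AE_density[OF unif_disc_density]) (auto elim!: eventually_mono)

lemma distr_unif_disc:
  assumes c: "c \<noteq> 0"
  shows "distr (unif_disc 1) borel (\<lambda>w. c * w) = unif_disc (cmod c)"
proof (rule measure_eqI)
  fix A assume "A \<in> sets (distr (unif_disc 1) borel (\<lambda>w. c * w))"
  then have A[measurable]: "A \<in> sets borel" by simp
  let ?K = "\<lambda>x. ennreal (indicator (ball 0 (cmod c)) x / (pi * (cmod c)\<^sup>2)) * indicator A x"
  have pt: "ennreal (indicator (ball 0 1) w / pi) * indicator A (c * w) = ?K (c * w + 0) * ennreal ((cmod c)\<^sup>2)" for w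
  proof -
    have "c * w \<in> ball 0 (cmod c) \<longleftrightarrow> w \<in> ball 0 1" using c by (simp add: norm_mult)
    then have "indicator (ball 0 1) w / pi = indicator (ball 0 (cmod c)) (c * w) / (pi * (cmod c)\<^sup>2) * (cmod c)\<^sup>2"
      using c by (simp add: indicator_def)
    then have "ennreal (indicator (ball 0 1) w / pi) = ennreal (indicator (ball 0 (cmod c)) (c * w) / (pi * (cmod c)\<^sup>2)) * ennreal ((cmod c)\<^sup>2)"
      by (simp only: ennreal_mult''[OF zero_le_power2])
    then show ?thesis by (simp only: add_0_right mult_ac)
  qed
  have "emeasure (distr (unif_disc 1) borel (\<lambda>w. c * w)) A = emeasure (unif_disc 1) ((\<lambda>w. c * w) -` A \<inter> space (unif_disc 1))"
  proof (rule emeasure_distr[OF _ A])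
    show "(\<lambda>w. c * w) \<in> borel_measurable (unif_disc 1)" by measurable
  qed
  also have "(\<lambda>w. c * w) -` A \<inter> space (unif_disc 1) = (\<lambda>w. c * w) -` A" by (simp add: unif_disc_def)
  also have "emeasure (unif_disc 1) ((\<lambda>w. c * w) -` A) = (\<integral>\<^sup>+w. ennreal (indicator (ball 0 1) w / pi) * indicator A (c * w) \<partial>lborel)"
  proof -
    have "(\<lambda>w. c * w) -` A \<inter> space borel \<in> sets borel" by (rule measurable_sets[OF _ A]) measurable
    then have "(\<lambda>w. c * w) -` A \<in> sets lborel" by simp
    then show ?thesis unfolding unif_disc_def by (subst emeasure_density[OF unif_disc_density]) (auto simp: indicator_def intro!: nn_integral_cong)
  qed
  also have "\<dots> = (\<integral>\<^sup>+w. ?K (c * w + 0) \<partial>lborel) * ennreal ((cmod c)\<^sup>2)"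
    unfolding pt by (rule nn_integral_multc) measurable
  also have "\<dots> = (\<integral>\<^sup>+w. ?K w \<partial>lborel)" by (rule nn_integral_complex_affine[OF c]) measurable
  also have "\<dots> = emeasure (unif_disc (cmod c)) A" by (simp add: unif_disc_def emeasure_density[OF unif_disc_density])
  finally show "emeasure (distr (unif_disc 1) borel (\<lambda>w. c * w)) A = emeasure (unif_disc (cmod c)) A" .
qed simp

lemma integrable_log_unif_disc:
  assumes "0 < r"
  shows "integrable (unif_disc r) (\<lambda>w. ln (cmod (z - w)))"
proof (rule integrableI_bounded)
  have "(\<integral>\<^sup>+w. ennreal (norm (ln (cmod (z - w)))) \<partial>unif_disc r) \<le> ennreal (1 / (pi * r\<^sup>2) * (pi / 2) + (cmod z + r))"
    unfolding unif_disc_def real_norm_def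
    by (rule nn_integral_abs_log_le) (use assms nn_integral_unif_disc_density[OF assms] in \<open>auto simp: indicator_def\<close>)
  then show "(\<integral>\<^sup>+w. ennreal (norm (ln (cmod (z - w)))) \<partial>unif_disc r) < \<infinity>" by (rule le_less_trans) simp
qed measurable

text \<open>The larger of |z| and |w| is factored out. The remaining factor has the form 1 - a q
  with |a| < 1, and its logarithm has mean zero.\<close>

lemma circle_mean_log_max:
  assumes "cmod z \<noteq> cmod w"
  shows "(\<integral>t. ln (cmod (z - exp (2 * of_real pi * \<i> * of_real t) * w)) \<partial>unif_circle) = ln (max (cmod z) (cmod w))"
proof -
  interpret C: prob_space unif_circle by (rule prob_space_unif_circle)
  let ?q = "\<lambda>t::real. exp (2 * of_real pi * \<i> * of_real t)"
  have q1: "cmod (?q t) = 1" for t by (simp add: norm_exp)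
  define A where "A = max (cmod z) (cmod w)"
  have "\<exists>a. cmod a < 1 \<and> (\<forall>t. cmod (z - ?q t * w) = A * cmod (1 - a * ?q t))"
  proof (cases "cmod w < cmod z")
    case True
    then have "z - ?q t * w = z * (1 - w / z * ?q t)" for t by (auto simp: field_simps)
    then have "cmod (z - ?q t * w) = cmod z * cmod (1 - w / z * ?q t)" for t by (metis norm_mult)
    moreover have "cmod (w / z) < 1" using True by (simp add: norm_divide divide_simps)
    ultimately show ?thesis using True by (intro exI[of _ "w / z"]) (simp add: A_def max_def)
  next
    case False
    then have lt: "cmod z < cmod w" using assms by simp
    have "cmod (z - ?q t * w) = cmod w * cmod (1 - cnj (z / w) * ?q t)" for t
    proof -
      \<comment> \<open>For |z| < |w| the circle variable stands at the larger term. As p is inverse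
        to its conjugate, conjugating the second factor restores the form 1 - a p.\<close>
      have gen: "z - p * w = - (p * w) * cnj (1 - cnj (z / w) * p)" if p: "p * cnj p = 1" for p
      proof -
        have al: "- (p * w) * (1 - v * r) = (p * r) * (w * v) - p * w" for v r by (simp add: algebra_simps)
        have wz: "w * (z / w) = z" using lt by auto
        have cj: "cnj (1 - cnj (z / w) * p) = 1 - z / w * cnj p" by (simp only: complex_cnj_diff complex_cnj_mult complex_cnj_cnj complex_cnj_one)
        show ?thesis unfolding cj al p wz by simp
      qed
      have "z - ?q t * w = - (?q t * w) * cnj (1 - cnj (z / w) * ?q t)"
        by (rule gen) (use complex_norm_square[of "?q t"] q1[of t] in simp)
      then have "cmod (z - ?q t * w) = cmod (?q t) * cmod w * cmod (1 - cnj (z / w) * ?q t)"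
        by (simp only: norm_mult norm_minus_cancel complex_mod_cnj)
      then show ?thesis using q1[of t] by simp
    qed
    moreover have "cmod (cnj (z / w)) < 1" using lt by (simp add: norm_divide divide_simps)
    ultimately show ?thesis using lt by (intro exI[of _ "cnj (z / w)"]) (simp add: A_def max_def)
  qed
  then obtain a where a: "cmod a < 1" "\<And>t. cmod (z - ?q t * w) = A * cmod (1 - a * ?q t)" by blast
  have A: "0 < A" using assms by (auto simp: A_def less_max_iff_disj)
  have nz: "0 < cmod (1 - a * ?q t)" for t
  proof -
    have "cmod (a * ?q t) < 1" using a(1) q1[of t] by (simp add: norm_mult)
    then have "a * ?q t \<noteq> 1" by auto
    then show ?thesis by simp
  qed
  note cm = circle_mean_log[OF a(1)]
  let ?f = "\<lambda>t. ln (cmod (1 - a * ?q t))"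
  have fi: "integrable unif_circle ?f" "(\<integral>t. ?f t \<partial>unif_circle) = 0"
    unfolding unif_circle_def using cm
    by (simp_all add: integrable_real_density integral_real_density set_integrable_def set_lebesgue_integral_def)
  have "(\<integral>t. ln (cmod (z - ?q t * w)) \<partial>unif_circle) = (\<integral>t. ln A + ?f t \<partial>unif_circle)"
    unfolding a(2) using A nz by (intro Bochner_Integration.integral_cong refl ln_mult_pos)
  also have "\<dots> = ln A" using fi by (simp add: C.prob_space)
  finally show ?thesis by (simp add: A_def)
qed

text \<open>Rotations preserve the uniform measure, so the logarithm may first be averaged over
  circles, which leaves ln (max |z| |w|). Inside the disc \<open>nn_integral_log_max\<close>
  evaluates the rest; outside, the integrand is constant.\<close>

lemma unif_disc_log_mean:
  shows "(\<integral>w. ln (cmod (z - w)) \<partial>unif_disc 1) = (if cmod z \<le> 1 then ((cmod z)\<^sup>2 - 1) / 2 else ln (cmod z))"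
proof -
  let ?q = "\<lambda>t::real. exp (2 * of_real pi * \<i> * of_real t)"
  have q0: "?q t \<noteq> 0" and q1: "cmod (?q t) = 1" for t by (auto simp: norm_exp)
  interpret C: prob_space unif_circle by (rule prob_space_unif_circle)
  interpret D: prob_space "unif_disc 1" by (rule prob_space_unif_disc) simp
  interpret P: pair_sigma_finite unif_circle "unif_disc 1" ..
  have rot: "(\<integral>w. f (?q t * w) \<partial>unif_disc 1) = (\<integral>w. f w \<partial>unif_disc 1)"
    and roti: "integrable (unif_disc 1) f \<Longrightarrow> integrable (unif_disc 1) (\<lambda>w. f (?q t * w))"
    if [measurable]: "f \<in> borel_measurable borel" for f :: "complex \<Rightarrow> real" and t
  proof -
    have d: "distr (unif_disc 1) borel (\<lambda>w. ?q t * w) = unif_disc 1" using distr_unif_disc[OF q0[of t]] q1[of t] by simp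
    have "(\<integral>w. f w \<partial>distr (unif_disc 1) borel (\<lambda>w. ?q t * w)) = (\<integral>w. f (?q t * w) \<partial>unif_disc 1)"
      by (rule integral_distr) measurable
    then show "(\<integral>w. f (?q t * w) \<partial>unif_disc 1) = (\<integral>w. f w \<partial>unif_disc 1)" unfolding d by simp
    assume "integrable (unif_disc 1) f"
    then have "integrable (distr (unif_disc 1) borel (\<lambda>w. ?q t * w)) f" unfolding d .
    then show "integrable (unif_disc 1) (\<lambda>w. f (?q t * w))" by (rule integrable_distr[rotated]) measurable
  qed
  let ?f = "\<lambda>w. ln (cmod (z - w))"
  have fi: "integrable (unif_disc 1) ?f" by (rule integrable_log_unif_disc) simp
  have FI: "integrable (unif_circle \<Otimes>\<^sub>M unif_disc 1) (\<lambda>(t, w). ?f (?q t * w))"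
  proof (rule P.Fubini_integrable)
    have "(\<integral>w. norm (case (t, w) of (t, w) \<Rightarrow> ?f (?q t * w)) \<partial>unif_disc 1) = (\<integral>w. norm (?f w) \<partial>unif_disc 1)" for t
      using rot[of "\<lambda>w. norm (?f w)" t] by simp
    then show "integrable unif_circle (\<lambda>t. \<integral>w. norm (case (t, w) of (t, w) \<Rightarrow> ?f (?q t * w)) \<partial>unif_disc 1)" by simp
    show "AE t in unif_circle. integrable (unif_disc 1) (\<lambda>w. case (t, w) of (t, w) \<Rightarrow> ?f (?q t * w))"
      using roti[of ?f] fi by simp
  qed measurable
  have "(\<integral>w. ?f w \<partial>unif_disc 1) = (\<integral>t. \<integral>w. ?f (?q t * w) \<partial>unif_disc 1 \<partial>unif_circle)"
    using rot[of ?f] by (simp add: C.prob_space)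
  also have "\<dots> = (\<integral>w. \<integral>t. ?f (?q t * w) \<partial>unif_circle \<partial>unif_disc 1)"
    by (rule P.Fubini_integral[OF FI, symmetric])
  also have "\<dots> = (\<integral>w. ln (max (cmod z) (cmod w)) \<partial>unif_disc 1)"
  proof (rule integral_cong_AE)
    have "AE w in unif_disc 1. cmod w \<noteq> cmod z" by (rule AE_unif_disc_lborel[OF _ AE_cmod_neq]) measurable
    then show "AE w in unif_disc 1. (\<integral>t. ?f (?q t * w) \<partial>unif_circle) = ln (max (cmod z) (cmod w))"
      by eventually_elim (rule circle_mean_log_max, simp)
  qed measurable
  also have "\<dots> = (if cmod z \<le> 1 then ((cmod z)\<^sup>2 - 1) / 2 else ln (cmod z))"
  proof (cases "cmod z \<le> 1")
    case True
    have nn: "AE w in unif_disc 1. 0 \<le> - ln (max (cmod z) (cmod w))"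
      using AE_unif_disc[of 1]
    proof eventually_elim
      fix w assume "cmod w < 1"
      then have "max (cmod z) (cmod w) \<le> 1" using True by simp
      then show "0 \<le> - ln (max (cmod z) (cmod w))"
        by (cases "max (cmod z) (cmod w) = 0") (simp_all add: le_max_iff_disj less_le)
    qed
    have "(\<integral>\<^sup>+w. ennreal (- ln (max (cmod z) (cmod w))) \<partial>unif_disc 1)
      = (\<integral>\<^sup>+w. ennreal (1 / pi) * (ennreal (- ln (max (cmod z) (cmod w))) * indicator (cball 0 1) w) \<partial>lborel)"
    proof -
      have "(\<integral>\<^sup>+w. ennreal (- ln (max (cmod z) (cmod w))) \<partial>unif_disc 1)
        = (\<integral>\<^sup>+w. ennreal (indicator (ball 0 1) w / (pi * 1\<^sup>2)) * ennreal (- ln (max (cmod z) (cmod w))) \<partial>lborel)"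
        unfolding unif_disc_def by (rule nn_integral_density) measurable
      also have "\<dots> = (\<integral>\<^sup>+w. ennreal (1 / pi) * (ennreal (- ln (max (cmod z) (cmod w))) * indicator (cball 0 1) w) \<partial>lborel)"
        by (rule nn_integral_cong_AE, use AE_cmod_neq[of 1] in \<open>eventually_elim\<close>) (auto simp: indicator_def)
      finally show ?thesis .
    qed
    also have "\<dots> = ennreal (1 / pi) * ennreal (pi * (1 - (cmod z)\<^sup>2) / 2)"
      by (subst nn_integral_cmult) (use True in \<open>simp_all add: nn_integral_log_max\<close>)
    also have "\<dots> = ennreal ((1 - (cmod z)\<^sup>2) / 2)" by (simp add: ennreal_mult'[symmetric])
    finally have "has_bochner_integral (unif_disc 1) (\<lambda>w. - ln (max (cmod z) (cmod w))) ((1 - (cmod z)\<^sup>2) / 2)"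
      using nn True by (intro has_bochner_integral_nn_integral) (auto simp: power_le_one)
    then have "(\<integral>w. - ln (max (cmod z) (cmod w)) \<partial>unif_disc 1) = (1 - (cmod z)\<^sup>2) / 2" by (rule has_bochner_integral_integral_eq)
    then show ?thesis using True by (simp add: field_simps)
  next
    case False
    have "(\<integral>w. ln (max (cmod z) (cmod w)) \<partial>unif_disc 1) = (\<integral>w. ln (cmod z) \<partial>unif_disc 1)"
      by (rule integral_cong_AE, measurable, use AE_unif_disc[of 1] in \<open>eventually_elim\<close>) (use False in \<open>auto simp: max_def\<close>)
    then show ?thesis using False by (simp add: D.prob_space)
  qed
  finally show ?thesis .
qed

text \<open>After scaling to the unit disc there is equality outside, and inside the claim is ln x
  \<le> (x^2 - 1) / 2. The centre is excluded because \<open>ln 0\<close> is 0 instead of minus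
  infinity.\<close>

lemma unif_disc_log_mean_ge:
  assumes r: "0 < r" and a: "a \<noteq> 0"
  shows "ln (cmod a) \<le> (\<integral>w. ln (cmod (a - w)) \<partial>unif_disc r)"
proof -
  interpret D: prob_space "unif_disc 1" by (rule prob_space_unif_disc) simp
  have r': "complex_of_real r \<noteq> 0" using r by simp
  have "(\<integral>w. ln (cmod (a - w)) \<partial>unif_disc r) = (\<integral>w. ln (cmod (a - of_real r * w)) \<partial>unif_disc 1)"
    using distr_unif_disc[OF r'] r integral_distr[of "\<lambda>w. of_real r * w" "unif_disc 1" borel "\<lambda>w. ln (cmod (a - w))"] by simp
  also have "\<dots> = (\<integral>w. ln r + ln (cmod (a / of_real r - w)) \<partial>unif_disc 1)"
  proof (rule integral_cong_AE)
    have "AE w in unif_disc 1. w \<noteq> a / of_real r" by (rule AE_unif_disc_lborel[OF _ AE_lborel_singleton]) simp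
    then show "AE w in unif_disc 1. ln (cmod (a - of_real r * w)) = ln r + ln (cmod (a / of_real r - w))"
    proof eventually_elim
      fix w assume w: "w \<noteq> a / of_real r"
      have "a - of_real r * w = of_real r * (a / of_real r - w)" using r by (simp add: field_simps)
      then have "cmod (a - of_real r * w) = r * cmod (a / of_real r - w)" using r by (simp only: norm_mult norm_of_real abs_of_pos)
      then show "ln (cmod (a - of_real r * w)) = ln r + ln (cmod (a / of_real r - w))" using r w by (simp add: ln_mult_pos)
    qed
  qed measurable
  also have "\<dots> = ln r + (\<integral>w. ln (cmod (a / of_real r - w)) \<partial>unif_disc 1)"
    using integrable_log_unif_disc[of 1 "a / of_real r"] by (simp add: D.prob_space)
  finally have I: "(\<integral>w. ln (cmod (a - w)) \<partial>unif_disc r) = ln r + (\<integral>w. ln (cmod (a / of_real r - w)) \<partial>unif_disc 1)" .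
  define x where "x = cmod a / r"
  have x: "0 < x" using a r by (simp add: x_def)
  have la: "ln (cmod a) = ln r + ln x" using a r by (simp add: x_def ln_div)
  have "ln x \<le> (x\<^sup>2 - 1) / 2" using ln_le_minus_one[of "x\<^sup>2"] x by (simp add: ln_realpow)
  moreover have "cmod (a / of_real r) = x" using r by (simp add: x_def norm_divide)
  ultimately show ?thesis unfolding I la unif_disc_log_mean by simp
qed

section \<open>Balayage and the equilibrium measure\<close>

text \<open>The minimiser will be the sum of an absolutely continuous measure and a balayage, which
  in general has no density; the sum is therefore built from the set functions.\<close>

definition add_measure :: "complex measure \<Rightarrow> complex measure \<Rightarrow> complex measure" where
  "add_measure M N = measure_of UNIV (sets borel) (\<lambda>A. emeasure M A + emeasure N A)"

lemma sets_add_measure [simp, measurable_cong]: "sets (add_measure M N) = sets borel"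
  unfolding add_measure_def using sets.sigma_sets_eq[of "borel :: complex measure"] by (simp add: sets_measure_of_conv)

lemma emeasure_add_measure:
  assumes M: "sets M = sets borel" and N: "sets N = sets borel" and A: "A \<in> sets borel"
  shows "emeasure (add_measure M N) A = emeasure M A + emeasure N A"
  unfolding add_measure_def
proof (rule emeasure_measure_of_sigma[OF _ _ _ A])
  show "sigma_algebra UNIV (sets (borel :: complex measure))"
    using sets.sigma_algebra_axioms[of "borel :: complex measure"] by simp
  show "positive (sets borel) (\<lambda>A. emeasure M A + emeasure N A)" by (simp add: positive_def)
  show "countably_additive (sets borel) (\<lambda>A. emeasure M A + emeasure N A)"
  proof (rule countably_additiveI)
    fix A :: "nat \<Rightarrow> complex set" assume A: "range A \<subseteq> sets borel" "disjoint_family A"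
    have "(\<Sum>i. emeasure M (A i) + emeasure N (A i)) = (\<Sum>i. emeasure M (A i)) + (\<Sum>i. emeasure N (A i))"
      by (rule suminf_add[symmetric]) simp_all
    also have "\<dots> = emeasure M (\<Union>i. A i) + emeasure N (\<Union>i. A i)"
      using A M N by (simp add: suminf_emeasure)
    finally show "(\<Sum>i. emeasure M (A i) + emeasure N (A i)) = emeasure M (\<Union>i. A i) + emeasure N (\<Union>i. A i)" .
  qed
qed

lemma nn_integral_add_measure:
  assumes M: "sets M = sets borel" and N: "sets N = sets borel" and f: "f \<in> borel_measurable borel"
  shows "(\<integral>\<^sup>+x. f x \<partial>add_measure M N) = (\<integral>\<^sup>+x. f x \<partial>M) + (\<integral>\<^sup>+x. f x \<partial>N)"
  using f
proof (induction rule: borel_measurable_induct)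
  case (cong f g)
  then have "f = g" by (intro ext) simp
  then show ?case using cong by simp
next
  case (set A)
  then show ?case using M N by (simp add: emeasure_add_measure)
next
  case (mult u c)
  note [measurable_cong] = M N
  have [measurable]: "u \<in> borel_measurable borel" by (rule mult)
  show ?case using mult.IH by (simp add: nn_integral_cmult distrib_left)
next
  case (add u v)
  note [measurable_cong] = M N
  have [measurable]: "u \<in> borel_measurable borel" "v \<in> borel_measurable borel" by (rule add)+
  show ?case using add.IH by (simp add: nn_integral_add ac_simps)
next
  case (seq U)
  note [measurable_cong] = M N
  have [measurable]: "U i \<in> borel_measurable borel" for i by (rule seq)
  have s: "(SUP i. U i) x = (SUP i. U i x)" for x by (simp add: image_comp)
  have inc: "incseq (\<lambda>i. \<integral>\<^sup>+x. U i x \<partial>K)" for K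
    using seq by (auto simp: incseq_def le_fun_def intro!: nn_integral_mono)
  have "(\<integral>\<^sup>+x. (SUP i. U i x) \<partial>add_measure M N) = (SUP i. \<integral>\<^sup>+x. U i x \<partial>add_measure M N)"
    by (rule nn_integral_monotone_convergence_SUP) (use seq in auto)
  also have "\<dots> = (SUP i. (\<integral>\<^sup>+x. U i x \<partial>M) + (\<integral>\<^sup>+x. U i x \<partial>N))" using seq.IH by simp
  also have "\<dots> = (SUP i. \<integral>\<^sup>+x. U i x \<partial>M) + (SUP i. \<integral>\<^sup>+x. U i x \<partial>N)"
    by (rule ennreal_SUP_add[OF inc inc])
  also have "(SUP i. \<integral>\<^sup>+x. U i x \<partial>M) = (\<integral>\<^sup>+x. (SUP i. U i x) \<partial>M)"
    by (rule nn_integral_monotone_convergence_SUP[symmetric]) (use seq in auto)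
  also have "(SUP i. \<integral>\<^sup>+x. U i x \<partial>N) = (\<integral>\<^sup>+x. (SUP i. U i x) \<partial>N)"
    by (rule nn_integral_monotone_convergence_SUP[symmetric]) (use seq in auto)
  finally show ?case unfolding s .
qed

lemma AE_add_measure:
  assumes M: "sets M = sets borel" and N: "sets N = sets borel" and P: "{x. \<not> P x} \<in> sets borel"
    and "AE x in M. P x" "AE x in N. P x"
  shows "AE x in add_measure M N. P x"
proof -
  have sp: "space M = UNIV" "space N = UNIV" using sets_eq_imp_space_eq[OF M] sets_eq_imp_space_eq[OF N] by auto
  have "emeasure M {x. \<not> P x} = 0"
    using AE_iff_measurable[of "{x. \<not> P x}" M P] assms sp by simp
  moreover have "emeasure N {x. \<not> P x} = 0"
    using AE_iff_measurable[of "{x. \<not> P x}" N P] assms sp by simp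
  moreover have "space (add_measure M N) = UNIV" using sets_eq_imp_space_eq[OF sets_add_measure] by simp
  ultimately show ?thesis
    using AE_iff_measurable[of "{x. \<not> P x}" "add_measure M N" P] P emeasure_add_measure[OF M N P] by simp
qed

lemma integral_add_measure:
  fixes f :: "complex \<Rightarrow> real"
  assumes M: "sets M = sets borel" and N: "sets N = sets borel" and f[measurable]: "f \<in> borel_measurable borel"
    and i: "integrable M f" "integrable N f"
  shows "integrable (add_measure M N) f" "(\<integral>x. f x \<partial>add_measure M N) = (\<integral>x. f x \<partial>M) + (\<integral>x. f x \<partial>N)"
proof -
  note add = nn_integral_add_measure[OF M N]
  have fin: "(\<integral>\<^sup>+x. ennreal (norm (f x)) \<partial>M) < \<infinity>" "(\<integral>\<^sup>+x. ennreal (norm (f x)) \<partial>N) < \<infinity>"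
    using i by (auto simp: integrable_iff_bounded)
  show I: "integrable (add_measure M N) f"
  proof (rule integrableI_bounded)
    show "(\<integral>\<^sup>+x. ennreal (norm (f x)) \<partial>add_measure M N) < \<infinity>" using fin by (subst add) auto
  qed measurable
  have lt: "(\<integral>\<^sup>+x. ennreal (f x) \<partial>K) < \<top>" "(\<integral>\<^sup>+x. ennreal (- f x) \<partial>K) < \<top>" if "(\<integral>\<^sup>+x. ennreal (norm (f x)) \<partial>K) < \<infinity>" for K
  proof -
    have "(\<integral>\<^sup>+x. ennreal (f x) \<partial>K) \<le> (\<integral>\<^sup>+x. ennreal (norm (f x)) \<partial>K)" "(\<integral>\<^sup>+x. ennreal (- f x) \<partial>K) \<le> (\<integral>\<^sup>+x. ennreal (norm (f x)) \<partial>K)"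
      by (intro nn_integral_mono ennreal_leI; simp)+
    then show "(\<integral>\<^sup>+x. ennreal (f x) \<partial>K) < \<top>" "(\<integral>\<^sup>+x. ennreal (- f x) \<partial>K) < \<top>" using that by auto
  qed
  show "(\<integral>x. f x \<partial>add_measure M N) = (\<integral>x. f x \<partial>M) + (\<integral>x. f x \<partial>N)"
    unfolding real_lebesgue_integral_def[OF I] real_lebesgue_integral_def[OF i(1)] real_lebesgue_integral_def[OF i(2)]
    using lt[OF fin(1)] lt[OF fin(2)] by (simp add: add enn2real_plus)
qed

section \<open>Polar sets\<close>

lemma polar_singleton: "polar {a}"
  unfolding polar_def
proof
  fix \<mu> assume \<mu>: "\<mu> \<in> cprob {a}"
  interpret prob_space \<mu> using cprobD[OF \<mu>] by simp
  obtain K where "K \<subseteq> {a}" "AE z in \<mu>. z \<in> K" using cprobD(3)[OF \<mu>] by blast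
  then have ae: "AE z in \<mu>. z = a" by (auto elim!: eventually_mono)
  have "(\<integral>\<^sup>+z. \<integral>\<^sup>+w. (if z = w then \<infinity> else ennreal (max 0 (- ln (cmod (z - w))))) \<partial>\<mu> \<partial>\<mu>) = (\<integral>\<^sup>+z. \<integral>\<^sup>+w. \<infinity> \<partial>\<mu> \<partial>\<mu>)"
    by (rule nn_integral_cong_AE, use ae in eventually_elim, rule nn_integral_cong_AE, use ae in eventually_elim) simp
  moreover have "(\<integral>\<^sup>+z. \<integral>\<^sup>+w. ennreal (max 0 (ln (cmod (z - w)))) \<partial>\<mu> \<partial>\<mu>) = (\<integral>\<^sup>+z. \<integral>\<^sup>+w. 0 \<partial>\<mu> \<partial>\<mu>)"
    by (rule nn_integral_cong_AE, use ae in eventually_elim, rule nn_integral_cong_AE, use ae in eventually_elim) simp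
  ultimately show "log_energy \<mu> = \<infinity>" by (simp add: log_energy_def emeasure_space_1 ennreal_top_mult)
qed

text \<open>By inner regularity a polar set of positive mass would contain a compact set
  \<open>K\<close> of positive mass. Normalising the measure on \<open>K\<close> multiplies the
  energy integral by at most the inverse square of that mass, so a probability measure of finite
  energy would live on the polar set.\<close>

lemma polar_null:
  assumes sm: "sets \<mu> = sets borel" and "finite_measure \<mu>"
    and fin: "(\<integral>\<^sup>+z. \<integral>\<^sup>+w. (if z = w then \<infinity> else ennreal (max 0 (- ln (cmod (z - w))))) \<partial>\<mu> \<partial>\<mu>) < \<infinity>"
    and B: "B \<in> sets borel" "polar B"
  shows "emeasure \<mu> B = 0"
proof (rule ccontr)
  assume pos: "emeasure \<mu> B \<noteq> 0"
  interpret finite_measure \<mu> by fact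
  note [measurable_cong] = sm
  define g where "g z w = (if z = w then \<infinity> else ennreal (max 0 (- ln (cmod (z - w)))))" for z w :: complex
  have g[measurable]: "(\<lambda>(z, w). g z w) \<in> borel_measurable (borel \<Otimes>\<^sub>M borel)" unfolding g_def by measurable
  have "emeasure \<mu> B = (SUP K\<in>{K. K \<subseteq> B \<and> compact K}. emeasure \<mu> K)"
    by (rule inner_regular) (use sm B emeasure_finite in auto)
  then have "0 < (SUP K\<in>{K. K \<subseteq> B \<and> compact K}. emeasure \<mu> K)" using pos by (simp add: zero_less_iff_neq_zero)
  then obtain K where K: "K \<subseteq> B" "compact K" "0 < emeasure \<mu> K" by (auto simp: less_SUP_iff)
  have Kb[measurable]: "K \<in> sets borel" using K(2) by (simp add: borel_compact)
  have Kf: "emeasure \<mu> K \<noteq> 0" "emeasure \<mu> K \<noteq> \<infinity>" using K(3) emeasure_finite by auto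
  define \<mu>' where "\<mu>' = uniform_measure \<mu> K"
  have s': "sets \<mu>' = sets borel" by (simp add: \<mu>'_def sm)
  interpret P: prob_space \<mu>' unfolding \<mu>'_def by (rule prob_space_uniform_measure[OF Kf])
  have "emeasure \<mu>' K = 1" unfolding \<mu>'_def by (rule emeasure_uniform_measure_1[OF Kf])
  then have "\<mu>' \<in> cprob B" using s' P.prob_space_axioms K by (intro cprobI) auto
  then have "log_energy \<mu>' = \<infinity>" using B(2) by (simp add: polar_def)
  then have "enn2ereal (\<integral>\<^sup>+z. \<integral>\<^sup>+w. g z w \<partial>\<mu>' \<partial>\<mu>') - enn2ereal N = \<infinity>" if "N = (\<integral>\<^sup>+z. \<integral>\<^sup>+w. ennreal (max 0 (ln (cmod (z - w)))) \<partial>\<mu>' \<partial>\<mu>')" for N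
    using that by (simp add: log_energy_def g_def)
  then obtain N where "enn2ereal (\<integral>\<^sup>+z. \<integral>\<^sup>+w. g z w \<partial>\<mu>' \<partial>\<mu>') - enn2ereal N = \<infinity>" by blast
  moreover have "0 \<le> enn2ereal N" by simp
  ultimately have inf: "(\<integral>\<^sup>+z. \<integral>\<^sup>+w. g z w \<partial>\<mu>' \<partial>\<mu>') = \<top>"
    by (cases "\<integral>\<^sup>+z. \<integral>\<^sup>+w. g z w \<partial>\<mu>' \<partial>\<mu>'"; cases "enn2ereal N") auto
  have le: "(\<integral>\<^sup>+x. h x \<partial>\<mu>') \<le> (\<integral>\<^sup>+x. h x \<partial>\<mu>) * inverse (emeasure \<mu> K)" if [measurable]: "h \<in> borel_measurable borel" for h
  proof -
    have "(\<integral>\<^sup>+x. h x \<partial>\<mu>') = (\<integral>\<^sup>+x. h x * indicator K x \<partial>\<mu>) * inverse (emeasure \<mu> K)"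
      unfolding \<mu>'_def divide_ennreal_def[symmetric] by (rule nn_integral_uniform_measure) measurable
    also have "\<dots> \<le> (\<integral>\<^sup>+x. h x \<partial>\<mu>) * inverse (emeasure \<mu> K)"
      by (intro mult_right_mono nn_integral_mono) (auto simp: indicator_def)
    finally show ?thesis .
  qed
  have "(\<integral>\<^sup>+z. \<integral>\<^sup>+w. g z w \<partial>\<mu>' \<partial>\<mu>') \<le> (\<integral>\<^sup>+z. (\<integral>\<^sup>+w. g z w \<partial>\<mu>) * inverse (emeasure \<mu> K) \<partial>\<mu>')"
    by (intro nn_integral_mono le) measurable
  also have "\<dots> \<le> (\<integral>\<^sup>+z. (\<integral>\<^sup>+w. g z w \<partial>\<mu>) * inverse (emeasure \<mu> K) \<partial>\<mu>) * inverse (emeasure \<mu> K)"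
    by (rule le) measurable
  also have "\<dots> = (\<integral>\<^sup>+z. \<integral>\<^sup>+w. g z w \<partial>\<mu> \<partial>\<mu>) * inverse (emeasure \<mu> K) * inverse (emeasure \<mu> K)"
  proof -
    have "(\<lambda>z. \<integral>\<^sup>+w. g z w \<partial>\<mu>) \<in> borel_measurable \<mu>" unfolding g_def by measurable
    then show ?thesis by (simp only: nn_integral_multc)
  qed
  also have "\<dots> < \<top>"
  proof -
    have "inverse (emeasure \<mu> K) < \<top>" using Kf(1) by (simp add: less_top[symmetric])
    then show ?thesis using fin unfolding g_def[symmetric] by (simp add: ennreal_mult_less_top)
  qed
  finally show False using inf by simp
qed

lemma polar_null_unif_disc:
  assumes r: "0 < r" and B: "B \<in> sets borel" "polar B"
  shows "emeasure (unif_disc r) B = 0"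
proof -
  interpret U: prob_space "unif_disc r" by (rule prob_space_unif_disc[OF r])
  let ?C = "1 / (pi * r\<^sup>2) * (pi / 2)"
  show ?thesis
  proof (rule polar_null[OF _ _ _ B])
    have "(\<integral>\<^sup>+z. \<integral>\<^sup>+w. (if z = w then \<infinity> else ennreal (max 0 (- ln (cmod (z - w))))) \<partial>unif_disc r \<partial>unif_disc r)
      \<le> (\<integral>\<^sup>+z. ennreal (?C + (r + r)) \<partial>unif_disc r)"
    proof (rule nn_integral_mono_AE, use AE_unif_disc[of r] in eventually_elim)
      fix z assume z: "cmod z < r"
      have "(\<integral>\<^sup>+w. (if z = w then \<infinity> else ennreal (max 0 (- ln (cmod (z - w))))) \<partial>unif_disc r) \<le> (\<integral>\<^sup>+w. ennreal \<bar>ln (cmod (z - w))\<bar> \<partial>unif_disc r)"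
      proof (rule nn_integral_mono_AE)
        have "AE w in unif_disc r. w \<noteq> z" by (rule AE_unif_disc_lborel[OF _ AE_lborel_singleton]) simp
        then show "AE w in unif_disc r. (if z = w then \<infinity> else ennreal (max 0 (- ln (cmod (z - w))))) \<le> ennreal \<bar>ln (cmod (z - w))\<bar>"
          by eventually_elim (auto intro!: ennreal_leI)
      qed
      also have "\<dots> \<le> ennreal (?C + (cmod z + r))"
        unfolding unif_disc_def
        by (rule nn_integral_abs_log_le) (use r nn_integral_unif_disc_density[OF r] in \<open>auto simp: indicator_def\<close>)
      also have "\<dots> \<le> ennreal (?C + (r + r))" using z by (intro ennreal_leI) simp
      finally show "(\<integral>\<^sup>+w. (if z = w then \<infinity> else ennreal (max 0 (- ln (cmod (z - w))))) \<partial>unif_disc r) \<le> ennreal (?C + (r + r))" .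
    qed
    also have "\<dots> < \<infinity>" by (simp add: U.emeasure_space_1)
    finally show "(\<integral>\<^sup>+z. \<integral>\<^sup>+w. (if z = w then \<infinity> else ennreal (max 0 (- ln (cmod (z - w))))) \<partial>unif_disc r \<partial>unif_disc r) < \<infinity>" .
  qed (simp, rule U.finite_measure_axioms)
qed

text \<open>Uniform measures on discs have finite energy and so do not charge polar sets; the plane
  is exhausted by countably many discs.\<close>

lemma polar_AE_lborel:
  assumes B: "B \<in> sets borel" "polar B"
  shows "AE z in lborel. z \<notin> B"
proof -
  have "AE z in lborel. 0 < ennreal (indicator (ball 0 (real (Suc n))) z / (pi * (real (Suc n))\<^sup>2)) \<longrightarrow> z \<notin> B" for n
  proof -
    have "B \<in> null_sets (unif_disc (real (Suc n)))" using polar_null_unif_disc[OF _ B] B by (simp add: null_sets_def)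
    from AE_not_in[OF this] show ?thesis unfolding unif_disc_def by (subst (asm) AE_density[OF unif_disc_density])
  qed
  then have "AE z in lborel. \<forall>n. 0 < ennreal (indicator (ball 0 (real (Suc n))) z / (pi * (real (Suc n))\<^sup>2)) \<longrightarrow> z \<notin> B"
    by (simp only: AE_all_countable) blast
  then show ?thesis
  proof eventually_elim
    fix z assume *: "\<forall>n. 0 < ennreal (indicator (ball 0 (real (Suc n))) z / (pi * (real (Suc n))\<^sup>2)) \<longrightarrow> z \<notin> B"
    obtain n where "cmod z < real n" using reals_Archimedean2 by blast
    then have "z \<in> ball 0 (real (Suc n))" by simp
    then have "0 < ennreal (indicator (ball 0 (real (Suc n))) z / (pi * (real (Suc n))\<^sup>2))"
      by (simp only: indicator_simps ennreal_less_zero_iff) (intro divide_pos_pos mult_pos_pos zero_less_power pi_gt_zero, simp_all)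
    then show "z \<notin> B" using * by blast
  qed
qed

lemma polar_null_energy:
  assumes \<mu>: "\<mu> \<in> cprob UNIV" and fin: "log_energy \<mu> \<noteq> \<infinity>" and B: "B \<in> sets borel" "polar B"
  shows "emeasure \<mu> B = 0"
proof (rule polar_null[OF cprobD(1)[OF \<mu>] _ _ B])
  note [measurable_cong] = cprobD(1)[OF \<mu>]
  interpret prob_space \<mu> using cprobD[OF \<mu>] by simp
  show "finite_measure \<mu>" by (rule finite_measure_axioms)
  define P where "P = (\<integral>\<^sup>+p. (if fst p = snd p then \<infinity> else ennreal (max 0 (- log_dist p))) \<partial>(\<mu> \<Otimes>\<^sub>M \<mu>))"
  define N where "N = (\<integral>\<^sup>+p. ennreal (max 0 (log_dist p)) \<partial>(\<mu> \<Otimes>\<^sub>M \<mu>))"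
  have "log_energy \<mu> = enn2ereal P - enn2ereal N" "N < \<infinity>" unfolding P_def N_def by (rule log_energy_pos_fin[OF \<mu>])+
  then have "P < \<infinity>" using fin by (cases N; cases P) auto
  moreover have "P = (\<integral>\<^sup>+z. \<integral>\<^sup>+w. (if fst (z, w) = snd (z, w) then \<infinity> else ennreal (max 0 (- log_dist (z, w)))) \<partial>\<mu> \<partial>\<mu>)"
    unfolding P_def by (rule nn_integral_fst[symmetric]) measurable
  ultimately show "(\<integral>\<^sup>+z. \<integral>\<^sup>+w. (if z = w then \<infinity> else ennreal (max 0 (- ln (cmod (z - w))))) \<partial>\<mu> \<partial>\<mu>) < \<infinity>"
    unfolding fst_conv snd_conv by simp
qed

section \<open>The potential of the unit disc\<close>

definition disc_potential :: "complex \<Rightarrow> real" where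
  "disc_potential z = (if cmod z \<le> 1 then (1 - (cmod z)\<^sup>2) / 2 else - ln (cmod z))"

lemma disc_potential_measurable [measurable]: "disc_potential \<in> borel_measurable borel"
  unfolding disc_potential_def by measurable

text \<open>The first inequality, an equality on the closed unit disc, is the variational inequality
  that makes the uniform measure the unconstrained minimiser. The other two bound the potential on
  bounded sets.\<close>

lemma disc_potential_bounds: "(1 - (cmod z)\<^sup>2) / 2 \<le> disc_potential z" "disc_potential z \<le> 1 / 2" "- cmod z \<le> disc_potential z"
proof -
  show 1: "(1 - (cmod z)\<^sup>2) / 2 \<le> disc_potential z"
  proof (cases "cmod z \<le> 1")
    case False
    then have "z \<noteq> 0" by auto
    then have "ln ((cmod z)\<^sup>2) \<le> (cmod z)\<^sup>2 - 1" by (intro ln_le_minus_one) simp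
    then show ?thesis using False by (simp add: disc_potential_def ln_realpow)
  qed (simp add: disc_potential_def)
  show "disc_potential z \<le> 1 / 2"
  proof (cases "cmod z \<le> 1")
    case False
    then have "0 \<le> ln (cmod z)" by simp
    then have "- ln (cmod z) \<le> 1 / 2" by linarith
    then show ?thesis using False by (simp add: disc_potential_def)
  qed (simp add: disc_potential_def)
  show "- cmod z \<le> disc_potential z"
  proof (cases "cmod z \<le> 1")
    case True
    then have "(cmod z)\<^sup>2 \<le> 1" by (simp add: power_le_one)
    then have "0 \<le> (1 - (cmod z)\<^sup>2) / 2" by simp
    then have "0 \<le> disc_potential z" using 1 by linarith
    then show ?thesis using norm_ge_zero[of z] by linarith
  next
    case False
    then show ?thesis using ln_upper[of "cmod z"] by (simp add: disc_potential_def)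
  qed
qed

lemma disc_log_potential:
  "integrable lborel (\<lambda>w. indicator (ball 0 1) w / pi * ln (cmod (z - w)))"
  "(\<integral>w. indicator (ball 0 1) w / pi * ln (cmod (z - w)) \<partial>lborel) = - disc_potential z"
  using integrable_log_unif_disc[of 1 z] unif_disc_log_mean[of z] unfolding unif_disc_def
  by (simp_all add: integrable_real_density integral_real_density disc_potential_def minus_divide_left)

lemma integrable_log_subset_disc:
  assumes [measurable]: "A \<in> sets borel" and A: "A \<subseteq> ball 0 1"
  shows "integrable lborel (\<lambda>w. indicator A w / pi * ln (cmod (z - w)))"
proof -
  have "integrable lborel (\<lambda>w. indicator A w *\<^sub>R (indicator (ball 0 1) w / pi * ln (cmod (z - w))))"
    by (rule integrable_mult_indicator[OF _ disc_log_potential(1)]) simp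
  then show ?thesis by (rule back_subst[of "integrable lborel"]) (use A in \<open>auto simp: indicator_def fun_eq_iff\<close>)
qed

text \<open>Turns control of a signed logarithmic potential on a bounded set into control of the
  integral of the absolute value.\<close>

lemma abs_ln_cmod_le: "\<bar>ln (cmod u)\<bar> \<le> 2 * cmod u - ln (cmod u)"
  using ln_upper[of "cmod u"] norm_ge_zero[of u] by (auto simp: abs_if)

lemma finite_measure_disc_part:
  fixes A :: "complex set"
  assumes [measurable]: "A \<in> sets borel" and A: "A \<subseteq> ball 0 1"
  defines "m \<equiv> density lborel (\<lambda>w. ennreal (indicator A w / pi))"
  shows "sets m = sets borel" "emeasure m UNIV = ennreal (measure lborel A / pi)" "AE w in m. w \<in> A" "emeasure lborel A < \<infinity>"
    and "\<And>f. f \<in> borel_measurable borel \<Longrightarrow> integrable m f \<longleftrightarrow> integrable lborel (\<lambda>w. indicator A w / pi * f w :: real)"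
    and "\<And>f. f \<in> borel_measurable borel \<Longrightarrow> (\<integral>w. f w \<partial>m) = (\<integral>w. indicator A w / pi * f w \<partial>lborel :: real)"
proof -
  have "emeasure lborel A \<le> emeasure lborel (ball (0::complex) 1)" by (rule emeasure_mono[OF A]) simp
  then show fin: "emeasure lborel A < \<infinity>" by (simp add: area_ball le_less_trans)
  have "emeasure m UNIV = (\<integral>\<^sup>+w. ennreal (1 / pi) * indicator A w \<partial>lborel)"
    unfolding m_def by (subst emeasure_density) (auto intro!: nn_integral_cong simp: indicator_def)
  also have "\<dots> = ennreal (1 / pi) * emeasure lborel A" by (rule nn_integral_cmult_indicator) simp
  also have "emeasure lborel A = ennreal (measure lborel A)" using fin by (intro emeasure_eq_ennreal_measure) simp
  finally show "emeasure m UNIV = ennreal (measure lborel A / pi)" by (simp add: ennreal_mult'[symmetric])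
  show "sets m = sets borel" by (simp add: m_def)
  show "AE w in m. w \<in> A" unfolding m_def by (subst AE_density) (auto simp: indicator_def)
  show "\<And>f. f \<in> borel_measurable borel \<Longrightarrow> integrable m f \<longleftrightarrow> integrable lborel (\<lambda>w. indicator A w / pi * f w :: real)"
    unfolding m_def by (subst integrable_real_density) auto
  show "\<And>f. f \<in> borel_measurable borel \<Longrightarrow> (\<integral>w. f w \<partial>m) = (\<integral>w. indicator A w / pi * f w \<partial>lborel :: real)"
    unfolding m_def by (subst integral_real_density) auto
qed

section \<open>Mass of the balayage and the minimiser outside an open set\<close>

context
  fixes V :: "complex set" and \<nu> :: "complex measure"
  assumes openV: "open V" and V1: "V \<subseteq> ball 0 1" and bal: "is_balayage V \<nu>"
begin

lemma balayage_sets: "sets \<nu> = sets borel" "finite_measure \<nu>"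
  using bal by (auto simp: is_balayage_def)

lemma V_borel: "V \<in> sets borel" "ball 0 1 - V \<in> sets borel"
  using openV by auto

lemma frontier_subset: "frontier V \<subseteq> cball 0 1 - V"
proof -
  have "closure V \<subseteq> cball 0 1" using V1 by (intro closure_minimal) auto
  then show ?thesis using openV by (auto simp: frontier_def interior_open)
qed

lemma balayage_AE: "AE w in \<nu>. w \<in> cball 0 1 - V"
proof -
  have "- frontier V \<in> null_sets \<nu>" using bal balayage_sets by (auto simp: is_balayage_def null_sets_def)
  from AE_not_in[OF this] show ?thesis by eventually_elim (use frontier_subset in auto)
qed

lemma balayage_potential:
  obtains E where "E \<in> sets borel" "polar E" "emeasure \<nu> E = 0"
    "\<And>z. z \<notin> V \<Longrightarrow> z \<notin> E \<Longrightarrow> integrable \<nu> (\<lambda>w. ln (cmod (z - w)))"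
    "\<And>z. z \<notin> V \<Longrightarrow> z \<notin> E \<Longrightarrow> (\<integral>w. ln (cmod (z - w)) \<partial>\<nu>) = (\<integral>w. indicator V w / pi * ln (cmod (z - w)) \<partial>lborel)"
proof -
  have ln1: "ln (1 / cmod u) = - ln (cmod u)" for u :: complex by (cases "u = 0") (simp_all add: ln_div)
  obtain E where E: "E \<in> sets borel" "polar E" and
    pot: "\<forall>z\<in>- V - E. integrable \<nu> (\<lambda>w. ln (1 / cmod (z - w))) \<and>
           (\<integral>w. ln (1 / cmod (z - w)) \<partial>\<nu>) = (1 / pi) * (LINT w:V|lborel. ln (1 / cmod (z - w)))"
    using bal unfolding is_balayage_def by blast
  have em: "emeasure \<nu> E = 0" using bal E unfolding is_balayage_def by blast
  have res: "integrable \<nu> (\<lambda>w. ln (cmod (z - w)))"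
    "(\<integral>w. ln (cmod (z - w)) \<partial>\<nu>) = (\<integral>w. indicator V w / pi * ln (cmod (z - w)) \<partial>lborel)" if "z \<notin> V" "z \<notin> E" for z
  proof -
    have z: "z \<in> - V - E" using that by blast
    have "integrable \<nu> (\<lambda>w. - ln (cmod (z - w)))" using bspec[OF pot z] unfolding ln1 by blast
    then have "integrable \<nu> (\<lambda>w. - (- ln (cmod (z - w))))" by (rule integrable_minus)
    then show "integrable \<nu> (\<lambda>w. ln (cmod (z - w)))" by simp
    have "- (\<integral>w. ln (cmod (z - w)) \<partial>\<nu>) = (1 / pi) * - (\<integral>w. indicator V w * ln (cmod (z - w)) \<partial>lborel)"
      using bspec[OF pot z] unfolding ln1 by (simp add: set_lebesgue_integral_def)
    then have "(\<integral>w. ln (cmod (z - w)) \<partial>\<nu>) = (1 / pi) * (\<integral>w. indicator V w * ln (cmod (z - w)) \<partial>lborel)" by simp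
    also have "\<dots> = (\<integral>w. (1 / pi) * (indicator V w * ln (cmod (z - w))) \<partial>lborel)" by (rule integral_mult_right_zero[symmetric])
    finally show "(\<integral>w. ln (cmod (z - w)) \<partial>\<nu>) = (\<integral>w. indicator V w / pi * ln (cmod (z - w)) \<partial>lborel)" by simp
  qed
  show ?thesis by (rule that[OF E em res])
qed

text \<open>The total mass is read off from the logarithmic growth of both potentials at infinity.\<close>

lemma balayage_mass: "measure \<nu> UNIV = measure lborel V / pi"
proof -
  interpret finite_measure \<nu> by (rule balayage_sets)
  have sp: "space \<nu> = UNIV" using sets_eq_imp_space_eq[OF balayage_sets(1)] by simp
  obtain E where E: "E \<in> sets borel" "polar E" and "emeasure \<nu> E = 0"
    and int: "\<And>z. z \<notin> V \<Longrightarrow> z \<notin> E \<Longrightarrow> integrable \<nu> (\<lambda>w. ln (cmod (z - w)))"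
    and pot: "\<And>z. z \<notin> V \<Longrightarrow> z \<notin> E \<Longrightarrow> (\<integral>w. ln (cmod (z - w)) \<partial>\<nu>) = (\<integral>w. indicator V w / pi * ln (cmod (z - w)) \<partial>lborel)"
    by (rule balayage_potential) (rule that; simp)
  \<comment> \<open>Polar sets are Lebesgue null, while the disc of radius R about 2 R has positive
    area and lies outside the open ball of radius R. So there are points of arbitrarily large
    modulus at which the potential identity holds.\<close>
  have ex: "\<exists>z. R \<le> cmod z \<and> z \<notin> E" if R: "0 < R" for R
  proof (rule ccontr)
    assume "\<not> (\<exists>z. R \<le> cmod z \<and> z \<notin> E)"
    then have sub: "\<And>z. R \<le> cmod z \<Longrightarrow> z \<in> E" by blast
    have "AE z in lborel. z \<notin> cball (complex_of_real (2 * R)) R"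
      using polar_AE_lborel[OF E]
    proof eventually_elim
      fix z assume "z \<notin> E"
      then have "cmod z < R" using sub[of z] by force
      moreover have "2 * R \<le> cmod (complex_of_real (2 * R) - z) + cmod z"
        using norm_triangle_ineq[of "complex_of_real (2 * R) - z" z] R by simp
      ultimately show "z \<notin> cball (complex_of_real (2 * R)) R" by (simp add: dist_norm)
    qed
    then have "emeasure lborel (cball (complex_of_real (2 * R)) R) = 0"
      by (subst (asm) AE_iff_measurable[of "cball (complex_of_real (2 * R)) R"]) auto
    then show False using R by (simp add: area_cball)
  qed
  define m where "m = density lborel (\<lambda>w. ennreal (indicator V w / pi))"
  note mf = finite_measure_disc_part[OF V_borel(1) V1, folded m_def]
  interpret m: finite_measure m by (rule finite_measureI) (simp add: mf(2) sets_eq_imp_space_eq[OF mf(1)])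
  have spm: "space m = UNIV" using sets_eq_imp_space_eq[OF mf(1)] by simp
  have mm: "measure m UNIV = measure lborel V / pi" using mf(2) by (simp add: measure_def)
  \<comment> \<open>For |z| \<ge> 2 and |w| \<le> 1 the ratio |z - w| / |z| lies between 1/2 and 2,
    so the integral is mass times ln |z| with an error of at most mass times ln 2.\<close>
  have est: "\<bar>(\<integral>w. ln (cmod (z - w)) \<partial>N) - measure N UNIV * ln (cmod z)\<bar> \<le> measure N UNIV * ln 2"
    if N: "finite_measure N" "sets N = sets borel" "AE w in N. cmod w \<le> 1" "integrable N (\<lambda>w. ln (cmod (z - w)))" and z: "2 \<le> cmod z" for N z
  proof -
    interpret N: finite_measure N by fact
    have spN: "space N = UNIV" using sets_eq_imp_space_eq[OF N(2)] by simp
    have i: "integrable N (\<lambda>w. ln (cmod (z - w)) - ln (cmod z))" using N(4) by simp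
    have "\<bar>ln (cmod (z - w)) - ln (cmod z)\<bar> \<le> ln 2" if w: "cmod w \<le> 1" for w
    proof -
      have a: "cmod z / 2 \<le> cmod (z - w)" using norm_triangle_ineq2[of z w] z w by linarith
      have b: "cmod (z - w) \<le> 2 * cmod z" using norm_triangle_ineq4[of z w] z w by linarith
      have p: "0 < cmod (z - w)" "0 < cmod z" using a z by linarith+
      have "ln (cmod z / 2) \<le> ln (cmod (z - w))" using a p by simp
      moreover have "ln (cmod (z - w)) \<le> ln (2 * cmod z)" using b p by simp
      moreover have "ln (cmod z / 2) = ln (cmod z) - ln 2" using p by (simp add: ln_div)
      moreover have "ln (2 * cmod z) = ln 2 + ln (cmod z)" using p by (simp add: ln_mult_pos)
      ultimately show ?thesis by linarith
    qed
    then have "AE w in N. \<bar>ln (cmod (z - w)) - ln (cmod z)\<bar> \<le> ln 2" using N(3) by (auto elim!: eventually_mono)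
    then have "(\<integral>w. \<bar>ln (cmod (z - w)) - ln (cmod z)\<bar> \<partial>N) \<le> (\<integral>w. ln 2 \<partial>N)"
      using i by (intro integral_mono_AE) auto
    then have "(\<integral>w. norm (ln (cmod (z - w)) - ln (cmod z)) \<partial>N) \<le> measure N UNIV * ln 2" by (simp add: spN)
    with integral_norm_bound have "norm (\<integral>w. ln (cmod (z - w)) - ln (cmod z) \<partial>N) \<le> measure N UNIV * ln 2" by (rule order_trans)
    then have "\<bar>\<integral>w. ln (cmod (z - w)) - ln (cmod z) \<partial>N\<bar> \<le> measure N UNIV * ln 2" by (simp only: real_norm_def)
    then show ?thesis using N(4) by (simp add: spN)
  qed
  define d where "d = measure \<nu> UNIV - measure m UNIV"
  define C where "C = (measure \<nu> UNIV + measure m UNIV) * ln 2"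
  have bd: "\<bar>d\<bar> * ln R \<le> C" if R: "2 \<le> R" for R
  proof -
    obtain z where z: "R \<le> cmod z" "z \<notin> E" using ex[of R] R by auto
    have zV: "z \<notin> V" using z R V1 by (auto simp: subset_iff)
    have "integrable m (\<lambda>w. ln (cmod (z - w)))"
      using integrable_log_subset_disc[OF V_borel(1) V1] by (subst mf(5)) auto
    then have 1: "\<bar>(\<integral>w. ln (cmod (z - w)) \<partial>m) - measure m UNIV * ln (cmod z)\<bar> \<le> measure m UNIV * ln 2"
      using mf(1,3) V1 z R by (intro est m.finite_measure_axioms) (auto elim!: eventually_mono)
    have 2: "\<bar>(\<integral>w. ln (cmod (z - w)) \<partial>\<nu>) - measure \<nu> UNIV * ln (cmod z)\<bar> \<le> measure \<nu> UNIV * ln 2"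
      using balayage_sets balayage_AE z R zV by (intro est int) (auto elim!: eventually_mono)
    have 3: "(\<integral>w. ln (cmod (z - w)) \<partial>\<nu>) = (\<integral>w. ln (cmod (z - w)) \<partial>m)"
      using pot[OF zV z(2)] by (subst mf(6)) auto
    have "\<bar>d * ln (cmod z)\<bar> \<le> C" using 1 2 unfolding 3 d_def C_def left_diff_distrib distrib_right by linarith
    then have "\<bar>d\<bar> * ln (cmod z) \<le> C" using z R by (simp add: abs_mult)
    moreover have "\<bar>d\<bar> * ln R \<le> \<bar>d\<bar> * ln (cmod z)"
    proof (rule mult_left_mono)
      have "0 < R" "0 < cmod z" using z(1) R by linarith+
      then show "ln R \<le> ln (cmod z)" using z(1) by simp
    qed simp
    ultimately show ?thesis by linarith
  qed
  have "d = 0"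
  proof (rule ccontr)
    assume "d \<noteq> 0"
    then have d: "0 < \<bar>d\<bar>" by simp
    \<comment> \<open>Chosen with ln R = |C| / |d| + 1, which contradicts |d| ln R \<le> C.\<close>
    define R where "R = exp (\<bar>C\<bar> / \<bar>d\<bar> + 1)"
    have "0 \<le> \<bar>C\<bar> / \<bar>d\<bar>" by simp
    then have "2 \<le> R" using exp_ge_add_one_self[of "\<bar>C\<bar> / \<bar>d\<bar> + 1"] unfolding R_def by linarith
    from bd[OF this] have "\<bar>d\<bar> * (\<bar>C\<bar> / \<bar>d\<bar> + 1) \<le> C" by (simp add: R_def)
    then show False using d by (simp add: distrib_left)
  qed
  then show ?thesis using mm by (simp add: d_def)
qed

text \<open>Inside the closed unit disc \<open>disc_potential\<close> is (1 - |z|^2) / 2, so the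
  energy of \<open>\<sigma>\<close> is a function of its second moment \<open>Q\<close>. A
  competitor of infinite energy is trivial. Any other one gives mass 0 to the exceptional set
  \<open>E\<close>, so its mutual energy with \<open>\<sigma>\<close> is the integral of
  \<open>disc_potential\<close>, and the variational inequality combined with positivity of the
  kernel gives the bound.\<close>

lemma balayage_extremal:
  defines "Q \<equiv> (\<integral>z. indicator (ball 0 1 - V) z / pi * (cmod z)\<^sup>2 \<partial>lborel) + (\<integral>z. (cmod z)\<^sup>2 \<partial>\<nu>)"
  shows "R_set V = ereal (1 / 2 + Q / 2)" and "\<exists>\<sigma>\<in>cprob (- V). R_measure \<sigma> = R_set V"
proof -
  interpret \<nu>: finite_measure \<nu> by (rule balayage_sets)
  have sp: "space \<nu> = UNIV" using sets_eq_imp_space_eq[OF balayage_sets(1)] by simp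
  note s\<nu> = balayage_sets(1)
  obtain E where E: "E \<in> sets borel" "polar E" "emeasure \<nu> E = 0"
    and int: "\<And>z. z \<notin> V \<Longrightarrow> z \<notin> E \<Longrightarrow> integrable \<nu> (\<lambda>w. ln (cmod (z - w)))"
    and pot: "\<And>z. z \<notin> V \<Longrightarrow> z \<notin> E \<Longrightarrow> (\<integral>w. ln (cmod (z - w)) \<partial>\<nu>) = (\<integral>w. indicator V w / pi * ln (cmod (z - w)) \<partial>lborel)"
    by (rule balayage_potential) (rule that; simp)
  let ?A = "ball 0 1 - V"
  define m where "m = density lborel (\<lambda>w. ennreal (indicator ?A w / pi))"
  note mf = finite_measure_disc_part[OF V_borel(2) Diff_subset, folded m_def]
  interpret m: finite_measure m by (rule finite_measureI) (simp add: mf(2) sets_eq_imp_space_eq[OF mf(1)])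
  define \<sigma> where "\<sigma> = add_measure m \<nu>"
  have s\<sigma>[measurable_cong]: "sets \<sigma> = sets borel" by (simp add: \<sigma>_def)
  have spo: "space \<sigma> = UNIV" using sets_eq_imp_space_eq[OF s\<sigma>] by simp
  have AE\<sigma>: "AE x in \<sigma>. P x" if "{x. \<not> P x} \<in> sets borel" "AE x in m. P x" "AE x in \<nu>. P x" for P
    unfolding \<sigma>_def by (rule AE_add_measure[OF mf(1) s\<nu> that])
  interpret \<sigma>: prob_space \<sigma>
  proof
    have "emeasure \<sigma> UNIV = emeasure m UNIV + emeasure \<nu> UNIV"
      unfolding \<sigma>_def by (rule emeasure_add_measure[OF mf(1) s\<nu>]) simp
    also have "emeasure \<nu> UNIV = ennreal (measure lborel V / pi)"
      using \<nu>.emeasure_eq_measure[of UNIV] balayage_mass by simp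
    also have "emeasure m UNIV = ennreal (measure lborel ?A / pi)" by (rule mf(2))
    also have "measure lborel ?A = pi - measure lborel V"
    proof -
      have "measure lborel (ball (0::complex) 1) = pi" by (simp add: measure_def area_ball)
      moreover have "measure lborel ?A = measure lborel (ball (0::complex) 1) - measure lborel V"
        by (rule measure_Diff) (use V_borel V1 in \<open>simp_all add: area_ball\<close>)
      ultimately show ?thesis by simp
    qed
    also have "ennreal ((pi - measure lborel V) / pi) + ennreal (measure lborel V / pi) = ennreal ((pi - measure lborel V) / pi + measure lborel V / pi)"
    proof (rule ennreal_plus[symmetric])
      have "measure lborel V \<le> measure lborel (ball (0::complex) 1)"
        by (rule measure_mono_fmeasurable) (use V_borel V1 in \<open>simp_all add: fmeasurable_def area_ball\<close>)
      moreover have "measure lborel (ball (0::complex) 1) = pi" by (simp add: measure_def area_ball)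
      ultimately show "0 \<le> (pi - measure lborel V) / pi" by simp
    qed simp
    also have "\<dots> = 1" by (simp add: field_simps flip: add_divide_distrib)
    finally show "emeasure \<sigma> (space \<sigma>) = 1" by (simp add: spo)
  qed
  have AEc: "AE w in \<sigma>. w \<in> cball 0 1 - V"
    by (rule AE\<sigma>[OF _ _ balayage_AE], use V_borel in simp, use mf(3) in eventually_elim, auto)
  have AE1: "AE w in \<sigma>. cmod w \<le> 1" using AEc by eventually_elim simp
  have "compact (cball 0 1 - V)" using openV by (intro compact_diff) auto
  moreover have "emeasure \<sigma> (cball 0 1 - V) = 1" by (rule \<sigma>.emeasure_eq_1_AE[OF _ AEc]) (use V_borel s\<sigma> in simp)
  ultimately have \<sigma>V: "\<sigma> \<in> cprob (- V)" using s\<sigma> \<sigma>.prob_space_axioms by (intro cprobI) auto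
  then have \<sigma>U: "\<sigma> \<in> cprob UNIV" using cprob_mono[of "- V" UNIV] by auto
  have AEE: "AE w in \<sigma>. w \<notin> E"
  proof (rule AE\<sigma>)
    show "{x. \<not> x \<notin> E} \<in> sets borel" using E by simp
    show "AE w in m. w \<notin> E" unfolding m_def
      by (subst AE_density) (use polar_AE_lborel[OF E(1,2)] V_borel in \<open>auto elim!: eventually_mono\<close>)
    show "AE w in \<nu>. w \<notin> E" by (rule AE_not_in) (use E s\<nu> in \<open>simp add: null_sets_def\<close>)
  qed
  have AEne: "AE w in \<sigma>. z \<noteq> w" for z
  proof (rule AE\<sigma>)
    show "{w. \<not> z \<noteq> w} \<in> sets borel" by simp
    show "AE w in m. z \<noteq> w" unfolding m_def
      by (subst AE_density) (use AE_lborel_singleton[of z] V_borel in \<open>auto elim!: eventually_mono\<close>)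
    have "emeasure \<nu> {z} = 0" using bal polar_singleton[of z] unfolding is_balayage_def by simp
    then have "AE w in \<nu>. w \<notin> {z}" by (intro AE_not_in) (simp add: null_sets_def s\<nu>)
    then show "AE w in \<nu>. z \<noteq> w" by eventually_elim auto
  qed
  have P\<sigma>: "integrable \<sigma> (\<lambda>w. ln (cmod (z - w)))" "(\<integral>w. ln (cmod (z - w)) \<partial>\<sigma>) = - disc_potential z"
    if z: "z \<notin> V" "z \<notin> E" for z
  proof -
    have iA: "integrable lborel (\<lambda>w. indicator ?A w / pi * ln (cmod (z - w)))" by (rule integrable_log_subset_disc[OF V_borel(2)]) auto
    then have im: "integrable m (\<lambda>w. ln (cmod (z - w)))" by (subst mf(5)) auto
    show "integrable \<sigma> (\<lambda>w. ln (cmod (z - w)))"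
      unfolding \<sigma>_def by (rule integral_add_measure(1)[OF mf(1) s\<nu> _ im int[OF z]]) simp
    have "(\<integral>w. ln (cmod (z - w)) \<partial>\<sigma>) = (\<integral>w. ln (cmod (z - w)) \<partial>m) + (\<integral>w. ln (cmod (z - w)) \<partial>\<nu>)"
      unfolding \<sigma>_def by (rule integral_add_measure(2)[OF mf(1) s\<nu> _ im int[OF z]]) simp
    also have "\<dots> = (\<integral>w. indicator ?A w / pi * ln (cmod (z - w)) \<partial>lborel) + (\<integral>w. indicator V w / pi * ln (cmod (z - w)) \<partial>lborel)"
      using pot[OF z] by (subst mf(6)) auto
    also have "\<dots> = (\<integral>w. indicator ?A w / pi * ln (cmod (z - w)) + indicator V w / pi * ln (cmod (z - w)) \<partial>lborel)"
      by (rule Bochner_Integration.integral_add[symmetric, OF iA integrable_log_subset_disc[OF V_borel(1) V1]])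
    also have "\<dots> = (\<integral>w. indicator (ball 0 1) w / pi * ln (cmod (z - w)) \<partial>lborel)"
      by (rule Bochner_Integration.integral_cong) (use V1 in \<open>auto simp: indicator_def\<close>)
    finally show "(\<integral>w. ln (cmod (z - w)) \<partial>\<sigma>) = - disc_potential z" by (simp only: disc_log_potential(2))
  qed
  have mutual: "integrable (\<alpha> \<Otimes>\<^sub>M \<sigma>) log_dist" "AE p in \<alpha> \<Otimes>\<^sub>M \<sigma>. fst p \<noteq> snd p"
    "(\<integral>p. log_dist p \<partial>(\<alpha> \<Otimes>\<^sub>M \<sigma>)) = (\<integral>z. - disc_potential z \<partial>\<alpha>)"
    if \<alpha>: "sets \<alpha> = sets borel" "prob_space \<alpha>" "AE z in \<alpha>. z \<notin> V" "AE z in \<alpha>. z \<notin> E" "AE z in \<alpha>. cmod z \<le> M" for \<alpha> M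
  proof -
    note [measurable_cong] = \<alpha>(1)
    interpret \<alpha>: prob_space \<alpha> by fact
    interpret P: pair_prob_space \<alpha> \<sigma> ..
    \<comment> \<open>Only the signed potential of \<open>\<sigma>\<close> is known.
      \<open>abs_ln_cmod_le\<close> bounds the absolute one by it, uniformly for bounded
      \<open>z\<close>, which is what Fubini needs.\<close>
    have le: "(\<integral>w. norm (ln (cmod (z - w))) \<partial>\<sigma>) \<le> 2 * (cmod z + 1) + 1 / 2" if z: "z \<notin> V" "z \<notin> E" for z
    proof -
      note i = P\<sigma>(1)[OF z]
      have "(\<integral>w. norm (ln (cmod (z - w))) \<partial>\<sigma>) \<le> (\<integral>w. 2 * (cmod z + 1) - ln (cmod (z - w)) \<partial>\<sigma>)"
      proof (rule integral_mono_AE)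
        show "AE w in \<sigma>. norm (ln (cmod (z - w))) \<le> 2 * (cmod z + 1) - ln (cmod (z - w))"
          using AE1
        proof eventually_elim
          fix w assume "cmod w \<le> 1"
          then have "2 * cmod (z - w) \<le> 2 * (cmod z + 1)" using norm_triangle_ineq4[of z w] by simp
          then have "2 * cmod (z - w) - ln (cmod (z - w)) \<le> 2 * (cmod z + 1) - ln (cmod (z - w))" by (rule diff_right_mono)
          with abs_ln_cmod_le[of "z - w"] show "norm (ln (cmod (z - w))) \<le> 2 * (cmod z + 1) - ln (cmod (z - w))"
            unfolding real_norm_def by (rule order_trans)
        qed
      qed (use i in auto)
      also have "\<dots> = 2 * (cmod z + 1) + disc_potential z" using i P\<sigma>(2)[OF z] by (simp add: \<sigma>.prob_space)
      finally show ?thesis using disc_potential_bounds(2)[of z] by linarith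
    qed
    show int': "integrable (\<alpha> \<Otimes>\<^sub>M \<sigma>) log_dist"
    proof (rule P.Fubini_integrable)
      show "log_dist \<in> borel_measurable (\<alpha> \<Otimes>\<^sub>M \<sigma>)" by measurable
      show "integrable \<alpha> (\<lambda>z. \<integral>w. norm (log_dist (z, w)) \<partial>\<sigma>)"
      proof (rule \<alpha>.integrable_const_bound)
        show "AE z in \<alpha>. norm (\<integral>w. norm (log_dist (z, w)) \<partial>\<sigma>) \<le> 2 * (M + 1) + 1 / 2"
          using \<alpha>(3,4,5)
        proof eventually_elim
          fix z assume z: "z \<notin> V" "z \<notin> E" "cmod z \<le> M"
          have "0 \<le> (\<integral>w. norm (ln (cmod (z - w))) \<partial>\<sigma>)" by (rule integral_nonneg_AE) simp
          then show "norm (\<integral>w. norm (log_dist (z, w)) \<partial>\<sigma>) \<le> 2 * (M + 1) + 1 / 2"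
            using le[OF z(1,2)] z(3) unfolding fst_conv snd_conv by simp
        qed
      qed measurable
      show "AE z in \<alpha>. integrable \<sigma> (\<lambda>w. log_dist (z, w))"
        using \<alpha>(3,4) by eventually_elim (use P\<sigma>(1) in simp)
    qed
    have "AE z in \<alpha>. AE w in \<sigma>. fst (z, w) \<noteq> snd (z, w)" using AEne by simp
    then show "AE p in \<alpha> \<Otimes>\<^sub>M \<sigma>. fst p \<noteq> snd p"
      by (rule P.AE_pair_measure[rotated]) measurable
    have "(\<integral>p. log_dist p \<partial>(\<alpha> \<Otimes>\<^sub>M \<sigma>)) = (\<integral>z. \<integral>w. log_dist (z, w) \<partial>\<sigma> \<partial>\<alpha>)"
      by (rule P.integral_fst'[OF int', symmetric])
    also have "\<dots> = (\<integral>z. - disc_potential z \<partial>\<alpha>)"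
      by (rule integral_cong_AE, measurable, use \<alpha>(3,4) in eventually_elim) (use P\<sigma>(2) in simp)
    finally show "(\<integral>p. log_dist p \<partial>(\<alpha> \<Otimes>\<^sub>M \<sigma>)) = (\<integral>z. - disc_potential z \<partial>\<alpha>)" .
  qed
  have AEV: "AE w in \<sigma>. w \<notin> V" using AEc by eventually_elim simp
  note \<sigma>\<sigma> = mutual[OF s\<sigma> \<sigma>.prob_space_axioms AEV AEE AE1]
  define q where "q \<mu> = (\<integral>z. (cmod z)\<^sup>2 \<partial>\<mu>)" for \<mu> :: "complex measure"
  have R: "R_measure \<mu> = log_energy \<mu> + ereal (q \<mu>)" "integrable \<mu> (\<lambda>z. (cmod z)\<^sup>2)" if "\<mu> \<in> cprob UNIV" for \<mu>
    using log_energy_pos_fin(3,4)[OF that] by (auto simp: q_def)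
  have q\<sigma>: "q \<sigma> = Q"
  proof -
    have "AE w in m. norm ((cmod w)\<^sup>2) \<le> 1" using mf(3) by eventually_elim (auto simp: power_le_one)
    then have im: "integrable m (\<lambda>w. (cmod w)\<^sup>2)" by (rule m.integrable_const_bound) (simp add: measurable_cong_sets[OF mf(1) refl])
    have "AE w in \<nu>. norm ((cmod w)\<^sup>2) \<le> 1" using balayage_AE by eventually_elim (auto simp: power_le_one)
    then have in': "integrable \<nu> (\<lambda>w. (cmod w)\<^sup>2)" by (rule \<nu>.integrable_const_bound) (simp add: measurable_cong_sets[OF s\<nu> refl])
    show ?thesis unfolding q_def \<sigma>_def Q_def
      by (subst integral_add_measure(2)[OF mf(1) s\<nu> _ im in'], simp) (subst mf(6), simp_all)
  qed
  have L\<sigma>: "(\<integral>p. log_dist p \<partial>(\<sigma> \<Otimes>\<^sub>M \<sigma>)) = (Q - 1) / 2"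
  proof -
    have "(\<integral>z. - disc_potential z \<partial>\<sigma>) = (\<integral>z. ((cmod z)\<^sup>2 - 1) / 2 \<partial>\<sigma>)"
      by (rule integral_cong_AE, measurable, use AE1 in eventually_elim) (simp add: disc_potential_def minus_divide_left)
    also have "\<dots> = (q \<sigma> - 1) / 2" using R(2)[OF \<sigma>U] by (simp add: q_def \<sigma>.prob_space)
    finally show ?thesis using \<sigma>\<sigma>(3) q\<sigma> by simp
  qed
  have R\<sigma>: "R_measure \<sigma> = ereal (1 / 2 + Q / 2)"
    unfolding R(1)[OF \<sigma>U] log_energy_of_integrable[OF \<sigma>U \<sigma>\<sigma>(1,2)] L\<sigma> q\<sigma> by (simp add: field_simps)
  have min: "R_measure \<sigma> \<le> R_measure \<mu>" if \<mu>: "\<mu> \<in> cprob (- V)" for \<mu>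
  proof (cases "log_energy \<mu> = \<infinity>")
    case True
    have "\<mu> \<in> cprob UNIV" using \<mu> cprob_mono[of "- V" UNIV] by auto
    then show ?thesis using R(1)[of \<mu>] True by simp
  next
    case False
    have \<mu>U: "\<mu> \<in> cprob UNIV" using \<mu> cprob_mono[of "- V" UNIV] by auto
    note s\<mu> = cprobD(1,2)[OF \<mu>]
    note [measurable_cong] = s\<mu>(1)
    interpret \<mu>: prob_space \<mu> by (rule s\<mu>)
    obtain M K where M: "M > 0" "K \<subseteq> - V" "K \<subseteq> cball 0 M" "AE z in \<mu>. z \<in> K" using cprobD(3)[OF \<mu>] by blast
    have a: "AE z in \<mu>. z \<notin> V" and c: "AE z in \<mu>. cmod z \<le> M" using M(4) by (eventually_elim, use M in auto)+
    have b: "AE z in \<mu>. z \<notin> E" by (rule AE_not_in) (use polar_null_energy[OF \<mu>U False E(1,2)] E s\<mu> in \<open>simp add: null_sets_def\<close>)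
    note fin = log_energy_finite[OF \<mu>U False]
    note \<mu>\<sigma> = mutual[OF s\<mu> a b c]
    have ker: "(\<integral>p. log_dist p \<partial>(\<mu> \<Otimes>\<^sub>M \<mu>)) + (\<integral>p. log_dist p \<partial>(\<sigma> \<Otimes>\<^sub>M \<sigma>)) \<le> 2 * (\<integral>p. log_dist p \<partial>(\<mu> \<Otimes>\<^sub>M \<sigma>))"
      by (rule log_kernel_positive[OF s\<mu> s\<sigma> \<sigma>.prob_space_axioms fin(1,2) \<sigma>\<sigma>(1,2) \<mu>\<sigma>(1,2)])
    have "(\<integral>z. - disc_potential z \<partial>\<mu>) \<le> (\<integral>z. ((cmod z)\<^sup>2 - 1) / 2 \<partial>\<mu>)"
    proof (rule integral_mono)
      have "AE z in \<mu>. norm (- disc_potential z) \<le> M + 1"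
        using c
      proof eventually_elim
        fix z assume "cmod z \<le> M"
        then show "norm (- disc_potential z) \<le> M + 1"
          using disc_potential_bounds(2,3)[of z] M(1) unfolding real_norm_def by linarith
      qed
      then show "integrable \<mu> (\<lambda>z. - disc_potential z)" by (rule \<mu>.integrable_const_bound) measurable
      show "integrable \<mu> (\<lambda>z. ((cmod z)\<^sup>2 - 1) / 2)" using R(2)[OF \<mu>U] by simp
      show "- disc_potential z \<le> ((cmod z)\<^sup>2 - 1) / 2" for z using disc_potential_bounds(1)[of z] by simp
    qed
    also have "\<dots> = (q \<mu> - 1) / 2" using R(2)[OF \<mu>U] by (simp add: q_def \<mu>.prob_space)
    finally have "2 * (\<integral>p. log_dist p \<partial>(\<mu> \<Otimes>\<^sub>M \<sigma>)) \<le> q \<mu> - 1" using \<mu>\<sigma>(3) by simp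
    \<comment> \<open>Here \<open>a\<close> stands for the double integral of
      \<open>log_dist\<close> over the competitor with itself, \<open>c\<close> for the mutual one
      with \<open>\<sigma>\<close>, and \<open>r\<close> for the second moment of the
      competitor.\<close>
    moreover have "1 / 2 + Q / 2 \<le> - a + r" if "2 * c \<le> r - 1" "a + (Q - 1) / 2 \<le> 2 * c" for a c r :: real
      using that by (simp add: field_simps)
    ultimately have "1 / 2 + Q / 2 \<le> - (\<integral>p. log_dist p \<partial>(\<mu> \<Otimes>\<^sub>M \<mu>)) + q \<mu>" using ker unfolding L\<sigma> by blast
    then show ?thesis unfolding R\<sigma> R(1)[OF \<mu>U] fin(3) by simp
  qed
  have "R_set V = R_measure \<sigma>" unfolding R_set_def
    by (intro antisym INF_lower[OF \<sigma>V] INF_greatest min)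
  then show "R_set V = ereal (1 / 2 + Q / 2)" "\<exists>\<sigma>\<in>cprob (- V). R_measure \<sigma> = R_set V" using R\<sigma> \<sigma>V by auto
qed

end

text \<open>The explicit value of \<open>R_set\<close> has two parts. Balayage measures live on the
  closed unit disc, so their second moment is the integral of the bounded continuous function min
  (|z|^2) 1. Testing with the constant 1 gives convergence of the masses, that is, of the areas; as
  \<open>U\<close> is contained in \<open>Us n\<close>, the area in between tends to 0 and with it
  the difference of the uniform parts.\<close>

lemma R_set_convergence:
  assumes U: "open U" "U \<subseteq> ball 0 1"
    and Us: "\<And>n. open (Us n)" "\<And>n. closure U \<subseteq> Us n" "\<And>n. Us n \<subseteq> ball 0 1" "\<And>n. is_balayage (Us n) (\<nu>s n)"
    and \<nu>: "is_balayage U \<nu>" "weak_conv_c \<nu>s \<nu>"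
  shows "(\<lambda>n. R_set (Us n)) \<longlonglongrightarrow> R_set U"
proof -
  define A where "A V = (\<integral>z. indicator (ball 0 1 - V) z / pi * (cmod z)\<^sup>2 \<partial>lborel)" for V
  define B where "B N = (\<integral>z. (cmod z)\<^sup>2 \<partial>N)" for N :: "complex measure"
  have R: "R_set V = ereal (1 / 2 + (A V + B N) / 2)" if "open V" "V \<subseteq> ball 0 1" "is_balayage V N" for V N
    unfolding A_def B_def by (rule balayage_extremal(1)[OF that])
  have Bmin: "B N = (\<integral>z. min ((cmod z)\<^sup>2) 1 \<partial>N)" if V: "open V" "V \<subseteq> ball 0 1" "is_balayage V N" for V N
    unfolding B_def
  proof (rule integral_cong_AE)
    note [measurable_cong] = balayage_sets(1)[OF V]
    show "(\<lambda>z. (cmod z)\<^sup>2) \<in> borel_measurable N" "(\<lambda>z. min ((cmod z)\<^sup>2) 1) \<in> borel_measurable N" by measurable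
    show "AE z in N. (cmod z)\<^sup>2 = min ((cmod z)\<^sup>2) 1"
      using balayage_AE[OF V]
    proof eventually_elim
      fix z assume "z \<in> cball 0 1 - V"
      then have "cmod z \<le> 1" by simp
      then have "(cmod z)\<^sup>2 \<le> 1" by (simp add: power_le_one)
      then show "(cmod z)\<^sup>2 = min ((cmod z)\<^sup>2) 1" by simp
    qed
  qed
  have wc: "(\<lambda>n. \<integral>z. f z \<partial>\<nu>s n) \<longlonglongrightarrow> (\<integral>z. f z \<partial>\<nu>)" if "continuous_on UNIV f" "bounded (range f)" for f :: "complex \<Rightarrow> real"
    using \<nu>(2) that unfolding weak_conv_c_def by blast
  have "bounded (range (\<lambda>z::complex. min ((cmod z)\<^sup>2) 1))"
    by (rule boundedI[of _ 1]) (auto simp: min_def abs_of_nonneg)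
  then have "(\<lambda>n. \<integral>z. min ((cmod z)\<^sup>2) 1 \<partial>\<nu>s n) \<longlonglongrightarrow> (\<integral>z. min ((cmod z)\<^sup>2) 1 \<partial>\<nu>)"
    by (intro wc continuous_intros)
  then have Blim: "(\<lambda>n. B (\<nu>s n)) \<longlonglongrightarrow> B \<nu>"
    unfolding Bmin[OF U \<nu>(1)] Bmin[OF Us(1,3,4)] .
  have mass: "(\<integral>z. 1 \<partial>N) = measure lborel V / pi" if V: "open V" "V \<subseteq> ball 0 1" "is_balayage V N" for V N
    using balayage_mass[OF V] sets_eq_imp_space_eq[OF balayage_sets(1)[OF V]] by simp
  have "(\<lambda>n. \<integral>z. 1 \<partial>\<nu>s n) \<longlonglongrightarrow> (\<integral>z. (1::real) \<partial>\<nu>)"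
    by (rule wc) (auto intro: boundedI)
  then have mlim: "(\<lambda>n. measure lborel (Us n) / pi) \<longlonglongrightarrow> measure lborel U / pi"
    unfolding mass[OF U \<nu>(1)] mass[OF Us(1,3,4)] .
  have dist: "\<bar>A (Us n) - A U\<bar> \<le> measure lborel (Us n) / pi - measure lborel U / pi" for n
  proof -
    have sub: "U \<subseteq> Us n" using Us(2)[of n] closure_subset[of U] by blast
    have b[measurable]: "U \<in> sets borel" "Us n \<in> sets borel" using U(1) Us(1) by auto
    have ii: "integrable lborel (\<lambda>z. indicator W z / pi * (1::real))" if [measurable]: "W \<in> sets borel" and "W \<subseteq> ball 0 1" for W :: "complex set"
      using finite_measure_disc_part(4)[OF that] by (simp add: integrable_real_indicator)
    have ig: "integrable lborel (\<lambda>z. indicator W z / pi * (cmod z)\<^sup>2)" if [measurable]: "W \<in> sets borel" and W: "W \<subseteq> ball 0 1" for W :: "complex set"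
    proof (rule Bochner_Integration.integrable_bound[OF ii[OF that]])
      show "AE z in lborel. norm (indicator W z / pi * (cmod z)\<^sup>2) \<le> norm (indicator W z / pi * (1::real))"
      proof (rule AE_I2)
        fix z
        show "norm (indicator W z / pi * (cmod z)\<^sup>2) \<le> norm (indicator W z / pi * (1::real))"
        proof (cases "z \<in> W")
          case True
          then have "cmod z < 1" using W by auto
          then have "(cmod z)\<^sup>2 \<le> 1" by (simp add: power_le_one)
          then show ?thesis using True by (simp add: divide_right_mono)
        qed simp
      qed
    qed measurable
    have i1: "integrable lborel (\<lambda>z. indicator (ball 0 1 - U) z / pi * (cmod z)\<^sup>2)" "integrable lborel (\<lambda>z. indicator (ball 0 1 - Us n) z / pi * (cmod z)\<^sup>2)"
      by (rule ig; auto)+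
    have i2: "integrable lborel (\<lambda>z. indicator (Us n) z / pi * (1::real))" "integrable lborel (\<lambda>z. indicator U z / pi * (1::real))"
      by (rule ii[OF b(2) Us(3)], rule ii[OF b(1) U(2)])
    have pt: "0 \<le> indicator (ball 0 1 - U) z / pi * (cmod z)\<^sup>2 - indicator (ball 0 1 - Us n) z / pi * (cmod z)\<^sup>2"
      "indicator (ball 0 1 - U) z / pi * (cmod z)\<^sup>2 - indicator (ball 0 1 - Us n) z / pi * (cmod z)\<^sup>2 \<le> indicator (Us n) z / pi * 1 - indicator U z / pi * 1" for z
    proof -
      have "0 \<le> indicator (ball 0 1 - U) z / pi * (cmod z)\<^sup>2 - indicator (ball 0 1 - Us n) z / pi * (cmod z)\<^sup>2 \<and>
        indicator (ball 0 1 - U) z / pi * (cmod z)\<^sup>2 - indicator (ball 0 1 - Us n) z / pi * (cmod z)\<^sup>2 \<le> indicator (Us n) z / pi * 1 - indicator U z / pi * 1"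
      proof (cases "z \<in> Us n - U")
        case True
        then have "cmod z < 1" using Us(3)[of n] by auto
        then have "(cmod z)\<^sup>2 \<le> 1" by (simp add: power_le_one)
        then show ?thesis using True \<open>cmod z < 1\<close> by (simp add: divide_right_mono)
      next
        case False
        then have "(z \<in> U \<and> z \<in> Us n) \<or> (z \<notin> U \<and> z \<notin> Us n)" using sub by auto
        then show ?thesis by (auto simp: indicator_def)
      qed
      then show "0 \<le> indicator (ball 0 1 - U) z / pi * (cmod z)\<^sup>2 - indicator (ball 0 1 - Us n) z / pi * (cmod z)\<^sup>2"
      "indicator (ball 0 1 - U) z / pi * (cmod z)\<^sup>2 - indicator (ball 0 1 - Us n) z / pi * (cmod z)\<^sup>2 \<le> indicator (Us n) z / pi * 1 - indicator U z / pi * 1" by blast+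
    qed
    have d: "A U - A (Us n) = (\<integral>z. indicator (ball 0 1 - U) z / pi * (cmod z)\<^sup>2 - indicator (ball 0 1 - Us n) z / pi * (cmod z)\<^sup>2 \<partial>lborel)"
      unfolding A_def by (rule Bochner_Integration.integral_diff[OF i1, symmetric])
    have e: "measure lborel (Us n) / pi - measure lborel U / pi = (\<integral>z. indicator (Us n) z / pi * 1 - indicator U z / pi * 1 \<partial>lborel)"
      by (subst Bochner_Integration.integral_diff[OF i2]) simp
    have "0 \<le> A U - A (Us n)" unfolding d by (rule integral_nonneg_AE) (use pt(1) in simp)
    moreover have "A U - A (Us n) \<le> measure lborel (Us n) / pi - measure lborel U / pi"
      unfolding d e by (rule integral_mono[OF Bochner_Integration.integrable_diff[OF i1] Bochner_Integration.integrable_diff[OF i2] pt(2)])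
    ultimately show ?thesis by linarith
  qed
  have "(\<lambda>n. A (Us n)) \<longlonglongrightarrow> A U"
  proof (rule LIM_zero_cancel, rule Lim_null_comparison)
    show "\<forall>\<^sub>F n in sequentially. norm (A (Us n) - A U) \<le> measure lborel (Us n) / pi - measure lborel U / pi"
      using dist by simp
    show "(\<lambda>n. measure lborel (Us n) / pi - measure lborel U / pi) \<longlonglongrightarrow> 0" using mlim by (rule LIM_zero)
  qed
  then have "(\<lambda>n. 1 / 2 + (A (Us n) + B (\<nu>s n)) / 2) \<longlonglongrightarrow> 1 / 2 + (A U + B \<nu>) / 2"
    using Blim by (intro tendsto_intros) auto
  then show ?thesis unfolding R[OF U \<nu>(1)] R[OF Us(1,3,4)] by simp
qed

lemma polar_empty: "polar {}"
  by (auto simp: polar_def cprob_def)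

text \<open>The zero measure is a balayage of the empty set, so the general result also yields
  existence of a minimiser and finiteness for the problem without a hole.\<close>

lemma R_empty_attained: "R_empty = R_set {}" "\<exists>r. R_empty = ereal r" "\<exists>\<sigma>\<in>cprob UNIV. R_measure \<sigma> = R_empty"
proof -
  show 1: "R_empty = R_set {}" by (simp add: R_empty_def R_set_def)
  have "is_balayage {} (density lborel (\<lambda>_. ennreal 0))"
    unfolding is_balayage_def
  proof (intro conjI ballI impI)
    show "finite_measure (density lborel (\<lambda>_. ennreal 0) :: complex measure)"
      by (rule finite_measureI) (simp add: emeasure_density)
    show "emeasure (density lborel (\<lambda>_. ennreal 0)) B = 0" if "B \<in> sets borel" for B :: "complex set"
      using that by (simp add: emeasure_density)
    show "\<exists>E\<in>sets borel. polar E \<and> (\<forall>z\<in>- {} - E. integrable (density lborel (\<lambda>_. ennreal 0)) (\<lambda>w. ln (1 / cmod (z - w))) \<and>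
      (\<integral>w. ln (1 / cmod (z - w)) \<partial>density lborel (\<lambda>_. ennreal 0)) = 1 / pi * (LINT w:{}|lborel. ln (1 / cmod (z - w))))"
      using polar_empty by (intro bexI[of _ "{}"]) (simp_all add: integrable_real_density integral_real_density set_lebesgue_integral_def del: ennreal_0)
  qed (simp_all add: emeasure_density)
  note b = balayage_extremal[OF open_empty empty_subsetI this]
  show "\<exists>r. R_empty = ereal r" "\<exists>\<sigma>\<in>cprob UNIV. R_measure \<sigma> = R_empty" using b unfolding 1 by auto
qed

section \<open>Averaging a measure over small discs\<close>

abbreviation with_density :: "(complex \<Rightarrow> real) \<Rightarrow> complex measure" where
  "with_density \<rho> \<equiv> (density lborel (\<lambda>w. ennreal (\<rho> w)))"

text \<open>The new measure is the convolution of \<open>\<sigma>\<close> with the uniform measure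
  on a disc of radius \<open>e\<close>: mass is spread over area pi e^2, which bounds the density,
  and moves by less than \<open>e\<close>, which keeps it in \<open>S\<close>. The mean value
  inequality for the logarithm is applied to one variable and then to the other, so the double
  integral of the logarithm does not decrease.\<close>

lemma smear:
  assumes \<sigma>: "\<sigma> \<in> cprob UNIV" "log_energy \<sigma> \<noteq> \<infinity>" and K: "K \<subseteq> cball 0 M" "AE z in \<sigma>. z \<in> K" "0 < M"
    and e: "0 < e" "e \<le> 1" and S: "\<And>y w. y \<in> K \<Longrightarrow> cmod (w - y) < e \<Longrightarrow> w \<in> S"
  obtains \<rho> where "\<rho> \<in> borel_measurable borel" "\<And>w. 0 \<le> \<rho> w" "\<And>w. \<rho> w \<le> 1 / (pi * e\<^sup>2)" "\<And>w. w \<notin> S \<Longrightarrow> \<rho> w = (0::real)"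
    "prob_space (with_density \<rho>)"
    "\<And>m. integrable (with_density \<rho>) (\<lambda>w. ln (cmod (m - w)))"
    "integrable (with_density \<rho>) (\<lambda>m. \<integral>w. ln (cmod (m - w)) \<partial>density lborel (\<lambda>w. ennreal (\<rho> w)))"
    "integrable (with_density \<rho>) (\<lambda>w. (cmod w)\<^sup>2)"
    "(\<integral>p. log_dist p \<partial>(\<sigma> \<Otimes>\<^sub>M \<sigma>)) \<le> (\<integral>m. \<integral>w. ln (cmod (m - w)) \<partial>density lborel (\<lambda>w. ennreal (\<rho> w)) \<partial>density lborel (\<lambda>w. ennreal (\<rho> w)))"
    "(\<integral>w. (cmod w)\<^sup>2 \<partial>density lborel (\<lambda>w. ennreal (\<rho> w))) \<le> (\<integral>w. (cmod w)\<^sup>2 \<partial>\<sigma>) + (2 * M + 1) * e"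
proof -
  note s\<sigma>[measurable_cong] = cprobD(1)[OF \<sigma>(1)]
  interpret \<sigma>: prob_space \<sigma> by (rule cprobD[OF \<sigma>(1)])
  interpret U: prob_space "unif_disc e" by (rule prob_space_unif_disc[OF e(1)])
  interpret SU: pair_prob_space \<sigma> "unif_disc e" ..
  interpret SL: pair_sigma_finite \<sigma> "lborel :: complex measure" ..
  let ?c = "1 / (pi * e\<^sup>2)"
  have c0: "0 < ?c" using e by simp
  define \<rho> where "\<rho> w = (\<integral>y. indicator (ball 0 e) (w - y) \<partial>\<sigma>) * ?c" for w
  have \<rho>m[measurable]: "\<rho> \<in> borel_measurable borel" unfolding \<rho>_def by measurable
  have ib: "integrable \<sigma> (\<lambda>y. indicator (ball 0 e) (w - y) :: real)" for w
    by (rule \<sigma>.integrable_const_bound[where B=1]) (auto simp: indicator_def)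
  have in0: "0 \<le> (\<integral>y. indicator (ball 0 e) (w - y) \<partial>\<sigma> :: real)" for w by (rule integral_nonneg_AE) simp
  have in1: "(\<integral>y. indicator (ball 0 e) (w - y) \<partial>\<sigma> :: real) \<le> 1" for w
    by (rule \<sigma>.integral_le_const[OF ib]) (simp add: indicator_def)
  have \<rho>0: "0 \<le> \<rho> w" and \<rho>1: "\<rho> w \<le> ?c" for w
    unfolding \<rho>_def using mult_right_mono[OF in1[of w], of ?c] in0[of w] c0 by simp_all
  have \<rho>S: "\<rho> w = 0" if "w \<notin> S" for w
  proof -
    have "(\<integral>y. indicator (ball 0 e) (w - y) \<partial>\<sigma>) = (\<integral>y. 0 \<partial>\<sigma> :: real)"
      by (rule integral_cong_AE, measurable, use K(2) in eventually_elim) (use S that in \<open>auto simp: indicator_def\<close>)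
    then show ?thesis by (simp add: \<rho>_def)
  qed
  have \<rho>M: "\<rho> w = 0" if "M + e < cmod w" for w
  proof -
    have "(\<integral>y. indicator (ball 0 e) (w - y) \<partial>\<sigma>) = (\<integral>y. 0 \<partial>\<sigma> :: real)"
    proof (rule integral_cong_AE, measurable, use K(2) in eventually_elim)
      fix y assume "y \<in> K"
      then have "cmod y \<le> M" using K(1) by auto
      then have "\<not> cmod (w - y) < e" using that norm_triangle_ineq2[of w y] by linarith
      then show "indicator (ball 0 e) (w - y) = (0::real)" by simp
    qed
    then show ?thesis by (simp add: \<rho>_def)
  qed
  have \<rho>e: "ennreal (\<rho> w) = (\<integral>\<^sup>+y. ennreal (indicator (ball 0 e) (w - y) / (pi * e\<^sup>2)) \<partial>\<sigma>)" for w
  proof -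
    have "integrable \<sigma> (\<lambda>y. indicator (ball 0 e) (w - y) * ?c)" using ib by (rule integrable_mult_left)
    then have "(\<integral>\<^sup>+y. ennreal (indicator (ball 0 e) (w - y) * ?c) \<partial>\<sigma>) = ennreal (\<integral>y. indicator (ball 0 e) (w - y) * ?c \<partial>\<sigma>)"
      by (rule nn_integral_eq_integral) (use c0 in simp)
    also have "(\<integral>y. indicator (ball 0 e) (w - y) * ?c \<partial>\<sigma>) = \<rho> w" unfolding \<rho>_def by (rule integral_mult_left_zero)
    finally show ?thesis by simp
  qed
  define \<tau> where "\<tau> = density lborel (\<lambda>w. ennreal (\<rho> w))"
  have s\<tau>[measurable_cong]: "sets \<tau> = sets borel" by (simp add: \<tau>_def)
  \<comment> \<open>The density is suited to bounds, the law of a sum of two independent points to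
    comparing integrals over \<open>\<tau>\<close> and \<open>\<sigma>\<close>; both descriptions
    are used.\<close>
  have \<tau>_distr: "\<tau> = distr (\<sigma> \<Otimes>\<^sub>M unif_disc e) borel (\<lambda>p. fst p + snd p)"
  proof (rule measure_eqI)
    fix A assume "A \<in> sets \<tau>"
    then have A[measurable]: "A \<in> sets borel" using s\<tau> by simp
    let ?k = "\<lambda>u::complex. ennreal (indicator (ball 0 e) u / (pi * e\<^sup>2))"
    have "emeasure \<tau> A = (\<integral>\<^sup>+w. ennreal (\<rho> w) * indicator A w \<partial>lborel)" unfolding \<tau>_def by (rule emeasure_density) measurable
    also have "\<dots> = (\<integral>\<^sup>+w. \<integral>\<^sup>+y. ?k (w - y) * indicator A w \<partial>\<sigma> \<partial>lborel)"
      unfolding \<rho>e by (rule nn_integral_cong, rule nn_integral_multc[symmetric]) measurable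
    also have "\<dots> = (\<integral>\<^sup>+y. \<integral>\<^sup>+w. ?k (w - y) * indicator A w \<partial>lborel \<partial>\<sigma>)"
      by (rule SL.Fubini') measurable
    also have "\<dots> = (\<integral>\<^sup>+y. \<integral>\<^sup>+u. indicator A (y + u) \<partial>unif_disc e \<partial>\<sigma>)"
    proof (rule nn_integral_cong)
      fix y
      have m1: "(\<lambda>w. ?k (w - y) * indicator A w) \<in> borel_measurable borel" by measurable
      have "(\<integral>\<^sup>+w. ?k (w - y) * indicator A w \<partial>lborel) = (\<integral>\<^sup>+u. ?k ((1 * u + y) - y) * indicator A (1 * u + y) \<partial>lborel)"
        using nn_integral_complex_affine[OF _ m1, of 1 y] by simp
      also have "\<dots> = (\<integral>\<^sup>+u. ?k u * indicator A (y + u) \<partial>lborel)" by (simp add: add.commute)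
      also have "\<dots> = (\<integral>\<^sup>+u. indicator A (y + u) \<partial>unif_disc e)"
        unfolding unif_disc_def by (rule nn_integral_density[symmetric, OF unif_disc_density]) measurable
      finally show "(\<integral>\<^sup>+w. ?k (w - y) * indicator A w \<partial>lborel) = (\<integral>\<^sup>+u. indicator A (y + u) \<partial>unif_disc e)" .
    qed
    also have "\<dots> = (\<integral>\<^sup>+p. indicator A (fst p + snd p) \<partial>(\<sigma> \<Otimes>\<^sub>M unif_disc e))"
      using U.nn_integral_fst[of "\<lambda>p. indicator A (fst p + snd p)" \<sigma>] by simp
    also have "\<dots> = (\<integral>\<^sup>+w. indicator A w \<partial>distr (\<sigma> \<Otimes>\<^sub>M unif_disc e) borel (\<lambda>p. fst p + snd p))"
      by (rule nn_integral_distr[symmetric]) measurable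
    also have "\<dots> = emeasure (distr (\<sigma> \<Otimes>\<^sub>M unif_disc e) borel (\<lambda>p. fst p + snd p)) A" by (rule nn_integral_indicator) simp
    finally show "emeasure \<tau> A = emeasure (distr (\<sigma> \<Otimes>\<^sub>M unif_disc e) borel (\<lambda>p. fst p + snd p)) A" .
  qed (simp add: s\<tau>)
  interpret \<tau>: prob_space \<tau> unfolding \<tau>_distr by (rule SU.prob_space_distr) measurable
  have mass: "(\<integral>\<^sup>+w. ennreal (\<rho> w) \<partial>lborel) \<le> 1"
    using \<tau>.emeasure_space_1 unfolding \<tau>_def by (simp add: emeasure_density)
  have AE\<tau>: "AE w in \<tau>. cmod w \<le> M + 1"
    unfolding \<tau>_def
  proof (subst AE_density)
    show "AE w in lborel. 0 < ennreal (\<rho> w) \<longrightarrow> cmod w \<le> M + 1"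
      using \<rho>M e by (intro AE_I2) (metis add_left_mono ennreal_0 less_irrefl not_le order_trans)
  qed measurable
  define C where "C = ?c * (pi / 2) + (M + 1 + (M + 1))"
  have nnlog: "(\<integral>\<^sup>+w. ennreal \<bar>ln (cmod (m - w))\<bar> \<partial>\<tau>) \<le> ennreal (?c * (pi / 2) + (cmod m + (M + e)))" for m
  proof -
    have "0 \<le> M + e" using K(3) e(1) by linarith
    then show ?thesis unfolding \<tau>_def by (intro nn_integral_abs_log_le[OF \<rho>m \<rho>0 \<rho>1 \<rho>M _ mass])
  qed
  have ilog: "integrable \<tau> (\<lambda>w. ln (cmod (m - w)))" for m
  proof (rule integrableI_bounded)
    show "(\<integral>\<^sup>+w. ennreal (norm (ln (cmod (m - w)))) \<partial>\<tau>) < \<infinity>" unfolding real_norm_def using nnlog[of m] by (rule le_less_trans) simp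
  qed measurable
  have ilogC: "(\<integral>w. norm (ln (cmod (m - w))) \<partial>\<tau>) \<le> C" if "cmod m \<le> M + 1" for m
  proof -
    have "ennreal (\<integral>w. norm (ln (cmod (m - w))) \<partial>\<tau>) = (\<integral>\<^sup>+w. ennreal \<bar>ln (cmod (m - w))\<bar> \<partial>\<tau>)"
      using nn_integral_eq_integral[OF integrable_norm[OF ilog[of m]]] by simp
    also have "\<dots> \<le> ennreal (?c * (pi / 2) + (cmod m + (M + e)))" by (rule nnlog)
    also have "\<dots> \<le> ennreal C" unfolding C_def using that e by (intro ennreal_leI) simp
    finally show ?thesis using c0 K(3) by (subst (asm) ennreal_le_iff) (auto simp: C_def)
  qed
  define p where "p m = (\<integral>w. ln (cmod (m - w)) \<partial>\<tau>)" for m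
  have pm[measurable]: "p \<in> borel_measurable borel" unfolding p_def[abs_def] by measurable
  have pC: "norm (p m) \<le> C" if "cmod m \<le> M + 1" for m
    unfolding p_def using integral_norm_bound ilogC[OF that] by (rule order_trans)
  have ip: "integrable \<tau> p"
    by (rule \<tau>.integrable_const_bound[where B=C], use AE\<tau> in eventually_elim, rule pC, assumption, measurable)
  have AE\<sigma>: "AE w in \<sigma>. cmod w \<le> M" using K(2) by eventually_elim (use K(1) in auto)
  have ip\<sigma>: "integrable \<sigma> p"
    by (rule \<sigma>.integrable_const_bound[where B=C], use AE\<sigma> in eventually_elim, rule pC, simp, measurable)
  have iq: "integrable \<tau> (\<lambda>w. (cmod w)\<^sup>2)"
  proof (rule \<tau>.integrable_const_bound)
    show "AE w in \<tau>. norm ((cmod w)\<^sup>2) \<le> (M + 1)\<^sup>2" using AE\<tau> by eventually_elim (simp add: power_mono)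
  qed measurable
  have q: "(\<integral>w. (cmod w)\<^sup>2 \<partial>\<tau>) \<le> (\<integral>w. (cmod w)\<^sup>2 \<partial>\<sigma>) + (2 * M + 1) * e"
  proof -
    note iq\<sigma> = log_energy_pos_fin(4)[OF \<sigma>(1)]
    have i1: "integrable (\<sigma> \<Otimes>\<^sub>M unif_disc e) (\<lambda>p. (cmod (fst p + snd p))\<^sup>2)"
      using iq unfolding \<tau>_distr by (rule integrable_distr[rotated]) measurable
    have "(\<integral>w. (cmod w)\<^sup>2 \<partial>\<tau>) = (\<integral>p. (cmod (fst p + snd p))\<^sup>2 \<partial>(\<sigma> \<Otimes>\<^sub>M unif_disc e))"
      unfolding \<tau>_distr by (rule integral_distr) measurable
    also have "\<dots> = (\<integral>y. \<integral>u. (cmod (y + u))\<^sup>2 \<partial>unif_disc e \<partial>\<sigma>)"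
      using SU.integral_fst'[OF i1] by simp
    also have "\<dots> \<le> (\<integral>y. (cmod y)\<^sup>2 + (2 * M + 1) * e \<partial>\<sigma>)"
    proof (rule integral_mono_AE)
      show "integrable \<sigma> (\<lambda>y. \<integral>u. (cmod (y + u))\<^sup>2 \<partial>unif_disc e)" using SU.integrable_fst'[OF i1] by simp
      show "integrable \<sigma> (\<lambda>y. (cmod y)\<^sup>2 + (2 * M + 1) * e)" using iq\<sigma> by simp
      show "AE y in \<sigma>. (\<integral>u. (cmod (y + u))\<^sup>2 \<partial>unif_disc e) \<le> (cmod y)\<^sup>2 + (2 * M + 1) * e"
        using AE\<sigma>
      proof eventually_elim
        fix y assume y: "cmod y \<le> M"
        have b: "AE u in unif_disc e. (cmod (y + u))\<^sup>2 \<le> (cmod y)\<^sup>2 + (2 * M + 1) * e"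
          using AE_unif_disc[of e]
        proof eventually_elim
          fix u assume "cmod u < e"
          then have "cmod (y + u) \<le> cmod y + e" using norm_triangle_ineq[of y u] by linarith
          then have "(cmod (y + u))\<^sup>2 \<le> (cmod y + e)\<^sup>2" by (intro power_mono) auto
          also have "\<dots> = (cmod y)\<^sup>2 + 2 * (cmod y * e) + e * e" by (simp add: power2_eq_square algebra_simps)
          also have "\<dots> \<le> (cmod y)\<^sup>2 + 2 * (M * e) + 1 * e"
            using y e by (intro add_mono mult_left_mono mult_right_mono) auto
          finally show "(cmod (y + u))\<^sup>2 \<le> (cmod y)\<^sup>2 + (2 * M + 1) * e" by (simp add: algebra_simps)
        qed
        then have "integrable (unif_disc e) (\<lambda>u. (cmod (y + u))\<^sup>2)"
          by (intro U.integrable_const_bound[where B="(cmod y)\<^sup>2 + (2 * M + 1) * e"]) auto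
        then show "(\<integral>u. (cmod (y + u))\<^sup>2 \<partial>unif_disc e) \<le> (cmod y)\<^sup>2 + (2 * M + 1) * e"
          using b by (rule U.integral_le_const)
      qed
    qed
    also have "\<dots> = (\<integral>w. (cmod w)\<^sup>2 \<partial>\<sigma>) + (2 * M + 1) * e" using iq\<sigma> by (simp add: \<sigma>.prob_space)
    finally show ?thesis .
  qed
  \<comment> \<open>The mean value inequality is false at the pole, where \<open>ln 0 = 0\<close>.
    Finite energy excludes atoms because single points are polar.\<close>
  have noatom: "AE y in \<sigma>. y \<noteq> m" for m
  proof -
    have "emeasure \<sigma> {m} = 0" by (rule polar_null_energy[OF \<sigma> _ polar_singleton]) simp
    then have "AE y in \<sigma>. y \<notin> {m}" by (intro AE_not_in) (simp add: null_sets_def s\<sigma>)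
    then show ?thesis by simp
  qed
  have super: "(\<integral>y. ln (cmod (m - y)) \<partial>\<sigma>) \<le> p m" if im: "integrable \<sigma> (\<lambda>y. ln (cmod (m - y)))" for m
  proof -
    have i1: "integrable (\<sigma> \<Otimes>\<^sub>M unif_disc e) (\<lambda>p. ln (cmod (m - (fst p + snd p))))"
      using ilog[of m] unfolding \<tau>_distr by (rule integrable_distr[rotated]) measurable
    have "(\<integral>y. ln (cmod (m - y)) \<partial>\<sigma>) \<le> (\<integral>y. \<integral>u. ln (cmod ((m - y) - u)) \<partial>unif_disc e \<partial>\<sigma>)"
    proof (rule integral_mono_AE[OF im])
      show "integrable \<sigma> (\<lambda>y. \<integral>u. ln (cmod ((m - y) - u)) \<partial>unif_disc e)" using SU.integrable_fst'[OF i1] by (simp add: algebra_simps)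
      show "AE y in \<sigma>. ln (cmod (m - y)) \<le> (\<integral>u. ln (cmod ((m - y) - u)) \<partial>unif_disc e)"
        using noatom[of m] by eventually_elim (rule unif_disc_log_mean_ge[OF e(1)], simp)
    qed
    also have "\<dots> = (\<integral>p. ln (cmod (m - (fst p + snd p))) \<partial>(\<sigma> \<Otimes>\<^sub>M unif_disc e))"
      using SU.integral_fst'[OF i1] by (simp add: algebra_simps)
    also have "\<dots> = p m" unfolding p_def \<tau>_distr by (rule integral_distr[symmetric]) measurable
    finally show ?thesis .
  qed
  interpret ST: pair_prob_space \<sigma> \<tau> ..
  interpret SS: pair_prob_space \<sigma> \<sigma> ..
  have iST: "integrable (\<sigma> \<Otimes>\<^sub>M \<tau>) (\<lambda>(y, m). ln (cmod (m - y)))"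
  proof (rule ST.Fubini_integrable)
    show "integrable \<sigma> (\<lambda>y. \<integral>m. norm (case (y, m) of (y, m) \<Rightarrow> ln (cmod (m - y))) \<partial>\<tau>)"
    proof (rule \<sigma>.integrable_const_bound[where B=C])
      show "AE y in \<sigma>. norm (\<integral>m. norm (case (y, m) of (y, m) \<Rightarrow> ln (cmod (m - y))) \<partial>\<tau>) \<le> C"
        using AE\<sigma>
      proof eventually_elim
        fix y assume "cmod y \<le> M"
        then have "(\<integral>m. norm (ln (cmod (y - m))) \<partial>\<tau>) \<le> C" by (intro ilogC) simp
        moreover have "0 \<le> (\<integral>m. norm (ln (cmod (y - m))) \<partial>\<tau>)" by (rule integral_nonneg_AE) simp
        ultimately show "norm (\<integral>m. norm (case (y, m) of (y, m) \<Rightarrow> ln (cmod (m - y))) \<partial>\<tau>) \<le> C"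
          unfolding prod.case norm_minus_commute[of _ y] real_norm_def by simp
      qed
    qed measurable
    show "AE y in \<sigma>. integrable \<tau> (\<lambda>m. case (y, m) of (y, m) \<Rightarrow> ln (cmod (m - y)))"
      using ilog by (simp add: norm_minus_commute)
  qed measurable
  have i\<sigma>m: "AE m in \<tau>. integrable \<sigma> (\<lambda>y. ln (cmod (m - y)))"
    using ST.AE_integrable_snd[OF iST] .
  note \<sigma>\<sigma> = log_energy_finite[OF \<sigma>]
  have "(\<integral>p. log_dist p \<partial>(\<sigma> \<Otimes>\<^sub>M \<sigma>)) = (\<integral>m. \<integral>y. ln (cmod (m - y)) \<partial>\<sigma> \<partial>\<sigma>)"
    using SS.integral_fst'[OF \<sigma>\<sigma>(1)] by simp
  also have "\<dots> \<le> (\<integral>m. p m \<partial>\<sigma>)"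
  proof (rule integral_mono_AE[OF _ ip\<sigma>])
    show "integrable \<sigma> (\<lambda>m. \<integral>y. ln (cmod (m - y)) \<partial>\<sigma>)" using SS.integrable_fst'[OF \<sigma>\<sigma>(1)] by simp
    have "AE m in \<sigma>. integrable \<sigma> (\<lambda>y. log_dist (m, y))" using SS.AE_integrable_fst'[OF \<sigma>\<sigma>(1)] .
    then show "AE m in \<sigma>. (\<integral>y. ln (cmod (m - y)) \<partial>\<sigma>) \<le> p m" by eventually_elim (rule super, simp)
  qed
  also have "\<dots> = (\<integral>y. \<integral>m. ln (cmod (m - y)) \<partial>\<tau> \<partial>\<sigma>)" unfolding p_def by (simp add: norm_minus_commute)
  \<comment> \<open>After the exchange of the integrals the still unsmoothed variable is the inner
    one, and the mean value inequality applies a second time.\<close>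
  also have "\<dots> = (\<integral>m. \<integral>y. ln (cmod (m - y)) \<partial>\<sigma> \<partial>\<tau>)" by (rule ST.Fubini_integral[OF iST, symmetric])
  also have "\<dots> \<le> (\<integral>m. p m \<partial>\<tau>)"
  proof (rule integral_mono_AE[OF _ ip])
    show "integrable \<tau> (\<lambda>m. \<integral>y. ln (cmod (m - y)) \<partial>\<sigma>)" by (rule ST.integrable_snd[OF iST])
    show "AE m in \<tau>. (\<integral>y. ln (cmod (m - y)) \<partial>\<sigma>) \<le> p m" using i\<sigma>m by eventually_elim (rule super)
  qed
  finally have en: "(\<integral>p. log_dist p \<partial>(\<sigma> \<Otimes>\<^sub>M \<sigma>)) \<le> (\<integral>m. p m \<partial>\<tau>)" .
  show ?thesis
    by (rule that[of \<rho>]) (fold \<tau>_def, (fact \<rho>m \<rho>0 \<rho>1 \<rho>S \<tau>.prob_space_axioms ilog iq q ip[unfolded p_def[abs_def]] en[unfolded p_def])+)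
qed

section \<open>The hole probability\<close>

text \<open>The normalisation \<open>G_const\<close> is never evaluated: it enters the bounds for \<open>- U\<close> and for the
  whole plane in the same way and cancels in the quotient, which is the hole probability.\<close>

definition lower_rate :: "complex set \<Rightarrow> real \<Rightarrow> bool" where
  "lower_rate S R \<longleftrightarrow> (\<exists>c. \<forall>n>0. G_const (sqrt (real n)) n 0 * ennreal (exp (- R * (real n)\<^sup>2 - c * real n))
      \<le> fact n * B_int (sqrt (real n)) n S [])"

text \<open>Smoothing does not worsen the logarithmic part and raises the second moment by at most
  \<open>\<eta>\<close>. The resulting bounded density meets the hypotheses of
  \<open>B_int_lower\<close>; the distance \<open>d\<close> from the support to the complement of
  \<open>S\<close> makes room for it.\<close>

lemma lower_rateI:
  assumes S: "closed S" and \<sigma>: "\<sigma> \<in> cprob E" and R: "R_measure \<sigma> = ereal R" and \<eta>: "0 < \<eta>"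
    and d: "0 < d" and sep: "\<And>y w. y \<in> E \<Longrightarrow> dist w y < d \<Longrightarrow> w \<in> S"
  shows "lower_rate S (R + \<eta>)"
proof -
  have \<sigma>U: "\<sigma> \<in> cprob UNIV" using \<sigma> cprob_mono[of E UNIV] by auto
  note RR = log_energy_pos_fin(3)[OF \<sigma>U]
  have fin: "log_energy \<sigma> \<noteq> \<infinity>" using R unfolding RR by auto
  obtain M K where K: "0 < M" "K \<subseteq> E" "K \<subseteq> cball 0 M" "AE z in \<sigma>. z \<in> K" using cprobD(3)[OF \<sigma>] by blast
  \<comment> \<open>The three terms keep the smoothed measure in \<open>S\<close>, satisfy the size
    condition of \<open>smear\<close>, and hold the increase (2 M + 1) e of the second moment below
    \<open>\<eta>\<close>.\<close>
  define e where "e = min (min d 1) (\<eta> / (2 * M + 1))"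
  have e: "0 < e" "e \<le> 1" "e \<le> d" using d \<eta> K(1) by (auto simp: e_def)
  have "(2 * M + 1) * e \<le> (2 * M + 1) * (\<eta> / (2 * M + 1))" using K(1) by (intro mult_left_mono) (auto simp: e_def)
  then have e\<eta>: "(2 * M + 1) * e \<le> \<eta>" using K(1) by simp
  define L where "L = (\<integral>p. log_dist p \<partial>(\<sigma> \<Otimes>\<^sub>M \<sigma>))"
  define q where "q = (\<integral>w. (cmod w)\<^sup>2 \<partial>\<sigma>)"
  have Lq: "R = - L + q" using R unfolding RR log_energy_finite(3)[OF \<sigma>U fin] L_def q_def by simp
  have sep': "w \<in> S" if "y \<in> K" "cmod (w - y) < e" for y w
    using that K(2) e(3) by (intro sep[of y]) (auto simp: dist_norm)
  obtain \<rho> where \<rho>: "\<rho> \<in> borel_measurable borel" "\<And>w. 0 \<le> \<rho> w" "\<And>w. \<rho> w \<le> 1 / (pi * e\<^sup>2)" "\<And>w. w \<notin> S \<Longrightarrow> \<rho> w = (0::real)"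
    "prob_space (with_density \<rho>)"
    "\<And>m. integrable (with_density \<rho>) (\<lambda>w. ln (cmod (m - w)))"
    "integrable (with_density \<rho>) (\<lambda>m. \<integral>w. ln (cmod (m - w)) \<partial>density lborel (\<lambda>w. ennreal (\<rho> w)))"
    "integrable (with_density \<rho>) (\<lambda>w. (cmod w)\<^sup>2)"
    "(\<integral>p. log_dist p \<partial>(\<sigma> \<Otimes>\<^sub>M \<sigma>)) \<le> (\<integral>m. \<integral>w. ln (cmod (m - w)) \<partial>density lborel (\<lambda>w. ennreal (\<rho> w)) \<partial>density lborel (\<lambda>w. ennreal (\<rho> w)))"
    "(\<integral>w. (cmod w)\<^sup>2 \<partial>density lborel (\<lambda>w. ennreal (\<rho> w))) \<le> (\<integral>w. (cmod w)\<^sup>2 \<partial>\<sigma>) + (2 * M + 1) * e"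
    by (rule smear[OF \<sigma>U fin K(3,4,1) e(1,2) sep']) (assumption | rule that; simp)+
  define \<tau> where "\<tau> = density lborel (\<lambda>w. ennreal (\<rho> w))"
  define p where "p m = (\<integral>w. ln (cmod (m - w)) \<partial>\<tau>)" for m
  define P where "P = (\<integral>m. p m \<partial>\<tau>)"
  define Q where "Q = (\<integral>w. (cmod w)\<^sup>2 \<partial>\<tau>)"
  define C where "C = ln (1 / (pi * e\<^sup>2))"
  have P: "L \<le> P" using \<rho>(9) unfolding L_def P_def p_def \<tau>_def .
  have Q: "Q \<le> q + \<eta>" using \<rho>(10) e\<eta> unfolding Q_def q_def \<tau>_def by linarith
  show ?thesis unfolding lower_rate_def
  \<comment> \<open>\<open>L\<close> is the linear term caused by n (n - 1) instead of n^2, and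
    \<open>C\<close> is the cost per step of the density bound.\<close>
  proof (intro exI[of _ "L + C"] allI impI)
    fix n :: nat assume n: "n > 0"
    have s: "0 < sqrt (real n)" using n by simp
    have "G_const (sqrt n) n (length ([] :: complex list)) * ennreal (exp (real n * (2 * (\<Sum>m\<leftarrow>[]. p m)) + real n * (real n - 1) * (\<integral>w. p w \<partial>\<tau>) - (sqrt n)\<^sup>2 * real n * (\<integral>w. (cmod w)\<^sup>2 \<partial>\<tau>) - real n * C))
      \<le> fact n * B_int (sqrt n) n S []"
      unfolding C_def
    proof (rule B_int_lower[OF s S \<rho>(1,2,3,4) _ \<tau>_def])
      show "0 < 1 / (pi * e\<^sup>2)" using e by simp
      show "prob_space \<tau>" unfolding \<tau>_def by (rule \<rho>(5))
      show "integrable \<tau> (\<lambda>w. ln (cmod (m - w)))" for m unfolding \<tau>_def by (rule \<rho>(6))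
      show "p m = (\<integral>w. ln (cmod (m - w)) \<partial>\<tau>)" for m by (rule p_def)
      show "integrable \<tau> p" unfolding p_def[abs_def] \<tau>_def by (rule \<rho>(7))
      show "integrable \<tau> (\<lambda>w. (cmod w)\<^sup>2)" unfolding \<tau>_def by (rule \<rho>(8))
    qed
    then have le: "G_const (sqrt n) n 0 * ennreal (exp (real n * (real n - 1) * P - real n * real n * Q - real n * C)) \<le> fact n * B_int (sqrt n) n S []"
      by (simp add: P_def Q_def)
    have "real n * (real n - 1) * L \<le> real n * (real n - 1) * P" using P n by (intro mult_left_mono) simp_all
    moreover have "real n * real n * Q \<le> real n * real n * (q + \<eta>)" using Q by (intro mult_left_mono) simp_all
    moreover have "real n * (real n - 1) * L - real n * real n * (q + \<eta>) - real n * C = - (R + \<eta>) * (real n)\<^sup>2 - (L + C) * real n"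
      unfolding Lq by (simp add: algebra_simps power2_eq_square)
    ultimately have "- (R + \<eta>) * (real n)\<^sup>2 - (L + C) * real n \<le> real n * (real n - 1) * P - real n * real n * Q - real n * C" by linarith
    then have "ennreal (exp (- (R + \<eta>) * (real n)\<^sup>2 - (L + C) * real n)) \<le> ennreal (exp (real n * (real n - 1) * P - real n * real n * Q - real n * C))"
      by (intro ennreal_leI) simp
    then have "G_const (sqrt n) n 0 * ennreal (exp (- (R + \<eta>) * (real n)\<^sup>2 - (L + C) * real n)) \<le> G_const (sqrt n) n 0 * ennreal (exp (real n * (real n - 1) * P - real n * real n * Q - real n * C))"
      by (rule mult_left_mono) simp
    also note le
    finally show "G_const (sqrt (real n)) n 0 * ennreal (exp (- (R + \<eta>) * (real n)\<^sup>2 - (L + C) * real n)) \<le> fact n * B_int (sqrt (real n)) n S []" .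
  qed
qed

text \<open>For s^2 = N the strength of \<open>T_weight\<close> is N - 1, so the weight is at most
  exp of minus the discrete energy and \<open>disc_energy_lower_bound\<close> applies. The factor
  pi^N is negligible on the scale N^2.\<close>

lemma upper_rate:
  assumes S: "closed S" and R: "ereal R < (INF \<mu>\<in>cprob S. R_measure \<mu>)"
  shows "\<exists>N0. \<forall>N\<ge>N0. 0 < N \<longrightarrow> B_int (sqrt (real N)) N S [] \<le> G_const (sqrt (real N)) N 0 * (ennreal pi ^ N * ennreal (exp (- R * (real N)\<^sup>2)))"
proof -
  obtain N0 where N0: "\<And>N Z. N \<ge> N0 \<Longrightarrow> finite Z \<Longrightarrow> Z \<subseteq> S \<Longrightarrow> card Z = N \<Longrightarrow> R * (real N)\<^sup>2 \<le> disc_energy Z"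
    using disc_energy_lower_bound[OF S R] by blast
  have "B_int (sqrt (real N)) N S [] \<le> G_const (sqrt (real N)) N 0 * (ennreal pi ^ N * ennreal (exp (- R * (real N)\<^sup>2)))"
    if N: "N \<ge> N0" "0 < N" for N
  proof -
    have "B_int (sqrt (real N)) N S [] * ennreal (T_weight ((sqrt (real N))\<^sup>2 - 1) []) \<le> G_const (sqrt (real N)) N (length ([]::complex list)) * (ennreal pi ^ N * ennreal (exp (- R * (real N)\<^sup>2)))"
    proof (rule B_int_upper[OF _ S])
      fix zs :: "complex list" assume zs: "length zs = N" "set zs \<subseteq> S"
      show "T_weight ((sqrt (real N))\<^sup>2 - 1) (zs @ []) \<le> exp (- R * (real N)\<^sup>2)"
      proof (cases "T_weight (real N - 1) zs = 0")
        case False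
        then have "card (set zs) = N" using T_weight_energy[OF zs(1)] by blast
        then have "R * (real N)\<^sup>2 \<le> disc_energy (set zs)" using N0[OF N(1), of "set zs"] zs(2) by simp
        then have "exp (- disc_energy (set zs)) \<le> exp (- R * (real N)\<^sup>2)" by simp
        moreover have "T_weight (real N - 1) zs \<le> exp (- disc_energy (set zs))" using T_weight_energy[OF zs(1)] by blast
        ultimately have "T_weight (real N - 1) zs \<le> exp (- R * (real N)\<^sup>2)" by (rule order_trans[rotated])
        then show ?thesis by simp
      qed simp
    qed (use N in simp_all)
    then show ?thesis by simp
  qed
  then show ?thesis by blast
qed

lemma ln_fact_le: "ln (fact n) \<le> real n * ln (real n)"
proof (cases "n = 0")
  case False
  have "(fact n :: real) \<le> real (n ^ n)" by (rule fact_le_power)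
  then have "ln (fact n) \<le> ln (real n ^ n)" using False by (subst ln_le_cancel_iff) auto
  then show ?thesis using False by (simp add: ln_realpow)
qed simp

text \<open>One set is estimated from above and the other from below, so \<open>G_const\<close>
  cancels. The lemma is applied twice, to the complement of the hole against the whole plane and
  with the roles exchanged. The term n ln n is the price of \<open>fact n\<close>.\<close>

lemma rate_ratio:
  assumes S1: "closed S1" and R1: "ereal R1 < (INF \<mu>\<in>cprob S1. R_measure \<mu>)" and S2: "lower_rate S2 R2"
  shows "\<exists>c N0. \<forall>n\<ge>N0. 0 < n \<longrightarrow> B_int (sqrt (real n)) n S1 [] \<le> ennreal (exp ((R2 - R1) * (real n)\<^sup>2 + c * real n + real n * ln (real n))) * B_int (sqrt (real n)) n S2 []"
proof -
  obtain N0 where u: "\<And>n. n \<ge> N0 \<Longrightarrow> 0 < n \<Longrightarrow> B_int (sqrt (real n)) n S1 [] \<le> G_const (sqrt (real n)) n 0 * (ennreal pi ^ n * ennreal (exp (- R1 * (real n)\<^sup>2)))"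
    using upper_rate[OF S1 R1] by blast
  obtain c where l: "\<And>n. n > 0 \<Longrightarrow> G_const (sqrt (real n)) n 0 * ennreal (exp (- R2 * (real n)\<^sup>2 - c * real n)) \<le> fact n * B_int (sqrt (real n)) n S2 []"
    using S2 unfolding lower_rate_def by blast
  have "B_int (sqrt (real n)) n S1 [] \<le> ennreal (exp ((R2 - R1) * (real n)\<^sup>2 + (c + ln pi) * real n + real n * ln (real n))) * B_int (sqrt (real n)) n S2 []"
    if n: "n \<ge> N0" "0 < n" for n
  proof -
    let ?G = "G_const (sqrt (real n)) n 0"
    let ?B = "B_int (sqrt (real n)) n S2 []"
    let ?x = "exp ((R2 - R1) * (real n)\<^sup>2 + (c + ln pi) * real n)"
    have "pi ^ n * exp (- R1 * (real n)\<^sup>2) = ?x * exp (- R2 * (real n)\<^sup>2 - c * real n)"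
    proof -
      have "pi ^ n = exp (ln pi * real n)" by (simp add: exp_of_nat2_mult)
      then show ?thesis by (simp add: algebra_simps flip: exp_add)
    qed
    then have eq: "ennreal pi ^ n * ennreal (exp (- R1 * (real n)\<^sup>2)) = ennreal ?x * ennreal (exp (- R2 * (real n)\<^sup>2 - c * real n))"
      by (simp add: ennreal_power ennreal_mult[symmetric])
    have "B_int (sqrt (real n)) n S1 [] \<le> ?G * (ennreal pi ^ n * ennreal (exp (- R1 * (real n)\<^sup>2)))" by (rule u[OF n])
    also have "\<dots> = ennreal ?x * (?G * ennreal (exp (- R2 * (real n)\<^sup>2 - c * real n)))" unfolding eq by (simp only: mult_ac)
    also have "\<dots> \<le> ennreal ?x * (fact n * ?B)" by (rule mult_left_mono[OF l[OF n(2)]]) simp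
    also have "\<dots> = ennreal (?x * fact n) * ?B"
    proof -
      have "(fact n :: ennreal) = ennreal (fact n)" using ennreal_of_nat_eq_real_of_nat[of "fact n"] by simp
      then show ?thesis by (simp add: ennreal_mult mult.assoc)
    qed
    also have "\<dots> \<le> ennreal (exp ((R2 - R1) * (real n)\<^sup>2 + (c + ln pi) * real n + real n * ln (real n))) * ?B"
    proof (intro mult_right_mono ennreal_leI)
      have "fact n \<le> exp (real n * ln (real n))" using ln_fact_le[of n] by (metis exp_le_cancel_iff exp_ln fact_gt_zero)
      then have "?x * fact n \<le> ?x * exp (real n * ln (real n))" by (rule mult_left_mono) simp
      then show "?x * fact n \<le> exp ((R2 - R1) * (real n)\<^sup>2 + (c + ln pi) * real n + real n * ln (real n))" by (simp add: exp_add)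
    qed simp
    finally show ?thesis .
  qed
  then show ?thesis by blast
qed

lemma rate_error: "(\<lambda>n. (c * real n + real n * ln (real n)) / (real n)\<^sup>2) \<longlonglongrightarrow> 0"
  by real_asymp

lemma lower_rate_UNIV:
  assumes "R_empty = ereal r" "0 < \<eta>"
  shows "lower_rate UNIV (r + \<eta>)"
proof -
  obtain \<sigma> where "\<sigma> \<in> cprob UNIV" "R_measure \<sigma> = ereal r" using R_empty_attained(3) assms(1) by auto
  from lower_rateI[OF closed_UNIV this assms(2), of 1] show ?thesis by simp
qed

lemma lower_rate_hole:
  assumes U: "open U" "U \<subseteq> ball 0 1"
    and Us: "\<And>n. open (Us n)" "\<And>n. closure U \<subseteq> Us n" "\<And>n. Us n \<subseteq> ball 0 1" "\<And>n. is_balayage (Us n) (\<nu>s n)"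
    and \<nu>: "is_balayage U \<nu>" "weak_conv_c \<nu>s \<nu>"
    and r: "R_set U = ereal r" and \<eta>: "0 < \<eta>"
  shows "lower_rate (- U) (r + \<eta>)"
proof -
  have "(\<lambda>n. R_set (Us n)) \<longlonglongrightarrow> ereal r"
    unfolding r[symmetric] by (rule R_set_convergence[OF U Us \<nu>])
  moreover have "ereal r < ereal (r + \<eta>)" using \<eta> by simp
  ultimately have "\<forall>\<^sub>F n in sequentially. R_set (Us n) < ereal (r + \<eta>)" by (rule order_tendstoD(2))
  \<comment> \<open>One set of the sequence is enough: its minimum exceeds that of \<open>U\<close>
    by less than \<open>\<eta>\<close>.\<close>
  then obtain n where n: "R_set (Us n) < ereal (r + \<eta>)" by (auto dest: eventually_happens)
  obtain r' where r': "R_set (Us n) = ereal r'" using balayage_extremal(1)[OF Us(1,3,4)] by blast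
  obtain \<sigma> where \<sigma>: "\<sigma> \<in> cprob (- Us n)" "R_measure \<sigma> = ereal r'" using balayage_extremal(2)[OF Us(1,3,4), of n] r' by auto
  have "bounded U" using U(2) bounded_ball bounded_subset by blast
  then have "compact (closure U)" by (simp add: compact_closure)
  moreover have "closed (- Us n)" using Us(1) by (simp add: closed_Compl)
  moreover have "closure U \<inter> - Us n = {}" using Us(2) by blast
  \<comment> \<open>Here the inclusion of the closure enters: the compact closure of
    \<open>U\<close> has positive distance from the closed complement of \<open>Us n\<close>, where
    the minimiser lives.\<close>
  ultimately obtain d where d: "0 < d" "\<And>x y. x \<in> closure U \<Longrightarrow> y \<in> - Us n \<Longrightarrow> d \<le> dist x y"
    using separate_compact_closed[of "closure U" "- Us n"] by blast
  have sep: "w \<in> - U" if "y \<in> - Us n" "dist w y < d" for y w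
  proof
    assume "w \<in> U"
    then have "d \<le> dist w y" using closure_subset that(1) by (intro d(2)) auto
    then show False using that(2) by simp
  qed
  have "closed (- U)" using U(1) by (simp add: closed_Compl)
  moreover have "0 < r + \<eta> - r'" using n r' by simp
  ultimately have "lower_rate (- U) (r' + (r + \<eta> - r'))"
    by (intro lower_rateI[OF _ \<sigma> _ d(1) sep])
  then show ?thesis by simp
qed

theorem theorem1p4:
  fixes U :: "complex set"
  assumes "open U" and "U \<subseteq> ball 0 1"
    and "\<exists>Us :: nat \<Rightarrow> complex set. \<exists>\<nu>s \<nu>.
           (\<forall>n. open (Us n) \<and> closure U \<subseteq> Us n \<and> Us n \<subseteq> ball 0 1 \<and> is_balayage (Us n) (\<nu>s n)) \<and>
           is_balayage U \<nu> \<and> weak_conv_c \<nu>s \<nu>"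
  shows "(\<lambda>n. ereal (ln (hole_prob n U) / (real n)^2)) \<longlonglongrightarrow> R_empty - R_set U"
proof -
  obtain Us \<nu>s \<nu> where Us: "\<And>n. open (Us n)" "\<And>n. closure U \<subseteq> Us n" "\<And>n. Us n \<subseteq> ball 0 1" "\<And>n. is_balayage (Us n) (\<nu>s n)"
    and \<nu>: "is_balayage U \<nu>" "weak_conv_c \<nu>s \<nu>" using assms(3) by blast
  obtain r0 where r0: "R_empty = ereal r0" using R_empty_attained(2) by blast
  obtain r where r: "R_set U = ereal r" using balayage_extremal(1)[OF assms(1,2) \<nu>(1)] by blast
  have cl: "closed (- U)" using assms(1) by (simp add: closed_Compl)
  have B: "B_int (sqrt (real n)) n (- U) [] = ennreal (hole_prob n U) * B_int (sqrt (real n)) n UNIV []"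
    "B_int (sqrt (real n)) n UNIV [] = ennreal (pi ^ (n * n))" if n: "0 < n" for n
  proof -
    note h = hole_prob_eq[OF assms(1) n]
    show b: "B_int (sqrt (real n)) n UNIV [] = ennreal (pi ^ (n * n))" by (rule h(2))
    have "ennreal (1 / pi ^ (n * n)) * ennreal (pi ^ (n * n)) = 1" by (simp add: ennreal_mult[symmetric])
    then show "B_int (sqrt (real n)) n (- U) [] = ennreal (hole_prob n U) * B_int (sqrt (real n)) n UNIV []"
      unfolding h(1) b by (simp only: mult.assoc mult_1_right)
  qed
  have hp: "0 \<le> hole_prob n U" for n by (simp add: hole_prob_def)
  have ev: "\<forall>\<^sub>F n in sequentially. \<bar>ln (hole_prob n U) / (real n)\<^sup>2 - (r0 - r)\<bar> < \<delta>" if \<delta>: "0 < \<delta>" for \<delta>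
  proof -
    \<comment> \<open>Each comparison loses 2 \<eta> in the two rates and less than \<eta> in the
      lower order terms, which together stays below \<delta>.\<close>
    define \<eta> where "\<eta> = \<delta> / 4"
    have \<eta>: "0 < \<eta>" using \<delta> by (simp add: \<eta>_def)
    have "ereal (r - \<eta>) < (INF \<mu>\<in>cprob (- U). R_measure \<mu>)" using \<eta> r unfolding R_set_def by simp
    from rate_ratio[OF cl this lower_rate_UNIV[OF r0 \<eta>]]
    obtain c1 N1 where 1: "\<And>n. n \<ge> N1 \<Longrightarrow> 0 < n \<Longrightarrow> B_int (sqrt (real n)) n (- U) [] \<le> ennreal (exp ((r0 + \<eta> - (r - \<eta>)) * (real n)\<^sup>2 + c1 * real n + real n * ln (real n))) * B_int (sqrt (real n)) n UNIV []"
      by blast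
    have "ereal (r0 - \<eta>) < (INF \<mu>\<in>cprob UNIV. R_measure \<mu>)" using \<eta> r0 unfolding R_empty_def by simp
    from rate_ratio[OF closed_UNIV this lower_rate_hole[OF assms(1,2) Us \<nu> r \<eta>]]
    obtain c2 N2 where 2: "\<And>n. n \<ge> N2 \<Longrightarrow> 0 < n \<Longrightarrow> B_int (sqrt (real n)) n UNIV [] \<le> ennreal (exp ((r + \<eta> - (r0 - \<eta>)) * (real n)\<^sup>2 + c2 * real n + real n * ln (real n))) * B_int (sqrt (real n)) n (- U) []"
      by blast
    have small: "\<forall>\<^sub>F n in sequentially. (c * real n + real n * ln (real n)) / (real n)\<^sup>2 < \<eta>" for c
      using rate_error[of c] \<eta> by (rule order_tendstoD(2))
    show ?thesis
      using small[of c1] small[of c2] eventually_gt_at_top[of 0] eventually_ge_at_top[of N1] eventually_ge_at_top[of N2]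
    proof eventually_elim
      fix n :: nat
      assume s1: "(c1 * real n + real n * ln (real n)) / (real n)\<^sup>2 < \<eta>" and s2: "(c2 * real n + real n * ln (real n)) / (real n)\<^sup>2 < \<eta>"
        and n: "0 < n" "N1 \<le> n" "N2 \<le> n"
      let ?h = "hole_prob n U"
      let ?x1 = "(r0 + \<eta> - (r - \<eta>)) * (real n)\<^sup>2 + c1 * real n + real n * ln (real n)"
      let ?x2 = "(r + \<eta> - (r0 - \<eta>)) * (real n)\<^sup>2 + c2 * real n + real n * ln (real n)"
      have P: "0 < pi ^ (n * n)" by simp
      have "ennreal (?h * pi ^ (n * n)) \<le> ennreal (exp ?x1 * pi ^ (n * n))"
        using 1[OF n(2,1)] unfolding B(1)[OF n(1)] B(2)[OF n(1)] by (simp only: ennreal_mult[OF hp less_imp_le[OF P]] ennreal_mult[OF exp_ge_zero less_imp_le[OF P]])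
      then have u: "?h \<le> exp ?x1" using P by (subst (asm) ennreal_le_iff) auto
      have "ennreal (pi ^ (n * n)) \<le> ennreal (exp ?x2 * ?h * pi ^ (n * n))"
      proof -
        have "ennreal (exp ?x2 * ?h * pi ^ (n * n)) = ennreal (exp ?x2) * (ennreal ?h * ennreal (pi ^ (n * n)))"
          unfolding ennreal_mult[OF mult_nonneg_nonneg[OF exp_ge_zero hp] less_imp_le[OF P]] ennreal_mult[OF exp_ge_zero hp] by (rule mult.assoc)
        then show ?thesis using 2[OF n(3,1)] unfolding B(1)[OF n(1)] B(2)[OF n(1)] by (simp only:)
      qed
      then have "pi ^ (n * n) \<le> exp ?x2 * ?h * pi ^ (n * n)" using P hp by (subst (asm) ennreal_le_iff) auto
      then have l: "1 \<le> exp ?x2 * ?h" using P by simp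
      \<comment> \<open>Positivity has to be proved before logarithms are taken, since
        \<open>ln 0 = 0\<close> would give a meaningless rate. It comes from comparing the whole
        plane with the complement of the hole.\<close>
      have h0: "0 < ?h" using l hp[of n] by (cases "?h = 0") auto
      have lu: "ln ?h \<le> ?x1" using u h0 by (metis exp_gt_zero ln_exp ln_le_cancel_iff)
      have "0 \<le> ln (exp ?x2 * ?h)" using l by simp
      also have "ln (exp ?x2 * ?h) = ?x2 + ln ?h" using h0 by (simp add: ln_mult_pos)
      finally have ll: "- ?x2 \<le> ln ?h" by simp
      have n2: "0 < (real n)\<^sup>2" using n by simp
      have "ln ?h / (real n)\<^sup>2 \<le> ?x1 / (real n)\<^sup>2" using lu n2 by (intro divide_right_mono) auto
      also have "\<dots> = (r0 + \<eta> - (r - \<eta>)) + (c1 * real n + real n * ln (real n)) / (real n)\<^sup>2" using n2 by (simp add: add_divide_distrib)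
      finally have a: "ln ?h / (real n)\<^sup>2 < r0 - r + \<delta>" using s1 \<delta> unfolding \<eta>_def by linarith
      have "- (ln ?h / (real n)\<^sup>2) \<le> ?x2 / (real n)\<^sup>2" unfolding minus_divide_left using ll n2 by (intro divide_right_mono) auto
      also have "\<dots> = (r + \<eta> - (r0 - \<eta>)) + (c2 * real n + real n * ln (real n)) / (real n)\<^sup>2" using n2 by (simp add: add_divide_distrib)
      finally have b: "- (ln ?h / (real n)\<^sup>2) < r - r0 + \<delta>" using s2 \<delta> unfolding \<eta>_def by linarith
      show "\<bar>ln ?h / (real n)\<^sup>2 - (r0 - r)\<bar> < \<delta>" using a b by linarith
    qed
  qed
  have "(\<lambda>n. ln (hole_prob n U) / (real n)\<^sup>2) \<longlonglongrightarrow> r0 - r"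
    using ev by (auto simp: tendsto_iff dist_real_def)
  then have "(\<lambda>n. ereal (ln (hole_prob n U) / (real n)\<^sup>2)) \<longlonglongrightarrow> ereal (r0 - r)" by (rule tendsto_ereal)
  then show ?thesis by (simp add: r0 r)
qed

end
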